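(* Let $\Gamma=(V,E)$ be a connected metric graph which is not a cycle, with Betti number $\beta=|E|-|V|+1$, total length $L(\Gamma)$, length of the shortest edge $\ell_{\min}$, and $P$ pendants. For each integer $k\ge 2$ put $$M_k(\Gamma):=\frac{\pi}{\sqrt{L(\Gamma)}}\left(k-2+\frac{P}{2}+\frac{3\beta}{2}\right).$$ Let $p\in[1,\infty]$ and $k\ge 2$. There exist constants $C\ge 0$ and $A_1\ge A_0>0$, depending only on $\Gamma$, $k$ and $p$, such that for every Schrödinger operator $H_q$ on $\Gamma$ with potential $q\in L^p(\Gamma)$ and coupling strengths $\alpha_v\ge0$ for all $v\in V$, writing $\alpha=\sum_{v\in V}\alpha_v$: (i) if $\alpha\ge A_1$, then $$\lambda_k(H_q)\le\left[\|q_+\|_{L^p(\Gamma)}k^{1/p}\left(\frac{2}{\ell_{\min}}\right)^{1/p}+\frac{\pi^2}{L(\Gamma)^2}(k-1+|E|)^2\right]\cdot\left[1+C\,\frac{M_k(\Gamma)}{\alpha}\left(\|q_+\|_{L^p(\Gamma)}+1\right)\right];$$ (ii) if $\alpha\le A_0$, then $$\lambda_k(H_q)\le\left[\|q_+\|_{L^p(\Gamma)}k^{1/p}M_k(\Gamma)^{2/p}+\frac{M_k(\Gamma)^2}{L(\Gamma)}\right]\cdot\left[1+C\,\alpha\,M_k(\Gamma)\left(\|q_+\|_{L^p(\Gamma)}+1\right)\right].$$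
   Context: A metric graph $\Gamma=(V,E)$ is a finite graph (loops and multiple edges allowed, every vertex is an endpoint of some edge, at least one edge) in which each edge $e\in E$ is identified with an interval $[0,\ell_e]$ of finite length $\ell_e>0$, endpoints of intervals being glued at the vertices. $L(\Gamma)=\sum_{e\in E}\ell_e$, $\ell_{\min}=\min_e \ell_e$. Pendants are vertices of degree one. A cycle is a graph which is homeomorphic to a circle. $L^p(\Gamma)$ is taken with respect to the Lebesgue measure on the edges. Convention: $1/p=2/p=0$ if $p=\infty$. For a function $q$, $q_+=\max(q,0)$. All functions are real-valued. $W^{1,2}(\Gamma)$ is the space of functions in $\bigoplus_{e\in E}W^{1,2}(e)$ that are continuous on $\Gamma$. Given $q\in L^1(\Gamma)$ and coupling strengths $\alpha_v\in\mathbb R$ ($v\in V$), the Schrödinger operator $H_q f=-f''+qf$ is considered with $\delta$-coupling conditions: $f$ is continuous on $\Gamma$ and $\sum_{e\in E_v}f_e'(v)=\alpha_v f(v)$ at every $v\in V$, where $E_v$ is the set of edges attached to $v$ and $f_e'(v)$ is the derivative of $f$ at $v$ in the direction pointing out of $v$ into $e$. Its eigenvalues $\lambda_1(H_q)\le\lambda_2(H_q)\le\cdots\nearrow\infty$, counted with multiplicity, satisfy $$\lambda_k(H_q)=\min_{\substack{F\subset W^{1,2}(\Gamma)\\ \dim F=k}}\ \max_{f\in F\setminus\{0\}}\frac{\int_\Gamma (f')^2\,dx+\sum_{v\in V}\alpha_v f(v)^2+\int_\Gamma q f^2\,dx}{\int_\Gamma f^2\,dx}.$$ *)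

theory Defs
  imports "HOL-Analysis.Analysis" "HOL-Probability.Essential_Supremum"
begin

section \<open>Metric graphs\<close>

text \<open>
  The edge \<open>e\<close> is identified with \<open>[0, len \<Gamma> e]\<close>, where \<open>0\<close> is glued to the vertex \<open>src \<Gamma> e\<close> and
  \<open>len \<Gamma> e\<close> to \<open>tgt \<Gamma> e\<close>. The orientation is only that of this identification. Loops
  (\<open>src \<Gamma> e = tgt \<Gamma> e\<close>) and multiple edges are allowed.
\<close>

record ('v, 'e) pre_metric_graph =
  verts :: "'v set"
  edges :: "'e set"
  src :: "'e \<Rightarrow> 'v"
  tgt :: "'e \<Rightarrow> 'v"
  len :: "'e \<Rightarrow> real"

locale metric_graph =
  fixes \<Gamma> :: "('v, 'e) pre_metric_graph"
  assumes finite_verts: "finite (verts \<Gamma>)"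
    and finite_edges: "finite (edges \<Gamma>)"
    and edges_nonempty: "edges \<Gamma> \<noteq> {}"
    and src_in_verts: "e \<in> edges \<Gamma> \<Longrightarrow> src \<Gamma> e \<in> verts \<Gamma>"
    and tgt_in_verts: "e \<in> edges \<Gamma> \<Longrightarrow> tgt \<Gamma> e \<in> verts \<Gamma>"
    and no_isolated_verts: "v \<in> verts \<Gamma> \<Longrightarrow> \<exists>e\<in>edges \<Gamma>. src \<Gamma> e = v \<or> tgt \<Gamma> e = v"
    and len_pos: "e \<in> edges \<Gamma> \<Longrightarrow> 0 < len \<Gamma> e"

definition total_length :: "('v, 'e) pre_metric_graph \<Rightarrow> real"
  where "total_length \<Gamma> = (\<Sum>e\<in>edges \<Gamma>. len \<Gamma> e)"

definition min_length :: "('v, 'e) pre_metric_graph \<Rightarrow> real"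
  where "min_length \<Gamma> = Min (len \<Gamma> ` edges \<Gamma>)"

definition betti :: "('v, 'e) pre_metric_graph \<Rightarrow> int"
  where "betti \<Gamma> = int (card (edges \<Gamma>)) - int (card (verts \<Gamma>)) + 1"

text \<open>A loop contributes 2 to the degree of its vertex.\<close>

definition degree :: "('v, 'e) pre_metric_graph \<Rightarrow> 'v \<Rightarrow> nat"
  where "degree \<Gamma> v = card {e \<in> edges \<Gamma>. src \<Gamma> e = v} + card {e \<in> edges \<Gamma>. tgt \<Gamma> e = v}"

definition pendants :: "('v, 'e) pre_metric_graph \<Rightarrow> 'v set"
  where "pendants \<Gamma> = {v \<in> verts \<Gamma>. degree \<Gamma> v = 1}"

section \<open>The glued space, its topology and its Lebesgue measure\<close>

datatype ('v, 'e) gpoint = Vertex 'v | Inner 'e real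

definition points :: "('v, 'e) pre_metric_graph \<Rightarrow> ('v, 'e) gpoint set"
  where "points \<Gamma> = Vertex ` verts \<Gamma> \<union> {Inner e t | e t. e \<in> edges \<Gamma> \<and> 0 < t \<and> t < len \<Gamma> e}"

text \<open>The canonical map \<open>[0, len \<Gamma> e] \<rightarrow> \<Gamma>\<close>.\<close>

definition edge_point :: "('v, 'e) pre_metric_graph \<Rightarrow> 'e \<Rightarrow> real \<Rightarrow> ('v, 'e) gpoint"
  where "edge_point \<Gamma> e t =
    (if t \<le> 0 then Vertex (src \<Gamma> e) else if len \<Gamma> e \<le> t then Vertex (tgt \<Gamma> e) else Inner e t)"

definition edge_preimage ::
    "('v, 'e) pre_metric_graph \<Rightarrow> 'e \<Rightarrow> ('v, 'e) gpoint set \<Rightarrow> real set"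
  where "edge_preimage \<Gamma> e A = {t \<in> {0..len \<Gamma> e}. edge_point \<Gamma> e t \<in> A}"

text \<open>The quotient topology of the disjoint union of the edges.\<close>

definition graph_topology :: "('v, 'e) pre_metric_graph \<Rightarrow> ('v, 'e) gpoint topology"
  where "graph_topology \<Gamma> = topology (\<lambda>U. U \<subseteq> points \<Gamma> \<and>
    (\<forall>e\<in>edges \<Gamma>. openin (top_of_set {0..len \<Gamma> e}) (edge_preimage \<Gamma> e U)))"

lemma openin_graph_topology:
  "openin (graph_topology \<Gamma>) U \<longleftrightarrow> U \<subseteq> points \<Gamma> \<and>
    (\<forall>e\<in>edges \<Gamma>. openin (top_of_set {0..len \<Gamma> e}) (edge_preimage \<Gamma> e U))"
proof -
  have "edge_preimage \<Gamma> e (S \<inter> T) = edge_preimage \<Gamma> e S \<inter> edge_preimage \<Gamma> e T" for e S T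
    by (auto simp: edge_preimage_def)
  moreover have "edge_preimage \<Gamma> e (\<Union>K) = \<Union>(edge_preimage \<Gamma> e ` K)" for e K
    by (auto simp: edge_preimage_def)
  ultimately have "istopology (\<lambda>U. U \<subseteq> points \<Gamma> \<and>
    (\<forall>e\<in>edges \<Gamma>. openin (top_of_set {0..len \<Gamma> e}) (edge_preimage \<Gamma> e U)))"
    unfolding istopology_def by (auto intro!: openin_Int openin_Union)
  then show ?thesis
    unfolding graph_topology_def by (simp add: topology_inverse')
qed

definition graph_connected :: "('v, 'e) pre_metric_graph \<Rightarrow> bool"
  where "graph_connected \<Gamma> \<longleftrightarrow> connected_space (graph_topology \<Gamma>)"

definition graph_cycle :: "('v, 'e) pre_metric_graph \<Rightarrow> bool"
  where "graph_cycle \<Gamma> \<longleftrightarrow>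
    graph_topology \<Gamma> homeomorphic_space top_of_set (sphere (0::complex) 1)"

text \<open>Lebesgue measure on the edges; the finitely many vertices form a null set.\<close>

definition graph_measure :: "('v, 'e) pre_metric_graph \<Rightarrow> ('v, 'e) gpoint measure"
  where "graph_measure \<Gamma> = measure_of (points \<Gamma>)
    {A. A \<subseteq> points \<Gamma> \<and> (\<forall>e\<in>edges \<Gamma>. edge_preimage \<Gamma> e A \<in> sets lebesgue)}
    (\<lambda>A. \<Sum>e\<in>edges \<Gamma>. emeasure lebesgue (edge_preimage \<Gamma> e A))"

context metric_graph
begin

lemma edge_point_in_points:
  "e \<in> edges \<Gamma> \<Longrightarrow> edge_point \<Gamma> e t \<in> points \<Gamma>"
  by (auto simp: edge_point_def points_def src_in_verts tgt_in_verts)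

lemma edge_preimage_points:
  "e \<in> edges \<Gamma> \<Longrightarrow> edge_preimage \<Gamma> e (points \<Gamma>) = {0..len \<Gamma> e}"
  by (auto simp: edge_preimage_def edge_point_in_points)

lemma topspace_graph_topology: "topspace (graph_topology \<Gamma>) = points \<Gamma>"
proof -
  have "openin (graph_topology \<Gamma>) (points \<Gamma>)"
    by (simp add: openin_graph_topology edge_preimage_points)
  then show ?thesis
    by (metis openin_graph_topology openin_subset openin_topspace subset_antisym)
qed

lemma sigma_algebra_graph:
  "sigma_algebra (points \<Gamma>)
    {A. A \<subseteq> points \<Gamma> \<and> (\<forall>e\<in>edges \<Gamma>. edge_preimage \<Gamma> e A \<in> sets lebesgue)}"
proof -
  have compl: "edge_preimage \<Gamma> e (points \<Gamma> - A) = {0..len \<Gamma> e} - edge_preimage \<Gamma> e A"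
    if "e \<in> edges \<Gamma>" for e A
    using edge_point_in_points[OF that] by (auto simp: edge_preimage_def)
  have un: "edge_preimage \<Gamma> e (\<Union>(A ` (UNIV::nat set))) = (\<Union>i. edge_preimage \<Gamma> e (A i))" for e A
    by (auto simp: edge_preimage_def)
  show ?thesis
    unfolding sigma_algebra_iff2
  proof (intro conjI ballI allI impI)
    show "{} \<in> {A. A \<subseteq> points \<Gamma> \<and> (\<forall>e\<in>edges \<Gamma>. edge_preimage \<Gamma> e A \<in> sets lebesgue)}"
      by (auto simp: edge_preimage_def)
  next
    fix A assume "A \<in> {A. A \<subseteq> points \<Gamma> \<and> (\<forall>e\<in>edges \<Gamma>. edge_preimage \<Gamma> e A \<in> sets lebesgue)}"
    then show "points \<Gamma> - A \<in>
        {A. A \<subseteq> points \<Gamma> \<and> (\<forall>e\<in>edges \<Gamma>. edge_preimage \<Gamma> e A \<in> sets lebesgue)}"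
      by (auto simp: compl intro!: sets.Diff)
  next
    fix A :: "nat \<Rightarrow> _"
    assume "range A \<subseteq> {A. A \<subseteq> points \<Gamma> \<and> (\<forall>e\<in>edges \<Gamma>. edge_preimage \<Gamma> e A \<in> sets lebesgue)}"
    then show "\<Union>(range A) \<in>
        {A. A \<subseteq> points \<Gamma> \<and> (\<forall>e\<in>edges \<Gamma>. edge_preimage \<Gamma> e A \<in> sets lebesgue)}"
      by (auto simp: un image_subset_iff intro!: sets.countable_UN)
  qed auto
qed

lemma space_graph_measure: "space (graph_measure \<Gamma>) = points \<Gamma>"
  unfolding graph_measure_def by (rule space_measure_of) auto

lemma sets_graph_measure: "sets (graph_measure \<Gamma>) =
  {A. A \<subseteq> points \<Gamma> \<and> (\<forall>e\<in>edges \<Gamma>. edge_preimage \<Gamma> e A \<in> sets lebesgue)}"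
  unfolding graph_measure_def using sigma_algebra.sets_measure_of_eq[OF sigma_algebra_graph] .

lemma emeasure_graph_measure:
  assumes "A \<in> sets (graph_measure \<Gamma>)"
  shows "emeasure (graph_measure \<Gamma>) A = (\<Sum>e\<in>edges \<Gamma>. emeasure lebesgue (edge_preimage \<Gamma> e A))"
proof (rule emeasure_measure_of[OF graph_measure_def])
  show "positive (sets (graph_measure \<Gamma>))
      (\<lambda>A. \<Sum>e\<in>edges \<Gamma>. emeasure lebesgue (edge_preimage \<Gamma> e A))"
    by (auto simp: positive_def edge_preimage_def)
  show "countably_additive (sets (graph_measure \<Gamma>))
      (\<lambda>A. \<Sum>e\<in>edges \<Gamma>. emeasure lebesgue (edge_preimage \<Gamma> e A))"
  proof (rule countably_additiveI)
    fix A :: "nat \<Rightarrow> _"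
    assume A: "range A \<subseteq> sets (graph_measure \<Gamma>)" "disjoint_family A"
    have un: "edge_preimage \<Gamma> e (\<Union>(range A)) = (\<Union>i. edge_preimage \<Gamma> e (A i))" for e
      by (auto simp: edge_preimage_def)
    have "(\<Sum>i. \<Sum>e\<in>edges \<Gamma>. emeasure lebesgue (edge_preimage \<Gamma> e (A i)))
        = (\<Sum>e\<in>edges \<Gamma>. \<Sum>i. emeasure lebesgue (edge_preimage \<Gamma> e (A i)))"
      by (rule suminf_sum) simp
    also have "\<dots> = (\<Sum>e\<in>edges \<Gamma>. emeasure lebesgue (\<Union>i. edge_preimage \<Gamma> e (A i)))"
    proof (rule sum.cong[OF refl], rule suminf_emeasure)
      fix e assume "e \<in> edges \<Gamma>"
      then show "range (\<lambda>i. edge_preimage \<Gamma> e (A i)) \<subseteq> sets lebesgue"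
        using A(1) by (auto simp: sets_graph_measure image_subset_iff)
      show "disjoint_family (\<lambda>i. edge_preimage \<Gamma> e (A i))"
        using A(2) by (auto simp: disjoint_family_on_def edge_preimage_def)
    qed
    finally show "(\<Sum>i. \<Sum>e\<in>edges \<Gamma>. emeasure lebesgue (edge_preimage \<Gamma> e (A i)))
        = (\<Sum>e\<in>edges \<Gamma>. emeasure lebesgue (edge_preimage \<Gamma> e (\<Union>(range A))))"
      by (simp add: un)
  qed
qed (use assms in \<open>auto simp: sets_graph_measure\<close>)

end

section \<open>$L^p$ spaces\<close>

definition Lp_space :: "ereal \<Rightarrow> 'a measure \<Rightarrow> ('a \<Rightarrow> real) set"
  where "Lp_space p M = {f \<in> borel_measurable M.
    if p = \<infinity> then esssup M (\<lambda>x. ereal \<bar>f x\<bar>) < \<infinity>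
    else integrable M (\<lambda>x. \<bar>f x\<bar> powr real_of_ereal p)}"

definition Lp_norm :: "ereal \<Rightarrow> 'a measure \<Rightarrow> ('a \<Rightarrow> real) \<Rightarrow> real"
  where "Lp_norm p M f =
    (if p = \<infinity> then real_of_ereal (esssup M (\<lambda>x. ereal \<bar>f x\<bar>))
     else (LINT x|M. \<bar>f x\<bar> powr real_of_ereal p) powr (1 / real_of_ereal p))"

section \<open>The Schroedinger operator and its eigenvalues\<close>

text \<open>\<open>u\<close> is absolutely continuous on \<open>[0, l]\<close> with almost everywhere derivative \<open>g\<close>.\<close>

definition abs_cont_deriv :: "real \<Rightarrow> (real \<Rightarrow> real) \<Rightarrow> (real \<Rightarrow> real) \<Rightarrow> bool"
  where "abs_cont_deriv l u g \<longleftrightarrow> set_integrable lebesgue {0..l} g \<and>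
    (\<forall>t\<in>{0..l}. u t = u 0 + (LINT s:{0..t}|lebesgue. g s))"

text \<open>
  \<open>schroedinger \<Gamma> \<alpha> q f h\<close> means that \<open>f\<close> is in the domain of $H_q$ and $H_q f = h$ in $L^2(\Gamma)$.
  The function \<open>f1 e\<close> is the derivative of \<open>f\<close> along \<open>e\<close> (everywhere on the closed edge, as it
  is itself absolutely continuous) and \<open>f2 e\<close> is the second derivative. The derivative at \<open>v\<close>
  pointing into \<open>e\<close> is \<open>f1 e 0\<close> at \<open>src \<Gamma> e\<close> and \<open>- f1 e (len \<Gamma> e)\<close> at \<open>tgt \<Gamma> e\<close>; a loop
  contributes both terms.
\<close>

definition schroedinger ::
    "('v, 'e) pre_metric_graph \<Rightarrow> ('v \<Rightarrow> real) \<Rightarrow> (('v, 'e) gpoint \<Rightarrow> real) \<Rightarrow>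
     (('v, 'e) gpoint \<Rightarrow> real) \<Rightarrow> (('v, 'e) gpoint \<Rightarrow> real) \<Rightarrow> bool"
  where "schroedinger \<Gamma> \<alpha> q f h \<longleftrightarrow>
    continuous_map (graph_topology \<Gamma>) euclideanreal f \<and>
    f \<in> Lp_space 2 (graph_measure \<Gamma>) \<and> h \<in> Lp_space 2 (graph_measure \<Gamma>) \<and>
    (\<exists>f1 f2.
      (\<forall>e\<in>edges \<Gamma>.
        abs_cont_deriv (len \<Gamma> e) (\<lambda>t. f (edge_point \<Gamma> e t)) (f1 e) \<and>
        abs_cont_deriv (len \<Gamma> e) (f1 e) (f2 e) \<and>
        (AE t in lebesgue. t \<in> {0..len \<Gamma> e} \<longrightarrow>
          h (edge_point \<Gamma> e t) = - f2 e t + q (edge_point \<Gamma> e t) * f (edge_point \<Gamma> e t))) \<and>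
      (\<forall>v\<in>verts \<Gamma>.
        (\<Sum>e | e \<in> edges \<Gamma> \<and> src \<Gamma> e = v. f1 e 0)
        + (\<Sum>e | e \<in> edges \<Gamma> \<and> tgt \<Gamma> e = v. - f1 e (len \<Gamma> e))
        = \<alpha> v * f (Vertex v)))"

definition eigenspace ::
    "('v, 'e) pre_metric_graph \<Rightarrow> ('v \<Rightarrow> real) \<Rightarrow> (('v, 'e) gpoint \<Rightarrow> real) \<Rightarrow> real \<Rightarrow>
     (('v, 'e) gpoint \<Rightarrow> real) set"
  where "eigenspace \<Gamma> \<alpha> q \<mu> = {f. schroedinger \<Gamma> \<alpha> q f (\<lambda>x. \<mu> * f x)}"

text \<open>Linear independence of \<open>u 0, \<dots>, u (k - 1)\<close> as functions on \<open>S\<close>.\<close>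

definition lin_indep_on :: "'a set \<Rightarrow> nat \<Rightarrow> (nat \<Rightarrow> 'a \<Rightarrow> real) \<Rightarrow> bool"
  where "lin_indep_on S k u \<longleftrightarrow>
    (\<forall>c. (\<forall>x\<in>S. (\<Sum>i<k. c i * u i x) = 0) \<longrightarrow> (\<forall>i<k. c i = 0))"

text \<open>
  The \<open>k\<close>-th eigenvalue (\<open>k \<ge> 1\<close>) in nondecreasing order, counted with multiplicity: the least
  \<open>\<mu>\<close> for which the eigenspaces of the eigenvalues \<open>\<le> \<mu>\<close> have total dimension at least \<open>k\<close>.
  Eigenspaces of different eigenvalues are independent ($H_q$ is symmetric), so this says that
  there are \<open>k\<close> linearly independent eigenfunctions with eigenvalues \<open>\<le> \<mu>\<close>. The set below is
  nonempty and bounded below because the spectrum is discrete and semibounded.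
\<close>

definition eigenvalue_nth ::
    "('v, 'e) pre_metric_graph \<Rightarrow> ('v \<Rightarrow> real) \<Rightarrow> (('v, 'e) gpoint \<Rightarrow> real) \<Rightarrow> nat \<Rightarrow> real"
  where "eigenvalue_nth \<Gamma> \<alpha> q k = Inf {\<mu>. \<exists>u \<nu>.
    (\<forall>i<k. u i \<in> eigenspace \<Gamma> \<alpha> q (\<nu> i) \<and> \<nu> i \<le> \<mu>) \<and> lin_indep_on (points \<Gamma>) k u}"

definition M_const :: "('v, 'e) pre_metric_graph \<Rightarrow> nat \<Rightarrow> real"
  where "M_const \<Gamma> k = pi / sqrt (total_length \<Gamma>) *
    (real k - 2 + real (card (pendants \<Gamma>)) / 2 + 3 * real_of_int (betti \<Gamma>) / 2)"

end

theory Submission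
  imports Defs "HOL-Complex_Analysis.Great_Picard" "HOL-Library.Function_Algebras"
begin

text \<open>
  By the min-max principle it suffices to exhibit \<open>k\<close>-dimensional spaces of trial functions. Let \<open>a\<close>
  be the total coupling strength, \<open>m = k - 2 + P/2 + 3\<beta>/2\<close>, and \<open>\<omega> > \<pi> m/L\<close>. On a space with
  \<open>\<integral> f'\<^sup>2 \<le> \<omega>\<^sup>2 \<integral> f\<^sup>2\<close>, the variation of \<open>f\<^sup>2\<close> is at most \<open>2\<omega> \<integral> f\<^sup>2\<close>, so \<open>f\<^sup>2 \<le> (1/L + 2\<omega>) \<integral> f\<^sup>2\<close>, where
  \<open>1/L + 2\<omega> \<le> k M\<^sup>2\<close> for \<open>\<omega>\<close> close to \<open>\<pi> m/L\<close>. This controls both the couplings and, by Hoelder's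
  inequality, the potential; in the limit \<open>\<omega> \<rightarrow> \<pi> m/L\<close> the Kirchhoff space gives
  \<open>\<lambda>\<^sub>k \<le> M\<^sup>2/L + a k M\<^sup>2 + \<parallel>q\<^sub>+\<parallel> (k M\<^sup>2)\<^bsup>1/p\<^esup>\<close> for all \<open>a\<close>, and \<open>C = k L/M\<close> absorbs the middle term. For (i)
  one takes \<open>k\<close> disjointly supported sine arcs of length \<open>s = L/(k - 1 + |E|)\<close> inside the edges,
  which do not see the couplings and satisfy \<open>f\<^sup>2 \<le> (2/s) \<integral> f\<^sup>2\<close>. Hence any \<open>A\<^sub>0 = A\<^sub>1\<close> works.

  The Kirchhoff space is built by induction on the edges with Robin conditions \<open>\<omega> y\<close> at the
  vertices: an edge of length \<open>l\<close> advances the Pruefer angle \<open>arctan y\<close> by \<open>\<omega> l\<close>, each half-wave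
  completed on it contributes one dimension, and the fractional rest is passed on as a Robin
  condition at the other end. Cutting a cycle costs one linear condition and creates one free end.
\<close>

section \<open>Absolutely continuous functions on an interval\<close>

text \<open>\<open>eigenvalue_nth\<close> is defined through eigenfunctions of the differential
  operator. A trial space bounds it only once k eigenfunctions below the bound exist and all
  eigenvalues are bounded below; hence compactness and regularity are needed. The number m is a
  balance of phases, in half-waves: a free end weighs -1/2, a length l adds
  \<open>\<omega> l / pi\<close>. Merging the Robin conditions of several branches at a vertex loses
  nothing, as the weights are superadditive. When no edge is left, one vertex with two conditions
  remains, and its constant function is a negative direction as soon as the weights sum to more than
  -1; this is the origin of k - 2. A pendant costs its free end, 1/2. A cut costs 1/2 for the new
  free end and 1 for the closing condition, and lowers \<beta> by one; hence 3/2. One of the two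
  final conditions comes from a pendant or, if there is none, from the first cut. That cut must not
  create a leaf, so the longest path used to find it starts at a vertex of degree at least 3. If
  there is neither a pendant nor such a vertex, all degrees are 2 and the graph is a circle.\<close>

abbreviation leb :: "real \<Rightarrow> real measure"
  where "leb l \<equiv> lebesgue_on {0..l}"

lemma finite_measure_leb: "finite_measure (leb l)"
  by (rule finite_measure_lebesgue_on) (metis cbox_interval lmeasurable_cbox)

lemma measure_leb: "0 \<le> l \<Longrightarrow> measure (leb l) {0..l} = l"
  by (simp add: measure_restrict_space)

lemma integral_leb_const: "0 \<le> l \<Longrightarrow> (LINT t|leb l. c) = l * c"
  by (simp add: measure_leb)

lemma id_measurable_leb [measurable]: "(\<lambda>x. x) \<in> borel_measurable (leb l)"
  using id_borel_measurable_lebesgue_on[of "{0..l}"] by (simp add: id_def)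

lemma integrable_leb_continuous:
  fixes f :: "real \<Rightarrow> real"
  shows "continuous_on {0..l} f \<Longrightarrow> integrable (leb l) f"
  using continuous_imp_integrable[of 0 l f] by (simp add: cbox_interval)

lemma measurable_leb_continuous:
  fixes f :: "real \<Rightarrow> real"
  shows "continuous_on {0..l} f \<Longrightarrow> f \<in> borel_measurable (leb l)"
  using integrable_leb_continuous by blast

lemma integrable_leb_mult_continuous:
  fixes f h :: "real \<Rightarrow> real"
  assumes h: "integrable (leb l) h" and f: "continuous_on {0..l} f"
  shows "integrable (leb l) (\<lambda>t. h t * f t)"
proof -
  have "bounded (f ` {0..l})"
    using f compact_continuous_image compact_imp_bounded by blast
  then obtain B where B: "\<forall>x\<in>{0..l}. \<bar>f x\<bar> \<le> B"
    by (auto simp: bounded_iff)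
  have m: "f \<in> borel_measurable (leb l)" "h \<in> borel_measurable (leb l)"
    using measurable_leb_continuous[OF f] h by auto
  show ?thesis
  proof (rule Bochner_Integration.integrable_bound[where f = "\<lambda>t. B * h t"])
    show "AE x in leb l. norm (h x * f x) \<le> norm (B * h x)"
    proof (rule AE_I2)
      fix x assume "x \<in> space (leb l)"
      then have "\<bar>f x\<bar> \<le> B" using B by simp
      then show "norm (h x * f x) \<le> norm (B * h x)"
        using mult_right_mono[of "\<bar>f x\<bar>" B "\<bar>h x\<bar>"]
        by (simp add: abs_mult mult.commute[of "\<bar>h x\<bar>"])
    qed
  qed (use h m in auto)
qed

text \<open>Cut-off integrals over one interval make integrals with different upper limits
  comparable and put Fubini's theorem on a fixed product measure.\<close>

lemma integral_leb_sub:
  fixes g :: "real \<Rightarrow> real"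
  assumes "t \<le> l"
  shows "integral\<^sup>L (leb t) g = (LINT s|leb l. indicator {..t} s * g s)"
proof -
  have "indicator {0..t} x *\<^sub>R g x = indicator {0..l} x *\<^sub>R (indicator {..t} x * g x)" for x :: real
    using assms by (auto simp: indicator_def)
  then show ?thesis
    unfolding integral_restrict_space[of "{0..t}" lebesgue, simplified] integral_restrict_space[of "{0..l}" lebesgue, simplified]
    by presburger
qed

lemma integrable_leb_sub:
  fixes g :: "real \<Rightarrow> real"
  assumes "integrable (leb l) g" "t \<le> l"
  shows "integrable (leb t) g"
proof -
  have "set_integrable lebesgue {0..t} g"
    by (rule set_integrable_subset[of _ "{0..l}"])
      (use assms in \<open>auto simp: set_integrable_def integrable_restrict_space\<close>)
  then show ?thesis
    by (simp add: set_integrable_def integrable_restrict_space)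
qed

lemma acd_iff: "abs_cont_deriv l u g \<longleftrightarrow> integrable (leb l) g \<and>
    (\<forall>t\<in>{0..l}. u t = u 0 + integral\<^sup>L (leb t) g)"
  by (simp add: abs_cont_deriv_def set_integrable_def integrable_restrict_space integral_restrict_space set_lebesgue_integral_def)

lemma acd_integrable: "abs_cont_deriv l u g \<Longrightarrow> integrable (leb l) g"
  by (meson acd_iff)

lemma acd_eq: "abs_cont_deriv l u g \<Longrightarrow> 0 \<le> t \<Longrightarrow> t \<le> l \<Longrightarrow> u t = u 0 + integral\<^sup>L (leb t) g"
  by (meson acd_iff atLeastAtMost_iff)

lemma AE_leb_neq: "AE r in leb l. r \<noteq> s"
proof -
  have "AE r in lebesgue. r \<noteq> s"
    by (rule AE_completion) (rule AE_lborel_singleton)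
  then show ?thesis
    by (auto simp: AE_restrict_space_iff elim!: eventually_mono)
qed

text \<open>Fubini on the square of side T: the triangles \<open>r \<le> s\<close> and
  \<open>s \<le> r\<close> cover it and overlap in the diagonal, a null set. This is integration by
  parts for the primitives of g and h that vanish at 0.\<close>

lemma integral_indicator_by_parts:
  fixes g h :: "real \<Rightarrow> real"
  assumes g: "integrable (leb T) g" and h: "integrable (leb T) h"
  shows "(LINT s|leb T. g s * (LINT r|leb T. indicator {..s} r * h r))
       + (LINT r|leb T. h r * (LINT s|leb T. indicator {..r} s * g s))
       = integral\<^sup>L (leb T) g * integral\<^sup>L (leb T) h"
    "integrable (leb T) (\<lambda>s. g s * (LINT r|leb T. indicator {..s} r * h r))"
proof -
  interpret F: finite_measure "leb T" by (rule finite_measure_leb)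
  interpret P: pair_sigma_finite "leb T" "leb T" by unfold_locales
  note [measurable] = borel_measurable_integrable[OF g] borel_measurable_integrable[OF h]
  have gh: "integrable (leb T \<Otimes>\<^sub>M leb T) (\<lambda>x. g (fst x) * h (snd x))"
    by (rule P.Fubini_integrable) (use g h in \<open>auto simp: abs_mult\<close>)
  have i1: "integrable (leb T \<Otimes>\<^sub>M leb T) (\<lambda>x. if snd x \<le> fst x then g (fst x) * h (snd x) else 0)"
    by (rule Bochner_Integration.integrable_bound[OF gh]) auto
  have i2: "integrable (leb T \<Otimes>\<^sub>M leb T) (\<lambda>x. if fst x \<le> snd x then g (fst x) * h (snd x) else 0)"
    by (rule Bochner_Integration.integrable_bound[OF gh]) auto
  let ?f1 = "\<lambda>s r. if r \<le> s then g s * h r else 0" and ?f2 = "\<lambda>s r. if s \<le> r then g s * h r else 0"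
  have j1: "integrable (leb T \<Otimes>\<^sub>M leb T) (case_prod ?f1)" "integrable (leb T \<Otimes>\<^sub>M leb T) (case_prod ?f2)"
    using i1 i2 by (simp_all add: case_prod_beta')
  have e1: "(LINT r|leb T. ?f1 s r) = g s * (LINT r|leb T. indicator {..s} r * h r)" for s
  proof -
    have "(LINT r|leb T. ?f1 s r) = (LINT r|leb T. g s * (indicator {..s} r * h r))"
      by (rule Bochner_Integration.integral_cong) auto
    then show ?thesis by simp
  qed
  have e2: "(LINT s|leb T. ?f2 s r) = h r * (LINT s|leb T. indicator {..r} s * g s)" for r
  proof -
    have "(LINT s|leb T. ?f2 s r) = (LINT s|leb T. h r * (indicator {..r} s * g s))"
      by (rule Bochner_Integration.integral_cong) auto
    then show ?thesis by simp
  qed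
  show *: "integrable (leb T) (\<lambda>s. g s * (LINT r|leb T. indicator {..s} r * h r))"
    using P.integrable_fst[OF j1(1)] by (simp add: e1)
  have **: "integrable (leb T) (\<lambda>s. LINT r|leb T. ?f2 s r)"
    using P.integrable_fst[OF j1(2)] .
  have "(LINT r|leb T. h r * (LINT s|leb T. indicator {..r} s * g s)) = (LINT s|leb T. LINT r|leb T. ?f2 s r)"
    using P.Fubini_integral[OF j1(2)] by (simp add: e2)
  then have "(LINT s|leb T. g s * (LINT r|leb T. indicator {..s} r * h r))
       + (LINT r|leb T. h r * (LINT s|leb T. indicator {..r} s * g s))
      = (LINT s|leb T. (LINT r|leb T. ?f1 s r) + (LINT r|leb T. ?f2 s r))"
    using * ** by (simp add: e1)
  also have "\<dots> = (LINT s|leb T. g s * integral\<^sup>L (leb T) h)"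
  proof (rule Bochner_Integration.integral_cong[OF refl])
    fix s
    have k: "integrable (leb T) (?f1 s)" "integrable (leb T) (?f2 s)"
      by (rule Bochner_Integration.integrable_bound[where f = "\<lambda>r. g s * h r"]; use h in auto)+
    have "(LINT r|leb T. ?f1 s r) + (LINT r|leb T. ?f2 s r) = (LINT r|leb T. ?f1 s r + ?f2 s r)"
      using k by simp
    also have "\<dots> = (LINT r|leb T. g s * h r)"
    proof (rule integral_cong_AE)
      show "AE r in leb T. ?f1 s r + ?f2 s r = g s * h r"
        using AE_leb_neq[of s T] by eventually_elim auto
    qed measurable
    finally show "(LINT r|leb T. ?f1 s r) + (LINT r|leb T. ?f2 s r) = g s * integral\<^sup>L (leb T) h"
      by simp
  qed
  finally show "(LINT s|leb T. g s * (LINT r|leb T. indicator {..s} r * h r))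
       + (LINT r|leb T. h r * (LINT s|leb T. indicator {..r} s * g s))
       = integral\<^sup>L (leb T) g * integral\<^sup>L (leb T) h"
    by simp
qed

lemma acd_diff:
  assumes "abs_cont_deriv l u g" "0 \<le> x" "x \<le> y" "y \<le> l"
  shows "u y - u x = (LINT s|leb l. indicator {x<..y} s * g s)"
proof -
  have i: "integrable (leb l) g" using assms acd_integrable by auto
  have i': "integrable (leb l) (\<lambda>s. indicator {..t} s * g s)" for t
    by (rule Bochner_Integration.integrable_bound[OF i]) (use i in \<open>auto simp: indicator_def\<close>)
  have "u y - u x = (LINT s|leb l. indicator {..y} s * g s) - (LINT s|leb l. indicator {..x} s * g s)"
    using acd_eq[OF assms(1), of x] acd_eq[OF assms(1), of y] assms(2-)
      integral_leb_sub[of x l g] integral_leb_sub[of y l g] by linarith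
  also have "\<dots> = (LINT s|leb l. indicator {..y} s * g s - indicator {..x} s * g s)"
    using i' by simp
  also have "\<dots> = (LINT s|leb l. indicator {x<..y} s * g s)"
    by (rule Bochner_Integration.integral_cong) (use assms in \<open>auto simp: indicator_def\<close>)
  finally show ?thesis .
qed

lemma acd_continuous:
  assumes "abs_cont_deriv l u g"
  shows "continuous_on {0..l} u"
proof -
  have i: "set_integrable lebesgue {0..l} g" using assms by (simp add: abs_cont_deriv_def)
  then have h: "g integrable_on {0..l}" 
    using set_lebesgue_integral_eq_integral(1) by blast
  have "continuous_on {0..l} (\<lambda>t. u 0 + integral {0..t} g)"
    by (intro continuous_intros indefinite_integral_continuous_1[OF h])
  moreover have "u t = u 0 + integral {0..t} g" if "t \<in> {0..l}" for t
  proof -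
    have "set_integrable lebesgue {0..t} g"
      by (rule set_integrable_subset[OF i]) (use that in auto)
    from set_lebesgue_integral_eq_integral(2)[OF this] show ?thesis
      using assms that unfolding abs_cont_deriv_def by metis
  qed
  ultimately show ?thesis
    using continuous_on_cong by (metis (no_types, lifting))
qed

text \<open>Since g and h are only integrable, no classical product rule applies. Inserting u and w
  as initial value plus primitive leaves exactly the identity for the two triangles, together with
  the products of initial values and integrals.\<close>

lemma acd_mult:
  assumes u: "abs_cont_deriv l u g" and w: "abs_cont_deriv l w h"
  shows "abs_cont_deriv l (\<lambda>t. u t * w t) (\<lambda>t. g t * w t + u t * h t)"
  unfolding acd_iff
proof (intro conjI ballI)
  have c: "continuous_on {0..l} u" "continuous_on {0..l} w"
    using assms acd_continuous by auto
  have i: "integrable (leb l) g" "integrable (leb l) h" using assms acd_integrable by auto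
  have j: "integrable (leb l) (\<lambda>t. g t * w t)" "integrable (leb l) (\<lambda>t. u t * h t)"
    using integrable_leb_mult_continuous[OF i(1) c(2)] integrable_leb_mult_continuous[OF i(2) c(1)]
    by (simp_all add: mult.commute)
  then show "integrable (leb l) (\<lambda>t. g t * w t + u t * h t)" by simp
  fix T assume T: "T \<in> {0..l}"
  then have "T \<le> l" by simp
  note iT = integrable_leb_sub[OF i(1) this] integrable_leb_sub[OF i(2) this]
    integrable_leb_sub[OF j(1) this] integrable_leb_sub[OF j(2) this]
  have ut: "u t = u 0 + (LINT s|leb T. indicator {..t} s * g s)"
    and wt: "w t = w 0 + (LINT s|leb T. indicator {..t} s * h s)" if "t \<in> {0..T}" for t
    using acd_eq[OF u, of t] acd_eq[OF w, of t] that T integral_leb_sub[of t T g] integral_leb_sub[of t T h]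
    by auto
  have "(LINT t|leb T. g t * w t + u t * h t) = (LINT t|leb T. g t * w t) + (LINT t|leb T. h t * u t)"
    using iT by (simp add: mult.commute)
  also have "(LINT t|leb T. g t * w t) = (LINT t|leb T. w 0 * g t + g t * (LINT s|leb T. indicator {..t} s * h s))"
  proof (rule Bochner_Integration.integral_cong[OF refl])
    fix t assume "t \<in> space (leb T)"
    then have t: "t \<in> {0..T}" by simp
    show "g t * w t = w 0 * g t + g t * (LINT s|leb T. indicator {..t} s * h s)"
      by (subst wt[OF t]) (simp add: algebra_simps)
  qed
  also have "\<dots> = w 0 * integral\<^sup>L (leb T) g + (LINT t|leb T. g t * (LINT s|leb T. indicator {..t} s * h s))"
    using integral_indicator_by_parts(2)[OF iT(1,2)] iT by simp
  also have "(LINT t|leb T. h t * u t) = (LINT t|leb T. u 0 * h t + h t * (LINT s|leb T. indicator {..t} s * g s))"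
  proof (rule Bochner_Integration.integral_cong[OF refl])
    fix t assume "t \<in> space (leb T)"
    then have t: "t \<in> {0..T}" by simp
    show "h t * u t = u 0 * h t + h t * (LINT s|leb T. indicator {..t} s * g s)"
      by (subst ut[OF t]) (simp add: algebra_simps)
  qed
  also have "\<dots> = u 0 * integral\<^sup>L (leb T) h + (LINT t|leb T. h t * (LINT s|leb T. indicator {..t} s * g s))"
    using integral_indicator_by_parts(2)[OF iT(2,1)] iT by simp
  finally have "(LINT t|leb T. g t * w t + u t * h t) = w 0 * integral\<^sup>L (leb T) g
      + u 0 * integral\<^sup>L (leb T) h + integral\<^sup>L (leb T) g * integral\<^sup>L (leb T) h"
    using integral_indicator_by_parts(1)[OF iT(1,2)] by simp
  moreover have "u T = u 0 + integral\<^sup>L (leb T) g" "w T = w 0 + integral\<^sup>L (leb T) h"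
    using acd_eq[OF u, of T] acd_eq[OF w, of T] T by simp_all
  ultimately show "u T * w T = u 0 * w 0 + (LINT t|leb T. g t * w t + u t * h t)"
    by (simp add: algebra_simps)
qed

lemma integration_by_parts_acd:
  assumes "abs_cont_deriv l u g" "abs_cont_deriv l w h" "0 \<le> l"
  shows "(LINT t|leb l. g t * w t) + (LINT t|leb l. u t * h t) = u l * w l - u 0 * w 0"
proof -
  have c: "continuous_on {0..l} u" "continuous_on {0..l} w"
    using assms acd_continuous by auto
  have i: "integrable (leb l) g" "integrable (leb l) h" using assms acd_integrable by auto
  have j: "integrable (leb l) (\<lambda>t. g t * w t)" "integrable (leb l) (\<lambda>t. u t * h t)"
    using integrable_leb_mult_continuous[OF i(1) c(2)] integrable_leb_mult_continuous[OF i(2) c(1)]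
    by (simp_all add: mult.commute)
  show ?thesis
    using acd_eq[OF acd_mult[OF assms(1,2)], of l] assms(3) j by simp
qed

lemma acd_add:
  assumes "abs_cont_deriv l u g" "abs_cont_deriv l w h"
  shows "abs_cont_deriv l (\<lambda>t. u t + w t) (\<lambda>t. g t + h t)"
  unfolding acd_iff
proof (intro conjI ballI)
  fix t assume t: "t \<in> {0..l}"
  then have "integrable (leb t) g" "integrable (leb t) h"
    using assms[THEN acd_integrable] integrable_leb_sub[of l _ t] by auto
  then show "u t + w t = u 0 + w 0 + (LINT t|leb t. g t + h t)"
    using acd_eq[OF assms(1), of t] acd_eq[OF assms(2), of t] t by simp
qed (use assms[THEN acd_integrable] in simp)

lemma acd_cmult:
  assumes "abs_cont_deriv l u g"
  shows "abs_cont_deriv l (\<lambda>t. c * u t) (\<lambda>t. c * g t)"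
  unfolding acd_iff
proof (intro conjI ballI)
  fix t assume t: "t \<in> {0..l}"
  then show "c * u t = c * u 0 + (LINT t|leb t. c * g t)"
    by (simp add: acd_eq[OF assms, of t] distrib_left)
qed (use acd_integrable[OF assms] in simp)

lemma acd_cong:
  assumes "abs_cont_deriv l u g" "\<And>t. t \<in> {0..l} \<Longrightarrow> u t = w t" "\<And>t. t \<in> {0..l} \<Longrightarrow> g t = h t"
  shows "abs_cont_deriv l w h"
  unfolding acd_iff
proof (intro conjI ballI)
  have e: "integrable (leb t) g \<longleftrightarrow> integrable (leb t) h" "integral\<^sup>L (leb t) g = integral\<^sup>L (leb t) h"
    if "t \<le> l" for t
    using that assms(3) by (auto intro!: Bochner_Integration.integrable_cong Bochner_Integration.integral_cong)
  show "integrable (leb l) h"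
    using e(1)[of l] acd_integrable[OF assms(1)] by simp
  fix t assume t: "t \<in> {0..l}"
  then show "w t = w 0 + integral\<^sup>L (leb t) h"
    using acd_eq[OF assms(1), of t] e(2)[of t] assms(2)[of t] assms(2)[of 0] by simp
qed

section \<open>Square-integrable functions: completeness and pointwise bounds\<close>

definition sq_int :: "'a measure \<Rightarrow> ('a \<Rightarrow> real) \<Rightarrow> bool"
  where "sq_int M g \<longleftrightarrow> g \<in> borel_measurable M \<and> integrable M (\<lambda>x. (g x)\<^sup>2)"

lemma sq_int_mult:
  assumes "sq_int M g" "sq_int M h"
  shows "integrable M (\<lambda>x. g x * h x)"
proof (rule Bochner_Integration.integrable_bound[where f = "\<lambda>x. (g x)\<^sup>2 + (h x)\<^sup>2"])
  show "AE x in M. norm (g x * h x) \<le> norm ((g x)\<^sup>2 + (h x)\<^sup>2)"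
  proof (rule AE_I2)
    fix x
    have "2 * (\<bar>g x\<bar> * \<bar>h x\<bar>) \<le> (g x)\<^sup>2 + (h x)\<^sup>2"
      using sum_squares_bound[of "\<bar>g x\<bar>" "\<bar>h x\<bar>"] by simp
    then show "norm (g x * h x) \<le> norm ((g x)\<^sup>2 + (h x)\<^sup>2)"
      using mult_nonneg_nonneg[of "\<bar>g x\<bar>" "\<bar>h x\<bar>"]
      by (simp add: abs_mult del: mult_nonneg_nonneg zero_le_mult_iff)
  qed
qed (use assms in \<open>auto simp: sq_int_def\<close>)

lemma sq_int_cmult: "sq_int M g \<Longrightarrow> sq_int M (\<lambda>x. c * g x)"
  by (auto simp: sq_int_def power_mult_distrib)

lemma sq_int_add:
  assumes "sq_int M g" "sq_int M h"
  shows "sq_int M (\<lambda>x. g x + h x)"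
proof -
  have "integrable M (\<lambda>x. (g x)\<^sup>2 + (h x)\<^sup>2 + 2 * (g x * h x))"
    using assms sq_int_mult[OF assms] by (simp add: sq_int_def)
  then show ?thesis
    using assms by (auto simp: sq_int_def power2_sum mult.assoc)
qed

lemma sq_int_diff:
  assumes "sq_int M g" "sq_int M h"
  shows "sq_int M (\<lambda>x. g x - h x)"
  using sq_int_add[OF assms(1) sq_int_cmult[OF assms(2), of "-1"]] by simp

lemma sq_int_integrable:
  assumes "finite_measure M" "sq_int M g"
  shows "integrable M g"
proof -
  have "sq_int M (\<lambda>_. 1)"
    using finite_measure.integrable_const[OF assms(1), of "1::real"] by (simp add: sq_int_def)
  from sq_int_mult[OF assms(2) this] show ?thesis by simp
qed

text \<open>Pointwise, \<open>\<bar>g\<bar> \<le> \<eta> * g\<^sup>2 + 1 / \<eta>\<close>. The free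
  parameter replaces the square root in the Cauchy-Schwarz inequality: optimizing it afterwards
  gives the product of the two norms up to a constant factor.\<close>

lemma integral_abs_le_square:
  assumes "finite_measure M" "sq_int M g" "0 < \<eta>"
  shows "(LINT x|M. \<bar>g x\<bar>) \<le> \<eta> * (LINT x|M. (g x)\<^sup>2) + measure M (space M) / \<eta>"
proof -
  interpret finite_measure M by fact
  have "(LINT x|M. \<bar>g x\<bar>) \<le> (LINT x|M. \<eta> * (g x)\<^sup>2 + 1 / \<eta>)"
  proof (rule integral_mono)
    fix x
    have "2 * ((\<eta> * \<bar>g x\<bar>) * 1) \<le> (\<eta> * \<bar>g x\<bar>)\<^sup>2 + 1\<^sup>2"
      using sum_squares_bound[of "\<eta> * \<bar>g x\<bar>" 1] by simp
    moreover have "0 \<le> \<eta> * \<bar>g x\<bar>" using assms by simp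
    ultimately have "\<eta> * \<bar>g x\<bar> \<le> \<eta>\<^sup>2 * (g x)\<^sup>2 + 1" by (simp add: power_mult_distrib)
    then show "\<bar>g x\<bar> \<le> \<eta> * (g x)\<^sup>2 + 1 / \<eta>"
      using assms(3) by (simp add: field_simps power2_eq_square)
  qed (use assms(2) sq_int_integrable[OF assms(1,2)] in \<open>auto simp: sq_int_def\<close>)
  also have "\<dots> = \<eta> * (LINT x|M. (g x)\<^sup>2) + measure M (space M) / \<eta>"
    using assms(2) by (auto simp: sq_int_def)
  finally show ?thesis .
qed

text \<open>Riesz-Fischer. A rapidly converging subsequence has summable increments in mean, hence
  converges almost everywhere; Fatou's lemma then carries the Cauchy estimates over to the limit,
  for the whole sequence and not only for the subsequence.\<close>

lemma sq_int_complete: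
  fixes g :: "nat \<Rightarrow> 'a \<Rightarrow> real"
  assumes fin: "finite_measure M" and g: "\<And>n. sq_int M (g n)"
    and cauchy: "\<And>e. 0 < e \<Longrightarrow> \<exists>N. \<forall>m\<ge>N. \<forall>n\<ge>N. (LINT x|M. (g m x - g n x)\<^sup>2) < e"
  shows "\<exists>h. sq_int M h \<and> (\<lambda>n. LINT x|M. (g n x - h x)\<^sup>2) \<longlonglongrightarrow> 0"
proof -
  interpret finite_measure M by fact
  have gm[measurable]: "g n \<in> borel_measurable M" for n using g by (simp add: sq_int_def)
  define c where "c k = ((1::real)/4)^k" for k
  have "\<forall>k. \<exists>N. \<forall>m\<ge>N. \<forall>n\<ge>N. (LINT x|M. (g m x - g n x)\<^sup>2) < c k"
    using cauchy by (simp add: c_def)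
  then obtain N where N: "\<And>k m n. m \<ge> N k \<Longrightarrow> n \<ge> N k \<Longrightarrow> (LINT x|M. (g m x - g n x)\<^sup>2) < c k"
    by metis
  \<comment> \<open>The maximum makes the indices strictly increasing and keeps each one beyond its
    own threshold.\<close>
  define r where "r = rec_nat (N 0) (\<lambda>k v. max (Suc v) (N (Suc k)))"
  have rN: "r k \<ge> N k" and rS: "r k < r (Suc k)" for k
    by (induction k) (auto simp: r_def)
  have rm: "strict_mono r" by (simp add: rS strict_monoI_Suc)
  let ?d = "\<lambda>k x. g (r (Suc k)) x - g (r k) x"
  have dq: "sq_int M (?d k)" for k using g by (intro sq_int_diff)
  have d1: "(LINT x|M. norm (?d k x)) \<le> (1 + measure M (space M)) * (1/2)^k" for k
  proof -
    \<comment> \<open>The parameter \<open>2^k\<close> balances the two terms: the square integral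
      is below \<open>4^(-k)\<close>, so both become multiples of \<open>2^(-k)\<close>.\<close>
    have "(LINT x|M. \<bar>?d k x\<bar>) \<le> 2^k * (LINT x|M. (?d k x)\<^sup>2) + measure M (space M) / 2^k"
      by (rule integral_abs_le_square[OF fin dq]) simp
    also have "\<dots> \<le> 2^k * c k + measure M (space M) / 2^k"
      using N[of k "r (Suc k)" "r k"] rN[of k] rS[of k] by simp
    also have "\<dots> = (1 + measure M (space M)) * (1/2)^k"
      proof -
      have "2^k * c k = ((1::real)/2)^k" unfolding c_def
        by (simp flip: power_mult_distrib)
      then show ?thesis by (simp add: field_simps power_divide)
    qed
    finally show ?thesis by simp
  qed
  have summ: "summable (\<lambda>k. LINT x|M. norm (?d k x))"
    by (rule summable_comparison_test'[where g = "\<lambda>k. (1 + measure M (space M)) * (1/2)^k"])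
      (use d1 in \<open>auto intro!: summable_mult summable_geometric\<close>)
  have dint: "integrable M (?d k)" for k using sq_int_integrable[OF fin dq] .
  have "AE x in M. summable (\<lambda>k. norm (?d k x))"
  proof -
    have "(\<integral>\<^sup>+x. (\<Sum>k. ennreal (norm (?d k x))) \<partial>M) = (\<Sum>k. \<integral>\<^sup>+x. ennreal (norm (?d k x)) \<partial>M)"
      by (rule nn_integral_suminf) auto
    also have "\<dots> = (\<Sum>k. ennreal (LINT x|M. norm (?d k x)))"
      using dint by (subst nn_integral_eq_integral) auto
    also have "\<dots> < \<infinity>"
      using summ by (subst suminf_ennreal2) auto
    finally have "(\<integral>\<^sup>+x. (\<Sum>k. ennreal (norm (?d k x))) \<partial>M) \<noteq> \<infinity>" by simp
    then have "AE x in M. (\<Sum>k. ennreal (norm (?d k x))) \<noteq> \<infinity>"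
      by (rule nn_integral_PInf_AE[rotated]) measurable
    then show ?thesis
      by eventually_elim (rule summable_suminf_not_top, auto)
  qed
  then have conv: "AE x in M. convergent (\<lambda>k. g (r k) x)"
  proof eventually_elim
    case (elim x)
    then have "summable (\<lambda>k. ?d k x)" by (rule summable_norm_cancel)
    then have "convergent (\<lambda>n. \<Sum>k<n. ?d k x)" by (simp add: summable_iff_convergent)
    then have "convergent (\<lambda>n. g (r n) x - g (r 0) x)"
      by (simp add: sum_lessThan_telescope[of "\<lambda>k. g (r k) x"])
    then show ?case
      using convergent_add[OF _ convergent_const[of "g (r 0) x"]] by fastforce
  qed
  define h where "h x = lim (\<lambda>k. g (r k) x)" for x
  have hm[measurable]: "h \<in> borel_measurable M" unfolding h_def by measurable
  have lim: "AE x in M. (\<lambda>k. g (r k) x) \<longlonglongrightarrow> h x"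
    using conv by eventually_elim (simp add: h_def convergent_LIMSEQ_iff)
  have fatou: "(\<integral>\<^sup>+x. ennreal ((g n x - h x)\<^sup>2) \<partial>M) \<le> ennreal (c k)" if "n \<ge> N k" for n k
  proof -
    have "(\<integral>\<^sup>+x. ennreal ((g n x - h x)\<^sup>2) \<partial>M) = (\<integral>\<^sup>+x. liminf (\<lambda>j. ennreal ((g n x - g (r j) x)\<^sup>2)) \<partial>M)"
    proof (rule nn_integral_cong_AE)
      show "AE x in M. ennreal ((g n x - h x)\<^sup>2) = liminf (\<lambda>j. ennreal ((g n x - g (r j) x)\<^sup>2))"
        using lim
      proof eventually_elim
        case (elim x)
        then have "(\<lambda>j. ennreal ((g n x - g (r j) x)\<^sup>2)) \<longlonglongrightarrow> ennreal ((g n x - h x)\<^sup>2)"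
          by (intro tendsto_ennrealI tendsto_intros)
        then show ?case by (metis lim_imp_Liminf trivial_limit_sequentially)
      qed
    qed
    also have "\<dots> \<le> liminf (\<lambda>j. \<integral>\<^sup>+x. ennreal ((g n x - g (r j) x)\<^sup>2) \<partial>M)"
      by (rule nn_integral_liminf) measurable
    also have "\<dots> \<le> ennreal (c k)"
    proof (rule Liminf_le)
      show "\<forall>\<^sub>F j in sequentially. (\<integral>\<^sup>+x. ennreal ((g n x - g (r j) x)\<^sup>2) \<partial>M) \<le> ennreal (c k)"
        using eventually_ge_at_top[of k]
      proof eventually_elim
        case (elim j)
        have "r j \<ge> r k" using elim rm by (simp add: strict_mono_less_eq)
        then have "(LINT x|M. (g n x - g (r j) x)\<^sup>2) < c k"
          using N[of k n "r j"] that rN[of k] by linarith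
        moreover have "integrable M (\<lambda>x. (g n x - g (r j) x)\<^sup>2)"
          using sq_int_diff[OF g g] by (simp add: sq_int_def)
        ultimately show ?case by (simp add: nn_integral_eq_integral ennreal_leI)
      qed
    qed simp
    finally show ?thesis .
  qed
  have hq: "sq_int M (\<lambda>x. g n x - h x)" if "n \<ge> N k" for n k
  proof -
    have "integrable M (\<lambda>x. (g n x - h x)\<^sup>2)"
    proof (rule integrableI_bounded)
      show "(\<integral>\<^sup>+x. ennreal (norm ((g n x - h x)\<^sup>2)) \<partial>M) < \<infinity>"
        using fatou[OF that] by (simp add: le_less_trans)
    qed measurable
    then show ?thesis by (simp add: sq_int_def)
  qed
  have le: "(LINT x|M. (g n x - h x)\<^sup>2) \<le> c k" if "n \<ge> N k" for n k
  proof -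
    have "ennreal (LINT x|M. (g n x - h x)\<^sup>2) \<le> ennreal (c k)"
      using fatou[OF that] hq[OF that] by (subst nn_integral_eq_integral[symmetric]) (auto simp: sq_int_def)
    then show ?thesis by (simp add: c_def)
  qed
  have "sq_int M h"
    using sq_int_diff[OF g[of "N 0"] hq[of 0 "N 0"]] by simp
  moreover have "(\<lambda>n. LINT x|M. (g n x - h x)\<^sup>2) \<longlonglongrightarrow> 0"
  proof (rule LIMSEQ_I)
    fix e :: real assume "0 < e"
    then obtain k where k: "c k < e"
      using real_arch_pow_inv[of e "1/4"] by (auto simp: c_def)
    have "norm ((LINT x|M. (g n x - h x)\<^sup>2) - 0) < e" if "n \<ge> N k" for n
      using le[OF that] k by simp
    then show "\<exists>n0. \<forall>n\<ge>n0. norm ((LINT x|M. (g n x - h x)\<^sup>2) - 0) < e" by blast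
  qed
  ultimately show ?thesis by blast
qed

lemma acd_abs_diff_le:
  assumes u: "abs_cont_deriv l u g" and xy: "x \<in> {0..l}" "y \<in> {0..l}"
  shows "\<bar>u y - u x\<bar> \<le> (LINT t|leb l. \<bar>g t\<bar>)"
proof -
  have i: "integrable (leb l) g" using acd_integrable[OF u] .
  have "\<bar>u y - u x\<bar> \<le> (LINT t|leb l. \<bar>g t\<bar>)" if "x \<le> y" "x \<in> {0..l}" "y \<in> {0..l}" for x y
  proof -
    have "\<bar>u y - u x\<bar> \<le> (LINT s|leb l. \<bar>indicator {x<..y} s * g s\<bar>)"
      using acd_diff[OF u, of x y] that by (simp add: integral_abs_bound)
    also have "\<dots> \<le> (LINT t|leb l. \<bar>g t\<bar>)"
    proof (rule integral_mono)
      show "integrable (leb l) (\<lambda>x'. \<bar>indicat_real {x<..y} x' * g x'\<bar>)"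
        by (rule Bochner_Integration.integrable_bound[OF i]) (use i in \<open>auto simp: indicator_def\<close>)
    qed (use i in \<open>auto simp: indicator_def\<close>)
    finally show ?thesis .
  qed
  from this[of x y] this[of y x] xy show ?thesis by linarith
qed

text \<open>Hoelder continuity of exponent 1/2 with a free parameter in place of the square root. It
  is uniform in all functions whose derivatives obey the same square bound, which is the
  equicontinuity asked for by Arzela-Ascoli.\<close>

lemma acd_holder:
  assumes u: "abs_cont_deriv l u g" and g: "sq_int (leb l) g" and \<eta>: "0 < \<eta>"
    and xy: "x \<in> {0..l}" "y \<in> {0..l}"
  shows "\<bar>u y - u x\<bar> \<le> \<eta> * (LINT t|leb l. (g t)\<^sup>2) + \<bar>y - x\<bar> / \<eta>"
proof -
  have *: "\<bar>u y - u x\<bar> \<le> \<eta> * (LINT t|leb l. (g t)\<^sup>2) + (y - x) / \<eta>"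
    if "x \<le> y" "x \<in> {0..l}" "y \<in> {0..l}" for x y
  proof -
    let ?g = "\<lambda>s. indicator {x<..y} s * g s"
    have i: "integrable (leb l) g" using acd_integrable[OF u] .
    have gi: "integrable (leb l) (\<lambda>s. (g s)\<^sup>2)" "g \<in> borel_measurable (leb l)" using g by (auto simp: sq_int_def)
    have i1: "integrable (leb l) ?g"
      by (rule Bochner_Integration.integrable_bound[OF i]) (use i in \<open>auto simp: indicator_def\<close>)
    have ind: "integrable (leb l) (indicator {x<..y} :: real \<Rightarrow> real)"
      by (rule Bochner_Integration.integrable_bound[where f = "\<lambda>_. 1::real"])
        (auto simp: indicator_def finite_measure.integrable_const[OF finite_measure_leb])
    have "\<bar>u y - u x\<bar> \<le> (LINT s|leb l. \<bar>?g s\<bar>)"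
      using acd_diff[OF u, of x y] that by (simp add: integral_abs_bound)
    also have "\<dots> \<le> (LINT s|leb l. \<eta> * (g s)\<^sup>2 + indicator {x<..y} s / \<eta>)"
    proof (rule integral_mono)
      fix s
      have "2 * ((\<eta> * \<bar>g s\<bar>) * 1) \<le> (\<eta> * \<bar>g s\<bar>)\<^sup>2 + 1\<^sup>2"
        using sum_squares_bound[of "\<eta> * \<bar>g s\<bar>" 1] by simp
      moreover have "0 \<le> \<eta> * \<bar>g s\<bar>" using \<eta> by simp
      ultimately have "\<eta> * \<bar>g s\<bar> \<le> \<eta>\<^sup>2 * (g s)\<^sup>2 + 1" by (simp add: power_mult_distrib)
      then have "\<bar>g s\<bar> \<le> \<eta> * (g s)\<^sup>2 + 1 / \<eta>"
        using \<eta> by (simp add: field_simps power2_eq_square)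
      then show "\<bar>?g s\<bar> \<le> \<eta> * (g s)\<^sup>2 + indicator {x<..y} s / \<eta>"
        using \<eta> by (auto simp: indicator_def)
    qed (use i1 gi ind in auto)
    also have "\<dots> = \<eta> * (LINT s|leb l. (g s)\<^sup>2) + (LINT s|leb l. indicator {x<..y} s) / \<eta>"
      using gi ind by simp
    also have "(LINT s|leb l. indicator {x<..y} s) = y - x"
    proof -
      have "{x<..y} \<inter> {0..l} = {x<..y}"
        using that by auto
      then have "(LINT s|leb l. indicator {x<..y} s) = measure (leb l) {x<..y}"
        by simp
      also have "\<dots> = y - x" 
        using that by (subst measure_restrict_space) (auto simp: subset_iff)
      finally show ?thesis .
    qed
    finally show ?thesis .
  qed
  show ?thesis
    using *[of x y] *[of y x] xy
    by (cases "x \<le> y") (simp_all add: abs_minus_commute[of "u y"] abs_of_nonneg abs_of_neg not_le)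
qed

text \<open>The square of u has derivative \<open>2 u g\<close>, and \<open>2 \<bar>u g\<bar> \<le>
  u\<^sup>2 / \<epsilon> + \<epsilon> g\<^sup>2\<close>; averaging the resulting comparison of
  \<open>u(x)\<^sup>2\<close> with \<open>u(t)\<^sup>2\<close> over t gives the term with 1/l. A
  small \<epsilon> makes the derivative part as small as desired.\<close>

lemma acd_sup_bound:
  assumes u: "abs_cont_deriv l u g" and g: "sq_int (leb l) g" and l: "0 < l" and e: "0 < \<epsilon>"
    and x: "x \<in> {0..l}"
  shows "(u x)\<^sup>2 \<le> (1 / l + 1 / \<epsilon>) * (LINT t|leb l. (u t)\<^sup>2) + \<epsilon> * (LINT t|leb l. (g t)\<^sup>2)"
proof -
  interpret finite_measure "leb l" by (rule finite_measure_leb)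
  let ?G = "LINT t|leb l. (g t)\<^sup>2" and ?U = "LINT t|leb l. (u t)\<^sup>2"
  have c: "continuous_on {0..l} u" using acd_continuous[OF u] .
  have ui: "integrable (leb l) (\<lambda>t. (u t)\<^sup>2)"
    by (intro integrable_leb_continuous continuous_intros c)
  have gi: "integrable (leb l) (\<lambda>t. (g t)\<^sup>2)" using g by (simp add: sq_int_def)
  have sq: "abs_cont_deriv l (\<lambda>t. u t * u t) (\<lambda>t. g t * u t + u t * g t)"
    by (rule acd_mult[OF u u])
  have D: "(LINT t|leb l. \<bar>g t * u t + u t * g t\<bar>) \<le> ?U / \<epsilon> + \<epsilon> * ?G"
  proof -
    have "(LINT t|leb l. \<bar>g t * u t + u t * g t\<bar>) \<le> (LINT t|leb l. (u t)\<^sup>2 / \<epsilon> + \<epsilon> * (g t)\<^sup>2)"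
    proof (rule integral_mono)
      fix t
      have "2 * (\<bar>u t\<bar> * (\<epsilon> * \<bar>g t\<bar>)) \<le> \<bar>u t\<bar>\<^sup>2 + (\<epsilon> * \<bar>g t\<bar>)\<^sup>2"
        using sum_squares_bound[of "\<bar>u t\<bar>" "\<epsilon> * \<bar>g t\<bar>"] by simp
      then have "\<epsilon> * (2 * (\<bar>u t\<bar> * \<bar>g t\<bar>)) \<le> (u t)\<^sup>2 + \<epsilon>\<^sup>2 * (g t)\<^sup>2"
        by (simp add: power_mult_distrib algebra_simps)
      then have "2 * (\<bar>u t\<bar> * \<bar>g t\<bar>) \<le> (u t)\<^sup>2 / \<epsilon> + \<epsilon> * (g t)\<^sup>2"
        using e by (simp add: field_simps power2_eq_square)
      moreover have "\<bar>g t * u t + u t * g t\<bar> = 2 * (\<bar>u t\<bar> * \<bar>g t\<bar>)"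
        by (simp add: mult.commute[of "g t"] abs_mult)
      ultimately show "\<bar>g t * u t + u t * g t\<bar> \<le> (u t)\<^sup>2 / \<epsilon> + \<epsilon> * (g t)\<^sup>2" by simp
    qed (use acd_integrable[OF sq] ui gi in auto)
    also have "\<dots> = ?U / \<epsilon> + \<epsilon> * ?G" using ui gi by simp
    finally show ?thesis .
  qed
  have "l * (u x)\<^sup>2 = (LINT t|leb l. (u x)\<^sup>2)"
    using integral_leb_const[of l "(u x)\<^sup>2"] l by linarith
  also have "\<dots> \<le> (LINT t|leb l. (u t)\<^sup>2 + (?U / \<epsilon> + \<epsilon> * ?G))"
  proof (rule integral_mono)
    fix t assume "t \<in> space (leb l)"
    then have "t \<in> {0..l}" by simp
    from acd_abs_diff_le[OF sq this x] D
    show "(u x)\<^sup>2 \<le> (u t)\<^sup>2 + (?U / \<epsilon> + \<epsilon> * ?G)" by (simp add: power2_eq_square)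
  qed (use ui in auto)
  also have "\<dots> = ?U + l * (?U / \<epsilon> + \<epsilon> * ?G)"
    using ui integral_leb_const[of l "?U / \<epsilon> + \<epsilon> * ?G"] l by simp
  also have "\<dots> = l * ((1 / l + 1 / \<epsilon>) * ?U + \<epsilon> * ?G)"
    using l by (simp add: distrib_left distrib_right)
  finally have "l * (u x)\<^sup>2 \<le> l * ((1 / l + 1 / \<epsilon>) * ?U + \<epsilon> * ?G)" .
  then show ?thesis using l by simp
qed

section \<open>Reflecting an interval and cutting functions off to a part of it\<close>

lemma leb_reflect:
  fixes f :: "real \<Rightarrow> real"
  shows "integrable (leb l) (\<lambda>t. f (l - t)) \<longleftrightarrow> integrable (leb l) f"
    and "(LINT t|leb l. f (l - t)) = (LINT t|leb l. f t)"
proof -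
  have ind: "indicator {0..l} (l + - 1 * t) *\<^sub>R f (l + - 1 * t) = indicator {0..l} t *\<^sub>R f (l - t)" for t :: real
    by (auto simp: indicator_def)
  show "integrable (leb l) (\<lambda>t. f (l - t)) \<longleftrightarrow> integrable (leb l) f"
    using lebesgue_integrable_real_affine_iff[of "-1" "\<lambda>t. indicator {0..l} t *\<^sub>R f t" l]
    unfolding ind by (simp add: integrable_restrict_space)
  show "(LINT t|leb l. f (l - t)) = (LINT t|leb l. f t)"
    using lebesgue_integral_real_affine[of "-1" "\<lambda>t. indicator {0..l} t *\<^sub>R f t" l]
    unfolding ind by (simp add: integral_restrict_space)
qed

lemma acd_reflect:
  assumes u: "abs_cont_deriv l u g"
  shows "abs_cont_deriv l (\<lambda>t. u (l - t)) (\<lambda>t. - g (l - t))"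
  unfolding acd_iff
proof (intro conjI ballI)
  have g: "integrable (leb l) g" using acd_integrable[OF u] .
  then show "integrable (leb l) (\<lambda>t. - g (l - t))"
    using leb_reflect(1)[of l g] by simp
  fix t assume t: "t \<in> {0..l}"
  have "(LINT s|leb t. g (l - s)) = (LINT s|leb l. indicator {..t} s * g (l - s))"
    using t by (intro integral_leb_sub) simp
  also have "\<dots> = (LINT s|leb l. indicator {..t} (l - s) * g s)"
    using leb_reflect(2)[of l "\<lambda>s. indicator {..t} (l - s) * g s"] by simp
  also have "\<dots> = (LINT s|leb l. indicator {l-t<..l} s * g s)"
  proof (rule integral_cong_AE)
    show "AE s in leb l. indicator {..t} (l - s) * g s = indicator {l-t<..l} s * g s"
      using AE_leb_neq[of "l - t" l] AE_space
      by eventually_elim (use t in \<open>auto simp: indicator_def\<close>)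
  qed (use g in \<open>auto intro!: borel_measurable_times\<close>)
  also have "\<dots> = u l - u (l - t)"
    using acd_diff[OF u, of "l - t" l] t by simp
  finally show "u (l - t) = u (l - 0) + (LINT s|leb t. - g (l - s))"
    by simp
qed

lemma sq_int_reflect:
  assumes "sq_int (leb l) g" "integrable (leb l) g"
  shows "sq_int (leb l) (\<lambda>t. g (l - t))"
  using assms leb_reflect(1)[of l g] leb_reflect(1)[of l "\<lambda>t. (g t)\<^sup>2"] by (auto simp: sq_int_def)

text \<open>The interval is half-open so that cut-off functions on adjacent intervals have disjoint
  supports at every point, not merely almost everywhere; the missing endpoint is a null set.\<close>

lemma integral_leb_FTC:
  fixes F F' :: "real \<Rightarrow> real"
  assumes F: "\<And>x. (F has_real_derivative F' x) (at x)" and F': "continuous_on UNIV F'"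
    and ab: "0 \<le> a" "a \<le> b" "b \<le> l"
  shows "integrable (leb l) (\<lambda>t. indicator {a..<b} t * F' t)"
    and "(LINT t|leb l. indicator {a..<b} t * F' t) = F b - F a"
proof -
  have "(F' has_integral F b - F a) {a..b}"
    by (rule fundamental_theorem_of_calculus)
      (use ab F in \<open>auto simp: has_real_derivative_iff_has_vector_derivative[symmetric] intro: has_field_derivative_at_within\<close>)
  moreover have ci: "integrable (lebesgue_on {a..b}) F'"
    using continuous_imp_integrable[of a b F'] continuous_on_subset[OF F'] by (simp add: cbox_interval)
  ultimately have h: "integral\<^sup>L (lebesgue_on {a..b}) F' = F b - F a"
    using lebesgue_integral_eq_integral[of "{a..b}" F'] by (simp add: integral_unique)
  have Fm: "F' \<in> borel_measurable (leb l)"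
    by (rule measurable_leb_continuous) (rule continuous_on_subset[OF F' subset_UNIV])
  show "integrable (leb l) (\<lambda>t. indicator {a..<b} t * F' t)"
    by (rule Bochner_Integration.integrable_bound[where f = F'])
      (use Fm in \<open>auto intro!: integrable_leb_continuous continuous_on_subset[OF F'] simp: indicator_def\<close>)
  have "(LINT t|leb l. indicator {a..<b} t * F' t) = (LINT t|leb l. indicator {a..b} t * F' t)"
  proof (rule integral_cong_AE)
    show "AE t in leb l. indicator {a..<b} t * F' t = indicator {a..b} t * F' t"
      using AE_leb_neq[of b l] by eventually_elim (auto simp: indicator_def)
  qed (use Fm in \<open>auto intro!: borel_measurable_times\<close>)
  also have "\<dots> = (LINT t|lebesgue. indicator {0..l} t *\<^sub>R (indicator {a..b} t * F' t))"
    by (simp add: integral_restrict_space)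
  also have "\<dots> = (LINT t|lebesgue. indicator {a..b} t *\<^sub>R F' t)"
    by (rule Bochner_Integration.integral_cong) (use ab in \<open>auto simp: indicator_def\<close>)
  also have "\<dots> = F b - F a"
    using h by (simp add: integral_restrict_space)
  finally show "(LINT t|leb l. indicator {a..<b} t * F' t) = F b - F a" .
qed

text \<open>Clamping the argument freezes F outside \<open>[a, b]\<close>, so the derivative is cut
  off there. If F vanishes at a and b, this is the extension of the arc by zero.\<close>

lemma acd_clamp:
  fixes F F' :: "real \<Rightarrow> real"
  assumes F: "\<And>x. (F has_real_derivative F' x) (at x)" and F': "continuous_on UNIV F'"
    and ab: "0 \<le> a" "a \<le> b" "b \<le> l"
  shows "abs_cont_deriv l (\<lambda>t. F (max a (min b t))) (\<lambda>t. indicator {a..<b} t * F' t)"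
    and "sq_int (leb l) (\<lambda>t. indicator {a..<b} t * F' t)"
proof -
  have Fm: "F' \<in> borel_measurable (leb l)"
    by (rule measurable_leb_continuous) (rule continuous_on_subset[OF F' subset_UNIV])
  show "sq_int (leb l) (\<lambda>t. indicator {a..<b} t * F' t)"
    unfolding sq_int_def
  proof
    have "continuous_on {0..l} (\<lambda>t. (F' t)\<^sup>2)"
      by (intro continuous_intros continuous_on_subset[OF F' subset_UNIV])
    then show "integrable (leb l) (\<lambda>t. (indicator {a..<b} t * F' t)\<^sup>2)"
      by (intro Bochner_Integration.integrable_bound[OF integrable_leb_continuous])
        (use Fm in \<open>auto simp: indicator_def intro!: borel_measurable_times borel_measurable_power\<close>)
  qed (use Fm in \<open>auto intro!: borel_measurable_times\<close>)
  show "abs_cont_deriv l (\<lambda>t. F (max a (min b t))) (\<lambda>t. indicator {a..<b} t * F' t)"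
    unfolding acd_iff
  proof (intro conjI ballI)
    show "integrable (leb l) (\<lambda>t. indicator {a..<b} t * F' t)"
      by (rule integral_leb_FTC(1)[OF F F' ab])
    fix t assume t: "t \<in> {0..l}"
    show "F (max a (min b t)) = F (max a (min b 0)) + (LINT t|leb t. indicator {a..<b} t * F' t)"
    proof (cases "a \<le> t")
      case True
      have "(LINT s|leb t. indicator {a..<b} s * F' s) = (LINT s|leb t. indicator {a..<min b t} s * F' s)"
      proof (rule integral_cong_AE)
        show "AE s in leb t. indicator {a..<b} s * F' s = indicator {a..<min b t} s * F' s"
          using AE_leb_neq[of t t] AE_space by eventually_elim (auto simp: indicator_def)
        show "(\<lambda>s. indicator {a..<b} s * F' s) \<in> borel_measurable (leb t)"
          "(\<lambda>s. indicator {a..<min b t} s * F' s) \<in> borel_measurable (leb t)"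
          using measurable_leb_continuous[OF continuous_on_subset[OF F' subset_UNIV], of t]
          by (auto intro!: borel_measurable_times)
      qed
      also have "\<dots> = F (min b t) - F a"
        by (rule integral_leb_FTC(2)[OF F F']) (use ab True in auto)
      finally show ?thesis using ab True t by (simp add: max_absorb1 max_absorb2 min_def)
    next
      case False
      have "(LINT s|leb t. indicator {a..<b} s * F' s) = (LINT s|leb t. 0)"
        by (rule Bochner_Integration.integral_cong) (use False in \<open>auto simp: indicator_def\<close>)
      then show ?thesis using ab False t by (simp add: min_def max_def)
    qed
  qed
qed

section \<open>The min-max principle for a closed form\<close>

text \<open>Gaussian elimination: if the last equation has a nonzero coefficient at p, it is solved
  for the unknown p and substituted into the others, which leaves one equation and one unknown
  fewer.\<close>

lemma homogeneous_system_nontrivial: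
  fixes A :: "nat \<Rightarrow> 'i \<Rightarrow> real"
  assumes "finite L" "n < card L"
  shows "\<exists>c. (\<exists>l\<in>L. c l \<noteq> 0) \<and> (\<forall>i<n. (\<Sum>l\<in>L. A i l * c l) = 0)"
  using assms
proof (induction n arbitrary: L A)
  case 0
  then obtain l where "l \<in> L" by fastforce
  then show ?case by (intro exI[of _ "\<lambda>_. 1"]) auto
next
  case (Suc n)
  show ?case
  proof (cases "\<forall>l\<in>L. A n l = 0")
    case True
    obtain c where "\<exists>l\<in>L. c l \<noteq> 0" "\<forall>i<n. (\<Sum>l\<in>L. A i l * c l) = 0"
      using Suc.IH[of L A] Suc.prems by auto
    with True show ?thesis by (intro exI[of _ c]) (auto simp: less_Suc_eq)
  next
    case False
    then obtain p where p: "p \<in> L" "A n p \<noteq> 0" by blast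
    define B where "B i l = A i l - A i p * A n l / A n p" for i l
    have "n < card (L - {p})" "finite (L - {p})" using Suc.prems p by (auto simp: card_Diff_singleton)
    from Suc.IH[OF this(2,1), of B] obtain c
      where c: "\<exists>l\<in>L - {p}. c l \<noteq> 0" "\<forall>i<n. (\<Sum>l\<in>L - {p}. B i l * c l) = 0" by auto
    let ?s = "\<Sum>l\<in>L - {p}. A n l * c l"
    \<comment> \<open>The value at p is the one forced by the last equation.\<close>
    define d where "d = c(p := - ?s / A n p)"
    have split: "(\<Sum>l\<in>L. A i l * d l) = A i p * (- ?s / A n p) + (\<Sum>l\<in>L - {p}. A i l * c l)" for i
    proof -
      have "(\<Sum>l\<in>L - {p}. A i l * d l) = (\<Sum>l\<in>L - {p}. A i l * c l)"
        by (rule sum.cong) (auto simp: d_def)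
      then show ?thesis
        using sum.remove[OF Suc.prems(1) p(1), of "\<lambda>l. A i l * d l"] by (simp add: d_def)
    qed
    have "(\<Sum>l\<in>L. A i l * d l) = 0" if "i < Suc n" for i
    proof (cases "i = n")
      case True
      then show ?thesis using p by (simp add: split)
    next
      case False
      then have "0 = (\<Sum>l\<in>L - {p}. B i l * c l)" using c(2) that by simp
      also have "\<dots> = (\<Sum>l\<in>L - {p}. A i l * c l) - A i p / A n p * ?s"
        by (simp add: B_def left_diff_distrib sum_subtractf sum_distrib_left mult.assoc)
      finally show ?thesis by (simp add: split)
    qed
    moreover have "\<exists>l\<in>L. d l \<noteq> 0" using c(1) by (auto simp: d_def)
    ultimately show ?thesis by blast
  qed
qed

text \<open>Bilinearity is demanded in the left argument; symmetry transfers it to the right. No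
  sign is required, because the potential may be negative.\<close>

definition sym_form :: "'a::real_vector set \<Rightarrow> ('a \<Rightarrow> 'a \<Rightarrow> real) \<Rightarrow> bool"
  where "sym_form X q \<longleftrightarrow> subspace X \<and> (\<forall>x\<in>X. \<forall>y\<in>X. q x y = q y x) \<and>
    (\<forall>x\<in>X. \<forall>y\<in>X. \<forall>z\<in>X. q (x + y) z = q x z + q y z) \<and> (\<forall>x\<in>X. \<forall>y\<in>X. \<forall>c. q (c *\<^sub>R x) y = c * q x y)"

context
  fixes X :: "'a::real_vector set" and q :: "'a \<Rightarrow> 'a \<Rightarrow> real"
  assumes q: "sym_form X q"
begin

lemma sym_form_subspace: "subspace X"
  using q unfolding sym_form_def by blast

lemma sym_form_commute: "x \<in> X \<Longrightarrow> y \<in> X \<Longrightarrow> q x y = q y x"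
  using q unfolding sym_form_def by blast

lemma sym_form_add_left: "x \<in> X \<Longrightarrow> y \<in> X \<Longrightarrow> z \<in> X \<Longrightarrow> q (x + y) z = q x z + q y z"
  using q unfolding sym_form_def by blast

lemma sym_form_scale_left: "x \<in> X \<Longrightarrow> y \<in> X \<Longrightarrow> q (c *\<^sub>R x) y = c * q x y"
  using q unfolding sym_form_def by blast

lemma sym_form_diff_left:
  assumes "x \<in> X" "y \<in> X" "z \<in> X"
  shows "q (x - y) z = q x z - q y z"
proof -
  have "q (x - y) z = q (x + (-1) *\<^sub>R y) z" by simp
  also have "\<dots> = q x z + (-1) * q y z"
    using assms subspace_scale[OF sym_form_subspace, of y "-1"]
    by (simp only: sym_form_add_left sym_form_scale_left)
  finally show ?thesis by simp
qed

lemma sym_form_add_right: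
  assumes "x \<in> X" "y \<in> X" "z \<in> X"
  shows "q z (x + y) = q z x + q z y"
  using assms sym_form_commute[of z "x + y"] sym_form_commute[of z x] sym_form_commute[of z y]
    subspace_add[OF sym_form_subspace, of x y] sym_form_add_left[of x y z] by simp

lemma sym_form_diff_right:
  assumes "x \<in> X" "y \<in> X" "z \<in> X"
  shows "q z (x - y) = q z x - q z y"
  using assms sym_form_commute[of z "x - y"] sym_form_commute[of z x] sym_form_commute[of z y]
    subspace_diff[OF sym_form_subspace, of x y] sym_form_diff_left[of x y z] by simp

lemma sym_form_scale_right:
  assumes "x \<in> X" "y \<in> X"
  shows "q y (c *\<^sub>R x) = c * q y x"
  using assms sym_form_commute[of y "c *\<^sub>R x"] sym_form_commute[of y x]
    subspace_scale[OF sym_form_subspace, of x c] sym_form_scale_left[of x y c] by simp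

lemmas sym_form_simps = sym_form_add_left sym_form_add_right sym_form_scale_left sym_form_scale_right
  sym_form_diff_left sym_form_diff_right

lemma sym_form_zero: "y \<in> X \<Longrightarrow> q 0 y = 0" "y \<in> X \<Longrightarrow> q y 0 = 0"
  using sym_form_scale_left[of 0 y 0] sym_form_scale_right[of 0 y 0] subspace_0[OF sym_form_subspace]
  by simp_all

lemma sym_form_sum:
  assumes "\<And>i. i \<in> I \<Longrightarrow> x i \<in> X" "y \<in> X"
  shows "q (\<Sum>i\<in>I. c i *\<^sub>R x i) y = (\<Sum>i\<in>I. c i * q (x i) y)"
  using assms
proof (induction I rule: infinite_finite_induct)
  case (insert j F)
  have "(\<Sum>i\<in>F. c i *\<^sub>R x i) \<in> X" "c j *\<^sub>R x j \<in> X"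
    using insert.prems by (auto intro!: subspace_sum subspace_scale sym_form_subspace)
  then show ?case using insert by (simp add: sym_form_simps)
qed (simp_all add: sym_form_zero)

lemma sym_form_square_add:
  assumes "x \<in> X" "y \<in> X"
  shows "q (x + y) (x + y) = q x x + 2 * q x y + q y y"
    "q (x - y) (x - y) = q x x - 2 * q x y + q y y"
proof -
  have "x + y \<in> X" "x - y \<in> X"
    using assms by (auto simp: subspace_add subspace_diff sym_form_subspace)
  then show "q (x + y) (x + y) = q x x + 2 * q x y + q y y"
    "q (x - y) (x - y) = q x x - 2 * q x y + q y y"
    using assms sym_form_commute[of x y] by (simp_all add: sym_form_simps)
qed

lemma sym_form_cauchy_schwarz:
  assumes Y: "subspace Y" "Y \<subseteq> X" and nonneg: "\<And>x. x \<in> Y \<Longrightarrow> 0 \<le> q x x" and xy: "x \<in> Y" "y \<in> Y"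
  shows "(q x y)\<^sup>2 \<le> q x x * q y y"
proof -
  have X: "x \<in> X" "y \<in> X" using xy Y by auto
  have p: "0 \<le> q x x + 2 * t * q x y + t\<^sup>2 * q y y" for t
  proof -
    have ty: "t *\<^sub>R y \<in> X" using X by (simp add: subspace_scale sym_form_subspace)
    have "0 \<le> q (x + t *\<^sub>R y) (x + t *\<^sub>R y)"
      using nonneg subspace_add[OF Y(1) xy(1) subspace_scale[OF Y(1) xy(2)]] by blast
    also have "\<dots> = q x x + 2 * (t * q x y) + t * (t * q y y)"
      using X ty by (simp add: sym_form_square_add sym_form_simps)
    finally show ?thesis by (simp add: power2_eq_square)
  qed
  show ?thesis
  proof (cases "q y y = 0")
    case True
    have "q x y = 0"
    proof (rule ccontr)
      \<comment> \<open>With \<open>q y y = 0\<close> the polynomial is affine in t; the chosen t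
        gives it the value -1.\<close>
      assume n: "q x y \<noteq> 0"
      have "0 \<le> q x x + 2 * (- (q x x + 1) / (2 * q x y)) * q x y"
        using p[of "- (q x x + 1) / (2 * q x y)"] unfolding True by simp
      moreover have "2 * (- (q x x + 1) / (2 * q x y)) * q x y = - (q x x + 1)"
        using n by simp
      ultimately show False by linarith
    qed
    then show ?thesis using True by simp
  next
    case False
    then have "q y y > 0" using nonneg xy by (simp add: less_le)
    moreover have "0 \<le> q x x + 2 * (- q x y / q y y) * q x y + (- q x y / q y y)\<^sup>2 * q y y" by (rule p)
    then have "0 \<le> q x x - (q x y)\<^sup>2 / q y y"
      using False by (simp add: power2_eq_square field_simps)
    ultimately show ?thesis by (simp add: field_simps)
  qed
qed

end

lemma sym_form_combine:
  assumes "sym_form X a" "sym_form X m"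
  shows "sym_form X (\<lambda>x y. a x y + c * m x y)"
  unfolding sym_form_def
proof (intro conjI ballI allI)
  note [simp] = sym_form_simps[OF assms(1)] sym_form_simps[OF assms(2)]
  show "subspace X" by (rule sym_form_subspace[OF assms(1)])
  fix x y z r assume X: "x \<in> X" "y \<in> X"
  show "a x y + c * m x y = a y x + c * m y x"
    using sym_form_commute[OF assms(1) X] sym_form_commute[OF assms(2) X] by simp
  show "a (r *\<^sub>R x) y + c * m (r *\<^sub>R x) y = r * (a x y + c * m x y)"
    using X by (simp add: distrib_left)
  show "a (x + y) z + c * m (x + y) z = a x z + c * m x z + (a y z + c * m y z)" if "z \<in> X"
    using X that by (simp add: distrib_left)
qed

text \<open>A semibounded closed form whose domain embeds compactly into the mass norm, in terms of
  sequences. The mass m may be degenerate, since the vectors will be concrete functions without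
  identification almost everywhere. Completeness speaks of the absolute value of a because a has no
  sign.\<close>

locale closed_form =
  fixes X :: "'a::real_vector set" and a m :: "'a \<Rightarrow> 'a \<Rightarrow> real" and C :: real
  assumes a: "sym_form X a" and m: "sym_form X m"
    and m_nonneg: "x \<in> X \<Longrightarrow> 0 \<le> m x x"
    and lower: "x \<in> X \<Longrightarrow> 0 \<le> a x x + C * m x x"
    and compactness: "\<lbrakk>\<And>n::nat. s n \<in> X; \<And>n. m (s n) (s n) \<le> 1; \<And>n. a (s n) (s n) \<le> B\<rbrakk> \<Longrightarrow>
      \<exists>r::nat \<Rightarrow> nat. strict_mono r \<and>
        (\<forall>e>0. \<exists>N. \<forall>i\<ge>N. \<forall>j\<ge>N. m (s (r i) - s (r j)) (s (r i) - s (r j)) < e)"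
    and completeness: "\<lbrakk>\<And>n::nat. s n \<in> X;
      \<And>e. 0 < e \<Longrightarrow> \<exists>N. \<forall>i\<ge>N. \<forall>j\<ge>N. m (s i - s j) (s i - s j) < e;
      \<And>e. 0 < e \<Longrightarrow> \<exists>N. \<forall>i\<ge>N. \<forall>j\<ge>N. \<bar>a (s i - s j) (s i - s j)\<bar> < e\<rbrakk> \<Longrightarrow>
      \<exists>y\<in>X. (\<lambda>n. m (s n - y) (s n - y)) \<longlonglongrightarrow> 0 \<and> (\<lambda>n. a (s n - y) (s n - y)) \<longlonglongrightarrow> 0"
begin

lemmas subspace_X = sym_form_subspace[OF a]

text \<open>A minimizing sequence converges because the form \<open>a - \<kappa> m\<close>, which is nonnegative on \<open>Y\<close>, obeys
  the parallelogram law.\<close>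

lemma minimizer_exists:
  fixes j :: nat
  assumes Y: "Y = {x \<in> X. \<forall>i<j. m x (u i) = 0}" and u: "\<And>i. i < j \<Longrightarrow> u i \<in> X"
    and \<psi>: "\<psi> \<in> Y" "0 < m \<psi> \<psi>" "a \<psi> \<psi> \<le> \<Lambda> * m \<psi> \<psi>"
  shows "\<exists>y\<in>Y. \<exists>\<nu>\<le>\<Lambda>. m y y = 1 \<and> (\<forall>w\<in>Y. a y w = \<nu> * m y w)"
proof -
  note sub = subspace_X
  have Ysub: "subspace Y"
    unfolding Y subspace_def using sub u
    by (auto simp: subspace_0 subspace_add subspace_scale sym_form_zero[OF m] sym_form_simps[OF m])
  have YX: "Y \<subseteq> X" using Y by auto
  define S where "S = {a x x | x. x \<in> Y \<and> m x x = 1}"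
  \<comment> \<open>The least Rayleigh quotient on Y: \<open>lower\<close> bounds it by -C, and the
    given trial vector bounds it by \<Lambda>.\<close>
  define \<kappa> where "\<kappa> = Inf S"
  define \<theta> where "\<theta> = (1 / sqrt (m \<psi> \<psi>)) *\<^sub>R \<psi>"
  have norml: "m (t *\<^sub>R x) (t *\<^sub>R x) = t\<^sup>2 * m x x" "a (t *\<^sub>R x) (t *\<^sub>R x) = t\<^sup>2 * a x x" if "x \<in> X" for t x
    using that subspace_scale[OF sub that, of t]
    by (simp_all add: sym_form_simps[OF m] sym_form_simps[OF a] power2_eq_square)
  have \<psi>X: "\<psi> \<in> X" using \<psi> YX by auto
  have S0: "a \<theta> \<theta> \<in> S"
    unfolding S_def \<theta>_def using \<psi> \<psi>X subspace_scale[OF Ysub \<psi>(1)]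
    by (auto simp: norml power_divide intro!: exI[of _ "(1 / sqrt (m \<psi> \<psi>)) *\<^sub>R \<psi>"])
  have S1: "- C \<le> s" if "s \<in> S" for s
    using that lower YX unfolding S_def by force
  then have bdd: "bdd_below S" by (auto simp: bdd_below_def)
  have kLam: "\<kappa> \<le> \<Lambda>"
  proof -
    have "\<kappa> \<le> a \<theta> \<theta>" unfolding \<kappa>_def by (rule cInf_lower[OF S0 bdd])
    also have "\<dots> = a \<psi> \<psi> / m \<psi> \<psi>" using \<psi> \<psi>X by (simp add: \<theta>_def norml power_divide)
    also have "\<dots> \<le> \<Lambda>" using \<psi> by (simp add: divide_le_eq)
    finally show ?thesis .
  qed
  define b where "b x y = a x y + (- \<kappa>) * m x y" for x y
  have b: "sym_form X b" unfolding b_def by (rule sym_form_combine[OF a m])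
  have b0: "0 \<le> b x x" if x: "x \<in> Y" for x
  proof (cases "m x x = 0")
    case True
    then show ?thesis using lower[of x] x YX by (auto simp: b_def)
  next
    case False
    then have pos: "0 < m x x" using m_nonneg x YX by (auto simp: less_le)
    let ?y = "(1 / sqrt (m x x)) *\<^sub>R x"
    have "m ?y ?y = 1" "a ?y ?y = a x x / m x x" "?y \<in> Y"
      using pos x YX subspace_scale[OF Ysub x] norml by (auto simp: power_divide)
    then have "a x x / m x x \<in> S" unfolding S_def by force
    then have "\<kappa> \<le> a x x / m x x" unfolding \<kappa>_def using bdd by (rule cInf_lower)
    then show ?thesis using pos by (simp add: b_def field_simps)
  qed
  have "\<exists>x. x \<in> Y \<and> m x x = 1 \<and> a x x < \<kappa> + 1 / Suc n" for n
  proof -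
    have "Inf S < \<kappa> + 1 / Suc n" by (simp add: \<kappa>_def)
    then obtain s where "s \<in> S" "s < \<kappa> + 1 / Suc n"
      using cInf_lessD[of S] S0 by auto
    then show ?thesis by (auto simp: S_def)
  qed
  then obtain x where x: "\<And>n. x n \<in> Y" "\<And>n. m (x n) (x n) = 1" "\<And>n. a (x n) (x n) < \<kappa> + 1 / Suc n"
    by metis
  have "a (x n) (x n) \<le> \<kappa> + 1" for n
  proof -
    have "1 / real (Suc n) \<le> 1" by simp
    then show ?thesis using x(3)[of n] by linarith
  qed
  then have "\<exists>r::nat \<Rightarrow> nat. strict_mono r \<and>
      (\<forall>e>0. \<exists>N. \<forall>i\<ge>N. \<forall>j\<ge>N. m (x (r i) - x (r j)) (x (r i) - x (r j)) < e)"
    using x YX by (intro compactness[of x "\<kappa> + 1"]) auto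
  then obtain r :: "nat \<Rightarrow> nat" where r: "strict_mono r"
    and rc: "\<forall>e>0. \<exists>N. \<forall>i\<ge>N. \<forall>j\<ge>N. m (x (r i) - x (r j)) (x (r i) - x (r j)) < e"
    by blast
  define z where "z n = x (r n)" for n
  have zY: "z n \<in> Y" and zX: "z n \<in> X" and z1: "m (z n) (z n) = 1" for n
    using x YX by (auto simp: z_def)
  have bz: "b (z n) (z n) < 1 / Suc n" for n
  proof -
    have "1 / real (Suc (r n)) \<le> 1 / real (Suc n)"
      using seq_suble[OF r, of n] by (simp add: frac_le)
    then show ?thesis using x(3)[of "r n"] z1[of n] by (simp add: b_def z_def)
  qed
  have par: "b (z i - z j) (z i - z j) \<le> 2 / Suc i + 2 / Suc j" for i j
  proof -
    have "0 \<le> b (z i + z j) (z i + z j)" by (rule b0) (simp add: subspace_add[OF Ysub] zY)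
    then have "b (z i - z j) (z i - z j) \<le> 2 * b (z i) (z i) + 2 * b (z j) (z j)"
      using sym_form_square_add[OF b zX zX, of i j] by simp
    also have "\<dots> \<le> 2 / Suc i + 2 / Suc j" using bz[of i] bz[of j] by simp
    finally show ?thesis .
  qed
  have mc: "\<exists>N. \<forall>i\<ge>N. \<forall>j\<ge>N. m (z i - z j) (z i - z j) < e" if "0 < e" for e
    using rc that by (auto simp: z_def)
  \<comment> \<open>On differences, a equals b plus \<kappa> times m. The first is small by the
    parallelogram law, the second because the sequence is Cauchy in mass; each receives half of
    e.\<close>
  have ac: "\<exists>N. \<forall>i\<ge>N. \<forall>j\<ge>N. \<bar>a (z i - z j) (z i - z j)\<bar> < e" if e: "0 < e" for e
  proof -
    have "0 < e / (2 * (\<bar>\<kappa>\<bar> + 1))" using e by simp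
    from mc[OF this] obtain N where N: "\<And>i j. i \<ge> N \<Longrightarrow> j \<ge> N \<Longrightarrow> m (z i - z j) (z i - z j) < e / (2 * (\<bar>\<kappa>\<bar> + 1))"
      by blast
    obtain N' where N': "8 / e < real N'" using reals_Archimedean2 by blast
    have "\<bar>a (z i - z j) (z i - z j)\<bar> < e" if ij: "i \<ge> max N N'" "j \<ge> max N N'" for i j
    proof -
      let ?d = "z i - z j"
      have dY: "?d \<in> Y" by (simp add: subspace_diff[OF Ysub] zY)
      have m0: "0 \<le> m ?d ?d" using m_nonneg dY YX by auto
      have "(\<bar>\<kappa>\<bar> + 1) * m ?d ?d < e / 2" using N[of i j] ij by (simp add: field_simps)
      then have lm: "\<bar>\<kappa> * m ?d ?d\<bar> < e / 2" using m0 by (simp add: abs_mult distrib_right)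
      have "8 / e < real (Suc i)" "8 / e < real (Suc j)" using N' ij by simp_all
      then have "2 / real (Suc i) < e / 4" "2 / real (Suc j) < e / 4"
        using e by (simp_all add: field_simps)
      then have "b ?d ?d < e / 2" using par[of i j] by simp
      moreover have "0 \<le> b ?d ?d" by (rule b0[OF dY])
      moreover have "a ?d ?d = b ?d ?d + \<kappa> * m ?d ?d" by (simp add: b_def)
      ultimately show ?thesis using lm by linarith
    qed
    then show ?thesis by blast
  qed
  obtain y where y: "y \<in> X" "(\<lambda>n. m (z n - y) (z n - y)) \<longlonglongrightarrow> 0" "(\<lambda>n. a (z n - y) (z n - y)) \<longlonglongrightarrow> 0"
    using completeness[OF zX mc ac] by blast
  have dX: "z n - y \<in> X" for n using subspace_diff[OF sub zX y(1)] .
  have conv: "(\<lambda>n. q (z n - y) w) \<longlonglongrightarrow> 0"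
    if q: "sym_form X q" "\<And>x. x \<in> X \<Longrightarrow> 0 \<le> q x x" and l: "(\<lambda>n. q (z n - y) (z n - y)) \<longlonglongrightarrow> 0" and w: "w \<in> X" for q w
  proof -
    have "(\<lambda>n. (q (z n - y) w)\<^sup>2) \<longlonglongrightarrow> 0"
    proof (rule tendsto_sandwich[where f = "\<lambda>_. 0", OF always_eventually always_eventually])
      show "\<forall>n. (q (z n - y) w)\<^sup>2 \<le> q (z n - y) (z n - y) * q w w"
        using sym_form_cauchy_schwarz[OF q(1) sub _ q(2)] dX w by blast
      show "(\<lambda>n. q (z n - y) (z n - y) * q w w) \<longlonglongrightarrow> 0"
        using tendsto_mult_right[OF l, of "q w w"] by simp
    qed auto
    then show ?thesis by (simp add: tendsto_null_power)
  qed
  have mconv: "(\<lambda>n. m (z n - y) w) \<longlonglongrightarrow> 0" if "w \<in> X" for w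
    by (rule conv[OF m m_nonneg y(2) that])
  have aconv: "(\<lambda>n. a (z n - y) w) \<longlonglongrightarrow> 0" if "w \<in> X" for w
  proof -
    have "(\<lambda>n. a (z n - y) (z n - y) + C * m (z n - y) (z n - y)) \<longlonglongrightarrow> 0 + C * 0"
      by (intro tendsto_intros y)
    then have "(\<lambda>n. a (z n - y) w + C * m (z n - y) w) \<longlonglongrightarrow> 0"
      using conv[OF sym_form_combine[OF a m, of C] lower _ that] by simp
    from tendsto_diff[OF this tendsto_mult[OF tendsto_const[of C] mconv[OF that]]] show ?thesis by simp
  qed
  have zy: "q (z n) (z n) = q y y + 2 * q (z n - y) y + q (z n - y) (z n - y)" if "sym_form X q" for q n
    using sym_form_square_add(1)[OF that dX y(1), of n] by simp
  have yY: "y \<in> Y"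
  proof -
    have "m y (u i) = 0" if i: "i < j" for i
    proof -
      have "m (z n - y) (u i) = - m y (u i)" for n
        using zY[of n] i u[OF i] y(1) zX by (simp add: Y sym_form_simps[OF m])
      then have "(\<lambda>n. - m y (u i)) \<longlonglongrightarrow> 0" using mconv[OF u[OF i]] by simp
      then show ?thesis by (simp add: LIMSEQ_const_iff)
    qed
    then show ?thesis using y(1) by (simp add: Y)
  qed
  have my: "m y y = 1"
  proof -
    have "(\<lambda>n. m y y + 2 * m (z n - y) y + m (z n - y) (z n - y)) \<longlonglongrightarrow> m y y + 2 * 0 + 0"
      by (intro tendsto_intros mconv y)
    then have "(\<lambda>n. 1) \<longlonglongrightarrow> m y y" using zy[OF m] z1 by simp
    then show ?thesis by (simp add: LIMSEQ_const_iff)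
  qed
  have ay: "b y y = 0"
  proof -
    have "(\<lambda>n. a y y + 2 * a (z n - y) y + a (z n - y) (z n - y)) \<longlonglongrightarrow> a y y + 2 * 0 + 0"
      by (intro tendsto_intros aconv y)
    then have 1: "(\<lambda>n. a (z n) (z n)) \<longlonglongrightarrow> a y y" using zy[OF a] by simp
    have 2: "(\<lambda>n. b (z n) (z n)) \<longlonglongrightarrow> 0"
    proof (rule tendsto_sandwich[where f = "\<lambda>_. 0", OF always_eventually always_eventually])
      show "\<forall>n. b (z n) (z n) \<le> 1 / Suc n" using bz less_imp_le by blast
      show "(\<lambda>n. 1 / real (Suc n)) \<longlonglongrightarrow> 0" using LIMSEQ_inverse_real_of_nat by (simp add: inverse_eq_divide)
    qed (use b0[OF zY] in auto)
    have "(\<lambda>n. a (z n) (z n)) \<longlonglongrightarrow> \<kappa>"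
      using tendsto_add[OF 2 tendsto_const[of \<kappa>]] z1 by (simp add: b_def)
    then have "a y y = \<kappa>" using 1 LIMSEQ_unique by blast
    then show ?thesis using my by (simp add: b_def)
  qed
  \<comment> \<open>The Euler-Lagrange equation without differentiation: b is nonnegative on Y and
    vanishes at y, so Cauchy-Schwarz annihilates \<open>b y w\<close>.\<close>
  have "a y w = \<kappa> * m y w" if w: "w \<in> Y" for w
  proof -
    have "(b y w)\<^sup>2 \<le> b y y * b w w"
      by (rule sym_form_cauchy_schwarz[OF b Ysub YX b0 yY w])
    then have "b y w = 0" using ay by simp
    then show ?thesis by (simp add: b_def)
  qed
  then show ?thesis using yY my kLam by blast
qed

text \<open>Successive constrained minimization. Given j < k orthonormal eigenvectors, some
  nontrivial combination of the k trial vectors is orthogonal to them, since j equations in k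
  unknowns are solvable. Its quotient is at most \<Lambda>, hence so is the minimum over the
  orthogonal complement, and the minimizer is the next eigenvector.\<close>

theorem min_max:
  fixes k :: nat
  assumes \<phi>: "\<And>i. i < k \<Longrightarrow> \<phi> i \<in> X"
    and indep: "\<And>c. m (\<Sum>i<k. c i *\<^sub>R \<phi> i) (\<Sum>i<k. c i *\<^sub>R \<phi> i) = 0 \<Longrightarrow> \<forall>i<k. c i = 0"
    and bound: "\<And>c. a (\<Sum>i<k. c i *\<^sub>R \<phi> i) (\<Sum>i<k. c i *\<^sub>R \<phi> i)
      \<le> \<Lambda> * m (\<Sum>i<k. c i *\<^sub>R \<phi> i) (\<Sum>i<k. c i *\<^sub>R \<phi> i)"
  shows "\<exists>u \<nu>. \<forall>i<k. u i \<in> X \<and> \<nu> i \<le> \<Lambda> \<and> (\<forall>w\<in>X. a (u i) w = \<nu> i * m (u i) w) \<and>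
    (\<forall>j<k. m (u i) (u j) = (if i = j then 1 else 0))"
proof -
  have "\<exists>u \<nu>. \<forall>i<j. u i \<in> X \<and> \<nu> i \<le> \<Lambda> \<and> (\<forall>w\<in>X. a (u i) w = \<nu> i * m (u i) w) \<and>
    (\<forall>l<j. m (u i) (u l) = (if i = l then 1 else 0))" if "j \<le> k" for j
    using that
  proof (induction j)
    case 0
    then show ?case by simp
  next
    case (Suc j)
    then have "\<exists>u \<nu>. \<forall>i<j. u i \<in> X \<and> \<nu> i \<le> \<Lambda> \<and> (\<forall>w\<in>X. a (u i) w = \<nu> i * m (u i) w) \<and>
        (\<forall>l<j. m (u i) (u l) = (if i = l then 1 else 0))" by simp
    then obtain u \<nu> where "\<forall>i<j. u i \<in> X \<and> \<nu> i \<le> \<Lambda> \<and> (\<forall>w\<in>X. a (u i) w = \<nu> i * m (u i) w) \<and>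
        (\<forall>l<j. m (u i) (u l) = (if i = l then 1 else 0))" by blast
    then have u: "\<And>i. i < j \<Longrightarrow> u i \<in> X" "\<And>i. i < j \<Longrightarrow> \<nu> i \<le> \<Lambda>"
      "\<And>i w. i < j \<Longrightarrow> w \<in> X \<Longrightarrow> a (u i) w = \<nu> i * m (u i) w"
      "\<And>i l. i < j \<Longrightarrow> l < j \<Longrightarrow> m (u i) (u l) = (if i = l then 1 else 0)"
      by auto
    define Y where "Y = {x \<in> X. \<forall>i<j. m x (u i) = 0}"
    obtain c where c: "\<exists>l\<in>{..<k}. c l \<noteq> 0" "\<forall>i<j. (\<Sum>l<k. m (\<phi> l) (u i) * c l) = 0"
      using homogeneous_system_nontrivial[of "{..<k}" j "\<lambda>i l. m (\<phi> l) (u i)"] Suc.prems by auto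
    let ?\<psi> = "\<Sum>l<k. c l *\<^sub>R \<phi> l"
    have \<psi>X: "?\<psi> \<in> X" using \<phi> subspace_X by (auto intro!: subspace_sum subspace_scale)
    have "m ?\<psi> (u i) = 0" if "i < j" for i
      using c(2) that sym_form_sum[OF m, of "{..<k}" \<phi> "u i" c] \<phi> u(1)[OF that] by (simp add: mult.commute)
    then have \<psi>Y: "?\<psi> \<in> Y" using \<psi>X by (simp add: Y_def)
    have "m ?\<psi> ?\<psi> \<noteq> 0"
    proof
      assume "m ?\<psi> ?\<psi> = 0"
      then have "\<forall>l<k. c l = 0" by (rule indep)
      then show False using c(1) by simp
    qed
    then have pos: "0 < m ?\<psi> ?\<psi>"
      using m_nonneg[OF \<psi>X] by linarith
    from minimizer_exists[OF Y_def u(1) \<psi>Y pos bound] obtain y \<mu>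
      where y: "y \<in> Y" "\<mu> \<le> \<Lambda>" "m y y = 1" "\<And>w. w \<in> Y \<Longrightarrow> a y w = \<mu> * m y w" by blast
    have yX: "y \<in> X" and yu: "\<And>i. i < j \<Longrightarrow> m y (u i) = 0" using y by (auto simp: Y_def)
    have uy: "m (u i) y = 0" if "i < j" for i
      using yu[OF that] sym_form_commute[OF m yX u(1)[OF that]] by simp
    \<comment> \<open>So far the equation holds only for test vectors in Y. The projection of w onto
      the earlier eigenvectors is annihilated by \<open>m y\<close> by orthogonality and by
      \<open>a y\<close> because those vectors are eigenvectors, so it may be subtracted.\<close>
    have ay: "a y w = \<mu> * m y w" if w: "w \<in> X" for w
    proof -
      let ?p = "\<Sum>i<j. m w (u i) *\<^sub>R u i"
      have pX: "?p \<in> X" using u(1) subspace_X by (auto intro!: subspace_sum subspace_scale)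
      have ps: "q ?p v = (\<Sum>i<j. m w (u i) * q (u i) v)" if "sym_form X q" "v \<in> X" for q v
        using sym_form_sum[OF that(1), of "{..<j}" u v] u(1) that by simp
      have "m (w - ?p) (u l) = 0" if l: "l < j" for l
      proof -
        have "m ?p (u l) = (\<Sum>i<j. m w (u i) * m (u i) (u l))" using ps[OF m u(1)[OF l]] .
        also have "\<dots> = (\<Sum>i<j. if i = l then m w (u l) else 0)"
          by (rule sum.cong) (use u(4) l in auto)
        finally have "m ?p (u l) = m w (u l)" using l by simp
        then show ?thesis using sym_form_diff_left[OF m w pX u(1)[OF l]] by simp
      qed
      then have wp: "w - ?p \<in> Y" using subspace_diff[OF subspace_X w pX] by (simp add: Y_def)
      have mp: "m y ?p = 0"
      proof -
        have "m y ?p = (\<Sum>i<j. m w (u i) * m (u i) y)" using ps[OF m yX] sym_form_commute[OF m yX pX] by simp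
        also have "\<dots> = 0" using uy by (intro sum.neutral) simp
        finally show ?thesis .
      qed
      have ap: "a y ?p = 0"
      proof -
        have "a y ?p = (\<Sum>i<j. m w (u i) * a (u i) y)" using ps[OF a yX] sym_form_commute[OF a yX pX] by simp
        also have "\<dots> = 0" using u(3)[OF _ yX] uy by (intro sum.neutral) simp
        finally show ?thesis .
      qed
      have "a y (w - ?p) = \<mu> * m y (w - ?p)" by (rule y(4)[OF wp])
      then show ?thesis
        using sym_form_diff_right[OF m w pX yX] sym_form_diff_right[OF a w pX yX] mp ap by simp
    qed
    show ?case
    proof (intro exI[of _ "u(j := y)"] exI[of _ "\<nu>(j := \<mu>)"])
      show "\<forall>i<Suc j. (u(j := y)) i \<in> X \<and> (\<nu>(j := \<mu>)) i \<le> \<Lambda> \<and>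
          (\<forall>w\<in>X. a ((u(j := y)) i) w = (\<nu>(j := \<mu>)) i * m ((u(j := y)) i) w) \<and>
          (\<forall>l<Suc j. m ((u(j := y)) i) ((u(j := y)) l) = (if i = l then 1 else 0))"
        using u y(2,3) yX ay yu uy by (auto simp: less_Suc_eq)
    qed
  qed
  from this[of k] show ?thesis by auto
qed

end

section \<open>Forms on a metric graph\<close>

text \<open>Together with the instance for pairs, this turns triples of functions into a real vector
  space on which the abstract min-max principle acts.\<close>

instantiation "fun" :: (type, real_vector) real_vector
begin

definition scaleR_fun_def: "c *\<^sub>R f = (\<lambda>x. c *\<^sub>R f x)"

instance
  by standard (simp_all add: scaleR_fun_def fun_eq_iff scaleR_add_right scaleR_add_left)

end

lemma scaleR_fun_apply [simp]: "(c *\<^sub>R f) x = c *\<^sub>R f x"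
  by (simp add: scaleR_fun_def)

text \<open>Vertex values, edge functions, edge derivatives. The derivative is carried along as data
  because it is determined only almost everywhere; the vertex values make continuity at the vertices
  a set of linear equations between components.\<close>

type_synonym ('v, 'e) graph_fun = "('v \<Rightarrow> real) \<times> ('e \<Rightarrow> real \<Rightarrow> real) \<times> ('e \<Rightarrow> real \<Rightarrow> real)"

abbreviation val :: "('v, 'e) graph_fun \<Rightarrow> 'v \<Rightarrow> real"
  where "val x \<equiv> fst x"

abbreviation fn :: "('v, 'e) graph_fun \<Rightarrow> 'e \<Rightarrow> real \<Rightarrow> real"
  where "fn x \<equiv> fst (snd x)"

abbreviation der :: "('v, 'e) graph_fun \<Rightarrow> 'e \<Rightarrow> real \<Rightarrow> real"
  where "der x \<equiv> snd (snd x)"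

lemma fun_sum_apply: "(\<Sum>i\<in>I. f i) x = (\<Sum>i\<in>I. f i x)"
  by (induction I rule: infinite_finite_induct) auto

lemma graph_fun_sum:
  "val (\<Sum>i\<in>I. x i) v = (\<Sum>i\<in>I. val (x i) v)"
  "fn (\<Sum>i\<in>I. x i) e t = (\<Sum>i\<in>I. fn (x i) e t)"
  "der (\<Sum>i\<in>I. x i) e t = (\<Sum>i\<in>I. der (x i) e t)"
  by (simp_all add: fst_sum snd_sum fun_sum_apply)

definition sobolev :: "('v, 'e) pre_metric_graph \<Rightarrow> ('v, 'e) graph_fun set"
  where "sobolev \<Gamma> = {x. \<forall>e\<in>edges \<Gamma>.
    abs_cont_deriv (len \<Gamma> e) (fn x e) (der x e) \<and> sq_int (leb (len \<Gamma> e)) (der x e) \<and>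
    fn x e 0 = val x (src \<Gamma> e) \<and> fn x e (len \<Gamma> e) = val x (tgt \<Gamma> e)}"

definition potential_form ::
    "('v, 'e) pre_metric_graph \<Rightarrow> ('e \<Rightarrow> real \<Rightarrow> real) \<Rightarrow> ('v, 'e) graph_fun \<Rightarrow> ('v, 'e) graph_fun \<Rightarrow> real"
  where "potential_form \<Gamma> w x y = (\<Sum>e\<in>edges \<Gamma>. LINT t|leb (len \<Gamma> e). w e t * (fn x e t * fn y e t))"

abbreviation mass_form :: "('v, 'e) pre_metric_graph \<Rightarrow> ('v, 'e) graph_fun \<Rightarrow> ('v, 'e) graph_fun \<Rightarrow> real"
  where "mass_form \<Gamma> \<equiv> potential_form \<Gamma> (\<lambda>e t. 1)"

definition dirichlet_form :: "('v, 'e) pre_metric_graph \<Rightarrow> ('v, 'e) graph_fun \<Rightarrow> ('v, 'e) graph_fun \<Rightarrow> real"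
  where "dirichlet_form \<Gamma> x y = (\<Sum>e\<in>edges \<Gamma>. LINT t|leb (len \<Gamma> e). der x e t * der y e t)"

definition vertex_form ::
    "('v, 'e) pre_metric_graph \<Rightarrow> ('v \<Rightarrow> real) \<Rightarrow> ('v, 'e) graph_fun \<Rightarrow> ('v, 'e) graph_fun \<Rightarrow> real"
  where "vertex_form \<Gamma> \<alpha> x y = (\<Sum>v\<in>verts \<Gamma>. \<alpha> v * (val x v * val y v))"

lemma sobolevD:
  assumes "x \<in> sobolev \<Gamma>" "e \<in> edges \<Gamma>"
  shows "abs_cont_deriv (len \<Gamma> e) (fn x e) (der x e)" "sq_int (leb (len \<Gamma> e)) (der x e)"
    "fn x e 0 = val x (src \<Gamma> e)" "fn x e (len \<Gamma> e) = val x (tgt \<Gamma> e)"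
    "continuous_on {0..len \<Gamma> e} (fn x e)"
  using assms acd_continuous by (auto simp: sobolev_def)

lemma acd_zero: "abs_cont_deriv l (\<lambda>_. 0) (\<lambda>_. 0)"
  by (simp add: acd_iff)

lemma subspace_sobolev: "subspace (sobolev \<Gamma>)"
  unfolding subspace_def
proof (intro conjI ballI allI)
  show "0 \<in> sobolev \<Gamma>"
    using acd_zero by (auto simp: sobolev_def sq_int_def zero_fun_def)
  fix x y c assume x: "x \<in> sobolev \<Gamma>"
  show "c *\<^sub>R x \<in> sobolev \<Gamma>"
    unfolding sobolev_def
  proof (clarsimp, intro conjI)
    fix e assume e: "e \<in> edges \<Gamma>"
    have "(c *\<^sub>R fn x e) = (\<lambda>t. c * fn x e t)" "(c *\<^sub>R der x e) = (\<lambda>t. c * der x e t)" by auto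
    then show "abs_cont_deriv (len \<Gamma> e) (c *\<^sub>R fn x e) (c *\<^sub>R der x e)" "sq_int (leb (len \<Gamma> e)) (c *\<^sub>R der x e)"
      using acd_cmult[OF sobolevD(1)[OF x e]] sq_int_cmult[OF sobolevD(2)[OF x e]] by simp_all
  qed (use sobolevD[OF x] in auto)
  assume y: "y \<in> sobolev \<Gamma>"
  show "x + y \<in> sobolev \<Gamma>"
    unfolding sobolev_def
  proof (clarsimp, intro conjI)
    fix e assume e: "e \<in> edges \<Gamma>"
    have "(fn x e + fn y e) = (\<lambda>t. fn x e t + fn y e t)" "der x e + der y e = (\<lambda>t. der x e t + der y e t)" by auto
    then show "abs_cont_deriv (len \<Gamma> e) (fn x e + fn y e) (der x e + der y e)" "sq_int (leb (len \<Gamma> e)) (der x e + der y e)"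
      using acd_add[OF sobolevD(1)[OF x e] sobolevD(1)[OF y e]]
        sq_int_add[OF sobolevD(2)[OF x e] sobolevD(2)[OF y e]] by simp_all
  qed (use sobolevD[OF x] sobolevD[OF y] in auto)
qed

lemma sym_form_edge_sum:
  assumes X: "subspace X" and bil:
    "\<And>e x y. e \<in> E \<Longrightarrow> x \<in> X \<Longrightarrow> y \<in> X \<Longrightarrow> b e x y = b e y x"
    "\<And>e x y z. e \<in> E \<Longrightarrow> x \<in> X \<Longrightarrow> y \<in> X \<Longrightarrow> z \<in> X \<Longrightarrow> b e (x + y) z = b e x z + b e y z"
    "\<And>e x y c. e \<in> E \<Longrightarrow> x \<in> X \<Longrightarrow> y \<in> X \<Longrightarrow> b e (c *\<^sub>R x) y = c * b e x y"
  shows "sym_form X (\<lambda>x y. \<Sum>e\<in>E. b e x y)"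
  unfolding sym_form_def using assms
  by (auto simp: sum.distrib[symmetric] sum_distrib_left intro!: sum.cong)

lemma sym_form_potential:
  assumes w: "\<And>e. e \<in> edges \<Gamma> \<Longrightarrow> integrable (leb (len \<Gamma> e)) (w e)"
  shows "sym_form (sobolev \<Gamma>) (potential_form \<Gamma> w)"
  unfolding potential_form_def
proof (rule sym_form_edge_sum[OF subspace_sobolev])
  have i: "integrable (leb (len \<Gamma> e)) (\<lambda>t. w e t * (fn x e t * fn y e t))"
    if "e \<in> edges \<Gamma>" "x \<in> sobolev \<Gamma>" "y \<in> sobolev \<Gamma>" for e x y
    using that by (intro integrable_leb_mult_continuous w continuous_intros sobolevD(5))
  fix e x y z c assume e: "e \<in> edges \<Gamma>" and x: "x \<in> sobolev \<Gamma>" and y: "y \<in> sobolev \<Gamma>"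
  show "(LINT t|leb (len \<Gamma> e). w e t * (fn x e t * fn y e t)) = (LINT t|leb (len \<Gamma> e). w e t * (fn y e t * fn x e t))"
    by (simp add: mult.commute)
  have "(LINT t|leb (len \<Gamma> e). w e t * (fn (c *\<^sub>R x) e t * fn y e t)) = (LINT t|leb (len \<Gamma> e). c * (w e t * (fn x e t * fn y e t)))"
    by (rule Bochner_Integration.integral_cong) (auto simp: algebra_simps)
  then show "(LINT t|leb (len \<Gamma> e). w e t * (fn (c *\<^sub>R x) e t * fn y e t)) = c * (LINT t|leb (len \<Gamma> e). w e t * (fn x e t * fn y e t))"
    by simp
  assume z: "z \<in> sobolev \<Gamma>"
  have "(LINT t|leb (len \<Gamma> e). w e t * (fn (x + y) e t * fn z e t))
      = (LINT t|leb (len \<Gamma> e). w e t * (fn x e t * fn z e t) + w e t * (fn y e t * fn z e t))"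
    by (rule Bochner_Integration.integral_cong) (auto simp: algebra_simps)
  then show "(LINT t|leb (len \<Gamma> e). w e t * (fn (x + y) e t * fn z e t))
      = (LINT t|leb (len \<Gamma> e). w e t * (fn x e t * fn z e t)) + (LINT t|leb (len \<Gamma> e). w e t * (fn y e t * fn z e t))"
    using i[OF e x z] i[OF e y z] by simp
qed

lemma sym_form_mass: "sym_form (sobolev \<Gamma>) (mass_form \<Gamma>)"
  by (rule sym_form_potential) (simp add: finite_measure.integrable_const[OF finite_measure_leb])

lemma sym_form_dirichlet: "sym_form (sobolev \<Gamma>) (dirichlet_form \<Gamma>)"
  unfolding dirichlet_form_def
proof (rule sym_form_edge_sum[OF subspace_sobolev])
  have i: "integrable (leb (len \<Gamma> e)) (\<lambda>t. der x e t * der y e t)"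
    if "e \<in> edges \<Gamma>" "x \<in> sobolev \<Gamma>" "y \<in> sobolev \<Gamma>" for e x y
    using that by (intro sq_int_mult sobolevD(2))
  fix e x y z c assume e: "e \<in> edges \<Gamma>" and x: "x \<in> sobolev \<Gamma>" and y: "y \<in> sobolev \<Gamma>"
  show "(LINT t|leb (len \<Gamma> e). der x e t * der y e t) = (LINT t|leb (len \<Gamma> e). der y e t * der x e t)"
    by (simp add: mult.commute)
  have "(LINT t|leb (len \<Gamma> e). der (c *\<^sub>R x) e t * der y e t) = (LINT t|leb (len \<Gamma> e). c * (der x e t * der y e t))"
    by (rule Bochner_Integration.integral_cong) (auto simp: algebra_simps)
  then show "(LINT t|leb (len \<Gamma> e). der (c *\<^sub>R x) e t * der y e t) = c * (LINT t|leb (len \<Gamma> e). der x e t * der y e t)"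
    by simp
  assume z: "z \<in> sobolev \<Gamma>"
  have "(LINT t|leb (len \<Gamma> e). der (x + y) e t * der z e t)
      = (LINT t|leb (len \<Gamma> e). der x e t * der z e t + der y e t * der z e t)"
    by (rule Bochner_Integration.integral_cong) (auto simp: algebra_simps)
  then show "(LINT t|leb (len \<Gamma> e). der (x + y) e t * der z e t)
      = (LINT t|leb (len \<Gamma> e). der x e t * der z e t) + (LINT t|leb (len \<Gamma> e). der y e t * der z e t)"
    using i[OF e x z] i[OF e y z] by simp
qed

lemma sym_form_vertex: "sym_form (sobolev \<Gamma>) (vertex_form \<Gamma> \<alpha>)"
  unfolding vertex_form_def
  by (rule sym_form_edge_sum[OF subspace_sobolev]) (auto simp: algebra_simps)

lemma abs_integral_le_sup:
  fixes w d :: "real \<Rightarrow> real"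
  assumes w: "integrable (leb l) w" and d: "continuous_on {0..l} d" and b: "\<And>t. t \<in> {0..l} \<Longrightarrow> (d t)\<^sup>2 \<le> b"
  shows "\<bar>LINT t|leb l. w t * (d t * d t)\<bar> \<le> b * (LINT t|leb l. \<bar>w t\<bar>)"
proof -
  have i: "integrable (leb l) (\<lambda>t. w t * (d t * d t))"
    by (rule integrable_leb_mult_continuous[OF w]) (intro continuous_intros d)
  have "\<bar>LINT t|leb l. w t * (d t * d t)\<bar> \<le> (LINT t|leb l. \<bar>w t * (d t * d t)\<bar>)"
    by (rule integral_abs_bound)
  also have "\<dots> \<le> (LINT t|leb l. b * \<bar>w t\<bar>)"
  proof (rule integral_mono)
    fix t assume "t \<in> space (leb l)"
    then have "(d t)\<^sup>2 \<le> b" using b by simp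
    then have "\<bar>w t\<bar> * (d t)\<^sup>2 \<le> \<bar>w t\<bar> * b" by (simp add: mult_left_mono)
    then show "\<bar>w t * (d t * d t)\<bar> \<le> b * \<bar>w t\<bar>" by (simp add: abs_mult power2_eq_square mult.commute)
  qed (use i w in auto)
  finally show ?thesis by simp
qed

locale graph_form = metric_graph \<Gamma> for \<Gamma> :: "('v, 'e) pre_metric_graph" +
  fixes \<alpha> :: "'v \<Rightarrow> real" and w :: "'e \<Rightarrow> real \<Rightarrow> real"
  assumes \<alpha>_nonneg: "v \<in> verts \<Gamma> \<Longrightarrow> 0 \<le> \<alpha> v"
    and w_integrable: "e \<in> edges \<Gamma> \<Longrightarrow> integrable (leb (len \<Gamma> e)) (w e)"
begin

definition energy :: "('v, 'e) graph_fun \<Rightarrow> ('v, 'e) graph_fun \<Rightarrow> real"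
  where "energy x y = dirichlet_form \<Gamma> x y + vertex_form \<Gamma> \<alpha> x y + potential_form \<Gamma> w x y"

lemma sym_form_energy: "sym_form (sobolev \<Gamma>) energy"
proof -
  have "sym_form (sobolev \<Gamma>) (\<lambda>x y. (dirichlet_form \<Gamma> x y + 1 * vertex_form \<Gamma> \<alpha> x y) + 1 * potential_form \<Gamma> w x y)"
    by (intro sym_form_combine sym_form_dirichlet sym_form_vertex sym_form_potential w_integrable)
  then show ?thesis by (simp add: energy_def[abs_def])
qed

definition B where "B = 1 + (\<Sum>e\<in>edges \<Gamma>. LINT t|leb (len \<Gamma> e). \<bar>w e t\<bar>)"

text \<open>Each summand is B times the mass coefficient in \<open>acd_sup_bound\<close> for the
  parameter \<open>1 / (2 * B)\<close>; the sum serves as a common upper bound over the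
  edges.\<close>

definition C where "C = (\<Sum>e\<in>edges \<Gamma>. B * (1 / len \<Gamma> e + 2 * B))"

definition K where "K = (\<Sum>e\<in>edges \<Gamma>. 1 / len \<Gamma> e + 1)"

lemma B_ge: "1 \<le> B" "e \<in> edges \<Gamma> \<Longrightarrow> (LINT t|leb (len \<Gamma> e). \<bar>w e t\<bar>) \<le> B"
proof -
  show "1 \<le> B" unfolding B_def by (simp add: sum_nonneg)
  assume "e \<in> edges \<Gamma>"
  then have "(LINT t|leb (len \<Gamma> e). \<bar>w e t\<bar>) \<le> (\<Sum>e\<in>edges \<Gamma>. LINT t|leb (len \<Gamma> e). \<bar>w e t\<bar>)"
    by (intro member_le_sum) (auto simp: finite_edges)
  then show "(LINT t|leb (len \<Gamma> e). \<bar>w e t\<bar>) \<le> B" by (simp add: B_def)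
qed

lemma C_ge: "e \<in> edges \<Gamma> \<Longrightarrow> B * (1 / len \<Gamma> e + 2 * B) \<le> C"
  unfolding C_def by (rule member_le_sum) (use B_ge(1) len_pos in \<open>auto simp: finite_edges less_imp_le\<close>)

lemma C_nonneg: "0 \<le> C"
  unfolding C_def using B_ge(1) len_pos by (intro sum_nonneg) (auto simp: less_imp_le)

lemma K_ge: "e \<in> edges \<Gamma> \<Longrightarrow> 1 / len \<Gamma> e + 1 \<le> K"
  unfolding K_def by (rule member_le_sum) (use len_pos in \<open>auto simp: finite_edges less_imp_le\<close>)

lemma mass_nonneg: "0 \<le> mass_form \<Gamma> x x"
  unfolding potential_form_def by (intro sum_nonneg) simp

lemma dirichlet_nonneg: "0 \<le> dirichlet_form \<Gamma> x x"
  unfolding dirichlet_form_def by (intro sum_nonneg) simp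

text \<open>The potential is form-bounded: on each edge its integral is at most B times the sup
  bound, and the parameter \<open>1 / (2 * B)\<close> leaves just one half of the Dirichlet part.
  The couplings are nonnegative and only increase the energy.\<close>

lemma coercive:
  assumes x: "x \<in> sobolev \<Gamma>"
  shows "dirichlet_form \<Gamma> x x / 2 \<le> energy x x + C * mass_form \<Gamma> x x"
proof -
  let ?U = "\<lambda>e. LINT t|leb (len \<Gamma> e). (fn x e t)\<^sup>2" and ?G = "\<lambda>e. LINT t|leb (len \<Gamma> e). (der x e t)\<^sup>2"
  have "\<bar>potential_form \<Gamma> w x x\<bar> \<le> (\<Sum>e\<in>edges \<Gamma>. C * ?U e + ?G e / 2)"
    unfolding potential_form_def
  proof (rule order.trans[OF sum_abs], rule sum_mono)
    fix e assume e: "e \<in> edges \<Gamma>"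
    have U0: "0 \<le> ?U e" and G0: "0 \<le> ?G e" by simp_all
    let ?b = "(1 / len \<Gamma> e + 1 / (1 / (2 * B))) * ?U e + 1 / (2 * B) * ?G e"
    have b0: "0 \<le> ?b" using U0 G0 B_ge(1) len_pos[OF e] by simp
    have "\<bar>LINT t|leb (len \<Gamma> e). w e t * (fn x e t * fn x e t)\<bar> \<le> ?b * (LINT t|leb (len \<Gamma> e). \<bar>w e t\<bar>)"
      by (rule abs_integral_le_sup[OF w_integrable[OF e] sobolevD(5)[OF x e]],
          rule acd_sup_bound[OF sobolevD(1,2)[OF x e] len_pos[OF e]]) (use B_ge(1) in auto)
    also have "\<dots> \<le> ?b * B" by (rule mult_left_mono[OF B_ge(2)[OF e] b0])
    also have "\<dots> = B * (1 / len \<Gamma> e + 2 * B) * ?U e + ?G e / 2"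
      using B_ge(1) by (simp add: field_simps)
    also have "\<dots> \<le> C * ?U e + ?G e / 2"
      using C_ge[OF e] U0 by (simp add: mult_right_mono)
    finally show "\<bar>LINT t|leb (len \<Gamma> e). w e t * (fn x e t * fn x e t)\<bar> \<le> C * ?U e + ?G e / 2" .
  qed
  also have "\<dots> = C * mass_form \<Gamma> x x + dirichlet_form \<Gamma> x x / 2"
    by (simp add: potential_form_def dirichlet_form_def sum.distrib sum_distrib_left sum_divide_distrib power2_eq_square)
  finally have "- (C * mass_form \<Gamma> x x + dirichlet_form \<Gamma> x x / 2) \<le> potential_form \<Gamma> w x x" by linarith
  moreover have "0 \<le> vertex_form \<Gamma> \<alpha> x x"
    unfolding vertex_form_def using \<alpha>_nonneg by (intro sum_nonneg) simp
  ultimately show ?thesis by (simp add: energy_def)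
qed

lemma edge_le_form:
  assumes "e \<in> edges \<Gamma>"
  shows "(LINT t|leb (len \<Gamma> e). (fn x e t)\<^sup>2) \<le> mass_form \<Gamma> x x"
    "(LINT t|leb (len \<Gamma> e). (der x e t)\<^sup>2) \<le> dirichlet_form \<Gamma> x x"
proof -
  have "(LINT t|leb (len \<Gamma> e). (fn x e t)\<^sup>2) \<le> (\<Sum>e\<in>edges \<Gamma>. LINT t|leb (len \<Gamma> e). (fn x e t)\<^sup>2)"
    by (rule member_le_sum[OF assms]) (auto simp: finite_edges)
  then show "(LINT t|leb (len \<Gamma> e). (fn x e t)\<^sup>2) \<le> mass_form \<Gamma> x x"
    by (simp add: potential_form_def power2_eq_square)
  have "(LINT t|leb (len \<Gamma> e). (der x e t)\<^sup>2) \<le> (\<Sum>e\<in>edges \<Gamma>. LINT t|leb (len \<Gamma> e). (der x e t)\<^sup>2)"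
    by (rule member_le_sum[OF assms]) (auto simp: finite_edges)
  then show "(LINT t|leb (len \<Gamma> e). (der x e t)\<^sup>2) \<le> dirichlet_form \<Gamma> x x"
    by (simp add: dirichlet_form_def power2_eq_square)
qed

lemma sup_bound:
  assumes x: "x \<in> sobolev \<Gamma>" and e: "e \<in> edges \<Gamma>" and t: "t \<in> {0..len \<Gamma> e}"
  shows "(fn x e t)\<^sup>2 \<le> K * (mass_form \<Gamma> x x + dirichlet_form \<Gamma> x x)"
proof -
  let ?U = "LINT t|leb (len \<Gamma> e). (fn x e t)\<^sup>2" and ?G = "LINT t|leb (len \<Gamma> e). (der x e t)\<^sup>2"
  have "(fn x e t)\<^sup>2 \<le> (1 / len \<Gamma> e + 1 / 1) * ?U + 1 * ?G"
    by (rule acd_sup_bound[OF sobolevD(1,2)[OF x e] len_pos[OF e] zero_less_one t])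
  also have "\<dots> \<le> (1 / len \<Gamma> e + 1) * (?U + ?G)"
    using len_pos[OF e] by (simp add: distrib_left distrib_right)
  also have "\<dots> \<le> K * (?U + ?G)"
    by (rule mult_right_mono[OF K_ge[OF e]]) simp
  also have "\<dots> \<le> K * (mass_form \<Gamma> x x + dirichlet_form \<Gamma> x x)"
  proof (rule mult_left_mono[OF add_mono])
    have "0 \<le> 1 / len \<Gamma> e + 1" using len_pos[OF e] by simp
    then show "0 \<le> K" using K_ge[OF e] by linarith
  qed (use edge_le_form[OF e] in auto)
  finally show ?thesis .
qed

text \<open>Arzela-Ascoli on one edge after the other, each time passing to a further subsequence.
  Mass and Dirichlet bounds together give the uniform bound, and the Dirichlet bound gives
  equicontinuity.\<close>

lemma uniformly_cauchy_subsequence: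
  fixes x :: "nat \<Rightarrow> ('v, 'e) graph_fun"
  assumes x: "\<And>n. x n \<in> sobolev \<Gamma>" and m: "\<And>n. mass_form \<Gamma> (x n) (x n) \<le> 1"
    and d: "\<And>n. dirichlet_form \<Gamma> (x n) (x n) \<le> G" and E: "finite E" "E \<subseteq> edges \<Gamma>"
  shows "\<exists>r::nat \<Rightarrow> nat. strict_mono r \<and> (\<forall>e\<in>E. \<forall>\<epsilon>>0. \<exists>N. \<forall>i\<ge>N. \<forall>j\<ge>N. \<forall>t\<in>{0..len \<Gamma> e}.
    \<bar>fn (x (r i)) e t - fn (x (r j)) e t\<bar> < \<epsilon>)"
  using E
proof (induction E rule: finite_induct)
  case empty
  then show ?case by (intro exI[of _ id]) (simp add: strict_mono_def)
next
  case (insert f E)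
  then obtain r :: "nat \<Rightarrow> nat" where r: "strict_mono r"
    and rc: "\<And>e \<epsilon>. e \<in> E \<Longrightarrow> 0 < \<epsilon> \<Longrightarrow> \<exists>N. \<forall>i\<ge>N. \<forall>j\<ge>N. \<forall>t\<in>{0..len \<Gamma> e}.
      \<bar>fn (x (r i)) e t - fn (x (r j)) e t\<bar> < \<epsilon>" by auto
  have f: "f \<in> edges \<Gamma>" using insert.prems by simp
  have G0: "0 \<le> G" using d[of 0] dirichlet_nonneg[of "x 0"] by linarith
  have K0: "0 \<le> K" using K_ge[OF f] len_pos[OF f] by (smt (verit) divide_pos_pos)
  have bound: "norm (fn (x n) f t) \<le> sqrt (K * (1 + G))" if "t \<in> {0..len \<Gamma> f}" for n t
  proof -
    have "(fn (x n) f t)\<^sup>2 \<le> K * (mass_form \<Gamma> (x n) (x n) + dirichlet_form \<Gamma> (x n) (x n))"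
      by (rule sup_bound[OF x f that])
    also have "\<dots> \<le> K * (1 + G)" by (rule mult_left_mono[OF add_mono[OF m d] K0])
    finally show ?thesis using real_le_rsqrt[of "\<bar>fn (x n) f t\<bar>"] by simp
  qed
  have hol: "\<bar>fn (x n) f t - fn (x n) f s\<bar> \<le> \<eta> * G + \<bar>t - s\<bar> / \<eta>"
    if "0 < \<eta>" "s \<in> {0..len \<Gamma> f}" "t \<in> {0..len \<Gamma> f}" for n s t \<eta>
  proof -
    have "\<bar>fn (x n) f t - fn (x n) f s\<bar> \<le> \<eta> * (LINT t|leb (len \<Gamma> f). (der (x n) f t)\<^sup>2) + \<bar>t - s\<bar> / \<eta>"
      by (rule acd_holder[OF sobolevD(1,2)[OF x f] that])
    also have "\<dots> \<le> \<eta> * G + \<bar>t - s\<bar> / \<eta>"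
      using edge_le_form(2)[OF f, of "x n"] d[of n] that(1) by simp
    finally show ?thesis .
  qed
  have eq: "\<exists>\<delta>>0. \<forall>n t. t \<in> {0..len \<Gamma> f} \<and> norm (s - t) < \<delta> \<longrightarrow> norm (fn (x (r n)) f s - fn (x (r n)) f t) < \<epsilon>"
    if s: "s \<in> {0..len \<Gamma> f}" and e: "0 < \<epsilon>" for s \<epsilon>
  proof -
    \<comment> \<open>The Dirichlet term of the Hoelder estimate takes less than half of \<epsilon>;
      the other half is left for the distance divided by \<eta>. Adding 1 to G covers G = 0.\<close>
    define \<eta> where "\<eta> = \<epsilon> / (2 * (G + 1))"
    have \<eta>: "0 < \<eta>" using e G0 by (simp add: \<eta>_def)
    have \<eta>G: "\<eta> * G < \<epsilon> / 2" using e G0 by (simp add: \<eta>_def field_simps)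
    show ?thesis
    proof (intro exI[of _ "\<eta> * \<epsilon> / 2"] conjI allI impI)
      show "0 < \<eta> * \<epsilon> / 2" using \<eta> e by simp
      fix n t assume t: "t \<in> {0..len \<Gamma> f} \<and> norm (s - t) < \<eta> * \<epsilon> / 2"
      then have "\<bar>s - t\<bar> / \<eta> < \<epsilon> / 2" using \<eta> by (simp add: field_simps)
      moreover have "\<bar>fn (x (r n)) f s - fn (x (r n)) f t\<bar> \<le> \<eta> * G + \<bar>s - t\<bar> / \<eta>"
        by (rule hol[OF \<eta>]) (use s t in auto)
      ultimately show "norm (fn (x (r n)) f s - fn (x (r n)) f t) < \<epsilon>"
        using \<eta>G unfolding real_norm_def by linarith
    qed
  qed
  obtain g k where k: "strict_mono (k :: nat \<Rightarrow> nat)"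
    and g: "\<And>\<epsilon>. 0 < \<epsilon> \<Longrightarrow> \<exists>N. \<forall>n t. n \<ge> N \<and> t \<in> {0..len \<Gamma> f} \<longrightarrow> norm (fn (x (r (k n))) f t - g t) < \<epsilon>"
  proof (rule Arzela_Ascoli[of "{0..len \<Gamma> f}" "\<lambda>n. fn (x (r n)) f" "sqrt (K * (1 + G))"])
    show "compact {0..len \<Gamma> f}" by simp
  qed (use bound eq in blast)+
  have kge: "i \<le> k i" for i using seq_suble[OF k] .
  show ?case
  proof (intro exI[of _ "r \<circ> k"] conjI ballI allI impI)
    show "strict_mono (r \<circ> k)" by (rule strict_mono_o[OF r k])
    fix e and \<epsilon> :: real assume e: "e \<in> insert f E" and \<epsilon>: "0 < \<epsilon>"
    show "\<exists>N. \<forall>i\<ge>N. \<forall>j\<ge>N. \<forall>t\<in>{0..len \<Gamma> e}. \<bar>fn (x ((r \<circ> k) i)) e t - fn (x ((r \<circ> k) j)) e t\<bar> < \<epsilon>"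
    proof (cases "e = f")
      case True
      from \<epsilon> have "0 < \<epsilon> / 2" by simp
      from g[OF this] obtain N where N: "\<And>n t. n \<ge> N \<Longrightarrow> t \<in> {0..len \<Gamma> f} \<Longrightarrow> norm (fn (x (r (k n))) f t - g t) < \<epsilon> / 2"
        by blast
      have "\<bar>fn (x (r (k i))) f t - fn (x (r (k j))) f t\<bar> < \<epsilon>"
        if "i \<ge> N" "j \<ge> N" "t \<in> {0..len \<Gamma> f}" for i j t
        using N[of i t] N[of j t] that unfolding real_norm_def by linarith
      then show ?thesis using True by (intro exI[of _ N]) simp
    next
      case False
      then have "e \<in> E" using e by simp
      from rc[OF this \<epsilon>] obtain N where N: "\<forall>i\<ge>N. \<forall>j\<ge>N. \<forall>t\<in>{0..len \<Gamma> e}. \<bar>fn (x (r i)) e t - fn (x (r j)) e t\<bar> < \<epsilon>" ..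
      have "k i \<ge> N" if "i \<ge> N" for i using kge[of i] that by linarith
      then show ?thesis using N by (intro exI[of _ N]) simp
    qed
  qed
qed

lemma potential_form_le:
  assumes v: "\<And>e. e \<in> edges \<Gamma> \<Longrightarrow> integrable (leb (len \<Gamma> e)) (v e)" and x: "x \<in> sobolev \<Gamma>"
    and b: "\<And>e t. e \<in> edges \<Gamma> \<Longrightarrow> t \<in> {0..len \<Gamma> e} \<Longrightarrow> (fn x e t)\<^sup>2 \<le> b"
  shows "\<bar>potential_form \<Gamma> v x x\<bar> \<le> b * (\<Sum>e\<in>edges \<Gamma>. LINT t|leb (len \<Gamma> e). \<bar>v e t\<bar>)"
  unfolding potential_form_def sum_distrib_left
  by (rule order.trans[OF sum_abs], rule sum_mono, rule abs_integral_le_sup[OF v sobolevD(5)[OF x] b])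

lemma mass_form_le:
  assumes x: "x \<in> sobolev \<Gamma>"
    and b: "\<And>e t. e \<in> edges \<Gamma> \<Longrightarrow> t \<in> {0..len \<Gamma> e} \<Longrightarrow> (fn x e t)\<^sup>2 \<le> b"
  shows "mass_form \<Gamma> x x \<le> b * total_length \<Gamma>"
proof -
  have "\<bar>mass_form \<Gamma> x x\<bar> \<le> b * (\<Sum>e\<in>edges \<Gamma>. LINT t|leb (len \<Gamma> e). \<bar>1\<bar>)"
    by (rule potential_form_le[OF _ x b]) (auto simp: finite_measure.integrable_const[OF finite_measure_leb])
  also have "(\<Sum>e\<in>edges \<Gamma>. LINT t|leb (len \<Gamma> e). \<bar>1::real\<bar>) = total_length \<Gamma>"
    unfolding total_length_def
    by (rule sum.cong) (use integral_leb_const[of _ 1] len_pos in \<open>auto simp: less_imp_le simp del: lebesgue_integral_const\<close>)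
  finally show ?thesis by linarith
qed

lemma total_length_pos: "0 < total_length \<Gamma>"
  unfolding total_length_def using len_pos finite_edges edges_nonempty by (intro sum_pos) auto

text \<open>Coercivity turns the energy bound into a Dirichlet bound. A sequence that is uniformly
  Cauchy on every edge is Cauchy in mass because the total length is finite.\<close>

lemma mass_compact:
  fixes x :: "nat \<Rightarrow> ('v, 'e) graph_fun"
  assumes x: "\<And>n. x n \<in> sobolev \<Gamma>" and m: "\<And>n. mass_form \<Gamma> (x n) (x n) \<le> 1"
    and d: "\<And>n. energy (x n) (x n) \<le> b"
  shows "\<exists>r::nat \<Rightarrow> nat. strict_mono r \<and>
    (\<forall>\<epsilon>>0. \<exists>N. \<forall>i\<ge>N. \<forall>j\<ge>N. mass_form \<Gamma> (x (r i) - x (r j)) (x (r i) - x (r j)) < \<epsilon>)"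
proof -
  have "dirichlet_form \<Gamma> (x n) (x n) \<le> 2 * (b + C)" for n
  proof -
    have "C * mass_form \<Gamma> (x n) (x n) \<le> C * 1" by (rule mult_left_mono[OF m C_nonneg])
    then show ?thesis using coercive[OF x, of n] d[of n] by simp
  qed
  from uniformly_cauchy_subsequence[of x, OF x m this finite_edges order_refl]
  obtain r :: "nat \<Rightarrow> nat" where r: "strict_mono r"
    and rc: "\<And>e \<epsilon>. e \<in> edges \<Gamma> \<Longrightarrow> 0 < \<epsilon> \<Longrightarrow> \<exists>N. \<forall>i\<ge>N. \<forall>j\<ge>N. \<forall>t\<in>{0..len \<Gamma> e}.
      \<bar>fn (x (r i)) e t - fn (x (r j)) e t\<bar> < \<epsilon>" by blast
  have "\<exists>N. \<forall>i\<ge>N. \<forall>j\<ge>N. mass_form \<Gamma> (x (r i) - x (r j)) (x (r i) - x (r j)) < \<epsilon>" if \<epsilon>: "0 < \<epsilon>" for \<epsilon>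
  proof -
    define \<delta> where "\<delta> = sqrt (\<epsilon> / (2 * total_length \<Gamma>))"
    have \<delta>: "0 < \<delta>" "\<delta>\<^sup>2 * total_length \<Gamma> < \<epsilon>"
      using \<epsilon> total_length_pos by (simp_all add: \<delta>_def)
    have "\<forall>e\<in>edges \<Gamma>. \<exists>N. \<forall>i\<ge>N. \<forall>j\<ge>N. \<forall>t\<in>{0..len \<Gamma> e}. \<bar>fn (x (r i)) e t - fn (x (r j)) e t\<bar> < \<delta>"
      using rc[OF _ \<delta>(1)] by blast
    then obtain N where N: "\<And>e i j t. e \<in> edges \<Gamma> \<Longrightarrow> i \<ge> N e \<Longrightarrow> j \<ge> N e \<Longrightarrow> t \<in> {0..len \<Gamma> e} \<Longrightarrow>
        \<bar>fn (x (r i)) e t - fn (x (r j)) e t\<bar> < \<delta>" by metis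
    have "mass_form \<Gamma> (x (r i) - x (r j)) (x (r i) - x (r j)) < \<epsilon>"
      if ij: "i \<ge> Max (N ` edges \<Gamma>)" "j \<ge> Max (N ` edges \<Gamma>)" for i j
    proof -
      have "mass_form \<Gamma> (x (r i) - x (r j)) (x (r i) - x (r j)) \<le> \<delta>\<^sup>2 * total_length \<Gamma>"
      proof (rule mass_form_le)
        show "x (r i) - x (r j) \<in> sobolev \<Gamma>" by (rule subspace_diff[OF subspace_sobolev x x])
        fix e t assume e: "e \<in> edges \<Gamma>" and t: "t \<in> {0..len \<Gamma> e}"
        have "N e \<le> Max (N ` edges \<Gamma>)" using e finite_edges by simp
        then have "\<bar>fn (x (r i)) e t - fn (x (r j)) e t\<bar> < \<delta>" using N[OF e _ _ t] ij by simp
        then have "\<bar>fn (x (r i)) e t - fn (x (r j)) e t\<bar>\<^sup>2 \<le> \<delta>\<^sup>2" by (intro power_mono) auto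
        then show "(fn (x (r i) - x (r j)) e t)\<^sup>2 \<le> \<delta>\<^sup>2" by simp
      qed
      then show ?thesis using \<delta>(2) by linarith
    qed
    then show ?thesis by blast
  qed
  then show ?thesis using r by blast
qed

text \<open>The functions converge uniformly by the sup bound, their derivatives in the mean square
  by completeness, and the limit of the derivatives is the derivative of the limit because the
  fundamental theorem passes to the limit. Uniform convergence then also handles the potential and
  the vertex terms.\<close>

lemma form_complete:
  fixes x :: "nat \<Rightarrow> ('v, 'e) graph_fun"
  assumes x: "\<And>n. x n \<in> sobolev \<Gamma>"
    and m: "\<And>\<epsilon>. 0 < \<epsilon> \<Longrightarrow> \<exists>N. \<forall>i\<ge>N. \<forall>j\<ge>N. mass_form \<Gamma> (x i - x j) (x i - x j) < \<epsilon>"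
    and a: "\<And>\<epsilon>. 0 < \<epsilon> \<Longrightarrow> \<exists>N. \<forall>i\<ge>N. \<forall>j\<ge>N. \<bar>energy (x i - x j) (x i - x j)\<bar> < \<epsilon>"
  shows "\<exists>y\<in>sobolev \<Gamma>. (\<lambda>n. mass_form \<Gamma> (x n - y) (x n - y)) \<longlonglongrightarrow> 0 \<and>
    (\<lambda>n. energy (x n - y) (x n - y)) \<longlonglongrightarrow> 0"
proof -
  have dx: "x i - x j \<in> sobolev \<Gamma>" for i j by (rule subspace_diff[OF subspace_sobolev x x])
  \<comment> \<open>The energy alone has no sign; by coercivity, adding C times the mass makes it
    control the Dirichlet form.\<close>
  have d: "\<exists>N. \<forall>i\<ge>N. \<forall>j\<ge>N. mass_form \<Gamma> (x i - x j) (x i - x j) + dirichlet_form \<Gamma> (x i - x j) (x i - x j) < \<epsilon>"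
    if \<epsilon>: "0 < \<epsilon>" for \<epsilon>
  proof -
    have "0 < \<epsilon> / (4 * (C + 1))" "0 < \<epsilon> / 8" using \<epsilon> C_nonneg by auto
    from m[OF this(1)] a[OF this(2)] obtain N1 N2
      where N1: "\<And>i j. i \<ge> N1 \<Longrightarrow> j \<ge> N1 \<Longrightarrow> mass_form \<Gamma> (x i - x j) (x i - x j) < \<epsilon> / (4 * (C + 1))"
        and N2: "\<And>i j. i \<ge> N2 \<Longrightarrow> j \<ge> N2 \<Longrightarrow> \<bar>energy (x i - x j) (x i - x j)\<bar> < \<epsilon> / 8" by blast
    have "mass_form \<Gamma> (x i - x j) (x i - x j) + dirichlet_form \<Gamma> (x i - x j) (x i - x j) < \<epsilon>"
      if "i \<ge> max N1 N2" "j \<ge> max N1 N2" for i j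
    proof -
      let ?m = "mass_form \<Gamma> (x i - x j) (x i - x j)"
      have "(C + 1) * ?m < \<epsilon> / 4" using N1[of i j] that C_nonneg by (simp add: field_simps)
      then have "C * ?m + ?m < \<epsilon> / 4" by (simp add: distrib_right)
      moreover have "0 \<le> C * ?m" "0 \<le> ?m" using C_nonneg mass_nonneg by auto
      ultimately show ?thesis using coercive[OF dx, of i j] N2[of i j] that by simp
    qed
    then show ?thesis by blast
  qed
  have K0: "0 < K"
  proof -
    obtain e where e: "e \<in> edges \<Gamma>" using edges_nonempty by blast
    then show ?thesis using K_ge[OF e] len_pos[OF e] by (smt (verit) divide_pos_pos)
  qed
  have uc: "\<exists>N. \<forall>i\<ge>N. \<forall>j\<ge>N. \<forall>e\<in>edges \<Gamma>. \<forall>t\<in>{0..len \<Gamma> e}. \<bar>fn (x i) e t - fn (x j) e t\<bar> < \<epsilon>"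
    if \<epsilon>: "0 < \<epsilon>" for \<epsilon>
  proof -
    have "0 < \<epsilon>\<^sup>2 / K" using \<epsilon> K0 by simp
    from d[OF this] obtain N where N: "\<And>i j. i \<ge> N \<Longrightarrow> j \<ge> N \<Longrightarrow>
      mass_form \<Gamma> (x i - x j) (x i - x j) + dirichlet_form \<Gamma> (x i - x j) (x i - x j) < \<epsilon>\<^sup>2 / K" by blast
    have "\<bar>fn (x i) e t - fn (x j) e t\<bar> < \<epsilon>" if "i \<ge> N" "j \<ge> N" "e \<in> edges \<Gamma>" "t \<in> {0..len \<Gamma> e}" for i j e t
    proof -
      have "(fn (x i - x j) e t)\<^sup>2 \<le> K * (mass_form \<Gamma> (x i - x j) (x i - x j) + dirichlet_form \<Gamma> (x i - x j) (x i - x j))"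
        by (rule sup_bound[OF dx that(3,4)])
      also have "\<dots> < \<epsilon>\<^sup>2" using N[OF that(1,2)] K0 by (simp add: field_simps)
      finally have "\<bar>fn (x i) e t - fn (x j) e t\<bar>\<^sup>2 < \<epsilon>\<^sup>2" by simp
      then show ?thesis by (rule power2_less_imp_less) (use \<epsilon> in simp)
    qed
    then show ?thesis by blast
  qed
  define lim_der where "lim_der e h \<longleftrightarrow> sq_int (leb (len \<Gamma> e)) h \<and>
    (\<lambda>n. LINT t|leb (len \<Gamma> e). (der (x n) e t - h t)\<^sup>2) \<longlonglongrightarrow> 0" for e h
  have "\<exists>h. lim_der e h" if e: "e \<in> edges \<Gamma>" for e
    unfolding lim_der_def
  proof (rule sq_int_complete[OF finite_measure_leb sobolevD(2)[OF x e]])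
    fix \<epsilon> :: real assume "0 < \<epsilon>"
    from d[OF this] obtain N where N: "\<And>i j. i \<ge> N \<Longrightarrow> j \<ge> N \<Longrightarrow>
      mass_form \<Gamma> (x i - x j) (x i - x j) + dirichlet_form \<Gamma> (x i - x j) (x i - x j) < \<epsilon>" by blast
    have "(LINT t|leb (len \<Gamma> e). (der (x i) e t - der (x j) e t)\<^sup>2) < \<epsilon>" if "i \<ge> N" "j \<ge> N" for i j
      using edge_le_form(2)[OF e, of "x i - x j"] mass_nonneg[of "x i - x j"] N[OF that] by simp
    then show "\<exists>N. \<forall>m\<ge>N. \<forall>n\<ge>N. (LINT t|leb (len \<Gamma> e). (der (x m) e t - der (x n) e t)\<^sup>2) < \<epsilon>" by blast
  qed
  then have "\<forall>e\<in>edges \<Gamma>. \<exists>h. lim_der e h" by blast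
  from bchoice[OF this] obtain h where "\<forall>e\<in>edges \<Gamma>. lim_der e (h e)" by blast
  then have h: "\<And>e. e \<in> edges \<Gamma> \<Longrightarrow> sq_int (leb (len \<Gamma> e)) (h e)"
    "\<And>e. e \<in> edges \<Gamma> \<Longrightarrow> (\<lambda>n. LINT t|leb (len \<Gamma> e). (der (x n) e t - h e t)\<^sup>2) \<longlonglongrightarrow> 0"
    by (auto simp: lim_der_def)
  define y where "y = ((\<lambda>v. lim (\<lambda>n. val (x n) v)), (\<lambda>e t. lim (\<lambda>n. fn (x n) e t)), h)"
  have ptw: "(\<lambda>n. fn (x n) e t) \<longlonglongrightarrow> fn y e t" if e: "e \<in> edges \<Gamma>" and t: "t \<in> {0..len \<Gamma> e}" for e t
  proof -
    have "Cauchy (\<lambda>n. fn (x n) e t)"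
      unfolding Cauchy_def dist_real_def
    proof (intro allI impI)
      fix \<epsilon> :: real assume "0 < \<epsilon>"
      from uc[OF this] obtain N where "\<forall>i\<ge>N. \<forall>j\<ge>N. \<forall>e\<in>edges \<Gamma>. \<forall>t\<in>{0..len \<Gamma> e}.
        \<bar>fn (x i) e t - fn (x j) e t\<bar> < \<epsilon>" by blast
      with e t show "\<exists>N. \<forall>i\<ge>N. \<forall>j\<ge>N. \<bar>fn (x i) e t - fn (x j) e t\<bar> < \<epsilon>" by blast
    qed
    then have "convergent (\<lambda>n. fn (x n) e t)" by (simp add: real_Cauchy_convergent)
    then show ?thesis by (simp add: y_def convergent_LIMSEQ_iff)
  qed
  have unif: "\<exists>N. \<forall>n\<ge>N. \<forall>e\<in>edges \<Gamma>. \<forall>t\<in>{0..len \<Gamma> e}. \<bar>fn (x n) e t - fn y e t\<bar> \<le> \<epsilon>" if \<epsilon>: "0 < \<epsilon>" for \<epsilon>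
  proof -
    obtain N where N: "\<And>i j e t. i \<ge> N \<Longrightarrow> j \<ge> N \<Longrightarrow> e \<in> edges \<Gamma> \<Longrightarrow> t \<in> {0..len \<Gamma> e} \<Longrightarrow> \<bar>fn (x i) e t - fn (x j) e t\<bar> < \<epsilon>"
      using uc[OF \<epsilon>] by blast
    have "\<bar>fn (x n) e t - fn y e t\<bar> \<le> \<epsilon>" if n: "n \<ge> N" and e: "e \<in> edges \<Gamma>" and t: "t \<in> {0..len \<Gamma> e}" for n e t
    proof (rule LIMSEQ_le_const2)
      show "(\<lambda>j. \<bar>fn (x n) e t - fn (x j) e t\<bar>) \<longlonglongrightarrow> \<bar>fn (x n) e t - fn y e t\<bar>"
        by (intro tendsto_intros ptw e t)
      show "\<exists>N. \<forall>j\<ge>N. \<bar>fn (x n) e t - fn (x j) e t\<bar> \<le> \<epsilon>"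
        using N[OF n _ e t] less_imp_le by blast
    qed
    then show ?thesis by blast
  qed
  have hint: "integrable (leb (len \<Gamma> e)) (h e)" if "e \<in> edges \<Gamma>" for e
    using sq_int_integrable[OF finite_measure_leb h(1)[OF that]] .
  have acd: "abs_cont_deriv (len \<Gamma> e) (fn y e) (h e)" if e: "e \<in> edges \<Gamma>" for e
    unfolding acd_iff
  proof (intro conjI ballI)
    show "integrable (leb (len \<Gamma> e)) (h e)" by (rule hint[OF e])
    fix t assume t: "t \<in> {0..len \<Gamma> e}"
    let ?l = "len \<Gamma> e"
    define D where "D n = (LINT s|leb ?l. (der (x n) e s - h e s)\<^sup>2)" for n
    have "(\<lambda>n. integral\<^sup>L (leb t) (der (x n) e) - integral\<^sup>L (leb t) (h e)) \<longlonglongrightarrow> 0"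
    proof (rule LIMSEQ_I)
      fix \<epsilon> :: real assume \<epsilon>: "0 < \<epsilon>"
      \<comment> \<open>A large parameter pushes the constant term \<open>?l / \<eta>\<close> below
        \<epsilon>/2; the square term follows by going far out in the sequence.\<close>
      define \<eta> where "\<eta> = 2 * (?l + 1) / \<epsilon>"
      have \<eta>: "0 < \<eta>" using \<epsilon> len_pos[OF e] by (simp add: \<eta>_def)
      have l\<eta>: "?l / \<eta> < \<epsilon> / 2" using \<epsilon> len_pos[OF e] by (simp add: \<eta>_def field_simps)
      have "0 < \<epsilon> / (2 * \<eta>)" using \<epsilon> \<eta> by simp
      from LIMSEQ_D[OF h(2)[OF e] this] obtain N where "\<And>n. n \<ge> N \<Longrightarrow> D n < \<epsilon> / (2 * \<eta>)"
        by (auto simp: D_def)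
      then have DN: "\<eta> * D n < \<epsilon> / 2" if "n \<ge> N" for n using that \<eta> by (simp add: field_simps)
      have "norm (integral\<^sup>L (leb t) (der (x n) e) - integral\<^sup>L (leb t) (h e) - 0) < \<epsilon>" if n: "n \<ge> N" for n
      proof -
        have gi: "integrable (leb ?l) (der (x n) e)" using acd_integrable[OF sobolevD(1)[OF x e]] .
        have sq: "sq_int (leb ?l) (\<lambda>s. der (x n) e s - h e s)"
          by (rule sq_int_diff[OF sobolevD(2)[OF x e] h(1)[OF e]])
        have tl: "t \<le> ?l" using t by simp
        have "integral\<^sup>L (leb t) (der (x n) e) - integral\<^sup>L (leb t) (h e) = (LINT s|leb t. der (x n) e s - h e s)"
          using integrable_leb_sub[OF gi tl] integrable_leb_sub[OF hint[OF e] tl] by simp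
        also have "\<dots> = (LINT s|leb ?l. indicator {..t} s * (der (x n) e s - h e s))"
          by (rule integral_leb_sub[OF tl])
        finally have "\<bar>integral\<^sup>L (leb t) (der (x n) e) - integral\<^sup>L (leb t) (h e)\<bar> \<le> (LINT s|leb ?l. \<bar>indicator {..t} s * (der (x n) e s - h e s)\<bar>)"
          using integral_abs_bound[of "leb ?l" "\<lambda>s. indicator {..t} s * (der (x n) e s - h e s)"] by simp
        also have "\<dots> \<le> (LINT s|leb ?l. \<bar>der (x n) e s - h e s\<bar>)"
        proof (rule integral_mono)
          show "integrable (leb ?l) (\<lambda>s. \<bar>indicat_real {..t} s * (der (x n) e s - h e s)\<bar>)"
            by (rule Bochner_Integration.integrable_bound[where f = "\<lambda>s. der (x n) e s - h e s"])
              (use gi hint[OF e] in \<open>auto simp: indicator_def\<close>)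
        qed (use gi hint[OF e] in \<open>auto simp: indicator_def\<close>)
        also have "\<dots> \<le> \<eta> * D n + measure (leb ?l) (space (leb ?l)) / \<eta>"
          unfolding D_def by (rule integral_abs_le_square[OF finite_measure_leb sq \<eta>])
        also have "measure (leb ?l) (space (leb ?l)) = ?l"
          using measure_leb[of ?l] len_pos[OF e] by simp
        finally show ?thesis using DN[OF n] l\<eta> unfolding real_norm_def diff_0_right by linarith
      qed
      then show "\<exists>n0. \<forall>n\<ge>n0. norm (integral\<^sup>L (leb t) (der (x n) e) - integral\<^sup>L (leb t) (h e) - 0) < \<epsilon>" by blast
    qed
    then have "(\<lambda>n. fn (x n) e 0 + (integral\<^sup>L (leb t) (der (x n) e) - integral\<^sup>L (leb t) (h e)) + integral\<^sup>L (leb t) (h e))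
        \<longlonglongrightarrow> fn y e 0 + 0 + integral\<^sup>L (leb t) (h e)"
      using len_pos[OF e] by (intro tendsto_intros ptw e) (auto simp: less_imp_le)
    moreover have "fn (x n) e t = fn (x n) e 0 + integral\<^sup>L (leb t) (der (x n) e)" for n
      using acd_eq[OF sobolevD(1)[OF x e], of t] t by simp
    ultimately have "(\<lambda>n. fn (x n) e t) \<longlonglongrightarrow> fn y e 0 + integral\<^sup>L (leb t) (h e)" by simp
    then show "fn y e t = fn y e 0 + integral\<^sup>L (leb t) (h e)"
      using ptw[OF e t] LIMSEQ_unique by blast
  qed
  have y: "y \<in> sobolev \<Gamma>"
    using acd h(1) sobolevD(3,4)[OF x] by (auto simp: sobolev_def y_def)
  have dy: "x n - y \<in> sobolev \<Gamma>" for n by (rule subspace_diff[OF subspace_sobolev x y])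
  have pot0: "(\<lambda>n. potential_form \<Gamma> v (x n - y) (x n - y)) \<longlonglongrightarrow> 0"
    if v: "\<And>e. e \<in> edges \<Gamma> \<Longrightarrow> integrable (leb (len \<Gamma> e)) (v e)" for v
  proof (rule LIMSEQ_I)
    fix \<epsilon> :: real assume \<epsilon>: "0 < \<epsilon>"
    let ?S = "\<Sum>e\<in>edges \<Gamma>. LINT t|leb (len \<Gamma> e). \<bar>v e t\<bar>"
    have S0: "0 \<le> ?S" by (intro sum_nonneg) simp
    define \<delta> where "\<delta> = sqrt (\<epsilon> / (2 * (?S + 1)))"
    have \<delta>: "0 < \<delta>" using \<epsilon> S0 by (simp add: \<delta>_def)
    have "\<delta>\<^sup>2 * ?S < \<epsilon>"
    proof -
      have "\<delta>\<^sup>2 * ?S = \<epsilon> * (?S / (2 * (?S + 1)))" using \<epsilon> S0 by (simp add: \<delta>_def)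
      also have "\<dots> < \<epsilon> * 1"
        by (rule mult_strict_left_mono[OF _ \<epsilon>]) (use S0 in \<open>simp add: divide_less_eq\<close>)
      finally show ?thesis by simp
    qed
    obtain N where N: "\<And>n e t. n \<ge> N \<Longrightarrow> e \<in> edges \<Gamma> \<Longrightarrow> t \<in> {0..len \<Gamma> e} \<Longrightarrow> \<bar>fn (x n) e t - fn y e t\<bar> \<le> \<delta>"
      using unif[OF \<delta>] by blast
    have "norm (potential_form \<Gamma> v (x n - y) (x n - y) - 0) < \<epsilon>" if n: "n \<ge> N" for n
    proof -
      have "\<bar>potential_form \<Gamma> v (x n - y) (x n - y)\<bar> \<le> \<delta>\<^sup>2 * ?S"
      proof (rule potential_form_le[OF v dy])
        fix e t assume "e \<in> edges \<Gamma>" "t \<in> {0..len \<Gamma> e}"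
        then have "\<bar>fn (x n) e t - fn y e t\<bar>\<^sup>2 \<le> \<delta>\<^sup>2" by (intro power_mono N n) auto
        then show "(fn (x n - y) e t)\<^sup>2 \<le> \<delta>\<^sup>2" by simp
      qed
      then show ?thesis using \<open>\<delta>\<^sup>2 * ?S < \<epsilon>\<close> by simp
    qed
    then show "\<exists>n0. \<forall>n\<ge>n0. norm (potential_form \<Gamma> v (x n - y) (x n - y) - 0) < \<epsilon>" by blast
  qed
  have "(\<lambda>n. \<Sum>e\<in>edges \<Gamma>. LINT t|leb (len \<Gamma> e). (der (x n) e t - h e t)\<^sup>2) \<longlonglongrightarrow> (\<Sum>e\<in>edges \<Gamma>. 0)"
    by (intro tendsto_sum h(2))
  then have dir0: "(\<lambda>n. dirichlet_form \<Gamma> (x n - y) (x n - y)) \<longlonglongrightarrow> 0"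
    by (simp add: dirichlet_form_def y_def power2_eq_square)
  have vert0: "(\<lambda>n. vertex_form \<Gamma> \<alpha> (x n - y) (x n - y)) \<longlonglongrightarrow> 0"
  proof -
    have "(\<lambda>n. val (x n) v) \<longlonglongrightarrow> val y v" if v: "v \<in> verts \<Gamma>" for v
    proof -
      obtain e where e: "e \<in> edges \<Gamma>" and se: "src \<Gamma> e = v \<or> tgt \<Gamma> e = v" using no_isolated_verts[OF v] by blast
      have l: "0 \<in> {0..len \<Gamma> e}" "len \<Gamma> e \<in> {0..len \<Gamma> e}" using len_pos[OF e] by auto
      show ?thesis
        using ptw[OF e l(1)] ptw[OF e l(2)] sobolevD(3,4)[OF x e] sobolevD(3,4)[OF y e] se by auto
    qed
    then have "(\<lambda>n. \<Sum>v\<in>verts \<Gamma>. \<alpha> v * ((val (x n) v - val y v) * (val (x n) v - val y v))) \<longlonglongrightarrow>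
        (\<Sum>v\<in>verts \<Gamma>. \<alpha> v * ((val y v - val y v) * (val y v - val y v)))"
      by (intro tendsto_intros)
    then show ?thesis by (simp add: vertex_form_def)
  qed
  have "(\<lambda>n. energy (x n - y) (x n - y)) \<longlonglongrightarrow> 0"
    using tendsto_add[OF tendsto_add[OF dir0 vert0] pot0[OF w_integrable]] by (simp add: energy_def)
  moreover have "(\<lambda>n. mass_form \<Gamma> (x n - y) (x n - y)) \<longlonglongrightarrow> 0"
    by (rule pot0) (simp add: finite_measure.integrable_const[OF finite_measure_leb])
  ultimately show ?thesis using y by blast
qed

sublocale closed_form "sobolev \<Gamma>" energy "mass_form \<Gamma>" C
proof
  show "0 \<le> energy x x + C * mass_form \<Gamma> x x" if "x \<in> sobolev \<Gamma>" for x
    using coercive[OF that] dirichlet_nonneg[of x] by linarith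
qed (use sym_form_energy sym_form_mass mass_nonneg mass_compact form_complete in blast)+

end

section \<open>Measure, integration and L^p bounds on the glued space, reduced to the edges\<close>

context metric_graph
begin

abbreviation pullback :: "(('v, 'e) gpoint \<Rightarrow> 'c) \<Rightarrow> 'e \<Rightarrow> real \<Rightarrow> 'c"
  where "pullback h e t \<equiv> h (edge_point \<Gamma> e t)"

lemma edge_preimage_vimage: "edge_preimage \<Gamma> e A = edge_point \<Gamma> e -` A \<inter> {0..len \<Gamma> e}"
  by (auto simp: edge_preimage_def)

lemma edge_point_measurable:
  assumes "e \<in> edges \<Gamma>"
  shows "edge_point \<Gamma> e \<in> measurable (leb (len \<Gamma> e)) (graph_measure \<Gamma>)"
proof (rule measurableI)
  fix A assume "A \<in> sets (graph_measure \<Gamma>)"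
  then have "edge_preimage \<Gamma> e A \<in> sets lebesgue" using assms by (auto simp: sets_graph_measure)
  then show "edge_point \<Gamma> e -` A \<inter> space (leb (len \<Gamma> e)) \<in> sets (leb (len \<Gamma> e))"
    by (simp add: edge_preimage_vimage sets_restrict_space_iff)
qed (use assms edge_point_in_points in \<open>auto simp: space_graph_measure\<close>)

lemma graph_measurable_iff:
  fixes h :: "('v, 'e) gpoint \<Rightarrow> 'c::topological_space"
  shows "h \<in> borel_measurable (graph_measure \<Gamma>) \<longleftrightarrow> (\<forall>e\<in>edges \<Gamma>. pullback h e \<in> borel_measurable (leb (len \<Gamma> e)))"
proof
  assume "h \<in> borel_measurable (graph_measure \<Gamma>)"
  then show "\<forall>e\<in>edges \<Gamma>. pullback h e \<in> borel_measurable (leb (len \<Gamma> e))"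
    using measurable_compose[OF edge_point_measurable] by blast
next
  assume h: "\<forall>e\<in>edges \<Gamma>. pullback h e \<in> borel_measurable (leb (len \<Gamma> e))"
  show "h \<in> borel_measurable (graph_measure \<Gamma>)"
  proof (rule measurableI)
    fix S :: "'c set" assume S: "S \<in> sets borel"
    have "edge_preimage \<Gamma> e (h -` S \<inter> points \<Gamma>) \<in> sets lebesgue" if e: "e \<in> edges \<Gamma>" for e
    proof -
      have "edge_preimage \<Gamma> e (h -` S \<inter> points \<Gamma>) = pullback h e -` S \<inter> space (leb (len \<Gamma> e))"
        using edge_point_in_points[OF e] by (auto simp: edge_preimage_def)
      moreover have "pullback h e -` S \<inter> space (leb (len \<Gamma> e)) \<in> sets (leb (len \<Gamma> e))"
        using h e S by (blast intro: measurable_sets)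
      ultimately show ?thesis by (simp add: sets_restrict_space_iff)
    qed
    then show "h -` S \<inter> space (graph_measure \<Gamma>) \<in> sets (graph_measure \<Gamma>)"
      by (auto simp: sets_graph_measure space_graph_measure)
  qed auto
qed

text \<open>The graph measure is the sum of the push-forwards of the edge measures. In this form
  integrals split over the edges by the usual induction on measurable functions.\<close>

lemma emeasure_graph_distr:
  assumes A: "A \<in> sets (graph_measure \<Gamma>)"
  shows "emeasure (graph_measure \<Gamma>) A
    = (\<Sum>e\<in>edges \<Gamma>. emeasure (distr (leb (len \<Gamma> e)) (graph_measure \<Gamma>) (edge_point \<Gamma> e)) A)"
  unfolding emeasure_graph_measure[OF A]
proof (rule sum.cong[OF refl])
  fix e assume e: "e \<in> edges \<Gamma>"
  have "emeasure (distr (leb (len \<Gamma> e)) (graph_measure \<Gamma>) (edge_point \<Gamma> e)) A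
      = emeasure (leb (len \<Gamma> e)) (edge_preimage \<Gamma> e A)"
    by (subst emeasure_distr[OF edge_point_measurable[OF e] A]) (simp add: edge_preimage_vimage)
  also have "\<dots> = emeasure lebesgue (edge_preimage \<Gamma> e A)"
    by (rule emeasure_restrict_space) (auto simp: edge_preimage_def)
  finally show "emeasure lebesgue (edge_preimage \<Gamma> e A)
    = emeasure (distr (leb (len \<Gamma> e)) (graph_measure \<Gamma>) (edge_point \<Gamma> e)) A" by simp
qed

lemma nn_integral_graph:
  assumes "h \<in> borel_measurable (graph_measure \<Gamma>)"
  shows "(\<integral>\<^sup>+x. h x \<partial>graph_measure \<Gamma>) = (\<Sum>e\<in>edges \<Gamma>. \<integral>\<^sup>+t. pullback h e t \<partial>leb (len \<Gamma> e))"
proof -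
  let ?M = "graph_measure \<Gamma>" and ?N = "\<lambda>e. distr (leb (len \<Gamma> e)) (graph_measure \<Gamma>) (edge_point \<Gamma> e)"
  have "(\<integral>\<^sup>+x. h x \<partial>?M) = (\<Sum>e\<in>edges \<Gamma>. \<integral>\<^sup>+x. h x \<partial>?N e)"
    using assms
  proof (induction h rule: borel_measurable_induct)
    case (cong f g)
    have "(\<integral>\<^sup>+x. f x \<partial>?N e) = (\<integral>\<^sup>+x. g x \<partial>?N e)" for e
      using cong(3) by (intro nn_integral_cong) simp
    then show ?case using cong by (simp cong: nn_integral_cong)
  next
    case (set A)
    then show ?case using emeasure_graph_distr[OF set] by simp
  next
    case (mult u c)
    then show ?case by (simp add: nn_integral_cmult sum_distrib_left)
  next
    case (add u v)
    then show ?case by (simp add: nn_integral_add sum.distrib)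
  next
    case (seq U)
    have "(\<integral>\<^sup>+x. (SUP i. U i x) \<partial>?M) = (SUP i. \<integral>\<^sup>+x. U i x \<partial>?M)"
      using seq by (intro nn_integral_monotone_convergence_SUP) auto
    also have "\<dots> = (SUP i. \<Sum>e\<in>edges \<Gamma>. \<integral>\<^sup>+x. U i x \<partial>?N e)" using seq by simp
    also have "\<dots> = (\<Sum>e\<in>edges \<Gamma>. SUP i. \<integral>\<^sup>+x. U i x \<partial>?N e)"
    proof (rule ennreal_SUP_sum)
      fix e
      show "incseq (\<lambda>i. \<integral>\<^sup>+x. U i x \<partial>?N e)"
        using seq(3) by (auto simp: incseq_def le_fun_def intro!: nn_integral_mono)
    qed
    also have "\<dots> = (\<Sum>e\<in>edges \<Gamma>. \<integral>\<^sup>+x. (SUP i. U i x) \<partial>?N e)"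
      using seq by (intro sum.cong nn_integral_monotone_convergence_SUP[symmetric]) auto
    finally show ?case by (simp add: SUP_apply image_image)
  qed
  also have "\<dots> = (\<Sum>e\<in>edges \<Gamma>. \<integral>\<^sup>+t. pullback h e t \<partial>leb (len \<Gamma> e))"
    by (intro sum.cong refl nn_integral_distr edge_point_measurable) (use assms in auto)
  finally show ?thesis .
qed

lemma integrable_graph_iff:
  fixes h :: "('v, 'e) gpoint \<Rightarrow> real"
  shows "integrable (graph_measure \<Gamma>) h \<longleftrightarrow> (\<forall>e\<in>edges \<Gamma>. integrable (leb (len \<Gamma> e)) (pullback h e))"
proof -
  have "(\<integral>\<^sup>+x. ennreal (norm (h x)) \<partial>graph_measure \<Gamma>) < \<infinity> \<longleftrightarrow>
      (\<forall>e\<in>edges \<Gamma>. (\<integral>\<^sup>+t. ennreal (norm (pullback h e t)) \<partial>leb (len \<Gamma> e)) < \<infinity>)"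
    if h: "h \<in> borel_measurable (graph_measure \<Gamma>)"
  proof -
    have "(\<lambda>x. ennreal (norm (h x))) \<in> borel_measurable (graph_measure \<Gamma>)" using h by measurable
    from nn_integral_graph[OF this] show ?thesis using finite_edges by simp
  qed
  then show ?thesis
    unfolding integrable_iff_bounded using graph_measurable_iff[of h] by blast
qed

lemma integral_graph_nonneg:
  fixes h :: "('v, 'e) gpoint \<Rightarrow> real"
  assumes h: "integrable (graph_measure \<Gamma>) h" and pos: "\<And>x. 0 \<le> h x"
  shows "(LINT x|graph_measure \<Gamma>. h x) = (\<Sum>e\<in>edges \<Gamma>. LINT t|leb (len \<Gamma> e). pullback h e t)"
proof -
  have e: "integrable (leb (len \<Gamma> e)) (pullback h e)" if "e \<in> edges \<Gamma>" for e
    using h that by (simp add: integrable_graph_iff)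
  have "ennreal (LINT x|graph_measure \<Gamma>. h x) = (\<integral>\<^sup>+x. ennreal (h x) \<partial>graph_measure \<Gamma>)"
    using h pos by (simp add: nn_integral_eq_integral)
  also have "\<dots> = (\<Sum>e\<in>edges \<Gamma>. \<integral>\<^sup>+t. ennreal (pullback h e t) \<partial>leb (len \<Gamma> e))"
    using h by (intro nn_integral_graph) auto
  also have "\<dots> = (\<Sum>e\<in>edges \<Gamma>. ennreal (LINT t|leb (len \<Gamma> e). pullback h e t))"
    using e pos by (intro sum.cong) (auto simp: nn_integral_eq_integral)
  also have "\<dots> = ennreal (\<Sum>e\<in>edges \<Gamma>. LINT t|leb (len \<Gamma> e). pullback h e t)"
    using pos by (intro sum_ennreal) simp
  finally show ?thesis
    using pos by (subst (asm) ennreal_inj) (auto intro!: sum_nonneg)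
qed

lemma AE_graph:
  assumes "AE x in graph_measure \<Gamma>. P x" and e: "e \<in> edges \<Gamma>"
  shows "AE t in leb (len \<Gamma> e). P (edge_point \<Gamma> e t)"
proof -
  obtain N where N: "N \<in> sets (graph_measure \<Gamma>)" "emeasure (graph_measure \<Gamma>) N = 0"
    "{x \<in> space (graph_measure \<Gamma>). \<not> P x} \<subseteq> N"
    using assms(1) by (auto elim!: AE_E)
  have "emeasure lebesgue (edge_preimage \<Gamma> e N) = 0"
    using N(2) e finite_edges by (auto simp: emeasure_graph_measure[OF N(1)])
  moreover have "edge_preimage \<Gamma> e N \<in> sets lebesgue" using N(1) e by (auto simp: sets_graph_measure)
  ultimately have "AE t in lebesgue. t \<notin> edge_preimage \<Gamma> e N"
    by (intro AE_not_in) auto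
  then have "AE t in lebesgue. t \<in> {0..len \<Gamma> e} \<longrightarrow> P (edge_point \<Gamma> e t)"
  proof eventually_elim
    case (elim t)
    then show ?case
      using N(3) edge_point_in_points[OF e, of t] by (auto simp: edge_preimage_def space_graph_measure)
  qed
  then show ?thesis by (subst AE_restrict_space_iff) auto
qed

end

text \<open>The power function of exponent r lies above its tangent at c; solved for x, this is
  linear in \<open>x powr r\<close> and can be integrated against any weight. It comes from Young's
  inequality for \<open>x / c\<close> and 1.\<close>

lemma young_tangent:
  fixes x c r :: real
  assumes "0 \<le> x" "0 < c" "1 \<le> r"
  shows "x \<le> x powr r * (c powr (1 - r) / r) + c * (1 - 1 / r)"
proof (cases "r = 1")
  case True
  then show ?thesis using assms by simp
next
  case False
  then have r: "1 < r" using assms by simp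
  have "x / c * 1 \<le> (x / c) powr r / r + 1 powr (r / (r - 1)) / (r / (r - 1))"
    by (rule Youngs_inequality) (use r assms in \<open>auto simp: field_simps\<close>)
  also have "1 powr (r / (r - 1)) / (r / (r - 1)) = 1 - 1 / r" using r by (simp add: field_simps)
  finally have "x \<le> c * ((x / c) powr r / r + (1 - 1 / r))" using assms by (simp add: divide_le_eq mult.commute)
  also have "\<dots> = x powr r * (c powr (1 - r) / r) + c * (1 - 1 / r)"
    using assms by (simp add: powr_divide powr_diff distrib_left)
  finally show ?thesis .
qed

lemma powr_self_inverse: "1 \<le> r \<Longrightarrow> 0 \<le> x \<Longrightarrow> (x powr (1 / r)) powr r = (x::real)"
  by (simp add: powr_powr)

context metric_graph
begin

text \<open>Edges have finite measure, so L^p lies in L^1. For finite p this is the tangent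
  inequality at c = 1, without a separate Hoelder inequality.\<close>

lemma Lp_edge_integrable:
  assumes q: "q \<in> Lp_space p (graph_measure \<Gamma>)" and p: "1 \<le> p" and e: "e \<in> edges \<Gamma>"
  shows "integrable (leb (len \<Gamma> e)) (pullback q e)"
proof -
  interpret F: finite_measure "leb (len \<Gamma> e)" by (rule finite_measure_leb)
  have m: "pullback q e \<in> borel_measurable (leb (len \<Gamma> e))"
    using q e by (auto simp: Lp_space_def graph_measurable_iff)
  show ?thesis
  proof (cases "p = \<infinity>")
    case True
    then have "esssup (graph_measure \<Gamma>) (\<lambda>x. ereal \<bar>q x\<bar>) < \<infinity>" using q by (simp add: Lp_space_def)
    then obtain B where B: "esssup (graph_measure \<Gamma>) (\<lambda>x. ereal \<bar>q x\<bar>) \<le> ereal B"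
      by (cases "esssup (graph_measure \<Gamma>) (\<lambda>x. ereal \<bar>q x\<bar>)") auto
    have "AE x in graph_measure \<Gamma>. ereal \<bar>q x\<bar> \<le> esssup (graph_measure \<Gamma>) (\<lambda>x. ereal \<bar>q x\<bar>)"
      by (rule esssup_AE)
    then have "AE x in graph_measure \<Gamma>. \<bar>q x\<bar> \<le> B"
      proof eventually_elim
      case (elim x)
      then have "ereal \<bar>q x\<bar> \<le> ereal B" using B by (rule order_trans)
      then show ?case by (simp only: ereal_less_eq)
    qed
    from AE_graph[OF this e] have "AE t in leb (len \<Gamma> e). norm (pullback q e t) \<le> B" by simp
    then show ?thesis using m by (rule F.integrable_const_bound)
  next
    case False
    then obtain r where r: "p = ereal r" "1 \<le> r" using p by (cases p) auto
    have "integrable (graph_measure \<Gamma>) (\<lambda>x. \<bar>q x\<bar> powr r)" using q r by (simp add: Lp_space_def)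
    then have i: "integrable (leb (len \<Gamma> e)) (\<lambda>t. \<bar>pullback q e t\<bar> powr r)"
      using e by (simp add: integrable_graph_iff)
    show ?thesis
    proof (rule Bochner_Integration.integrable_bound)
      show "integrable (leb (len \<Gamma> e)) (\<lambda>t. \<bar>pullback q e t\<bar> powr r * (1 powr (1 - r) / r) + 1 * (1 - 1 / r))"
        using i by simp
      show "AE t in leb (len \<Gamma> e). norm (pullback q e t) \<le> norm (\<bar>pullback q e t\<bar> powr r * (1 powr (1 - r) / r) + 1 * (1 - 1 / r))"
      proof (rule AE_I2)
        fix t
        have "\<bar>pullback q e t\<bar> \<le> \<bar>pullback q e t\<bar> powr r * (1 powr (1 - r) / r) + 1 * (1 - 1 / r)"
          by (rule young_tangent) (use r(2) in auto)
        then show "norm (pullback q e t) \<le> norm (\<bar>pullback q e t\<bar> powr r * (1 powr (1 - r) / r) + 1 * (1 - 1 / r))"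
          unfolding real_norm_def by linarith
      qed
    qed (rule m)
  qed
qed

text \<open>For p = \<infinity> this is not formal: an essential supremum of a nonnegative function
  is negative only over a null measure, which an edge of positive length excludes.\<close>

lemma Lp_norm_nonneg: "0 \<le> Lp_norm p (graph_measure \<Gamma>) (\<lambda>x. max (q x) 0)"
proof (cases "p = \<infinity>")
  case True
  let ?s = "esssup (graph_measure \<Gamma>) (\<lambda>x. ereal \<bar>max (q x) 0\<bar>)"
  have "0 \<le> real_of_ereal ?s"
  proof (rule ccontr)
    assume n: "\<not> 0 \<le> real_of_ereal ?s"
    obtain e where e: "e \<in> edges \<Gamma>" using edges_nonempty by blast
    have "AE x in graph_measure \<Gamma>. ereal \<bar>max (q x) 0\<bar> \<le> ?s" by (rule esssup_AE)
    then have "AE x in graph_measure \<Gamma>. False"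
    proof eventually_elim
      case (elim x)
      have "(0::real) \<le> \<bar>max (q x) 0\<bar>" by simp
      then have "0 \<le> ereal \<bar>max (q x) 0\<bar>" unfolding zero_ereal_def by (simp only: ereal_less_eq)
      then have "0 \<le> ?s" using elim by (rule order_trans)
      then show ?case using n by (simp add: real_of_ereal_pos)
    qed
    from AE_graph[OF this e] have "emeasure (leb (len \<Gamma> e)) (space (leb (len \<Gamma> e))) = 0"
      by (simp add: eventually_False ae_filter_eq_bot_iff)
    then show False
      using len_pos[OF e] by (simp add: emeasure_restrict_space)
  qed
  then show ?thesis using True by (simp add: Lp_norm_def)
qed (simp add: Lp_norm_def)

text \<open>Hoelder's inequality against \<open>f\<^sup>2\<close>: with \<open>c = (Q + \<epsilon>) W\<^bsup>1/p\<^esup>\<close>, integrating the tangent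
  inequality for \<open>q \<mapsto> q\<^sup>p\<close> at \<open>c\<close> against the weight \<open>f\<^sup>2\<close> gives the bound \<open>c \<integral> f\<^sup>2\<close>.\<close>

lemma potential_form_Lp_bound:
  assumes q: "q \<in> Lp_space p (graph_measure \<Gamma>)" and p: "1 \<le> p" and x: "x \<in> sobolev \<Gamma>" and W: "0 < W"
    and sup: "\<And>e t. e \<in> edges \<Gamma> \<Longrightarrow> t \<in> {0..len \<Gamma> e} \<Longrightarrow> (fn x e t)\<^sup>2 \<le> W * mass_form \<Gamma> x x"
  shows "potential_form \<Gamma> (pullback q) x x
    \<le> Lp_norm p (graph_measure \<Gamma>) (\<lambda>x. max (q x) 0) * W powr real_of_ereal (1 / p) * mass_form \<Gamma> x x"
proof -
  let ?M = "graph_measure \<Gamma>" and ?m = "mass_form \<Gamma> x x"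
  define Q where "Q = Lp_norm p ?M (\<lambda>x. max (q x) 0)"
  have Q0: "0 \<le> Q" unfolding Q_def by (rule Lp_norm_nonneg)
  have m0: "0 \<le> ?m" unfolding potential_form_def by (intro sum_nonneg) simp
  have qm: "q \<in> borel_measurable ?M" using q by (simp add: Lp_space_def)
  have qi: "integrable (leb (len \<Gamma> e)) (\<lambda>t. pullback q e t * (fn x e t * fn x e t))" if e: "e \<in> edges \<Gamma>" for e
    by (rule integrable_leb_mult_continuous[OF Lp_edge_integrable[OF q p e]])
      (intro continuous_intros sobolevD(5)[OF x e])
  have mi: "integrable (leb (len \<Gamma> e)) (\<lambda>t. fn x e t * fn x e t)" if e: "e \<in> edges \<Gamma>" for e
    by (intro integrable_leb_continuous continuous_intros sobolevD(5)[OF x e])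
  show ?thesis
  proof (cases "p = \<infinity>")
    case True
    let ?s = "esssup ?M (\<lambda>x. ereal \<bar>max (q x) 0\<bar>)"
    have fin: "?s < \<infinity>"
    proof -
      have "?s \<le> esssup ?M (\<lambda>x. ereal \<bar>q x\<bar>)" using qm by (intro esssup_mono) auto
      also have "\<dots> < \<infinity>" using q True by (simp add: Lp_space_def)
      finally show ?thesis .
    qed
    have "AE x in ?M. ereal \<bar>max (q x) 0\<bar> \<le> ?s" by (rule esssup_AE)
    then have "AE x in ?M. q x \<le> Q"
    proof eventually_elim
      case (elim x)
      have "\<bar>?s\<bar> \<noteq> \<infinity>" using elim fin by (cases ?s) auto
      then have "ereal Q = ?s" using True by (simp add: Q_def Lp_norm_def ereal_real')
      then have "ereal \<bar>max (q x) 0\<bar> \<le> ereal Q" using elim by (simp only:)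
      then have "\<bar>max (q x) 0\<bar> \<le> Q" by (simp only: ereal_less_eq)
      then show ?case by linarith
    qed
    then have qQ: "AE t in leb (len \<Gamma> e). pullback q e t \<le> Q" if "e \<in> edges \<Gamma>" for e
      using that by (rule AE_graph)
    have "potential_form \<Gamma> (pullback q) x x \<le> (\<Sum>e\<in>edges \<Gamma>. LINT t|leb (len \<Gamma> e). Q * (fn x e t * fn x e t))"
      unfolding potential_form_def
    proof (rule sum_mono)
      fix e assume e: "e \<in> edges \<Gamma>"
      show "(LINT t|leb (len \<Gamma> e). pullback q e t * (fn x e t * fn x e t)) \<le> (LINT t|leb (len \<Gamma> e). Q * (fn x e t * fn x e t))"
      proof (rule integral_mono_AE)
        show "AE t in leb (len \<Gamma> e). pullback q e t * (fn x e t * fn x e t) \<le> Q * (fn x e t * fn x e t)"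
          using qQ[OF e] by eventually_elim (rule mult_right_mono, auto)
      qed (use qi[OF e] mi[OF e] in auto)
    qed
    also have "\<dots> = Q * ?m" by (simp add: potential_form_def sum_distrib_left)
    finally show ?thesis using True W by (simp add: Q_def)
  next
    case False
    then obtain r where r: "p = ereal r" "1 \<le> r" using p by (cases p) auto
    have qr: "integrable ?M (\<lambda>x. \<bar>max (q x) 0\<bar> powr r)"
    proof (rule Bochner_Integration.integrable_bound)
      show "integrable ?M (\<lambda>x. \<bar>q x\<bar> powr r)" using q r by (simp add: Lp_space_def)
      show "AE x in ?M. norm (\<bar>max (q x) 0\<bar> powr r) \<le> norm (\<bar>q x\<bar> powr r)"
        using r(2) by (intro AE_I2) (auto intro!: powr_mono2)
    qed (use qm in measurable)
    define J where "J = (LINT x|?M. \<bar>max (q x) 0\<bar> powr r)"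
    have J: "J = (\<Sum>e\<in>edges \<Gamma>. LINT t|leb (len \<Gamma> e). \<bar>max (pullback q e t) 0\<bar> powr r)"
      unfolding J_def by (rule integral_graph_nonneg[OF qr]) simp
    have J0: "0 \<le> J" unfolding J_def by simp
    have QJ: "Q powr r = J" using r J0 powr_self_inverse[of r J] by (simp add: Q_def Lp_norm_def J_def)
    have qre: "integrable (leb (len \<Gamma> e)) (\<lambda>t. \<bar>max (pullback q e t) 0\<bar> powr r)" if "e \<in> edges \<Gamma>" for e
      using qr that by (simp add: integrable_graph_iff)
    \<comment> \<open>Q may be zero while the tangent point c has to be positive; \<epsilon> repairs
      this and tends to zero at the end.\<close>
    have main: "potential_form \<Gamma> (pullback q) x x \<le> ((Q + \<epsilon>) * W powr (1 / r)) * ?m" if \<epsilon>: "0 < \<epsilon>" for \<epsilon>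
    proof -
      define c where "c = (Q + \<epsilon>) * W powr (1 / r)"
      have c: "0 < c" using W Q0 \<epsilon> by (simp add: c_def)
      let ?k = "c powr (1 - r) / r"
      have k0: "0 \<le> ?k" using r by simp
      have "potential_form \<Gamma> (pullback q) x x
          \<le> (\<Sum>e\<in>edges \<Gamma>. LINT t|leb (len \<Gamma> e). ?k * (W * ?m) * (\<bar>max (pullback q e t) 0\<bar> powr r) + c * (1 - 1 / r) * (fn x e t * fn x e t))"
        unfolding potential_form_def
      proof (rule sum_mono)
        fix e assume e: "e \<in> edges \<Gamma>"
        show "(LINT t|leb (len \<Gamma> e). pullback q e t * (fn x e t * fn x e t))
          \<le> (LINT t|leb (len \<Gamma> e). ?k * (W * (\<Sum>e\<in>edges \<Gamma>. LINT t|leb (len \<Gamma> e). 1 * (fn x e t * fn x e t))) * (\<bar>max (pullback q e t) 0\<bar> powr r) + c * (1 - 1 / r) * (fn x e t * fn x e t))"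
          unfolding potential_form_def[symmetric, of \<Gamma> "\<lambda>_ _. 1"]
        proof (rule integral_mono)
          fix t assume "t \<in> space (leb (len \<Gamma> e))"
          then have t: "t \<in> {0..len \<Gamma> e}" by simp
          let ?y = "max (pullback q e t) 0"
          have u0: "0 \<le> fn x e t * fn x e t" by simp
          have "?y \<le> ?y powr r * ?k + c * (1 - 1 / r)" by (rule young_tangent[OF _ c r(2)]) simp
          moreover have "pullback q e t \<le> ?y" by simp
          ultimately have "pullback q e t \<le> ?y powr r * ?k + c * (1 - 1 / r)" by linarith
          then have "pullback q e t * (fn x e t * fn x e t) \<le> (?y powr r * ?k + c * (1 - 1 / r)) * (fn x e t * fn x e t)"
            using u0 by (rule mult_right_mono)
          also have "\<dots> = ?y powr r * ?k * (fn x e t * fn x e t) + c * (1 - 1 / r) * (fn x e t * fn x e t)"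
            by (simp add: distrib_right)
          also have "?y powr r * ?k * (fn x e t * fn x e t) \<le> ?y powr r * ?k * (W * ?m)"
            by (rule mult_left_mono) (use sup[OF e t] r in \<open>auto simp: power2_eq_square\<close>)
          also have "?y powr r * ?k * (W * ?m) = ?k * (W * ?m) * (\<bar>?y\<bar> powr r)"
          proof -
            have "\<bar>?y\<bar> = ?y" by simp
            then show ?thesis by (simp only: mult_ac)
          qed
          finally show "pullback q e t * (fn x e t * fn x e t) \<le> ?k * (W * ?m) * (\<bar>?y\<bar> powr r) + c * (1 - 1 / r) * (fn x e t * fn x e t)"
            by simp
        qed (use qi[OF e] qre[OF e] mi[OF e] in auto)
      qed
      also have "\<dots> = ?k * (W * ?m) * J + c * (1 - 1 / r) * ?m"
      proof -
        have "(\<Sum>e\<in>edges \<Gamma>. LINT t|leb (len \<Gamma> e). ?k * (W * ?m) * (\<bar>max (pullback q e t) 0\<bar> powr r) + c * (1 - 1 / r) * (fn x e t * fn x e t))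
          = (\<Sum>e\<in>edges \<Gamma>. ?k * (W * ?m) * (LINT t|leb (len \<Gamma> e). \<bar>max (pullback q e t) 0\<bar> powr r) + c * (1 - 1 / r) * (LINT t|leb (len \<Gamma> e). fn x e t * fn x e t))"
        proof (rule sum.cong[OF refl])
          fix e assume "e \<in> edges \<Gamma>"
          from qre[OF this] mi[OF this] show "(LINT t|leb (len \<Gamma> e). ?k * (W * ?m) * (\<bar>max (pullback q e t) 0\<bar> powr r) + c * (1 - 1 / r) * (fn x e t * fn x e t))
              = ?k * (W * ?m) * (LINT t|leb (len \<Gamma> e). \<bar>max (pullback q e t) 0\<bar> powr r) + c * (1 - 1 / r) * (LINT t|leb (len \<Gamma> e). fn x e t * fn x e t)"
            by simp
        qed
        also have "\<dots> = ?k * (W * ?m) * J + c * (1 - 1 / r) * (\<Sum>e\<in>edges \<Gamma>. LINT t|leb (len \<Gamma> e). fn x e t * fn x e t)"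
          unfolding J sum.distrib sum_distrib_left ..
        finally show ?thesis by (simp add: potential_form_def)
      qed
      \<comment> \<open>The choice of c is made for this step: \<open>c powr r\<close> is at least W
        times J, so the first term is at most the share c/r and the two shares add up to c.\<close>
      also have "\<dots> \<le> c / r * ?m + c * (1 - 1 / r) * ?m"
      proof -
        have "c powr r = (Q + \<epsilon>) powr r * W"
          using Q0 \<epsilon> W r powr_self_inverse[of r W] by (simp add: c_def powr_mult)
        moreover have "Q powr r \<le> (Q + \<epsilon>) powr r" using Q0 \<epsilon> r by (intro powr_mono2) auto
        ultimately have "W * J \<le> c powr r" using W QJ by (simp add: mult.commute)
        then have "c powr (1 - r) * (W * J) \<le> c powr (1 - r) * c powr r" by (rule mult_left_mono) simp
        also have "\<dots> = c" using c by (simp flip: powr_add)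
        finally have le: "c powr (1 - r) * (W * J) * (?m / r) \<le> c * (?m / r)"
          by (rule mult_right_mono) (use m0 r in simp)
        have e: "?k * (W * ?m) * J = c powr (1 - r) * (W * J) * (?m / r)" "c / r * ?m = c * (?m / r)"
          by simp_all
        show ?thesis unfolding e by (rule add_right_mono[OF le])
      qed
      also have "\<dots> = c * ?m" by (simp add: algebra_simps)
      finally show ?thesis unfolding c_def .
    qed
    have lim: "((\<lambda>\<epsilon>. ((Q + \<epsilon>) * W powr (1 / r)) * ?m) \<longlongrightarrow> ((Q + 0) * W powr (1 / r)) * ?m) (at_right 0)"
      by (intro tendsto_intros)
    have "potential_form \<Gamma> (pullback q) x x \<le> ((Q + 0) * W powr (1 / r)) * ?m"
      by (rule tendsto_lowerbound[OF lim]) (use main in \<open>auto simp: eventually_at_right_less intro: eventually_mono[OF eventually_at_right_less]\<close>)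
    then show ?thesis using r by (simp add: Q_def one_ereal_def)
  qed
qed

end

section \<open>From the form to the operator\<close>

definition point_fun :: "('v, 'e) graph_fun \<Rightarrow> ('v, 'e) gpoint \<Rightarrow> real"
  where "point_fun x p = (case p of Vertex v \<Rightarrow> val x v | Inner e t \<Rightarrow> fn x e t)"

lemma point_fun_edge_point:
  assumes "x \<in> sobolev \<Gamma>" "e \<in> edges \<Gamma>" "t \<in> {0..len \<Gamma> e}"
  shows "point_fun x (edge_point \<Gamma> e t) = fn x e t"
proof -
  consider "t = 0" | "t = len \<Gamma> e" "t \<noteq> 0" | "0 < t" "t < len \<Gamma> e" using assms(3) by fastforce
  then show ?thesis
    using sobolevD(3,4)[OF assms(1,2)] assms(3)
    by cases (auto simp: point_fun_def edge_point_def)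
qed

lemma acd_cong_AE:
  assumes u: "abs_cont_deriv l u g" and g: "AE t in leb l. g t = h t" and h: "integrable (leb l) h"
  shows "abs_cont_deriv l u h"
  unfolding acd_iff
proof (intro conjI ballI)
  fix t assume t: "t \<in> {0..l}"
  have "AE s in leb t. g s = h s"
    using g t by (auto simp: AE_restrict_space_iff elim!: eventually_mono)
  moreover have "integrable (leb t) g" "integrable (leb t) h"
    using integrable_leb_sub[OF acd_integrable[OF u], of t] integrable_leb_sub[OF h, of t] t by auto
  ultimately have "integral\<^sup>L (leb t) g = integral\<^sup>L (leb t) h"
    by (intro integral_cong_AE) auto
  then show "u t = u 0 + integral\<^sup>L (leb t) h" using acd_eq[OF u, of t] t by simp
qed (rule h)

lemma acd_primitive:
  assumes "integrable (leb l) h"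
  shows "abs_cont_deriv l (\<lambda>t. c + integral\<^sup>L (leb t) h) h"
proof -
  have "integral\<^sup>L (leb 0) h = 0"
  proof (rule integral_eq_zero_AE)
    show "AE r in leb 0. h r = 0"
      using AE_leb_neq[of 0 0] AE_space by eventually_elim auto
  qed
  then show ?thesis using assms by (simp add: acd_iff)
qed

text \<open>The fundamental lemma of the calculus of variations, tested with the primitive of the deviation
  of \<open>g - H\<close> from its mean.\<close>

lemma weak_derivative_regularity:
  assumes l: "0 < l" and g: "sq_int (leb l) g" and h: "integrable (leb l) h"
    and weak: "\<And>\<phi> \<psi>. abs_cont_deriv l \<phi> \<psi> \<Longrightarrow> sq_int (leb l) \<psi> \<Longrightarrow> \<phi> 0 = 0 \<Longrightarrow> \<phi> l = 0 \<Longrightarrow>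
      (LINT t|leb l. g t * \<psi> t) + (LINT t|leb l. h t * \<phi> t) = 0"
  shows "\<exists>c. AE t in leb l. g t = c + integral\<^sup>L (leb t) h"
proof -
  interpret F: finite_measure "leb l" by (rule finite_measure_leb)
  define H where "H t = integral\<^sup>L (leb t) h" for t
  have H: "abs_cont_deriv l H h" using acd_primitive[OF h, of 0] by (simp add: H_def[abs_def])
  have Hc: "continuous_on {0..l} H" by (rule acd_continuous[OF H])
  have "continuous_on {0..l} (\<lambda>t. (H t)\<^sup>2)" by (intro continuous_intros Hc)
  from integrable_leb_continuous[OF this] have Hs: "sq_int (leb l) H"
    using measurable_leb_continuous[OF Hc] by (simp add: sq_int_def)
  define c where "c = (LINT t|leb l. g t - H t) / l"
  define \<psi> where "\<psi> t = g t - H t - c" for t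
  have cs: "sq_int (leb l) (\<lambda>_. c)" by (simp add: sq_int_def)
  have gH: "sq_int (leb l) (\<lambda>t. g t - H t)" by (rule sq_int_diff[OF g Hs])
  have \<psi>s: "sq_int (leb l) \<psi>" unfolding \<psi>_def[abs_def] by (rule sq_int_diff[OF gH cs])
  have \<psi>i: "integrable (leb l) \<psi>" by (rule sq_int_integrable[OF finite_measure_leb \<psi>s])
  define \<phi> where "\<phi> t = 0 + integral\<^sup>L (leb t) \<psi>" for t
  have \<phi>: "abs_cont_deriv l \<phi> \<psi>" unfolding \<phi>_def by (rule acd_primitive[OF \<psi>i])
  have \<psi>0: "integral\<^sup>L (leb l) \<psi> = 0"
  proof -
    have "integral\<^sup>L (leb l) \<psi> = (LINT t|leb l. g t - H t) - (LINT t|leb l. c)"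
      unfolding \<psi>_def using sq_int_integrable[OF finite_measure_leb gH]
      by (subst Bochner_Integration.integral_diff) auto
    also have "\<dots> = 0" using integral_leb_const[of l c] l by (simp add: c_def)
    finally show ?thesis .
  qed
  have \<phi>l: "\<phi> l = 0" by (simp add: \<phi>_def \<psi>0)
  have \<phi>0: "\<phi> 0 = 0" using acd_eq[OF \<phi>, of l] l \<psi>0 \<phi>l by simp
  have 1: "(LINT t|leb l. g t * \<psi> t) + (LINT t|leb l. h t * \<phi> t) = 0" by (rule weak[OF \<phi> \<psi>s \<phi>0 \<phi>l])
  have 2: "(LINT t|leb l. h t * \<phi> t) + (LINT t|leb l. H t * \<psi> t) = 0"
    using integration_by_parts_acd[OF H \<phi>] l \<phi>l \<phi>0 by simp
  \<comment> \<open>One factor \<psi> is expanded. The terms with g and H cancel by the weak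
    equation and integration by parts, and the term with c vanishes because \<psi> has mean
    zero.\<close>
  have "(LINT t|leb l. (\<psi> t)\<^sup>2) = (LINT t|leb l. g t * \<psi> t - H t * \<psi> t - c * \<psi> t)"
    by (rule Bochner_Integration.integral_cong) (auto simp: \<psi>_def power2_eq_square algebra_simps)
  also have "\<dots> = (LINT t|leb l. g t * \<psi> t) - (LINT t|leb l. H t * \<psi> t) - c * integral\<^sup>L (leb l) \<psi>"
    using sq_int_mult[OF g \<psi>s] sq_int_mult[OF Hs \<psi>s] \<psi>i by simp
  also have "\<dots> = 0" using 1 2 \<psi>0 by simp
  finally have "(LINT t|leb l. (\<psi> t)\<^sup>2) = 0" .
  then have "AE t in leb l. (\<psi> t)\<^sup>2 = 0"
    using \<psi>s by (subst (asm) integral_nonneg_eq_0_iff_AE) (auto simp: sq_int_def)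
  then have "AE t in leb l. g t = c + H t"
    by eventually_elim (auto simp: \<psi>_def)
  then show ?thesis unfolding H_def by blast
qed

context metric_graph
begin

lemma continuous_map_graph:
  fixes f :: "('v, 'e) gpoint \<Rightarrow> 'a::topological_space"
  assumes "\<And>e. e \<in> edges \<Gamma> \<Longrightarrow> continuous_on {0..len \<Gamma> e} (\<lambda>t. f (edge_point \<Gamma> e t))"
  shows "continuous_map (graph_topology \<Gamma>) euclidean f"
  unfolding continuous_map_def
proof (intro conjI allI impI)
  fix U :: "'a set" assume "openin euclidean U"
  then have U: "open U" by simp
  have "edge_preimage \<Gamma> e {x \<in> points \<Gamma>. f x \<in> U} = {0..len \<Gamma> e} \<inter> (\<lambda>t. f (edge_point \<Gamma> e t)) -` U"
    if "e \<in> edges \<Gamma>" for e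
    using edge_point_in_points[OF that] by (auto simp: edge_preimage_def)
  then show "openin (graph_topology \<Gamma>) {x \<in> topspace (graph_topology \<Gamma>). f x \<in> U}"
    using continuous_openin_preimage_gen[OF assms U]
    by (auto simp: openin_graph_topology topspace_graph_topology)
qed (auto simp: topspace_graph_topology)

lemma continuous_in_L2:
  assumes "\<And>e. e \<in> edges \<Gamma> \<Longrightarrow> continuous_on {0..len \<Gamma> e} (\<lambda>t. f (edge_point \<Gamma> e t))"
  shows "f \<in> Lp_space 2 (graph_measure \<Gamma>)"
proof -
  have "f \<in> borel_measurable (graph_measure \<Gamma>)"
    using measurable_leb_continuous[OF assms] by (simp add: graph_measurable_iff)
  moreover have "integrable (graph_measure \<Gamma>) (\<lambda>x. \<bar>f x\<bar> powr 2)"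
    unfolding integrable_graph_iff
  proof
    fix e assume e: "e \<in> edges \<Gamma>"
    have "integrable (leb (len \<Gamma> e)) (\<lambda>t. \<bar>f (edge_point \<Gamma> e t)\<bar>\<^sup>2)"
      by (intro integrable_leb_continuous continuous_intros assms[OF e])
    then show "integrable (leb (len \<Gamma> e)) (\<lambda>t. \<bar>f (edge_point \<Gamma> e t)\<bar> powr 2)" by simp
  qed
  ultimately show ?thesis by (simp add: Lp_space_def)
qed

text \<open>In the sup bound the mass term drops out, and the parameter makes the derivative term
  arbitrarily small.\<close>

lemma mass_zero_imp_zero:
  assumes x: "x \<in> sobolev \<Gamma>" and m: "mass_form \<Gamma> x x = 0" and e: "e \<in> edges \<Gamma>" and t: "t \<in> {0..len \<Gamma> e}"
  shows "fn x e t = 0"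
proof -
  have "(\<Sum>e\<in>edges \<Gamma>. LINT t|leb (len \<Gamma> e). fn x e t * fn x e t) = 0" using m by (simp add: potential_form_def)
  then have z: "(LINT t|leb (len \<Gamma> e). (fn x e t)\<^sup>2) = 0"
    using e finite_edges by (subst (asm) sum_nonneg_eq_0_iff) (auto simp: power2_eq_square)
  let ?G = "LINT t|leb (len \<Gamma> e). (der x e t)\<^sup>2"
  have "(fn x e t)\<^sup>2 \<le> \<epsilon>" if \<epsilon>: "0 < \<epsilon>" for \<epsilon>
  proof -
    define G where "G = ?G"
    have G: "0 \<le> G" by (simp add: G_def)
    have "(fn x e t)\<^sup>2 \<le> (1 / len \<Gamma> e + 1 / (\<epsilon> / (G + 1))) * (LINT t|leb (len \<Gamma> e). (fn x e t)\<^sup>2) + \<epsilon> / (G + 1) * G"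
      unfolding G_def by (rule acd_sup_bound[OF sobolevD(1,2)[OF x e] len_pos[OF e] _ t]) (use G \<epsilon> in \<open>simp add: G_def add_nonneg_pos\<close>)
    also have "\<dots> = \<epsilon> * (G / (G + 1))" by (simp add: z)
    also have "\<dots> \<le> \<epsilon> * 1" by (rule mult_left_mono) (use G \<epsilon> in \<open>auto simp: divide_le_eq\<close>)
    finally show ?thesis by simp
  qed
  then have "(fn x e t)\<^sup>2 \<le> 0" by (rule field_le_epsilon) auto
  then show ?thesis by simp
qed

end

locale schroedinger_form = metric_graph \<Gamma> for \<Gamma> :: "('v, 'e) pre_metric_graph" +
  fixes \<alpha> :: "'v \<Rightarrow> real" and q :: "('v, 'e) gpoint \<Rightarrow> real"
  assumes \<alpha>_ge0: "v \<in> verts \<Gamma> \<Longrightarrow> 0 \<le> \<alpha> v"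
    and q_integrable: "e \<in> edges \<Gamma> \<Longrightarrow> integrable (leb (len \<Gamma> e)) (pullback q e)"
begin

sublocale graph_form \<Gamma> \<alpha> "pullback q"
  by unfold_locales (use \<alpha>_ge0 q_integrable in auto)

text \<open>Test functions living on one edge give the differential equation there; test functions
  that are linear on every edge and equal to 1 at one vertex then give the coupling condition, after
  integration by parts.\<close>

lemma weak_imp_schroedinger:
  assumes u: "u \<in> sobolev \<Gamma>" and weak: "\<And>y. y \<in> sobolev \<Gamma> \<Longrightarrow> energy u y = \<nu> * mass_form \<Gamma> u y"
  shows "point_fun u \<in> eigenspace \<Gamma> \<alpha> q \<nu>"
proof -
  define h where "h e t = pullback q e t * fn u e t - \<nu> * fn u e t" for e t
  have qu: "integrable (leb (len \<Gamma> e)) (\<lambda>t. pullback q e t * fn u e t)" if "e \<in> edges \<Gamma>" for e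
    by (rule integrable_leb_mult_continuous[OF q_integrable[OF that] sobolevD(5)[OF u that]])
  have ui: "integrable (leb (len \<Gamma> e)) (fn u e)" if "e \<in> edges \<Gamma>" for e
    by (rule integrable_leb_continuous[OF sobolevD(5)[OF u that]])
  have hi: "integrable (leb (len \<Gamma> e)) (h e)" if "e \<in> edges \<Gamma>" for e
    unfolding h_def using qu[OF that] ui[OF that] by simp
  have weak': "dirichlet_form \<Gamma> u y + (\<Sum>e\<in>edges \<Gamma>. LINT t|leb (len \<Gamma> e). h e t * fn y e t) + vertex_form \<Gamma> \<alpha> u y = 0"
    if y: "y \<in> sobolev \<Gamma>" for y
  proof -
    have "(LINT t|leb (len \<Gamma> e). h e t * fn y e t)
        = (LINT t|leb (len \<Gamma> e). pullback q e t * (fn u e t * fn y e t)) - \<nu> * (LINT t|leb (len \<Gamma> e). 1 * (fn u e t * fn y e t))"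
      if e: "e \<in> edges \<Gamma>" for e
    proof -
      have "integrable (leb (len \<Gamma> e)) (\<lambda>t. pullback q e t * fn u e t * fn y e t)"
        "integrable (leb (len \<Gamma> e)) (\<lambda>t. fn u e t * fn y e t)"
        using integrable_leb_mult_continuous[OF qu[OF e] sobolevD(5)[OF y e]]
          integrable_leb_mult_continuous[OF ui[OF e] sobolevD(5)[OF y e]] by auto
      then show ?thesis by (simp add: h_def left_diff_distrib mult.assoc)
    qed
    then have "(\<Sum>e\<in>edges \<Gamma>. LINT t|leb (len \<Gamma> e). h e t * fn y e t)
        = potential_form \<Gamma> (pullback q) u y - \<nu> * mass_form \<Gamma> u y"
      by (simp add: potential_form_def sum_subtractf sum_distrib_left)
    then show ?thesis using weak[OF y] by (simp add: energy_def)
  qed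
  have "\<exists>c. AE t in leb (len \<Gamma> e). der u e t = c + integral\<^sup>L (leb t) (h e)" if e: "e \<in> edges \<Gamma>" for e
  proof (rule weak_derivative_regularity[OF len_pos[OF e] sobolevD(2)[OF u e] hi[OF e]])
    fix \<phi> \<psi> assume \<phi>: "abs_cont_deriv (len \<Gamma> e) \<phi> \<psi>" "sq_int (leb (len \<Gamma> e)) \<psi>" "\<phi> 0 = 0" "\<phi> (len \<Gamma> e) = 0"
    define y :: "('v, 'e) graph_fun" where "y = ((\<lambda>_. 0), (\<lambda>e' t. if e' = e then \<phi> t else 0), (\<lambda>e' t. if e' = e then \<psi> t else 0))"
    have y: "y \<in> sobolev \<Gamma>"
      using \<phi> acd_zero by (auto simp: sobolev_def y_def sq_int_def)
    have "dirichlet_form \<Gamma> u y = (\<Sum>e'\<in>edges \<Gamma>. if e' = e then (LINT t|leb (len \<Gamma> e). der u e t * \<psi> t) else 0)"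
      unfolding dirichlet_form_def y_def by (intro sum.cong) auto
    moreover have "(\<Sum>e'\<in>edges \<Gamma>. LINT t|leb (len \<Gamma> e'). h e' t * fn y e' t)
        = (\<Sum>e'\<in>edges \<Gamma>. if e' = e then (LINT t|leb (len \<Gamma> e). h e t * \<phi> t) else 0)"
      unfolding y_def by (intro sum.cong) auto
    moreover have "vertex_form \<Gamma> \<alpha> u y = 0" by (simp add: vertex_form_def y_def)
    ultimately show "(LINT t|leb (len \<Gamma> e). der u e t * \<psi> t) + (LINT t|leb (len \<Gamma> e). h e t * \<phi> t) = 0"
      using weak'[OF y] e finite_edges by simp
  qed
  then have "\<forall>e\<in>edges \<Gamma>. \<exists>c. AE t in leb (len \<Gamma> e). der u e t = c + integral\<^sup>L (leb t) (h e)" by blast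
  from bchoice[OF this] obtain c where
    c: "\<And>e. e \<in> edges \<Gamma> \<Longrightarrow> AE t in leb (len \<Gamma> e). der u e t = c e + integral\<^sup>L (leb t) (h e)" by blast
  \<comment> \<open>The absolutely continuous representative of the weak derivative: only this one
    has values at the endpoints, which the coupling condition refers to.\<close>
  define f1 where "f1 e t = c e + integral\<^sup>L (leb t) (h e)" for e t
  have f1: "abs_cont_deriv (len \<Gamma> e) (f1 e) (h e)" if "e \<in> edges \<Gamma>" for e
    unfolding f1_def by (rule acd_primitive[OF hi[OF that]])
  have uf1: "abs_cont_deriv (len \<Gamma> e) (fn u e) (f1 e)" if e: "e \<in> edges \<Gamma>" for e
    by (rule acd_cong_AE[OF sobolevD(1)[OF u e]])
      (use c[OF e] integrable_leb_continuous[OF acd_continuous[OF f1[OF e]]] in \<open>simp_all add: f1_def\<close>)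
  have pf: "point_fun u (edge_point \<Gamma> e t) = fn u e t" if "e \<in> edges \<Gamma>" "t \<in> {0..len \<Gamma> e}" for e t
    by (rule point_fun_edge_point[OF u that])
  have cont: "continuous_on {0..len \<Gamma> e} (\<lambda>t. point_fun u (edge_point \<Gamma> e t))" if e: "e \<in> edges \<Gamma>" for e
    by (rule continuous_on_eq[OF sobolevD(5)[OF u e]]) (simp add: pf[OF e])
  have kirchhoff: "(\<Sum>e | e \<in> edges \<Gamma> \<and> src \<Gamma> e = v. f1 e 0) + (\<Sum>e | e \<in> edges \<Gamma> \<and> tgt \<Gamma> e = v. - f1 e (len \<Gamma> e))
      = \<alpha> v * point_fun u (Vertex v)" if v: "v \<in> verts \<Gamma>" for v
  proof -
    \<comment> \<open>Values of the test function at the two ends of e. At a loop both are 1, so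
      that both end derivatives enter the condition.\<close>
    define a b where "a e = (if src \<Gamma> e = v then 1 else 0 :: real)" and "b e = (if tgt \<Gamma> e = v then 1 else 0 :: real)" for e
    define y :: "('v, 'e) graph_fun" where "y = ((\<lambda>w. if w = v then 1 else 0),
      (\<lambda>e t. a e + (b e - a e) / len \<Gamma> e * t), (\<lambda>e t. (b e - a e) / len \<Gamma> e))"
    have lin: "abs_cont_deriv l (\<lambda>t. p + s * t) (\<lambda>t. s)" for l p s :: real
      unfolding acd_iff
      by (auto simp: finite_measure.integrable_const[OF finite_measure_leb] measure_leb)
    have y: "y \<in> sobolev \<Gamma>"
      unfolding sobolev_def mem_Collect_eq
    proof (intro ballI conjI)
      fix e assume e: "e \<in> edges \<Gamma>"
      show "abs_cont_deriv (len \<Gamma> e) (fn y e) (der y e)"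
        unfolding y_def fst_conv snd_conv by (rule lin)
      show "sq_int (leb (len \<Gamma> e)) (der y e)" by (simp add: y_def sq_int_def)
      show "fn y e 0 = val y (src \<Gamma> e)" by (simp add: y_def a_def)
      show "fn y e (len \<Gamma> e) = val y (tgt \<Gamma> e)" using len_pos[OF e] by (simp add: y_def b_def)
    qed
    have "(LINT t|leb (len \<Gamma> e). der u e t * der y e t) + (LINT t|leb (len \<Gamma> e). h e t * fn y e t)
        = f1 e (len \<Gamma> e) * b e - f1 e 0 * a e" if e: "e \<in> edges \<Gamma>" for e
    proof -
      have "(LINT t|leb (len \<Gamma> e). der u e t * der y e t) = (LINT t|leb (len \<Gamma> e). f1 e t * der y e t)"
      proof (rule integral_cong_AE)
        show "AE t in leb (len \<Gamma> e). der u e t * der y e t = f1 e t * der y e t"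
          using c[OF e] by eventually_elim (simp add: f1_def)
        show "(\<lambda>t. der u e t * der y e t) \<in> borel_measurable (leb (len \<Gamma> e))"
          "(\<lambda>t. f1 e t * der y e t) \<in> borel_measurable (leb (len \<Gamma> e))"
          using sobolevD(2)[OF u e] sobolevD(2)[OF y e] measurable_leb_continuous[OF acd_continuous[OF f1[OF e]]]
          by (auto simp: sq_int_def)
      qed
      moreover have "fn y e 0 = a e" "fn y e (len \<Gamma> e) = b e"
        using len_pos[OF e] by (simp_all add: y_def)
      ultimately show ?thesis
        using integration_by_parts_acd[OF f1[OF e] sobolevD(1)[OF y e]] len_pos[OF e] by simp
    qed
    then have "dirichlet_form \<Gamma> u y + (\<Sum>e\<in>edges \<Gamma>. LINT t|leb (len \<Gamma> e). h e t * fn y e t)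
        = (\<Sum>e\<in>edges \<Gamma>. f1 e (len \<Gamma> e) * b e - f1 e 0 * a e)"
      by (simp add: dirichlet_form_def sum.distrib[symmetric])
    also have "\<dots> = (\<Sum>e\<in>edges \<Gamma>. if tgt \<Gamma> e = v then f1 e (len \<Gamma> e) else 0) - (\<Sum>e\<in>edges \<Gamma>. if src \<Gamma> e = v then f1 e 0 else 0)"
      unfolding sum_subtractf by (intro arg_cong2[where f = minus] sum.cong) (auto simp: a_def b_def)
    also have "\<dots> = (\<Sum>e | e \<in> edges \<Gamma> \<and> tgt \<Gamma> e = v. f1 e (len \<Gamma> e)) - (\<Sum>e | e \<in> edges \<Gamma> \<and> src \<Gamma> e = v. f1 e 0)"
      using finite_edges by (simp add: sum.inter_filter)
    finally have "(\<Sum>e | e \<in> edges \<Gamma> \<and> src \<Gamma> e = v. f1 e 0) - (\<Sum>e | e \<in> edges \<Gamma> \<and> tgt \<Gamma> e = v. f1 e (len \<Gamma> e))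
        = vertex_form \<Gamma> \<alpha> u y" using weak'[OF y] by linarith
    also have "\<dots> = (\<Sum>w\<in>verts \<Gamma>. if w = v then \<alpha> v * val u v else 0)"
      unfolding vertex_form_def y_def by (intro sum.cong) auto
    also have "\<dots> = \<alpha> v * point_fun u (Vertex v)" using v finite_verts by (simp add: point_fun_def)
    finally show ?thesis by (simp add: sum_negf)
  qed
  have cont\<nu>: "continuous_on {0..len \<Gamma> e} (\<lambda>t. \<nu> * point_fun u (edge_point \<Gamma> e t))" if e: "e \<in> edges \<Gamma>" for e
    by (intro continuous_intros cont e)
  have "\<exists>f1 f2. (\<forall>e\<in>edges \<Gamma>.
      abs_cont_deriv (len \<Gamma> e) (\<lambda>t. point_fun u (edge_point \<Gamma> e t)) (f1 e) \<and>
      abs_cont_deriv (len \<Gamma> e) (f1 e) (f2 e) \<and>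
      (AE t in lebesgue. t \<in> {0..len \<Gamma> e} \<longrightarrow> \<nu> * point_fun u (edge_point \<Gamma> e t)
        = - f2 e t + q (edge_point \<Gamma> e t) * point_fun u (edge_point \<Gamma> e t))) \<and>
    (\<forall>v\<in>verts \<Gamma>. (\<Sum>e | e \<in> edges \<Gamma> \<and> src \<Gamma> e = v. f1 e 0)
      + (\<Sum>e | e \<in> edges \<Gamma> \<and> tgt \<Gamma> e = v. - f1 e (len \<Gamma> e)) = \<alpha> v * point_fun u (Vertex v))"
  proof (rule exI[of _ f1], rule exI[of _ h], intro conjI ballI)
    fix e assume e: "e \<in> edges \<Gamma>"
    show "abs_cont_deriv (len \<Gamma> e) (\<lambda>t. point_fun u (edge_point \<Gamma> e t)) (f1 e)"
      by (rule acd_cong[OF uf1[OF e]]) (auto simp: pf[OF e])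
    show "abs_cont_deriv (len \<Gamma> e) (f1 e) (h e)" by (rule f1[OF e])
    show "AE t in lebesgue. t \<in> {0..len \<Gamma> e} \<longrightarrow> \<nu> * point_fun u (edge_point \<Gamma> e t)
        = - h e t + pullback q e t * point_fun u (edge_point \<Gamma> e t)"
      by (intro always_eventually) (auto simp: h_def pf[OF e])
  qed (rule kirchhoff)
  then show ?thesis
    using continuous_map_graph[OF cont] continuous_in_L2[OF cont] continuous_in_L2[OF cont\<nu>]
    unfolding eigenspace_def schroedinger_def mem_Collect_eq by (intro conjI)
qed

text \<open>Testing the equation with the eigenfunction itself turns the boundary terms into the
  vertex form and gives energy equal to \<nu> times mass. A nonzero value must be assumed because
  the zero function lies in every eigenspace.\<close>

lemma eigenvalue_ge:
  assumes f: "f \<in> eigenspace \<Gamma> \<alpha> q \<nu>" and nz: "\<exists>p\<in>points \<Gamma>. f p \<noteq> 0"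
  shows "- C \<le> \<nu>"
proof -
  have "\<exists>f1 f2. (\<forall>e\<in>edges \<Gamma>. abs_cont_deriv (len \<Gamma> e) (\<lambda>t. f (edge_point \<Gamma> e t)) (f1 e) \<and>
        abs_cont_deriv (len \<Gamma> e) (f1 e) (f2 e) \<and>
        (AE t in lebesgue. t \<in> {0..len \<Gamma> e} \<longrightarrow>
          \<nu> * f (edge_point \<Gamma> e t) = - f2 e t + q (edge_point \<Gamma> e t) * f (edge_point \<Gamma> e t))) \<and>
      (\<forall>v\<in>verts \<Gamma>. (\<Sum>e | e \<in> edges \<Gamma> \<and> src \<Gamma> e = v. f1 e 0)
        + (\<Sum>e | e \<in> edges \<Gamma> \<and> tgt \<Gamma> e = v. - f1 e (len \<Gamma> e)) = \<alpha> v * f (Vertex v))"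
    using f unfolding eigenspace_def schroedinger_def mem_Collect_eq by (elim conjE)
  then obtain f1 f2 where F: "\<forall>e\<in>edges \<Gamma>. abs_cont_deriv (len \<Gamma> e) (\<lambda>t. f (edge_point \<Gamma> e t)) (f1 e) \<and>
        abs_cont_deriv (len \<Gamma> e) (f1 e) (f2 e) \<and>
        (AE t in lebesgue. t \<in> {0..len \<Gamma> e} \<longrightarrow>
          \<nu> * f (edge_point \<Gamma> e t) = - f2 e t + q (edge_point \<Gamma> e t) * f (edge_point \<Gamma> e t))"
      and 4: "\<forall>v\<in>verts \<Gamma>. (\<Sum>e | e \<in> edges \<Gamma> \<and> src \<Gamma> e = v. f1 e 0)
        + (\<Sum>e | e \<in> edges \<Gamma> \<and> tgt \<Gamma> e = v. - f1 e (len \<Gamma> e)) = \<alpha> v * f (Vertex v)"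
    by (elim exE conjE)
  have 1: "abs_cont_deriv (len \<Gamma> e) (\<lambda>t. f (edge_point \<Gamma> e t)) (f1 e)"
    and 2: "abs_cont_deriv (len \<Gamma> e) (f1 e) (f2 e)"
    and 3: "AE t in lebesgue. t \<in> {0..len \<Gamma> e} \<longrightarrow>
      \<nu> * f (edge_point \<Gamma> e t) = - f2 e t + q (edge_point \<Gamma> e t) * f (edge_point \<Gamma> e t)"
    if "e \<in> edges \<Gamma>" for e
    using bspec[OF F that] by simp_all
  define x :: "('v, 'e) graph_fun" where "x = ((\<lambda>v. f (Vertex v)), (\<lambda>e t. f (edge_point \<Gamma> e t)), f1)"
  have x: "x \<in> sobolev \<Gamma>"
    unfolding sobolev_def mem_Collect_eq
  proof (intro ballI conjI)
    fix e assume e: "e \<in> edges \<Gamma>"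
    show "abs_cont_deriv (len \<Gamma> e) (fn x e) (der x e)" using 1[OF e] by (simp add: x_def)
    have c: "continuous_on {0..len \<Gamma> e} (f1 e)" by (rule acd_continuous[OF 2[OF e]])
    have "continuous_on {0..len \<Gamma> e} (\<lambda>t. (f1 e t)\<^sup>2)" by (intro continuous_intros c)
    from integrable_leb_continuous[OF this] show "sq_int (leb (len \<Gamma> e)) (der x e)"
      using measurable_leb_continuous[OF c] by (simp add: sq_int_def x_def)
    show "fn x e 0 = val x (src \<Gamma> e)" "fn x e (len \<Gamma> e) = val x (tgt \<Gamma> e)"
      using len_pos[OF e] by (auto simp: edge_point_def x_def)
  qed
  have edge: "(LINT t|leb (len \<Gamma> e). der x e t * der x e t) + (LINT t|leb (len \<Gamma> e). pullback q e t * (fn x e t * fn x e t))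
      - \<nu> * (LINT t|leb (len \<Gamma> e). 1 * (fn x e t * fn x e t))
      = f1 e (len \<Gamma> e) * val x (tgt \<Gamma> e) - f1 e 0 * val x (src \<Gamma> e)" if e: "e \<in> edges \<Gamma>" for e
  proof -
    have c: "continuous_on {0..len \<Gamma> e} (fn x e)" by (rule sobolevD(5)[OF x e])
    have i1: "integrable (leb (len \<Gamma> e)) (\<lambda>t. pullback q e t * (fn x e t * fn x e t))"
      by (rule integrable_leb_mult_continuous[OF q_integrable[OF e]]) (intro continuous_intros c)
    have i2: "integrable (leb (len \<Gamma> e)) (\<lambda>t. fn x e t * fn x e t)"
      by (intro integrable_leb_continuous continuous_intros c)
    have "(LINT t|leb (len \<Gamma> e). f2 e t * fn x e t)
        = (LINT t|leb (len \<Gamma> e). pullback q e t * (fn x e t * fn x e t) - \<nu> * (fn x e t * fn x e t))"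
    proof (rule integral_cong_AE)
      have "AE t in leb (len \<Gamma> e). \<nu> * f (edge_point \<Gamma> e t) = - f2 e t + q (edge_point \<Gamma> e t) * f (edge_point \<Gamma> e t)"
        using 3[OF e] by (subst AE_restrict_space_iff) auto
      then show "AE t in leb (len \<Gamma> e). f2 e t * fn x e t = pullback q e t * (fn x e t * fn x e t) - \<nu> * (fn x e t * fn x e t)"
      proof eventually_elim
        case (elim t)
        then have f2: "f2 e t = (pullback q e t - \<nu>) * fn x e t" by (simp add: x_def algebra_simps)
        show ?case unfolding f2 by (simp add: algebra_simps)
      qed
      show "(\<lambda>t. f2 e t * fn x e t) \<in> borel_measurable (leb (len \<Gamma> e))"
        using integrable_leb_mult_continuous[OF acd_integrable[OF 2[OF e]] c] by auto
    qed (use i1 i2 in auto)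
    also have "\<dots> = (LINT t|leb (len \<Gamma> e). pullback q e t * (fn x e t * fn x e t)) - \<nu> * (LINT t|leb (len \<Gamma> e). fn x e t * fn x e t)"
      using i1 i2 by simp
    finally show ?thesis
      using integration_by_parts_acd[OF 2[OF e] sobolevD(1)[OF x e]] len_pos[OF e] sobolevD(3,4)[OF x e]
      by (simp add: x_def)
  qed
  have "dirichlet_form \<Gamma> x x + potential_form \<Gamma> (pullback q) x x - \<nu> * mass_form \<Gamma> x x
      = (\<Sum>e\<in>edges \<Gamma>. f1 e (len \<Gamma> e) * val x (tgt \<Gamma> e) - f1 e 0 * val x (src \<Gamma> e))"
    unfolding dirichlet_form_def potential_form_def sum_distrib_left
    using edge by (simp add: sum.distrib[symmetric] sum_subtractf[symmetric])
  also have "\<dots> = - (\<Sum>v\<in>verts \<Gamma>. val x v * ((\<Sum>e | e \<in> edges \<Gamma> \<and> src \<Gamma> e = v. f1 e 0)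
      + (\<Sum>e | e \<in> edges \<Gamma> \<and> tgt \<Gamma> e = v. - f1 e (len \<Gamma> e))))"
  proof -
    \<comment> \<open>Boundary terms are regrouped from edges to vertices, once for the sources and
      once for the targets.\<close>
    have g: "(\<Sum>e\<in>edges \<Gamma>. c e * val x (s e)) = (\<Sum>v\<in>verts \<Gamma>. val x v * (\<Sum>e | e \<in> edges \<Gamma> \<and> s e = v. c e))"
      if "\<And>e. e \<in> edges \<Gamma> \<Longrightarrow> s e \<in> verts \<Gamma>" for s and c :: "'e \<Rightarrow> real"
    proof -
      have "(\<Sum>v\<in>verts \<Gamma>. val x v * (\<Sum>e | e \<in> edges \<Gamma> \<and> s e = v. c e))
          = (\<Sum>v\<in>verts \<Gamma>. \<Sum>e | e \<in> edges \<Gamma> \<and> s e = v. c e * val x (s e))"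
        by (intro sum.cong refl) (auto simp: sum_distrib_left mult.commute intro!: sum.cong)
      also have "\<dots> = (\<Sum>e\<in>edges \<Gamma>. c e * val x (s e))"
        using sum.group[OF finite_edges finite_verts, of s "\<lambda>e. c e * val x (s e)"] that by (simp add: image_subset_iff)
      finally show ?thesis by simp
    qed
    show ?thesis
      using g[of "tgt \<Gamma>" "\<lambda>e. f1 e (len \<Gamma> e)"] g[of "src \<Gamma>" "\<lambda>e. f1 e 0"] src_in_verts tgt_in_verts
      by (simp add: sum_subtractf sum_negf right_diff_distrib distrib_left)
  qed
  also have "\<dots> = - vertex_form \<Gamma> \<alpha> x x"
    unfolding vertex_form_def
    by (intro arg_cong[where f = uminus] sum.cong) (simp_all add: 4 x_def)
  finally have "energy x x = \<nu> * mass_form \<Gamma> x x" by (simp add: energy_def)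
  then have "0 \<le> (\<nu> + C) * mass_form \<Gamma> x x"
    using lower[OF x] by (simp add: distrib_right)
  moreover have "0 < mass_form \<Gamma> x x"
  proof (rule ccontr)
    assume "\<not> 0 < mass_form \<Gamma> x x"
    then have "mass_form \<Gamma> x x = 0" using mass_nonneg[of x] by linarith
    then have z: "f (edge_point \<Gamma> e t) = 0" if "e \<in> edges \<Gamma>" "t \<in> {0..len \<Gamma> e}" for e t
      using mass_zero_imp_zero[OF x _ that] by (simp add: x_def)
    have "f p = 0" if p: "p \<in> points \<Gamma>" for p
    proof (cases p)
      case (Vertex v)
      then have "v \<in> verts \<Gamma>" using p by (auto simp: points_def)
      then obtain e where e: "e \<in> edges \<Gamma>" "src \<Gamma> e = v \<or> tgt \<Gamma> e = v" using no_isolated_verts by blast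
      then show ?thesis
        using z[OF e(1), of 0] z[OF e(1), of "len \<Gamma> e"] len_pos[OF e(1)] Vertex by (auto simp: edge_point_def)
    next
      case (Inner e t)
      then show ?thesis using z[of e t] p by (auto simp: points_def edge_point_def)
    qed
    then show False using nz by blast
  qed
  ultimately show ?thesis by (simp add: zero_le_mult_iff)
qed

text \<open>The eigenvalue is an infimum of reals, so two things are needed: \<Lambda> belongs to
  the set, by the min-max principle and regularity, and the set is bounded below. Orthonormality in
  mass gives linear independence as functions on the points.\<close>

theorem eigenvalue_nth_le:
  assumes k: "0 < k" and \<phi>: "\<And>i. i < k \<Longrightarrow> \<phi> i \<in> sobolev \<Gamma>"
    and indep: "\<And>c. mass_form \<Gamma> (\<Sum>i<k. c i *\<^sub>R \<phi> i) (\<Sum>i<k. c i *\<^sub>R \<phi> i) = 0 \<Longrightarrow> \<forall>i<k. c i = 0"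
    and bound: "\<And>x. x \<in> sobolev \<Gamma> \<Longrightarrow> \<exists>c. x = (\<Sum>i<k. c i *\<^sub>R \<phi> i) \<Longrightarrow> energy x x \<le> \<Lambda> * mass_form \<Gamma> x x"
  shows "eigenvalue_nth \<Gamma> \<alpha> q k \<le> \<Lambda>"
proof -
  let ?S = "{\<mu>. \<exists>u \<nu>. (\<forall>i<k. u i \<in> eigenspace \<Gamma> \<alpha> q (\<nu> i) \<and> \<nu> i \<le> \<mu>) \<and> lin_indep_on (points \<Gamma>) k u}"
  have "energy (\<Sum>i<k. c i *\<^sub>R \<phi> i) (\<Sum>i<k. c i *\<^sub>R \<phi> i) \<le> \<Lambda> * mass_form \<Gamma> (\<Sum>i<k. c i *\<^sub>R \<phi> i) (\<Sum>i<k. c i *\<^sub>R \<phi> i)" for c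
    by (rule bound) (use \<phi> subspace_sobolev in \<open>auto intro!: subspace_sum subspace_scale\<close>)
  from min_max[OF \<phi> indep this] obtain u \<nu> where u: "\<And>i. i < k \<Longrightarrow> u i \<in> sobolev \<Gamma>"
    "\<And>i. i < k \<Longrightarrow> \<nu> i \<le> \<Lambda>" "\<And>i y. i < k \<Longrightarrow> y \<in> sobolev \<Gamma> \<Longrightarrow> energy (u i) y = \<nu> i * mass_form \<Gamma> (u i) y"
    "\<And>i j. i < k \<Longrightarrow> j < k \<Longrightarrow> mass_form \<Gamma> (u i) (u j) = (if i = j then 1 else 0)" by blast
  have "lin_indep_on (points \<Gamma>) k (\<lambda>i. point_fun (u i))"
    unfolding lin_indep_on_def
  proof (intro allI impI)
    fix c j assume z: "\<forall>x\<in>points \<Gamma>. (\<Sum>i<k. c i * point_fun (u i) x) = 0" and j: "j < k"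
    let ?x = "\<Sum>i<k. c i *\<^sub>R u i"
    have "fn ?x e t = 0" if e: "e \<in> edges \<Gamma>" and t: "t \<in> {0..len \<Gamma> e}" for e t
    proof -
      have "fn ?x e t = (\<Sum>i<k. c i * fn (u i) e t)" by (simp add: graph_fun_sum)
      also have "\<dots> = (\<Sum>i<k. c i * point_fun (u i) (edge_point \<Gamma> e t))"
        by (intro sum.cong) (auto simp: point_fun_edge_point[OF u(1) e t])
      finally show ?thesis using z edge_point_in_points[OF e] by simp
    qed
    then have "mass_form \<Gamma> ?x (u j) = 0"
      unfolding potential_form_def by (intro sum.neutral ballI integral_eq_zero_AE AE_I2) auto
    moreover have "mass_form \<Gamma> ?x (u j) = (\<Sum>i<k. c i * mass_form \<Gamma> (u i) (u j))"
      using sym_form_sum[OF sym_form_mass, of "{..<k}" u \<Gamma> "u j" c] u(1) j by simp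
    moreover have "\<dots> = (\<Sum>i<k. if i = j then c j else 0)"
      by (rule sum.cong) (use u(4) j in auto)
    ultimately show "c j = 0" using j by simp
  qed
  moreover have "point_fun (u i) \<in> eigenspace \<Gamma> \<alpha> q (\<nu> i)" if "i < k" for i
    by (rule weak_imp_schroedinger[OF u(1)[OF that] u(3)[OF that]])
  ultimately have "\<Lambda> \<in> ?S"
    using u(2) by (intro CollectI exI[of _ "\<lambda>i. point_fun (u i)"] exI[of _ \<nu>]) simp
  moreover have "bdd_below ?S"
  proof (rule bdd_belowI)
    fix \<mu> assume "\<mu> \<in> ?S"
    then obtain u \<nu> where u: "\<forall>i<k. u i \<in> eigenspace \<Gamma> \<alpha> q (\<nu> i) \<and> \<nu> i \<le> \<mu>" "lin_indep_on (points \<Gamma>) k u" by blast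
    \<comment> \<open>Independence rules out a zero function, and k > 0 provides the index 0 to
      which the lower bound on eigenvalues is applied.\<close>
    have "\<exists>p\<in>points \<Gamma>. u 0 p \<noteq> 0"
    proof (rule ccontr)
      let ?c = "\<lambda>i::nat. if i = 0 then 1 else 0 :: real"
      assume "\<not> ?thesis"
      then have "\<forall>x\<in>points \<Gamma>. (\<Sum>i<k. ?c i * u i x) = 0"
        by (auto intro!: sum.neutral)
      moreover have "(\<forall>x\<in>points \<Gamma>. (\<Sum>i<k. ?c i * u i x) = 0) \<longrightarrow> (\<forall>i<k. ?c i = 0)"
        using u(2) unfolding lin_indep_on_def by (rule spec)
      ultimately have "\<forall>i<k. ?c i = 0" by (rule rev_mp)
      then show False using k by auto
    qed
    moreover have "u 0 \<in> eigenspace \<Gamma> \<alpha> q (\<nu> 0)" "\<nu> 0 \<le> \<mu>" using u(1) k by auto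
    ultimately show "- C \<le> \<mu>" using eigenvalue_ge[of "u 0" "\<nu> 0"] by linarith
  qed
  ultimately show ?thesis unfolding eigenvalue_nth_def by (rule cInf_lower)
qed

end

section \<open>Trial functions along one edge\<close>

text \<open>The Pruefer angle of the Robin condition of strength \<open>\<omega> y\<close> in units of half-waves: \<open>-1/2\<close> for a
  free end, tending to \<open>-1\<close> and \<open>0\<close> for \<open>y \<rightarrow> \<infinity>\<close> and \<open>y \<rightarrow> -\<infinity>\<close>.\<close>

definition phase_weight :: "real \<Rightarrow> real"
  where "phase_weight y = - 1 / 2 - arctan y / pi"

lemma phase_weight_neg: "phase_weight y < 0"
proof -
  have "- (pi / 2) < arctan y" by (rule arctan_lbound)
  then have "- (1 / 2) < arctan y / pi" by (simp add: field_simps)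
  then show ?thesis by (simp add: phase_weight_def)
qed

text \<open>Superadditivity is what allows several Robin conditions at one vertex to be merged: the
  strengths add, and the weight does not drop below the sum. If one strength is at most 0,
  monotonicity of arctan suffices; if both are positive, its upper bound does.\<close>

lemma phase_weight_add: "phase_weight y + phase_weight z \<le> phase_weight (y + z)"
proof -
  have *: "arctan (y + z) \<le> pi / 2 + arctan y + arctan z" if "z \<le> 0" for y z
  proof -
    have "arctan (y + z) \<le> arctan y" using that by (simp add: arctan_le_iff)
    then show ?thesis using arctan_lbound[of z] by linarith
  qed
  have "arctan (y + z) \<le> pi / 2 + arctan y + arctan z"
  proof (cases "z \<le> 0 \<or> y \<le> 0")
    case True
    then show ?thesis using *[of z y] *[of y z] by (auto simp: add.commute)
  next
    case False
    then have "0 \<le> arctan y" "0 \<le> arctan z" by auto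
    then show ?thesis using arctan_ubound[of "y + z"] by linarith
  qed
  then have "arctan (y + z) / pi \<le> (pi / 2 + arctan y + arctan z) / pi"
    by (rule divide_right_mono) simp
  then show ?thesis by (simp add: phase_weight_def add_divide_distrib)
qed

text \<open>This decouples arcs with disjoint supports: a quadratic form of a combination becomes a
  sum over single arcs.\<close>

lemma sum_square_disjoint:
  fixes f :: "'i \<Rightarrow> real"
  assumes "\<And>i j. i \<in> I \<Longrightarrow> j \<in> I \<Longrightarrow> i \<noteq> j \<Longrightarrow> f i * f j = 0"
  shows "(\<Sum>i\<in>I. f i)\<^sup>2 = (\<Sum>i\<in>I. (f i)\<^sup>2)"
  using assms
proof (induction I rule: infinite_finite_induct)
  case (insert x F)
  have "f x * (\<Sum>i\<in>F. f i) = 0"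
    unfolding sum_distrib_left using insert.hyps insert.prems by (intro sum.neutral) auto
  then show ?case using insert by (simp add: power2_sum mult.assoc)
qed auto

text \<open>\<open>arctan y\<close> is increased slightly to some \<open>a\<close> for which \<open>cos (\<omega> l - a) \<noteq> 0\<close>.\<close>

lemma nonresonant_phase:
  fixes \<epsilon> y \<omega> l :: real
  assumes \<epsilon>: "0 < \<epsilon>" and \<omega>: "0 < \<omega>" and l: "0 < l"
  obtains a and n :: nat where "arctan y < a" "a < pi / 2" "a < arctan y + \<epsilon>"
    "- (pi / 2) < \<omega> * l - a - n * pi" "\<omega> * l - a - n * pi < pi / 2"
proof -
  define \<delta> where "\<delta> = min \<epsilon> (min (pi / 2 - arctan y) pi) / 4"
  have \<delta>: "0 < \<delta>" "4 * \<delta> \<le> \<epsilon>" "4 * \<delta> \<le> pi / 2 - arctan y" "4 * \<delta> \<le> pi"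
    using \<epsilon> arctan_ubound[of y] by (auto simp: \<delta>_def min_def)
  define x where "x a = (\<omega> * l - a) / pi + 1 / 2" for a
  \<comment> \<open>\<open>x a\<close> is an integer exactly for resonant a. The values of x at the
    two candidates differ by less than 1, so at most one of them is resonant.\<close>
  have "x (arctan y + \<delta>) - x (arctan y + 2 * \<delta>) = \<delta> / pi"
    by (simp add: x_def diff_divide_distrib add_divide_distrib)
  moreover have "0 < \<delta> / pi" "\<delta> / pi < 1" using \<delta> by (auto simp: field_simps)
  ultimately have "x (arctan y + \<delta>) \<notin> \<int> \<or> x (arctan y + 2 * \<delta>) \<notin> \<int>"
    by (metis Ints_diff frac_eq_0_iff frac_eq order_less_imp_le order_less_irrefl)
  then obtain a where a: "a = arctan y + \<delta> \<or> a = arctan y + 2 * \<delta>" "x a \<notin> \<int>" by blast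
  have a1: "arctan y < a" "a < pi / 2" "a < arctan y + \<epsilon>" using a(1) \<delta> by auto
  have "0 < x a"
  proof -
    have "- (pi / 2) < \<omega> * l - a" using a1 mult_pos_pos[OF \<omega> l] by linarith
    then have "- (pi / 2) / pi < (\<omega> * l - a) / pi" by (rule divide_strict_right_mono) simp
    then show ?thesis by (simp add: x_def)
  qed
  define n where "n = nat \<lfloor>x a\<rfloor>"
  have n: "real n = of_int \<lfloor>x a\<rfloor>" using \<open>0 < x a\<close> by (simp add: n_def)
  have "real n \<noteq> x a" using a(2) by (metis Ints_of_nat)
  then have "real n < x a" "x a < real n + 1" using n by linarith+
  then have "pi * real n < pi * x a" "pi * x a < pi * (real n + 1)" by simp_all
  moreover have "pi * x a = \<omega> * l - a + pi / 2" by (simp add: x_def distrib_left)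
  ultimately have "- (pi / 2) < \<omega> * l - a - n * pi" "\<omega> * l - a - n * pi < pi / 2"
    by (simp_all add: algebra_simps)
  with a1 show thesis by (rule that)
qed

text \<open>\<open>R 0, \<dots>, R n\<close> are the arcs of \<open>cos (\<omega> t - a)\<close> between consecutive zeros; the last one, which
  reaches \<open>l\<close>, is normalized there.\<close>

lemma edge_profile_near_end:
  fixes \<omega> l y \<epsilon> :: real
  assumes \<omega>: "0 < \<omega>" and l: "0 < l" and \<epsilon>: "0 < \<epsilon>"
  shows "\<exists>(n::nat) y' (R :: nat \<Rightarrow> real \<Rightarrow> real) (R' :: nat \<Rightarrow> real \<Rightarrow> real). phase_weight y + l * \<omega> / pi - n - \<epsilon> \<le> phase_weight y' \<and>
    (\<forall>j\<le>n. abs_cont_deriv l (R j) (R' j) \<and> sq_int (leb l) (R' j) \<and> R j l = (if j = n then 1 else 0)) \<and>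
    (\<forall>d :: nat \<Rightarrow> real. (LINT t|leb l. (\<Sum>j\<le>n. d j * R' j t)\<^sup>2) - \<omega>\<^sup>2 * (LINT t|leb l. (\<Sum>j\<le>n. d j * R j t)\<^sup>2)
      + \<omega> * y * (\<Sum>j\<le>n. d j * R j 0)\<^sup>2 \<le> \<omega> * y' * (d n)\<^sup>2) \<and>
    (\<forall>d :: nat \<Rightarrow> real. (\<forall>t\<in>{0..l}. (\<Sum>j\<le>n. d j * R j t) = 0) \<longrightarrow> (\<forall>j\<le>n. d j = 0))"
proof -
  have "0 < pi * \<epsilon>" using \<epsilon> by simp
  from nonresonant_phase[OF this \<omega> l, of y] obtain a and n :: nat where
    a: "arctan y < a" "a < pi / 2" "a < arctan y + pi * \<epsilon>"
    and n: "- (pi / 2) < \<omega> * l - a - n * pi" "\<omega> * l - a - n * pi < pi / 2" by metis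
  have a0: "- (pi / 2) < a" using a(1) arctan_lbound[of y] by linarith
  \<comment> \<open>The logarithmic derivative of F at l divided by \<omega>: the Robin strength
    handed on to the near vertex.\<close>
  define y' where "y' = - tan (\<omega> * l - a - n * pi)"
  define F where "F t = cos (\<omega> * t - a)" for t
  define F' where "F' t = - \<omega> * sin (\<omega> * t - a)" for t
  \<comment> \<open>Since the second derivative of F is -\<omega>^2 F, G is a primitive of the
    defect density. The defect of an arc is therefore a difference of boundary terms, which vanish
    at the zeros of F.\<close>
  define G where "G t = F t * F' t" for t
  define G' where "G' t = (F' t)\<^sup>2 - \<omega>\<^sup>2 * (F t)\<^sup>2" for t
  have F: "(F has_real_derivative F' t) (at t)" for t
    unfolding F_def F'_def by (auto intro!: derivative_eq_intros)
  have G: "(G has_real_derivative G' t) (at t)" for t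
    unfolding G_def[abs_def] G'_def F_def F'_def
    by (auto intro!: derivative_eq_intros simp: power2_eq_square algebra_simps)
  have contF': "continuous_on UNIV F'" and contG': "continuous_on UNIV G'"
    unfolding F'_def[abs_def] G'_def[abs_def] F_def by (intro continuous_intros)+
  \<comment> \<open>The breakpoints: the start, the n zeros of F inside the edge, and the end. For n
    = 0 there is a single arc over the whole edge.\<close>
  define b where "b j = (if j = 0 then 0 else if j \<le> n then (a - pi / 2 + real j * pi) / \<omega> else l)" for j :: nat
  have Fb: "F (b j) = 0" if "1 \<le> j" "j \<le> n" for j
  proof -
    have "F (b j) = cos (- (pi / 2) + real j * pi)" using that \<omega> by (simp add: F_def b_def)
    then show ?thesis by (simp add: cos_add cos_diff)
  qed
  have bl: "b j < l" if "j \<le> n" for j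
  proof (cases "j = 0")
    case False
    have "real j * pi \<le> real n * pi" using that by simp
    then have "a - pi / 2 + real j * pi < \<omega> * l" using n by linarith
    then show ?thesis using False that \<omega> by (simp add: b_def field_simps)
  qed (use l in \<open>simp add: b_def\<close>)
  have b0: "0 < b j" if "j \<noteq> 0" for j
  proof (cases "j \<le> n")
    case True
    have "pi \<le> real j * pi" using that by simp
    then have "0 < a - pi / 2 + real j * pi" using a0 by linarith
    then show ?thesis using that True \<omega> by (simp add: b_def)
  qed (use l in \<open>simp add: b_def\<close>)
  have bS: "b j < b (Suc j)" if "j \<le> n" for j
  proof (cases "Suc j \<le> n")
    case True
    show ?thesis
    proof (cases "j = 0")
      case True
      then show ?thesis using b0[of "Suc j"] by (simp add: b_def)
    next
      case False
      then show ?thesis using True \<omega> that by (simp add: b_def divide_strict_right_mono)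
    qed
  qed (use bl[OF that] in \<open>simp add: b_def[of "Suc j"]\<close>)
  have bmono: "b i \<le> b j" if "i \<le> j" "j \<le> Suc n" for i j
    using that
  proof (induction j rule: dec_induct)
    case (step k)
    then show ?case using bS[of k] by simp
  qed simp
  have bnl: "b (Suc n) = l" by (simp add: b_def)
  have Fl: "F l \<noteq> 0"
  proof -
    have "cos (\<omega> * l - a - n * pi) > 0" using n by (intro cos_gt_zero_pi) auto
    moreover have "cos (\<omega> * l - a - n * pi) = F l * cos (n * pi)" by (simp add: cos_diff F_def)
    ultimately show ?thesis by auto
  qed
  have y': "F' l / F l = \<omega> * y'"
  proof -
    have "tan (\<omega> * l - a - n * pi) = tan (\<omega> * l - a)"
    proof -
      have "sin (\<omega> * l - a - n * pi) = sin (\<omega> * l - a) * cos (n * pi)"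
        "cos (\<omega> * l - a - n * pi) = cos (\<omega> * l - a) * cos (n * pi)"
        by (simp_all add: sin_diff cos_diff)
      then show ?thesis by (simp add: tan_def)
    qed
    then show ?thesis by (simp add: y'_def F_def F'_def tan_def)
  qed
  define c where "c j = (if j = n then 1 / F l else 1)" for j
  define R where "R j t = c j * F (max (b j) (min (b (Suc j)) t))" for j t
  define R' where "R' j t = c j * (indicator {b j..<b (Suc j)} t * F' t)" for j t
  have bj: "0 \<le> b j" "b j \<le> b (Suc j)" "b (Suc j) \<le> l" if "j \<le> n" for j
    using bS[OF that] b0[of j] bmono[of "Suc j" "Suc n"] that bnl by (auto simp: b_def)
  have R1: "abs_cont_deriv l (R j) (R' j)" "sq_int (leb l) (R' j)" if "j \<le> n" for j
    unfolding R_def R'_def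
    using acd_cmult[OF acd_clamp(1)[OF F contF' bj[OF that]]] sq_int_cmult[OF acd_clamp(2)[OF F contF' bj[OF that]]]
    by blast+
  have Rt: "R j t = (if b j \<le> t \<and> t \<le> b (Suc j) then c j * F t else 0)" if j: "j \<le> n" and t: "t \<in> {0..l}" for j t
  proof -
    have "F (b j) = 0" if "t < b j" using that t j Fb[of j] by (cases "j = 0") (auto simp: b_def)
    moreover have "F (b (Suc j)) = 0" if "b (Suc j) < t"
      using that t j Fb[of "Suc j"] bnl by (cases "j = n") auto
    ultimately show ?thesis using bS[OF j] by (auto simp: R_def max_def min_def)
  qed
  have Rl: "R j l = (if j = n then 1 else 0)" if j: "j \<le> n" for j
  proof (cases "j = n")
    case True
    then show ?thesis using Rt[OF j, of l] bl[of n] bnl Fl l by (simp add: c_def)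
  next
    case False
    then have "b (Suc j) < l" using bl[of "Suc j"] j by simp
    then show ?thesis using Rt[OF j, of l] False l by simp
  qed
  have disjR: "R i t * R j t = 0" if "i \<noteq> j" "i \<le> n" "j \<le> n" "t \<in> {0..l}" for i j t
  proof -
    have *: "R i t * R j t = 0" if "i < j" "j \<le> n" "t \<in> {0..l}" for i j
    proof (cases "t = b j")
      case True
      then have "R j t = 0" using that Fb[of j] Rt[of j t] by simp
      then show ?thesis by simp
    next
      case False
      have "b (Suc i) \<le> b j" using bmono[of "Suc i" j] that by simp
      then have "\<not> (t \<le> b (Suc i) \<and> b j \<le> t)" using False by auto
      then show ?thesis using Rt[of i t] Rt[of j t] that by auto
    qed
    show ?thesis using *[of i j] *[of j i] that by (cases "i < j") (auto simp: mult.commute)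
  qed
  have disjR': "R' i t * R' j t = 0" if "i \<noteq> j" "i \<le> n" "j \<le> n" for i j t
  proof -
    have *: "R' i t * R' j t = 0" if "i < j" "j \<le> n" for i j
      using bmono[of "Suc i" j] that by (auto simp: R'_def indicator_def)
    show ?thesis using *[of i j] *[of j i] that by (cases "i < j") (auto simp: mult.commute)
  qed
  have Ri: "integrable (leb l) (\<lambda>t. (R j t)\<^sup>2)" if "j \<le> n" for j
    by (intro integrable_leb_continuous continuous_intros acd_continuous[OF R1(1)[OF that]])
  have R'i: "integrable (leb l) (\<lambda>t. (R' j t)\<^sup>2)" if "j \<le> n" for j
    using R1(2)[OF that] by (simp add: sq_int_def)
  have energy: "(LINT t|leb l. (R' j t)\<^sup>2) - \<omega>\<^sup>2 * (LINT t|leb l. (R j t)\<^sup>2) = (c j)\<^sup>2 * (G (b (Suc j)) - G (b j))"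
    if j: "j \<le> n" for j
  proof -
    have "(LINT t|leb l. (R' j t)\<^sup>2) - \<omega>\<^sup>2 * (LINT t|leb l. (R j t)\<^sup>2) = (LINT t|leb l. (R' j t)\<^sup>2 - \<omega>\<^sup>2 * (R j t)\<^sup>2)"
      using Ri[OF j] R'i[OF j] by simp
    also have "\<dots> = (LINT t|leb l. (c j)\<^sup>2 * (indicator {b j..<b (Suc j)} t * G' t))"
    proof (rule integral_cong_AE)
      show "AE t in leb l. (R' j t)\<^sup>2 - \<omega>\<^sup>2 * (R j t)\<^sup>2 = (c j)\<^sup>2 * (indicator {b j..<b (Suc j)} t * G' t)"
        using AE_leb_neq[of "b (Suc j)" l] AE_space
      proof eventually_elim
        case (elim t)
        then have "R j t = (if t \<in> {b j..<b (Suc j)} then c j * F t else 0)" using Rt[OF j, of t] by auto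
        then show ?case by (auto simp: R'_def G'_def power_mult_distrib algebra_simps)
      qed
      show "(\<lambda>t. (c j)\<^sup>2 * (indicat_real {b j..<b (Suc j)} t * G' t)) \<in> borel_measurable (leb l)"
        using integral_leb_FTC(1)[OF G contG' bj[OF j]] by auto
    qed (use Ri[OF j] R'i[OF j] in auto)
    also have "\<dots> = (c j)\<^sup>2 * (G (b (Suc j)) - G (b j))"
      using integral_leb_FTC(2)[OF G contG' bj[OF j]] by simp
    finally show ?thesis .
  qed
  have Gb: "G (b j) = 0" if "1 \<le> j" "j \<le> n" for j using Fb[OF that] by (simp add: G_def)
  \<comment> \<open>Here the increase of \<open>arctan y\<close> to a works in the right direction:
    the first arc starts with logarithmic derivative \<open>\<omega> * tan a\<close>, which exceeds
    \<open>\<omega> * y\<close>.\<close>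
  have y0: "\<omega> * y * (F 0)\<^sup>2 \<le> G 0"
  proof -
    have "cos a > 0" using a a0 by (intro cos_gt_zero_pi) auto
    moreover have "y < tan a"
      using a(1,2) arctan_lbound[of y] tan_arctan[of y] tan_monotone[of "arctan y" a] by simp
    ultimately have "y * (cos a)\<^sup>2 \<le> sin a * cos a" by (simp add: tan_def power2_eq_square field_simps)
    then have "\<omega> * (y * (cos a)\<^sup>2) \<le> \<omega> * (sin a * cos a)" using \<omega> by simp
    then show ?thesis by (simp add: F_def G_def F'_def algebra_simps)
  qed
  show ?thesis
  proof (rule exI[of _ n], rule exI[of _ y'], rule exI[of _ R], rule exI[of _ R'], intro conjI allI impI)
    have "arctan y' = - (\<omega> * l - a - n * pi)"
      unfolding y'_def using n by (simp add: arctan_minus arctan_tan)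
    then have "phase_weight y' = - 1 / 2 - a / pi + l * \<omega> / pi - n"
      by (simp add: phase_weight_def diff_divide_distrib add_divide_distrib mult.commute)
    moreover have "a / pi \<le> arctan y / pi + \<epsilon>" using a(3) by (simp add: field_simps)
    ultimately show "phase_weight y + l * \<omega> / pi - n - \<epsilon> \<le> phase_weight y'" by (simp add: phase_weight_def)
  next
    fix j assume "j \<le> n"
    then show "abs_cont_deriv l (R j) (R' j)" "sq_int (leb l) (R' j)" "R j l = (if j = n then 1 else 0)"
      using R1 Rl by blast+
  next
    fix d :: "nat \<Rightarrow> real"
    have "(LINT t|leb l. (\<Sum>j\<le>n. d j * R' j t)\<^sup>2) = (LINT t|leb l. (\<Sum>j\<le>n. (d j)\<^sup>2 * (R' j t)\<^sup>2))"
    proof (rule Bochner_Integration.integral_cong[OF refl])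
      fix t
      have "(\<Sum>j\<le>n. d j * R' j t)\<^sup>2 = (\<Sum>j\<le>n. (d j * R' j t)\<^sup>2)"
        by (rule sum_square_disjoint) (use disjR'[of _ _ t] in auto)
      then show "(\<Sum>j\<le>n. d j * R' j t)\<^sup>2 = (\<Sum>j\<le>n. (d j)\<^sup>2 * (R' j t)\<^sup>2)" by (simp add: power_mult_distrib)
    qed
    also have "\<dots> = (\<Sum>j\<le>n. (d j)\<^sup>2 * (LINT t|leb l. (R' j t)\<^sup>2))"
      using R'i by simp
    finally have 1: "(LINT t|leb l. (\<Sum>j\<le>n. d j * R' j t)\<^sup>2) = (\<Sum>j\<le>n. (d j)\<^sup>2 * (LINT t|leb l. (R' j t)\<^sup>2))" .
    have sqR: "(\<Sum>j\<le>n. d j * R j t)\<^sup>2 = (\<Sum>j\<le>n. (d j)\<^sup>2 * (R j t)\<^sup>2)" if "t \<in> {0..l}" for t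
    proof -
      have "(\<Sum>j\<le>n. d j * R j t)\<^sup>2 = (\<Sum>j\<le>n. (d j * R j t)\<^sup>2)"
        by (rule sum_square_disjoint) (use disjR[OF _ _ _ that] in auto)
      then show ?thesis by (simp add: power_mult_distrib)
    qed
    have "(LINT t|leb l. (\<Sum>j\<le>n. d j * R j t)\<^sup>2) = (LINT t|leb l. (\<Sum>j\<le>n. (d j)\<^sup>2 * (R j t)\<^sup>2))"
      by (rule Bochner_Integration.integral_cong) (auto simp: sqR)
    also have "\<dots> = (\<Sum>j\<le>n. (d j)\<^sup>2 * (LINT t|leb l. (R j t)\<^sup>2))"
      using Ri by simp
    finally have 2: "(LINT t|leb l. (\<Sum>j\<le>n. d j * R j t)\<^sup>2) = (\<Sum>j\<le>n. (d j)\<^sup>2 * (LINT t|leb l. (R j t)\<^sup>2))" .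
    have "(LINT t|leb l. (\<Sum>j\<le>n. d j * R' j t)\<^sup>2) - \<omega>\<^sup>2 * (LINT t|leb l. (\<Sum>j\<le>n. d j * R j t)\<^sup>2)
        + \<omega> * y * (\<Sum>j\<le>n. d j * R j 0)\<^sup>2
      = (\<Sum>j\<le>n. (d j)\<^sup>2 * ((LINT t|leb l. (R' j t)\<^sup>2) - \<omega>\<^sup>2 * (LINT t|leb l. (R j t)\<^sup>2) + \<omega> * y * (R j 0)\<^sup>2))"
      using l by (simp add: 1 2 sqR sum_distrib_left sum.distrib[symmetric] sum_subtractf[symmetric] algebra_simps)
    also have "\<dots> = (\<Sum>j\<le>n. (d j)\<^sup>2 * ((c j)\<^sup>2 * (G (b (Suc j)) - G (b j)) + \<omega> * y * (R j 0)\<^sup>2))"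
      by (intro sum.cong refl) (simp add: energy)
    also have "\<dots> \<le> (\<Sum>j\<le>n. if j = n then \<omega> * y' * (d n)\<^sup>2 else 0)"
    proof (rule sum_mono)
      fix j assume "j \<in> {..n}"
      then have j: "j \<le> n" by simp
      have "\<omega> * y * (R j 0)\<^sup>2 \<le> (c j)\<^sup>2 * G (b j)"
      proof (cases "j = 0")
        case True
        have "R 0 0 = c 0 * F 0" using Rt[of 0 0] l bj(1)[of "Suc 0"] bS[of 0] by (auto simp: b_def[of 0])
        then have "\<omega> * y * (R 0 0)\<^sup>2 = (c 0)\<^sup>2 * (\<omega> * y * (F 0)\<^sup>2)" by (simp add: power_mult_distrib)
        also have "\<dots> \<le> (c 0)\<^sup>2 * G 0" by (rule mult_left_mono[OF y0]) simp
        finally show ?thesis using True by (simp add: b_def)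
      next
        case False
        then have "R j 0 = 0" using Rt[OF j, of 0] l b0[of j] by auto
        then show ?thesis using Gb[of j] j False by simp
      qed
      then have "(c j)\<^sup>2 * (G (b (Suc j)) - G (b j)) + \<omega> * y * (R j 0)\<^sup>2 \<le> (c j)\<^sup>2 * G (b (Suc j))"
        by (simp add: algebra_simps)
      then have "(d j)\<^sup>2 * ((c j)\<^sup>2 * (G (b (Suc j)) - G (b j)) + \<omega> * y * (R j 0)\<^sup>2) \<le> (d j)\<^sup>2 * ((c j)\<^sup>2 * G (b (Suc j)))"
        by (rule mult_left_mono) simp
      also have "\<dots> = (if j = n then \<omega> * y' * (d n)\<^sup>2 else 0)"
      proof (cases "j = n")
        case True
        have "(c n)\<^sup>2 * G l = F' l / F l" using Fl by (simp add: c_def G_def power2_eq_square)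
        then show ?thesis using True y' bnl by simp
      next
        case False
        then show ?thesis using Gb[of "Suc j"] j by simp
      qed
      finally show "(d j)\<^sup>2 * ((c j)\<^sup>2 * (G (b (Suc j)) - G (b j)) + \<omega> * y * (R j 0)\<^sup>2)
        \<le> (if j = n then \<omega> * y' * (d n)\<^sup>2 else 0)" .
    qed
    finally show "(LINT t|leb l. (\<Sum>j\<le>n. d j * R' j t)\<^sup>2) - \<omega>\<^sup>2 * (LINT t|leb l. (\<Sum>j\<le>n. d j * R j t)\<^sup>2)
        + \<omega> * y * (\<Sum>j\<le>n. d j * R j 0)\<^sup>2 \<le> \<omega> * y' * (d n)\<^sup>2" by simp
  next
    fix d :: "nat \<Rightarrow> real" and j
    assume z: "\<forall>t\<in>{0..l}. (\<Sum>j\<le>n. d j * R j t) = 0" and j: "j \<le> n"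
    \<comment> \<open>At such a point all other arcs vanish, which isolates the coefficient d j. A
      sinusoid that is zero on an interval would have zero derivative there too, against sin^2 +
      cos^2 = 1.\<close>
    have "\<exists>t. b j < t \<and> t < b (Suc j) \<and> F t \<noteq> 0"
    proof (rule ccontr)
      assume "\<not> ?thesis"
      then have F0: "F t = 0" if "b j < t" "t < b (Suc j)" for t using that by blast
      define t where "t = (b j + b (Suc j)) / 2"
      have t: "b j < t" "t < b (Suc j)" using bS[OF j] by (auto simp: t_def)
      have "eventually (\<lambda>s. s \<in> {b j<..<b (Suc j)}) (nhds t)"
        using t by (intro eventually_nhds_in_open) auto
      then have "eventually (\<lambda>s. F s = 0) (nhds t)" by eventually_elim (auto intro: F0)
      then have "(F has_real_derivative 0) (at t) \<longleftrightarrow> ((\<lambda>_. 0) has_real_derivative 0) (at t)"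
        by (intro DERIV_cong_ev) auto
      then have "(F has_real_derivative 0) (at t)" by simp
      then have "F' t = 0" using F DERIV_unique by blast
      then have "sin (\<omega> * t - a) = 0" using \<omega> by (simp add: F'_def)
      moreover have "cos (\<omega> * t - a) = 0" using F0[OF t] by (simp add: F_def)
      ultimately show False using sin_cos_squared_add[of "\<omega> * t - a"] by simp
    qed
    then obtain t where t: "b j < t" "t < b (Suc j)" "F t \<noteq> 0" by blast
    have tl: "t \<in> {0..l}" using t bj[OF j] by auto
    have Rj: "R j t \<noteq> 0" using Rt[OF j tl] t Fl by (simp add: c_def)
    have "(\<Sum>i\<le>n. d i * R i t) = (\<Sum>i\<le>n. if i = j then d j * R j t else 0)"
    proof (rule sum.cong[OF refl])
      fix i assume "i \<in> {..n}"
      then show "d i * R i t = (if i = j then d j * R j t else 0)"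
        using disjR[of i j t] j tl Rj by auto
    qed
    then show "d j = 0" using z tl j Rj by simp
  qed
qed

text \<open>The edge is attached at \<open>l - far\<close>, and the Robin condition sits at
  \<open>far\<close>. Reflecting the interval lets an edge be used in either orientation.\<close>

lemma edge_profile:
  fixes \<omega> l y \<epsilon> far :: real
  assumes \<omega>: "0 < \<omega>" and l: "0 < l" and \<epsilon>: "0 < \<epsilon>" and far: "far = 0 \<or> far = l"
  shows "\<exists>(n::nat) y' (R :: nat \<Rightarrow> real \<Rightarrow> real) (R' :: nat \<Rightarrow> real \<Rightarrow> real). phase_weight y + l * \<omega> / pi - n - \<epsilon> \<le> phase_weight y' \<and>
    (\<forall>j\<le>n. abs_cont_deriv l (R j) (R' j) \<and> sq_int (leb l) (R' j) \<and> R j (l - far) = (if j = n then 1 else 0)) \<and>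
    (\<forall>d :: nat \<Rightarrow> real. (LINT t|leb l. (\<Sum>j\<le>n. d j * R' j t)\<^sup>2) - \<omega>\<^sup>2 * (LINT t|leb l. (\<Sum>j\<le>n. d j * R j t)\<^sup>2)
      + \<omega> * y * (\<Sum>j\<le>n. d j * R j far)\<^sup>2 \<le> \<omega> * y' * (d n)\<^sup>2) \<and>
    (\<forall>d :: nat \<Rightarrow> real. (\<forall>t\<in>{0..l}. (\<Sum>j\<le>n. d j * R j t) = 0) \<longrightarrow> (\<forall>j\<le>n. d j = 0))"
proof (cases "far = 0")
  case True
  then show ?thesis using edge_profile_near_end[OF \<omega> l \<epsilon>, of y] by simp
next
  case False
  then have fl: "far = l" using far by simp
  from edge_profile_near_end[OF \<omega> l \<epsilon>, of y] obtain n :: nat and y' and R R' :: "nat \<Rightarrow> real \<Rightarrow> real" where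
    1: "phase_weight y + l * \<omega> / pi - n - \<epsilon> \<le> phase_weight y'" and
    2: "\<forall>j\<le>n. abs_cont_deriv l (R j) (R' j) \<and> sq_int (leb l) (R' j) \<and> R j l = (if j = n then 1 else 0)" and
    3: "\<forall>d :: nat \<Rightarrow> real. (LINT t|leb l. (\<Sum>j\<le>n. d j * R' j t)\<^sup>2) - \<omega>\<^sup>2 * (LINT t|leb l. (\<Sum>j\<le>n. d j * R j t)\<^sup>2)
      + \<omega> * y * (\<Sum>j\<le>n. d j * R j 0)\<^sup>2 \<le> \<omega> * y' * (d n)\<^sup>2" and
    4: "\<forall>d :: nat \<Rightarrow> real. (\<forall>t\<in>{0..l}. (\<Sum>j\<le>n. d j * R j t) = 0) \<longrightarrow> (\<forall>j\<le>n. d j = 0)"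
    by (elim exE conjE)
  show ?thesis
  proof (rule exI[of _ n], rule exI[of _ y'], rule exI[of _ "\<lambda>j t. R j (l - t)"],
      rule exI[of _ "\<lambda>j t. - R' j (l - t)"], intro conjI allI impI)
    fix j assume "j \<le> n"
    then have j: "abs_cont_deriv l (R j) (R' j)" "sq_int (leb l) (R' j)" "R j l = (if j = n then 1 else 0)"
      using 2 by blast+
    show "abs_cont_deriv l (\<lambda>t. R j (l - t)) (\<lambda>t. - R' j (l - t))" by (rule acd_reflect[OF j(1)])
    show "sq_int (leb l) (\<lambda>t. - R' j (l - t))"
      using sq_int_cmult[OF sq_int_reflect[OF j(2) acd_integrable[OF j(1)]], of "-1"] by simp
    show "R j (l - (l - far)) = (if j = n then 1 else 0)" using j(3) fl by simp
  next
    fix d :: "nat \<Rightarrow> real"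
    have "(LINT t|leb l. (\<Sum>j\<le>n. d j * - R' j (l - t))\<^sup>2) = (LINT t|leb l. (\<Sum>j\<le>n. d j * R' j t)\<^sup>2)"
      using leb_reflect(2)[of l "\<lambda>t. (\<Sum>j\<le>n. d j * R' j t)\<^sup>2"] by (simp add: sum_negf)
    moreover have "(LINT t|leb l. (\<Sum>j\<le>n. d j * R j (l - t))\<^sup>2) = (LINT t|leb l. (\<Sum>j\<le>n. d j * R j t)\<^sup>2)"
      using leb_reflect(2)[of l "\<lambda>t. (\<Sum>j\<le>n. d j * R j t)\<^sup>2"] by simp
    ultimately show "(LINT t|leb l. (\<Sum>j\<le>n. d j * - R' j (l - t))\<^sup>2) - \<omega>\<^sup>2 * (LINT t|leb l. (\<Sum>j\<le>n. d j * R j (l - t))\<^sup>2)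
      + \<omega> * y * (\<Sum>j\<le>n. d j * R j (l - far))\<^sup>2 \<le> \<omega> * y' * (d n)\<^sup>2"
      using spec[OF 3, of d] fl by simp
  next
    fix d :: "nat \<Rightarrow> real" and j
    assume z: "\<forall>t\<in>{0..l}. (\<Sum>j\<le>n. d j * R j (l - t)) = 0" and j: "j \<le> n"
    have "(\<Sum>j\<le>n. d j * R j t) = 0" if "t \<in> {0..l}" for t
      using bspec[OF z, of "l - t"] that by simp
    then show "d j = 0" using 4 j by blast
  qed (rule 1)
qed

text \<open>A k-dimensional space on which b is nonpositive, given by a basis. Independence is
  measured by N and not by equality to zero, because a triple also has components away from the
  graph at hand, which must not count.\<close>

definition neg_family :: "'a::real_vector set \<Rightarrow> ('a \<Rightarrow> real) \<Rightarrow> ('a \<Rightarrow> bool) \<Rightarrow> nat \<Rightarrow> (nat \<Rightarrow> 'a) \<Rightarrow> bool"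
  where "neg_family X b N k \<phi> \<longleftrightarrow> (\<forall>i<k. \<phi> i \<in> X) \<and> (\<forall>c. b (\<Sum>i<k. c i *\<^sub>R \<phi> i) \<le> 0) \<and>
    (\<forall>c. N (\<Sum>i<k. c i *\<^sub>R \<phi> i) \<longrightarrow> (\<forall>i<k. c i = 0))"

lemma neg_familyD:
  assumes "neg_family X b N k \<phi>"
  shows "i < k \<Longrightarrow> \<phi> i \<in> X" "b (\<Sum>i<k. c i *\<^sub>R \<phi> i) \<le> 0"
    "N (\<Sum>i<k. c i *\<^sub>R \<phi> i) \<Longrightarrow> i < k \<Longrightarrow> c i = 0"
  using assms unfolding neg_family_def by simp_all

lemma neg_family_mono:
  assumes f: "neg_family X b N K \<phi>" and k: "k \<le> K"
  shows "neg_family X b N k \<phi>"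
proof -
  have e: "(\<Sum>i<k. c i *\<^sub>R \<phi> i) = (\<Sum>i<K. (if i < k then c i else 0) *\<^sub>R \<phi> i)" for c
    using k by (intro sum.mono_neutral_cong_left) auto
  show ?thesis
    unfolding neg_family_def
  proof (intro conjI allI impI)
    show "\<phi> i \<in> X" if "i < k" for i using f that k by (auto simp: neg_family_def)
    fix c
    show "b (\<Sum>i<k. c i *\<^sub>R \<phi> i) \<le> 0" unfolding e by (rule neg_familyD(2)[OF f])
    fix i assume N: "N (\<Sum>i<k. c i *\<^sub>R \<phi> i)" and i: "i < k"
    have "(if i < k then c i else 0) = 0"
      by (rule neg_familyD(3)[OF f, of "\<lambda>i. if i < k then c i else 0"]) (use N e i k in simp_all)
    then show "c i = 0" using i by simp
  qed
qed

lemma neg_family_weaken: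
  assumes f: "neg_family X b N k \<phi>" and X: "subspace X"
    and w: "\<And>x. x \<in> X \<Longrightarrow> x \<in> Y" "\<And>x. x \<in> X \<Longrightarrow> b' x \<le> b x" "\<And>x. x \<in> X \<Longrightarrow> N' x \<Longrightarrow> N x"
  shows "neg_family Y b' N' k \<phi>"
proof -
  have x: "(\<Sum>i<k. c i *\<^sub>R \<phi> i) \<in> X" for c
    using f X by (auto simp: neg_family_def intro!: subspace_sum subspace_scale)
  show ?thesis
    unfolding neg_family_def
  proof (intro conjI allI impI)
    show "\<phi> i \<in> Y" if "i < k" for i using f that w(1) by (auto simp: neg_family_def)
    fix c
    have "b (\<Sum>i<k. c i *\<^sub>R \<phi> i) \<le> 0" by (rule neg_familyD(2)[OF f])
    then show "b' (\<Sum>i<k. c i *\<^sub>R \<phi> i) \<le> 0" using w(2)[OF x[of c]] by linarith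
    fix i assume "N' (\<Sum>i<k. c i *\<^sub>R \<phi> i)" "i < k"
    then show "c i = 0" using w(3)[OF x[of c]] neg_familyD(3)[OF f] by blast
  qed
qed

text \<open>The kernel of a linear functional loses at most one dimension: if some basis vector has
  a nonzero value, a suitable multiple of it is subtracted from the others; if none has, one vector
  is dropped.\<close>

lemma neg_family_constraint:
  assumes f: "neg_family X b N (Suc k) \<phi>" and X: "subspace X" and l: "linear l"
  shows "\<exists>\<psi>. neg_family {x \<in> X. l x = (0::real)} b N k \<psi>"
proof (cases "\<forall>i<Suc k. l (\<phi> i) = 0")
  case True
  have "neg_family X b N k \<phi>" by (rule neg_family_mono[OF f]) simp
  then have "neg_family {x \<in> X. l x = 0} b N k \<phi>" using True unfolding neg_family_def by auto
  then show ?thesis by blast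
next
  case False
  then obtain p where p: "p < Suc k" "l (\<phi> p) \<noteq> 0" by blast
  define \<sigma> where "\<sigma> i = (if i < p then i else Suc i)" for i
  define \<tau> where "\<tau> j = (if j < p then j else j - 1)" for j
  define r where "r i = l (\<phi> (\<sigma> i)) / l (\<phi> p)" for i
  define \<psi> where "\<psi> i = \<phi> (\<sigma> i) - r i *\<^sub>R \<phi> p" for i
  have \<sigma>: "\<sigma> i < Suc k" "\<sigma> i \<noteq> p" "\<tau> (\<sigma> i) = i" if "i < k" for i
    using that by (auto simp: \<sigma>_def \<tau>_def)
  have bij: "bij_betw \<sigma> {..<k} ({..<Suc k} - {p})"
    by (rule bij_betwI[where g = \<tau>]) (use p in \<open>auto simp: \<sigma>_def \<tau>_def split: if_splits\<close>)
  \<comment> \<open>The same combination in the old basis; all subtracted multiples are collected at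
    p.\<close>
  define c' where "c' c j = (if j = p then - (\<Sum>i<k. c i * r i) else c (\<tau> j))" for c :: "nat \<Rightarrow> real" and j
  have e: "(\<Sum>i<k. c i *\<^sub>R \<psi> i) = (\<Sum>j<Suc k. c' c j *\<^sub>R \<phi> j)" for c
  proof -
    have "(\<Sum>j<Suc k. c' c j *\<^sub>R \<phi> j) = c' c p *\<^sub>R \<phi> p + (\<Sum>j\<in>{..<Suc k} - {p}. c' c j *\<^sub>R \<phi> j)"
      using p by (intro sum.remove) auto
    also have "(\<Sum>j\<in>{..<Suc k} - {p}. c' c j *\<^sub>R \<phi> j) = (\<Sum>i<k. c' c (\<sigma> i) *\<^sub>R \<phi> (\<sigma> i))"
      by (rule sum.reindex_bij_betw[OF bij, symmetric])
    also have "\<dots> = (\<Sum>i<k. c i *\<^sub>R \<phi> (\<sigma> i))"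
      by (rule sum.cong) (use \<sigma> in \<open>auto simp: c'_def\<close>)
    finally show ?thesis
      by (simp add: \<psi>_def c'_def scaleR_diff_right sum_subtractf scaleR_sum_left del: sum.lessThan_Suc)
  qed
  have "neg_family {x \<in> X. l x = 0} b N k \<psi>"
    unfolding neg_family_def
  proof (intro conjI allI impI)
    fix i assume i: "i < k"
    have "\<phi> (\<sigma> i) \<in> X" "\<phi> p \<in> X" using f \<sigma>(1)[OF i] p by (auto simp: neg_family_def)
    then have "\<psi> i \<in> X" unfolding \<psi>_def by (intro subspace_diff subspace_scale X)
    moreover have "l (\<psi> i) = 0" using p by (simp add: \<psi>_def r_def linear_diff[OF l] linear_cmul[OF l])
    ultimately show "\<psi> i \<in> {x \<in> X. l x = 0}" by simp
  next
    fix c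
    show "b (\<Sum>i<k. c i *\<^sub>R \<psi> i) \<le> 0" unfolding e by (rule neg_familyD(2)[OF f])
    fix i assume N: "N (\<Sum>i<k. c i *\<^sub>R \<psi> i)" and i: "i < k"
    have "c' c (\<sigma> i) = 0"
      by (rule neg_familyD(3)[OF f N[unfolded e] \<sigma>(1)[OF i]])
    then show "c i = 0" using \<sigma>[OF i] by (simp add: c'_def)
  qed
  then show ?thesis by blast
qed

lemma sum_lessThan_add:
  fixes f :: "nat \<Rightarrow> 'a::comm_monoid_add"
  shows "(\<Sum>i<k + n. f i) = (\<Sum>i<k. f i) + (\<Sum>j<n. f (k + j))"
  by (induction n) (simp_all add: add.assoc)

abbreviation subgraph :: "('v, 'e) pre_metric_graph \<Rightarrow> 'v set \<Rightarrow> 'e set \<Rightarrow> ('v, 'e) pre_metric_graph"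
  where "subgraph \<Gamma> V E \<equiv> \<Gamma>\<lparr>verts := V, edges := E\<rparr>"

definition defect :: "('v, 'e) pre_metric_graph \<Rightarrow> real \<Rightarrow> ('v, 'e) graph_fun \<Rightarrow> real"
  where "defect \<Gamma> \<omega> x = dirichlet_form \<Gamma> x x - \<omega>\<^sup>2 * mass_form \<Gamma> x x"

text \<open>Vertex values are tested separately because the induction over edges ends in a single
  vertex without edges, where nothing else is left.\<close>

definition vanishes :: "('v, 'e) pre_metric_graph \<Rightarrow> ('v, 'e) graph_fun \<Rightarrow> bool"
  where "vanishes \<Gamma> x \<longleftrightarrow> (\<forall>v\<in>verts \<Gamma>. val x v = 0) \<and> (\<forall>e\<in>edges \<Gamma>. \<forall>t\<in>{0..len \<Gamma> e}. fn x e t = 0)"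

lemma defect_insert:
  assumes "finite E" "e \<notin> E"
  shows "defect (subgraph \<Gamma> V (insert e E)) \<omega> x = defect (subgraph \<Gamma> V' E) \<omega> x
    + ((LINT t|leb (len \<Gamma> e). (der x e t)\<^sup>2) - \<omega>\<^sup>2 * (LINT t|leb (len \<Gamma> e). (fn x e t)\<^sup>2))"
  using assms by (simp add: defect_def dirichlet_form_def potential_form_def power2_eq_square algebra_simps)

lemma defect_cong:
  assumes "\<And>e t. e \<in> edges \<Gamma> \<Longrightarrow> fn x e t = fn y e t" "\<And>e t. e \<in> edges \<Gamma> \<Longrightarrow> der x e t = der y e t"
  shows "defect \<Gamma> \<omega> x = defect \<Gamma> \<omega> y"
  using assms by (simp add: defect_def dirichlet_form_def potential_form_def)

text \<open>Functions on \<open>E\<close> extended over a new edge \<open>e\<close> attached at \<open>w\<close>; at the far end nothing is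
  required, except that, if \<open>L\<close> holds, the value there is recorded at the vertex \<open>v\<close>.\<close>

definition pre_extension ::
    "('v, 'e) pre_metric_graph \<Rightarrow> 'v set \<Rightarrow> 'e set \<Rightarrow> 'e \<Rightarrow> real \<Rightarrow> 'v \<Rightarrow> bool \<Rightarrow> 'v \<Rightarrow> ('v, 'e) graph_fun set"
  where "pre_extension \<Gamma> V E e far w L v = {x \<in> sobolev (subgraph \<Gamma> V E).
    abs_cont_deriv (len \<Gamma> e) (fn x e) (der x e) \<and> sq_int (leb (len \<Gamma> e)) (der x e) \<and>
    fn x e (len \<Gamma> e - far) = val x w \<and> (L \<longrightarrow> fn x e far = val x v)}"

lemma subspace_pre_extension: "subspace (pre_extension \<Gamma> V E e far w L v)"
proof -
  have "fn (x + y) e = (\<lambda>t. fn x e t + fn y e t)" "der (x + y) e = (\<lambda>t. der x e t + der y e t)"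
    "fn (c *\<^sub>R x) e = (\<lambda>t. c * fn x e t)" "der (c *\<^sub>R x) e = (\<lambda>t. c * der x e t)" for x y :: "('a, 'b) graph_fun" and c
    by auto
  moreover have "fn 0 e = (\<lambda>t. 0)" "der (0 :: ('a, 'b) graph_fun) e = (\<lambda>t. 0)" by auto
  moreover have "sq_int (leb (len \<Gamma> e)) (\<lambda>t. 0)" by (simp add: sq_int_def)
  ultimately show ?thesis
    using subspace_sobolev[of "subgraph \<Gamma> V E"] acd_zero
    unfolding subspace_def pre_extension_def
    by (auto simp: acd_add acd_cmult sq_int_add sq_int_cmult)
qed

text \<open>The numbers n and y' are fixed before any family appears, since the smaller graph has to
  be given y' as its strength at w. A function is continued by its value at w times the last arc,
  while the other n arcs vanish at w and are new directions. Q collects the remaining vertex terms;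
  L distinguishes a new leaf v at the far end from an end that is left loose.\<close>

lemma extend_over_edge:
  fixes \<Gamma> :: "('v, 'e) pre_metric_graph"
  assumes \<omega>: "0 < \<omega>" and l: "0 < len \<Gamma> e" and \<epsilon>: "0 < \<epsilon>" and far: "far = 0 \<or> far = len \<Gamma> e"
    and E: "finite E" "e \<notin> E"
  shows "\<exists>(n::nat) y'. phase_weight y + len \<Gamma> e * \<omega> / pi - n - \<epsilon> \<le> phase_weight y' \<and>
    (\<forall>V w L v (Q :: ('v \<Rightarrow> real) \<Rightarrow> real) k \<phi>.
      neg_family (sobolev (subgraph \<Gamma> V E)) (\<lambda>x. defect (subgraph \<Gamma> V E) \<omega> x + Q (val x) + \<omega> * y' * (val x w)\<^sup>2)
        (vanishes (subgraph \<Gamma> V E)) k \<phi> \<longrightarrow>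
      (\<forall>f g. (\<forall>u\<in>V. f u = g u) \<longrightarrow> Q f = Q g) \<longrightarrow> w \<in> V \<longrightarrow>
      (\<forall>f\<in>E. src \<Gamma> f \<in> V \<and> tgt \<Gamma> f \<in> V) \<longrightarrow> (L \<longrightarrow> v \<notin> V) \<longrightarrow>
      (\<exists>\<psi>. neg_family (pre_extension \<Gamma> V E e far w L v)
        (\<lambda>x. defect (subgraph \<Gamma> V (insert e E)) \<omega> x + Q (val x) + \<omega> * y * (fn x e far)\<^sup>2)
        (vanishes (subgraph \<Gamma> V (insert e E))) (k + n) \<psi>))"
proof -
  let ?l = "len \<Gamma> e"
  from edge_profile[OF \<omega> l \<epsilon> far, of y] obtain n :: nat and y' and R R' :: "nat \<Rightarrow> real \<Rightarrow> real" where
    1: "phase_weight y + ?l * \<omega> / pi - n - \<epsilon> \<le> phase_weight y'" and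
    2: "\<forall>j\<le>n. abs_cont_deriv ?l (R j) (R' j) \<and> sq_int (leb ?l) (R' j) \<and> R j (?l - far) = (if j = n then 1 else 0)" and
    3: "\<forall>d :: nat \<Rightarrow> real. (LINT t|leb ?l. (\<Sum>j\<le>n. d j * R' j t)\<^sup>2) - \<omega>\<^sup>2 * (LINT t|leb ?l. (\<Sum>j\<le>n. d j * R j t)\<^sup>2)
      + \<omega> * y * (\<Sum>j\<le>n. d j * R j far)\<^sup>2 \<le> \<omega> * y' * (d n)\<^sup>2" and
    4: "\<forall>d :: nat \<Rightarrow> real. (\<forall>t\<in>{0..?l}. (\<Sum>j\<le>n. d j * R j t) = 0) \<longrightarrow> (\<forall>j\<le>n. d j = 0)"
    by (elim exE conjE)
  show ?thesis
  proof (rule exI[of _ n], rule exI[of _ y'], intro conjI allI impI)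
    fix V :: "'v set" and w :: 'v and L :: bool and v :: 'v and Q :: "('v \<Rightarrow> real) \<Rightarrow> real" and k \<phi>
    assume fam: "neg_family (sobolev (subgraph \<Gamma> V E)) (\<lambda>x. defect (subgraph \<Gamma> V E) \<omega> x + Q (val x) + \<omega> * y' * (val x w)\<^sup>2)
        (vanishes (subgraph \<Gamma> V E)) k \<phi>"
      and Q: "\<forall>f g. (\<forall>u\<in>V. f u = g u) \<longrightarrow> Q f = Q g" and w: "w \<in> V"
      and ends: "\<forall>f\<in>E. src \<Gamma> f \<in> V \<and> tgt \<Gamma> f \<in> V" and L: "L \<longrightarrow> v \<notin> V"
    define bump :: "nat \<Rightarrow> ('v, 'e) graph_fun" where "bump j = ((\<lambda>u. if L \<and> u = v then R j far else 0),
      (\<lambda>e'. if e' = e then R j else (\<lambda>_. 0)), (\<lambda>e'. if e' = e then R' j else (\<lambda>_. 0)))" for j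
    define ext :: "('v, 'e) graph_fun \<Rightarrow> ('v, 'e) graph_fun" where
      "ext x = ((\<lambda>u. if L \<and> u = v then val x w * R n far else val x u),
      (\<lambda>e'. if e' = e then (\<lambda>t. val x w * R n t) else fn x e'),
      (\<lambda>e'. if e' = e then (\<lambda>t. val x w * R' n t) else der x e'))" for x
    define \<psi> where "\<psi> i = (if i < k then ext (\<phi> i) else bump (i - k))" for i
    define x1 where "x1 c = (\<Sum>i<k. c i *\<^sub>R \<phi> i)" for c
    define x where "x c = (\<Sum>i<k + n. c i *\<^sub>R \<psi> i)" for c
    \<comment> \<open>Coefficients of the arcs on the new edge: the added ones, and last the value
      at w, which is tied to the old part.\<close>
    define D where "D c j = (if j < n then c (k + j) else val (x1 c) w)" for c j
    have split: "x c = (\<Sum>i<k. c i *\<^sub>R ext (\<phi> i)) + (\<Sum>j<n. c (k + j) *\<^sub>R bump j)" for c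
      unfolding x_def sum_lessThan_add by (simp add: \<psi>_def)
    have Dsum: "(\<Sum>j\<le>n. D c j * f j) = (\<Sum>j<n. c (k + j) * f j) + val (x1 c) w * f n" for c and f :: "nat \<Rightarrow> real"
    proof -
      have "(\<Sum>j\<le>n. D c j * f j) = (\<Sum>j<n. D c j * f j) + D c n * f n"
        by (simp add: lessThan_Suc_atMost[symmetric])
      then show ?thesis by (simp add: D_def)
    qed
    have valsum: "val (x1 c) w * r = (\<Sum>i<k. c i * (val (\<phi> i) w * r))" for c r
      by (simp add: x1_def graph_fun_sum sum_distrib_right mult.assoc)
    have fne: "fn (x c) e t = (\<Sum>j\<le>n. D c j * R j t)" for c t
      unfolding split Dsum valsum by (simp add: graph_fun_sum ext_def bump_def)
    have dere: "der (x c) e t = (\<Sum>j\<le>n. D c j * R' j t)" for c t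
      unfolding split Dsum valsum by (simp add: graph_fun_sum ext_def bump_def)
    have fno: "fn (x c) e' t = fn (x1 c) e' t" "der (x c) e' t = der (x1 c) e' t" if "e' \<noteq> e" for c e' t
      using that unfolding split x1_def by (simp_all add: graph_fun_sum ext_def bump_def)
    have valo: "val (x c) u = val (x1 c) u" if "u \<in> V" for c u
    proof -
      have "L \<Longrightarrow> u \<noteq> v" using that L by auto
      then show ?thesis unfolding split x1_def by (cases L) (simp_all add: graph_fun_sum ext_def bump_def)
    qed
    have "neg_family (pre_extension \<Gamma> V E e far w L v)
        (\<lambda>x. defect (subgraph \<Gamma> V (insert e E)) \<omega> x + Q (val x) + \<omega> * y * (fn x e far)\<^sup>2)
        (vanishes (subgraph \<Gamma> V (insert e E))) (k + n) \<psi>"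
      unfolding neg_family_def x_def[symmetric]
    proof (intro conjI allI impI)
      fix i assume i: "i < k + n"
      show "\<psi> i \<in> pre_extension \<Gamma> V E e far w L v"
      proof (cases "i < k")
        case True
        then have \<phi>: "\<phi> i \<in> sobolev (subgraph \<Gamma> V E)" using fam by (simp add: neg_family_def)
        have "ext (\<phi> i) \<in> sobolev (subgraph \<Gamma> V E)"
          unfolding sobolev_def mem_Collect_eq
        proof
          fix f assume "f \<in> edges (subgraph \<Gamma> V E)"
          then have f: "f \<in> E" "f \<noteq> e" "src \<Gamma> f \<in> V" "tgt \<Gamma> f \<in> V" using E(2) ends by auto
          then have "src \<Gamma> f \<noteq> v \<or> \<not> L" "tgt \<Gamma> f \<noteq> v \<or> \<not> L" using L by auto
          then show "abs_cont_deriv (len (subgraph \<Gamma> V E) f) (fn (ext (\<phi> i)) f) (der (ext (\<phi> i)) f) \<and>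
            sq_int (leb (len (subgraph \<Gamma> V E) f)) (der (ext (\<phi> i)) f) \<and>
            fn (ext (\<phi> i)) f 0 = val (ext (\<phi> i)) (src (subgraph \<Gamma> V E) f) \<and>
            fn (ext (\<phi> i)) f (len (subgraph \<Gamma> V E) f) = val (ext (\<phi> i)) (tgt (subgraph \<Gamma> V E) f)"
            using sobolevD[OF \<phi>, of f] f by (auto simp: ext_def)
        qed
        moreover have "val (ext (\<phi> i)) w = val (\<phi> i) w" using w L by (auto simp: ext_def)
        moreover have "abs_cont_deriv ?l (\<lambda>t. val (\<phi> i) w * R n t) (\<lambda>t. val (\<phi> i) w * R' n t)"
          "sq_int (leb ?l) (\<lambda>t. val (\<phi> i) w * R' n t)" "R n (?l - far) = 1"
          using acd_cmult[of ?l "R n" "R' n"] sq_int_cmult[of "leb ?l" "R' n"] spec[OF 2, of n] by simp_all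
        ultimately show ?thesis using True by (auto simp: pre_extension_def \<psi>_def ext_def)
      next
        case False
        then have j: "i - k < n" using i by simp
        have "bump (i - k) \<in> sobolev (subgraph \<Gamma> V E)"
          unfolding sobolev_def mem_Collect_eq
        proof
          fix f assume "f \<in> edges (subgraph \<Gamma> V E)"
          then have f: "f \<in> E" "f \<noteq> e" "src \<Gamma> f \<in> V" "tgt \<Gamma> f \<in> V" using E(2) ends by auto
          then have "src \<Gamma> f \<noteq> v \<or> \<not> L" "tgt \<Gamma> f \<noteq> v \<or> \<not> L" using L by auto
          then show "abs_cont_deriv (len (subgraph \<Gamma> V E) f) (fn (bump (i - k)) f) (der (bump (i - k)) f) \<and>
            sq_int (leb (len (subgraph \<Gamma> V E) f)) (der (bump (i - k)) f) \<and>
            fn (bump (i - k)) f 0 = val (bump (i - k)) (src (subgraph \<Gamma> V E) f) \<and>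
            fn (bump (i - k)) f (len (subgraph \<Gamma> V E) f) = val (bump (i - k)) (tgt (subgraph \<Gamma> V E) f)"
            using acd_zero f by (auto simp: bump_def sq_int_def)
        qed
        moreover have "val (bump (i - k)) w = 0" using w L by (auto simp: bump_def)
        moreover have "abs_cont_deriv ?l (R (i - k)) (R' (i - k))" "sq_int (leb ?l) (R' (i - k))" "R (i - k) (?l - far) = 0"
          using 2 j by auto
        ultimately show ?thesis using False by (auto simp: pre_extension_def \<psi>_def bump_def)
      qed
    next
      fix c
      have "defect (subgraph \<Gamma> V E) \<omega> (x c) = defect (subgraph \<Gamma> V E) \<omega> (x1 c)"
        by (rule defect_cong; rule fno) (use E(2) in auto)
      moreover have "Q (val (x c)) = Q (val (x1 c))" using Q valo by blast
      moreover have "D c n = val (x1 c) w" by (simp add: D_def)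
      moreover have "defect (subgraph \<Gamma> V E) \<omega> (x1 c) + Q (val (x1 c)) + \<omega> * y' * (val (x1 c) w)\<^sup>2 \<le> 0"
        unfolding x1_def by (rule neg_familyD(2)[OF fam])
      ultimately show "defect (subgraph \<Gamma> V (insert e E)) \<omega> (x c) + Q (val (x c)) + \<omega> * y * (fn (x c) e far)\<^sup>2 \<le> 0"
        using spec[OF 3, of "D c"] unfolding defect_insert[OF E, where \<Gamma> = \<Gamma> and V = V and V' = V] fne dere by simp
      fix i assume van: "vanishes (subgraph \<Gamma> V (insert e E)) (x c)" and i: "i < k + n"
      have "\<forall>t\<in>{0..?l}. (\<Sum>j\<le>n. D c j * R j t) = 0" using van unfolding fne[symmetric] by (simp add: vanishes_def)
      then have D0: "\<forall>j\<le>n. D c j = 0" using 4 by blast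
      have "vanishes (subgraph \<Gamma> V E) (x1 c)"
        unfolding vanishes_def
      proof (intro conjI ballI)
        fix u assume "u \<in> verts (subgraph \<Gamma> V E)"
        then show "val (x1 c) u = 0" using van valo[of u c] by (simp add: vanishes_def)
      next
        fix f t assume "f \<in> edges (subgraph \<Gamma> V E)" "t \<in> {0..len (subgraph \<Gamma> V E) f}"
        then show "fn (x1 c) f t = 0" using van fno(1)[of f c t] E(2) by (auto simp: vanishes_def)
      qed
      then have c0: "\<forall>i<k. c i = 0" unfolding x1_def using neg_familyD(3)[OF fam] by blast
      show "c i = 0"
      proof (cases "i < k")
        case False
        then have "i - k < n" using i by linarith
        then have "D c (i - k) = c i" using False by (simp add: D_def)
        moreover have "i - k \<le> n" using i by simp
        ultimately show ?thesis using D0 by metis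
      qed (use c0 in simp)
    qed
    then show "\<exists>\<psi>. neg_family (pre_extension \<Gamma> V E e far w L v)
        (\<lambda>x. defect (subgraph \<Gamma> V (insert e E)) \<omega> x + Q (val x) + \<omega> * y * (fn x e far)\<^sup>2)
        (vanishes (subgraph \<Gamma> V (insert e E))) (k + n) \<psi>" by blast
  qed (rule 1)
qed

section \<open>Trial functions on a graph with Robin conditions\<close>

definition joins :: "('v, 'e) pre_metric_graph \<Rightarrow> 'e \<Rightarrow> 'v \<Rightarrow> 'v \<Rightarrow> bool"
  where "joins G e u v \<longleftrightarrow> src G e = u \<and> tgt G e = v \<or> src G e = v \<and> tgt G e = u"

definition incident :: "('v, 'e) pre_metric_graph \<Rightarrow> 'e \<Rightarrow> 'v \<Rightarrow> bool"
  where "incident G e v \<longleftrightarrow> src G e = v \<or> tgt G e = v"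

text \<open>Connectedness by closed vertex sets instead of paths: it follows at once from the
  topology and is easily checked after an edge has been removed.\<close>

definition comb_connected :: "('v, 'e) pre_metric_graph \<Rightarrow> bool"
  where "comb_connected G \<longleftrightarrow>
    (\<forall>S\<subseteq>verts G. S \<noteq> {} \<longrightarrow> (\<forall>e\<in>edges G. src G e \<in> S \<longleftrightarrow> tgt G e \<in> S) \<longrightarrow> S = verts G)"

definition finite_graph :: "('v, 'e) pre_metric_graph \<Rightarrow> bool"
  where "finite_graph G \<longleftrightarrow> finite (verts G) \<and> finite (edges G) \<and> (\<forall>e\<in>edges G. src G e \<in> verts G \<and> tgt G e \<in> verts G)"

definition simple_path :: "('v, 'e) pre_metric_graph \<Rightarrow> 'v list \<Rightarrow> 'e list \<Rightarrow> bool"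
  where "simple_path G vs es \<longleftrightarrow> length vs = Suc (length es) \<and> distinct vs \<and> set vs \<subseteq> verts G \<and>
    set es \<subseteq> edges G \<and> (\<forall>i<length es. joins G (es ! i) (vs ! i) (vs ! Suc i))"

text \<open>Vertices of a simple path are distinct, so lengths are bounded and a longest path
  exists; an edge from its end to a new vertex would prolong it.\<close>

lemma maximal_simple_path:
  assumes G: "finite_graph G" and r: "r \<in> verts G"
  shows "\<exists>vs es. simple_path G vs es \<and> vs ! 0 = r \<and>
    (\<forall>e\<in>edges G. \<forall>u. joins G e (vs ! length es) u \<longrightarrow> u \<in> set vs)"
proof -
  let ?P = "\<lambda>n. \<exists>vs es. simple_path G vs es \<and> vs ! 0 = r \<and> length vs = n"
  have "simple_path G [r] []" using r by (simp add: simple_path_def)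
  then have "?P 1" by (intro exI[of _ "[r]"] exI[of _ "[]"]) simp
  moreover have "\<forall>n. ?P n \<longrightarrow> n \<le> card (verts G)"
  proof (intro allI impI)
    fix n assume "?P n"
    then obtain vs es where "simple_path G vs es" "length vs = n" by blast
    then have "distinct vs" "set vs \<subseteq> verts G" by (simp_all add: simple_path_def)
    then show "n \<le> card (verts G)"
      using card_mono[of "verts G" "set vs"] distinct_card[of vs] G \<open>length vs = n\<close> by (simp add: finite_graph_def)
  qed
  ultimately have "\<exists>n. ?P n \<and> (\<forall>m. ?P m \<longrightarrow> m \<le> n)" by (rule Nat.ex_has_greatest_nat[where P = ?P])
  then obtain vs es where p: "simple_path G vs es" "vs ! 0 = r" and max: "\<And>m. ?P m \<Longrightarrow> m \<le> length vs" by blast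
  have "u \<in> set vs" if e: "e \<in> edges G" and j: "joins G e (vs ! length es) u" for e u
  proof (rule ccontr)
    assume u: "u \<notin> set vs"
    have "u \<in> verts G" using G e j by (auto simp: finite_graph_def joins_def)
    then have "simple_path G (vs @ [u]) (es @ [e])"
      using p(1) e j u by (auto simp: simple_path_def nth_append less_Suc_eq)
    moreover have "(vs @ [u]) ! 0 = r" using p by (cases vs) (auto simp: simple_path_def)
    ultimately have "?P (length (vs @ [u]))" by blast
    from max[OF this] show False by simp
  qed
  then have "\<forall>e\<in>edges G. \<forall>u. joins G e (vs ! length es) u \<longrightarrow> u \<in> set vs" by blast
  with p show ?thesis by blast
qed

context
  fixes G :: "('v, 'e) pre_metric_graph" and vs es
  assumes path: "simple_path G vs es"
begin

lemma simple_path_simps: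
  "length vs = Suc (length es)" "distinct vs" "set vs \<subseteq> verts G" "set es \<subseteq> edges G"
  "i < length es \<Longrightarrow> joins G (es ! i) (vs ! i) (vs ! Suc i)"
  using path by (simp_all add: simple_path_def)

lemma simple_path_incident:
  assumes "i < length es" "j \<le> length es" "incident G (es ! i) (vs ! j)"
  shows "j = i \<or> j = Suc i"
proof -
  have "vs ! j = vs ! i \<or> vs ! j = vs ! Suc i"
    using simple_path_simps(5)[OF assms(1)] assms(3) by (auto simp: joins_def incident_def)
  moreover have "i < length vs" "Suc i < length vs" "j < length vs" using assms(1,2) simple_path_simps(1) by simp_all
  ultimately show ?thesis
    using nth_eq_iff_index_eq[OF simple_path_simps(2), of j i] nth_eq_iff_index_eq[OF simple_path_simps(2), of j "Suc i"]
    by blast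
qed

lemma simple_path_edges_distinct:
  assumes "i < length es" "j < length es" "es ! i = es ! j"
  shows "i = j"
proof -
  have "incident G (es ! i) (vs ! j)" "incident G (es ! j) (vs ! i)"
    using simple_path_simps(5)[OF assms(1)] simple_path_simps(5)[OF assms(2)] assms(3)
    by (simp_all add: joins_def incident_def) blast+
  then have "j = i \<or> j = Suc i" "i = j \<or> i = Suc j"
    using simple_path_incident[of i j] simple_path_incident[of j i] assms(1,2) by simp_all
  then show ?thesis by linarith
qed

end

lemma joins_subgraph [simp]:
  "joins (G\<lparr>edges := E\<rparr>) = joins G" "joins (G\<lparr>verts := V\<rparr>) = joins G"
  "incident (G\<lparr>edges := E\<rparr>) = incident G" "incident (G\<lparr>verts := V\<rparr>) = incident G"
  by (simp_all add: joins_def incident_def fun_eq_iff)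

lemma joins_incident: "joins G e u v \<Longrightarrow> incident G e u" "joins G e u v \<Longrightarrow> incident G e v"
  "incident G e u \<Longrightarrow> \<exists>v. joins G e u v" "joins G e u v \<Longrightarrow> incident G e x \<Longrightarrow> x = u \<or> x = v"
  by (auto simp: joins_def incident_def)

text \<open>Take a longest simple path from r. If every edge at its last vertex belongs to the path,
  that vertex is a leaf. Otherwise a further edge leads from there back to a vertex v of the path;
  it can be removed without disconnecting, since the path joins its ends, and v keeps two path edges
  unless it is the first or the last vertex.\<close>

lemma graph_reduction:
  assumes G: "finite_graph G" and conn: "comb_connected G" and r: "r \<in> verts G" and E: "edges G \<noteq> {}"
  shows "\<exists>e\<in>edges G. \<exists>w\<in>verts G. \<exists>v\<in>verts G. joins G e w v \<and>
    (v \<noteq> w \<and> v \<noteq> r \<and> (\<forall>f\<in>edges G. incident G f v \<longrightarrow> f = e) \<or>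
     comb_connected (G\<lparr>edges := edges G - {e}\<rparr>) \<and> (v = r \<or> v = w \<or>
       (\<exists>e1\<in>edges G - {e}. \<exists>e2\<in>edges G - {e}. e1 \<noteq> e2 \<and> incident G e1 v \<and> incident G e2 v)))"
proof -
  obtain vs es where p: "simple_path G vs es" and r0: "vs ! 0 = r"
    and max: "\<And>e u. e \<in> edges G \<Longrightarrow> joins G e (vs ! length es) u \<Longrightarrow> u \<in> set vs"
    using maximal_simple_path[OF G r] by blast
  note ps = simple_path_simps[OF p]
  let ?m = "length es"
  define w where "w = vs ! ?m"
  have w: "w \<in> verts G" using ps by (auto simp: w_def)
  have vsv: "vs ! i \<in> verts G" if "i \<le> ?m" for i using ps that by (auto simp: subset_iff)
  have inj: "vs ! i = vs ! j \<longleftrightarrow> i = j" if "i \<le> ?m" "j \<le> ?m" for i j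
    using nth_eq_iff_index_eq[OF ps(2)] ps(1) that by simp
  show ?thesis
  proof (cases "\<exists>e\<in>edges G. incident G e w \<and> e \<notin> set es")
    case True
    then obtain e where e: "e \<in> edges G" "incident G e w" "e \<notin> set es" by blast
    then obtain v where j: "joins G e w v" using joins_incident(3) by metis
    then have "v \<in> set vs" using max e(1) by (simp add: w_def)
    then obtain i where "i < length vs" "v = vs ! i" unfolding in_set_conv_nth by blast
    then have i: "i \<le> ?m" "v = vs ! i" using ps(1) by auto
    have conn': "comb_connected (G\<lparr>edges := edges G - {e}\<rparr>)"
      unfolding comb_connected_def
    proof (intro allI impI)
      fix S assume S: "S \<subseteq> verts (G\<lparr>edges := edges G - {e}\<rparr>)" "S \<noteq> {}"
        and cl: "\<forall>f\<in>edges (G\<lparr>edges := edges G - {e}\<rparr>). (src (G\<lparr>edges := edges G - {e}\<rparr>) f \<in> S) = (tgt (G\<lparr>edges := edges G - {e}\<rparr>) f \<in> S)"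
      have step: "vs ! k \<in> S \<longleftrightarrow> vs ! Suc k \<in> S" if k: "k < ?m" for k
      proof -
        have "es ! k \<in> edges G - {e}" using k ps(4) e(3) nth_mem[OF k] by auto
        then have "(src G (es ! k) \<in> S) = (tgt G (es ! k) \<in> S)" using cl by simp
        then show ?thesis using ps(5)[OF k] unfolding joins_def by metis
      qed
      have all0: "vs ! k \<in> S \<longleftrightarrow> vs ! 0 \<in> S" if "k \<le> ?m" for k
        using that
      proof (induction k)
        case (Suc k)
        then show ?case using step[of k] by linarith
      qed simp
      have "w \<in> S \<longleftrightarrow> v \<in> S" using all0[of ?m] all0[OF i(1)] unfolding w_def i(2) by blast
      then have "(src G e \<in> S) = (tgt G e \<in> S)" using j unfolding joins_def by metis
      moreover have "\<forall>f\<in>edges G - {e}. (src G f \<in> S) = (tgt G f \<in> S)" using cl by simp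
      ultimately have "\<forall>f\<in>edges G. (src G f \<in> S) = (tgt G f \<in> S)" by blast
      moreover have "S \<subseteq> verts G" using S(1) by simp
      ultimately have "S = verts G"
        using conn S(2) unfolding comb_connected_def by blast
      then show "S = verts (G\<lparr>edges := edges G - {e}\<rparr>)" by simp
    qed
    have vd: "v = r \<or> v = w \<or> (\<exists>e1\<in>edges G - {e}. \<exists>e2\<in>edges G - {e}. e1 \<noteq> e2 \<and> incident G e1 v \<and> incident G e2 v)"
    proof (cases "i = 0 \<or> i = ?m")
      case True
      then show ?thesis using i r0 by (auto simp: w_def)
    next
      case False
      then have i': "i - 1 < ?m" "i < ?m" "Suc (i - 1) = i" using i by auto
      have "es ! (i - 1) \<in> edges G - {e}" "es ! i \<in> edges G - {e}"
        using nth_mem[OF i'(1)] nth_mem[OF i'(2)] ps(4) e(3) by auto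
      moreover have "es ! (i - 1) \<noteq> es ! i" using simple_path_edges_distinct[OF p i'(1,2)] i' by auto
      moreover have "incident G (es ! (i - 1)) v" "incident G (es ! i) v"
        using joins_incident(2)[OF ps(5)[OF i'(1)]] joins_incident(1)[OF ps(5)[OF i'(2)]] i i' by auto
      ultimately show ?thesis by blast
    qed
    have v: "v \<in> verts G" using vsv[OF i(1)] i(2) by simp
    show ?thesis
      by (intro bexI[of _ e] bexI[of _ w] bexI[of _ v] conjI[OF j] disjI2 conjI conn' vd e(1) w v)
  next
    case False
    then have all: "e \<in> set es" if "e \<in> edges G" "incident G e w" for e using that by blast
    have m: "?m \<noteq> 0"
    proof
      assume m: "?m = 0"
      then have "\<not> incident G e r" if "e \<in> edges G" for e using all[OF that] r0 by (auto simp: w_def)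
      then have "{r} = verts G" using conn r unfolding comb_connected_def
        by (auto simp: incident_def dest!: spec[of _ "{r}"])
      moreover obtain e where "e \<in> edges G" using E by blast
      ultimately have "src G e = r" "e \<in> edges G" using G by (auto simp: finite_graph_def)
      then show False using \<open>\<And>e. e \<in> edges G \<Longrightarrow> \<not> incident G e r\<close> by (auto simp: incident_def)
    qed
    then have m': "?m - 1 < ?m" "Suc (?m - 1) = ?m" by auto
    let ?e = "es ! (?m - 1)" and ?u = "vs ! (?m - 1)"
    have e: "?e \<in> edges G" using nth_mem[OF m'(1)] ps(4) by blast
    have j: "joins G ?e ?u w" using ps(5)[OF m'(1)] m'(2) by (simp add: w_def)
    have leaf: "\<forall>f\<in>edges G. incident G f w \<longrightarrow> f = ?e"
    proof (intro ballI impI)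
      fix f assume f: "f \<in> edges G" "incident G f w"
      then obtain k where k: "k < ?m" "f = es ! k" using all[OF f] by (auto simp: in_set_conv_nth)
      then have "?m = k \<or> ?m = Suc k" using simple_path_incident[OF p k(1), of ?m] f by (simp add: w_def)
      then have "k = ?m - 1" using k(1) by auto
      then show "f = ?e" using k(2) by simp
    qed
    have u: "?u \<in> verts G" by (rule vsv) simp
    have "?m \<noteq> ?m - 1" using m'(2) by linarith
    then have wu: "w \<noteq> ?u" using inj[of ?m "?m - 1"] unfolding w_def by simp
    have wr: "w \<noteq> r" using inj[of ?m 0] m unfolding w_def r0[symmetric] by simp
    show ?thesis
      by (intro bexI[of _ ?e] bexI[of _ ?u] bexI[of _ w] disjI1 conjI j wu wr leaf e u w)
  qed
qed

text \<open>A closed set of the smaller graph becomes closed in the larger one when the leaf is put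
  on the side of its neighbour.\<close>

lemma comb_connected_remove_leaf:
  assumes conn: "comb_connected G" and e: "e \<in> edges G" "joins G e w v" "v \<noteq> w" and w: "w \<in> verts G" and v: "v \<in> verts G"
    and leaf: "\<forall>f\<in>edges G. incident G f v \<longrightarrow> f = e"
  shows "comb_connected (G\<lparr>verts := verts G - {v}, edges := edges G - {e}\<rparr>)"
  unfolding comb_connected_def
proof (intro allI impI)
  fix S assume S: "S \<subseteq> verts (G\<lparr>verts := verts G - {v}, edges := edges G - {e}\<rparr>)" "S \<noteq> {}"
    and cl: "\<forall>f\<in>edges (G\<lparr>verts := verts G - {v}, edges := edges G - {e}\<rparr>).
      (src (G\<lparr>verts := verts G - {v}, edges := edges G - {e}\<rparr>) f \<in> S) = (tgt (G\<lparr>verts := verts G - {v}, edges := edges G - {e}\<rparr>) f \<in> S)"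
  define S' where "S' = (if w \<in> S then insert v S else S)"
  have vS: "v \<notin> S" using S by auto
  have "(src G f \<in> S') = (tgt G f \<in> S')" if f: "f \<in> edges G" for f
  proof (cases "f = e")
    case True
    then show ?thesis using e vS by (auto simp: S'_def joins_def)
  next
    case False
    then have "src G f \<noteq> v" "tgt G f \<noteq> v" using leaf f by (auto simp: incident_def)
    then show ?thesis using cl f False by (auto simp: S'_def)
  qed
  moreover have "S' \<subseteq> verts G" "S' \<noteq> {}" using S v by (auto simp: S'_def)
  ultimately have "S' = verts G" using conn unfolding comb_connected_def by blast
  then show "S = verts (G\<lparr>verts := verts G - {v}, edges := edges G - {e}\<rparr>)"
    using vS S by (auto simp: S'_def split: if_splits)
qed

lemma comb_connected_no_edges:
  assumes "comb_connected G" "edges G = {}" "r \<in> verts G"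
  shows "verts G = {r}"
proof -
  have "{r} \<subseteq> verts G" "{r} \<noteq> {}" using assms(3) by auto
  moreover have "\<forall>e\<in>edges G. (src G e \<in> {r}) = (tgt G e \<in> {r})" using assms(2) by blast
  ultimately show ?thesis using assms(1) unfolding comb_connected_def by blast
qed

lemma finite_graph_remove:
  "finite_graph G \<Longrightarrow> finite_graph (G\<lparr>edges := edges G - {e}\<rparr>)"
  "finite_graph G \<Longrightarrow> \<forall>f\<in>edges G. incident G f v \<longrightarrow> f = e \<Longrightarrow>
    finite_graph (G\<lparr>verts := verts G - {v}, edges := edges G - {e}\<rparr>)"
  by (auto simp: finite_graph_def incident_def)

text \<open>Removing a leaf lowers both counts by one, any other reduction only the number of edges.
  This is the nonnegativity of the Betti number.\<close>

lemma comb_connected_card_verts: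
  assumes "finite_graph G" "comb_connected G"
  shows "card (verts G) \<le> card (edges G) + 1"
  using assms
proof (induction "card (edges G)" arbitrary: G rule: less_induct)
  case less
  have fin: "finite (verts G)" "finite (edges G)" using less.prems by (auto simp: finite_graph_def)
  show ?case
  proof (cases "verts G = {}")
    case False
    then obtain r where r: "r \<in> verts G" by blast
    show ?thesis
    proof (cases "edges G = {}")
      case True
      then show ?thesis using comb_connected_no_edges[OF less.prems(2) _ r] by simp
    next
      case False
      from graph_reduction[OF less.prems r False] obtain e w v where e: "e \<in> edges G"
        and w: "w \<in> verts G" and v: "v \<in> verts G" and j: "joins G e w v"
        and alt: "v \<noteq> w \<and> v \<noteq> r \<and> (\<forall>f\<in>edges G. incident G f v \<longrightarrow> f = e) \<or> comb_connected (G\<lparr>edges := edges G - {e}\<rparr>)"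
        by blast
      have c: "card (edges G - {e}) < card (edges G)" using e fin by (intro psubset_card_mono) auto
      from alt show ?thesis
      proof
        assume a: "v \<noteq> w \<and> v \<noteq> r \<and> (\<forall>f\<in>edges G. incident G f v \<longrightarrow> f = e)"
        have "card (verts G - {v}) \<le> card (edges G - {e}) + 1"
          using less.hyps[of "G\<lparr>verts := verts G - {v}, edges := edges G - {e}\<rparr>"] c a
            comb_connected_remove_leaf[OF less.prems(2) e j _ w v] finite_graph_remove(2)[OF less.prems(1), of v e] by simp
        then show ?thesis using card.remove[OF fin(1) v] card.remove[OF fin(2) e] by linarith
      next
        assume a: "comb_connected (G\<lparr>edges := edges G - {e}\<rparr>)"
        have "card (verts G) \<le> card (edges G - {e}) + 1"
          using less.hyps[of "G\<lparr>edges := edges G - {e}\<rparr>"] c a finite_graph_remove(1)[OF less.prems(1), of e] by simp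
        then show ?thesis using c by simp
      qed
    qed
  qed simp
qed

text \<open>Adding strength y' at w never loses weight: if w already carries a condition,
  superadditivity applies; otherwise the strength there was 0, was not counted, and y' simply
  contributes its own weight.\<close>

lemma phase_weight_update_sum:
  assumes "finite A" "\<And>u. u \<notin> A \<Longrightarrow> y u = 0"
  shows "(\<Sum>u\<in>A. phase_weight (y u)) + phase_weight y' \<le> (\<Sum>u\<in>insert w A. phase_weight ((y(w := y w + y')) u))"
proof (cases "w \<in> A")
  case True
  have "(\<Sum>u\<in>A. phase_weight ((y(w := y w + y')) u)) = phase_weight (y w + y') + (\<Sum>u\<in>A - {w}. phase_weight (y u))"
    using sum.remove[OF assms(1) True, of "\<lambda>u. phase_weight ((y(w := y w + y')) u)"] by simp
  moreover have "(\<Sum>u\<in>A. phase_weight (y u)) = phase_weight (y w) + (\<Sum>u\<in>A - {w}. phase_weight (y u))"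
    by (rule sum.remove[OF assms(1) True])
  ultimately show ?thesis using phase_weight_add[of "y w" y'] True by (simp add: insert_absorb)
next
  case False
  have "(\<Sum>u\<in>A. phase_weight ((y(w := y w + y')) u)) = (\<Sum>u\<in>A. phase_weight (y u))"
    by (rule sum.cong) (use False in auto)
  then show ?thesis using False assms by simp
qed

lemma sobolev_pre_extension:
  assumes "far = 0 \<and> src \<Gamma> e = v \<and> tgt \<Gamma> e = w \<or> far = len \<Gamma> e \<and> tgt \<Gamma> e = v \<and> src \<Gamma> e = w"
    and "x \<in> pre_extension \<Gamma> V E e far w L v" "fn x e far = val x v"
  shows "x \<in> sobolev (subgraph \<Gamma> V' (insert e E))"
  using assms by (auto simp: pre_extension_def sobolev_def)

text \<open>The kernel consists of the functions whose loose end takes the value of the vertex v,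
  that is, for which the cut is closed again.\<close>

lemma linear_far_gap: "linear (\<lambda>x :: ('v, 'e) graph_fun. fn x e far - val x v)"
  by (rule linearI) (simp_all add: algebra_simps)

text \<open>Each vertex of \<open>A\<close> carries a Robin condition of strength \<open>\<omega> y\<^sub>u\<close>; the root \<open>r\<close> carries an
  additional one of strength \<open>\<omega> y\<^sub>0\<close>. Removing an edge \<open>e\<close> moves its contribution to the vertex
  \<open>w\<close>: either the other end \<open>v\<close> is a leaf, or \<open>e\<close> is cut off \<open>v\<close>, at the price of the one linear
  condition that closes the cut again.\<close>

theorem neg_family_exists:
  fixes \<Gamma> :: "('v, 'e) pre_metric_graph" and y :: "'v \<Rightarrow> real" and y0 :: real and k :: nat
  assumes \<omega>: "0 < \<omega>" and "finite_graph (subgraph \<Gamma> V E)" "comb_connected (subgraph \<Gamma> V E)"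
    and "\<And>e. e \<in> E \<Longrightarrow> 0 < len \<Gamma> e" and "r \<in> V" and "A \<subseteq> V" and "\<And>u. u \<notin> A \<Longrightarrow> y u = 0"
    and "\<And>u. u \<in> V \<Longrightarrow> u \<in> A \<or> u = r \<or> (\<exists>e\<in>E. src \<Gamma> e = u \<and> tgt \<Gamma> e = u) \<or>
      (\<exists>e1\<in>E. \<exists>e2\<in>E. e1 \<noteq> e2 \<and> incident \<Gamma> e1 u \<and> incident \<Gamma> e2 u)"
    and "E \<noteq> {} \<or> r \<in> A"
    and "real k - 2 < (\<Sum>e\<in>E. len \<Gamma> e) * \<omega> / pi + (\<Sum>u\<in>A. phase_weight (y u)) + phase_weight y0
      - 3 / 2 * (real (card E) - real (card V) + 1)"
  shows "\<exists>\<phi>. neg_family (sobolev (subgraph \<Gamma> V E))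
    (\<lambda>x. defect (subgraph \<Gamma> V E) \<omega> x + ((\<Sum>u\<in>V. \<omega> * y u * (val x u)\<^sup>2) + \<omega> * y0 * (val x r)\<^sup>2))
    (vanishes (subgraph \<Gamma> V E)) k \<phi>"
  using assms(2-)
proof (induction "card E" arbitrary: V E A y k rule: less_induct)
  case less
  note fg = less.prems(1) and conn = less.prems(2) and pos = less.prems(3) and r = less.prems(4)
    and A = less.prems(5) and yA = less.prems(6) and deg = less.prems(7) and ne = less.prems(8) and ineq = less.prems(9)
  let ?G = "subgraph \<Gamma> V E"
  have fin: "finite V" "finite E" "finite A" and ends: "\<And>e. e \<in> E \<Longrightarrow> src \<Gamma> e \<in> V \<and> tgt \<Gamma> e \<in> V"
    using fg A by (auto simp: finite_graph_def intro: finite_subset)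
  show ?case
  proof (cases "E = {}")
    case True
    then have V: "V = {r}" using comb_connected_no_edges[OF conn, of r] r by simp
    have rA: "r \<in> A" using ne True by simp
    then have "A = {r}" using A V by auto
    then have i: "real k - 2 < phase_weight (y r) + phase_weight y0" using ineq True V by simp
    show ?thesis
    proof (cases "k = 0")
      case True
      then show ?thesis
        by (intro exI[of _ "\<lambda>_. 0"]) (simp add: neg_family_def defect_def dirichlet_form_def potential_form_def \<open>E = {}\<close>)
    next
      case False
      then have "k = 1" using i phase_weight_neg[of "y r"] phase_weight_neg[of y0] by linarith
      \<comment> \<open>For k = 1 the hypothesis says that the two weights exceed -1 in sum. Their
        constants add up to exactly -1, so the total strength at the vertex is negative and the
        constant 1 is a negative direction.\<close>
      then have "(arctan (y r) + arctan y0) / pi < 0" using i by (simp add: phase_weight_def add_divide_distrib)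
      then have "arctan (y r) < arctan (- y0)" by (simp add: divide_less_0_iff arctan_minus)
      then have "y r + y0 < 0" by (simp add: arctan_less_iff)
      then have "\<omega> * (y r + y0) * s\<^sup>2 \<le> 0" for s
        using \<omega> by (simp add: mult_nonneg_nonpos2 mult_nonpos_nonneg mult_nonneg_nonpos)
      then have n: "\<omega> * y r * s\<^sup>2 + \<omega> * y0 * s\<^sup>2 \<le> 0" for s by (simp add: distrib_left distrib_right)
      have "neg_family (sobolev ?G) (\<lambda>x. defect ?G \<omega> x + ((\<Sum>u\<in>V. \<omega> * y u * (val x u)\<^sup>2) + \<omega> * y0 * (val x r)\<^sup>2))
        (vanishes ?G) 1 (\<lambda>_. ((\<lambda>_. 1), (\<lambda>_ _. 0), (\<lambda>_ _. 0)))"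
        using n by (auto simp: neg_family_def sobolev_def \<open>E = {}\<close> V defect_def dirichlet_form_def potential_form_def vanishes_def)
      then show ?thesis using \<open>k = 1\<close> by blast
    qed
  next
    case False
    have "\<exists>e\<in>E. \<exists>w\<in>V. \<exists>v\<in>V. joins \<Gamma> e w v \<and>
        (v \<noteq> w \<and> v \<noteq> r \<and> (\<forall>f\<in>E. incident \<Gamma> f v \<longrightarrow> f = e) \<or>
        comb_connected (subgraph \<Gamma> V (E - {e})) \<and> (v = r \<or> v = w \<or>
        (\<exists>e1\<in>E - {e}. \<exists>e2\<in>E - {e}. e1 \<noteq> e2 \<and> incident \<Gamma> e1 v \<and> incident \<Gamma> e2 v)))"
      using graph_reduction[OF fg conn, of r] r False by simp
    then obtain e w v where
      e: "e \<in> E" and w: "w \<in> V" and v: "v \<in> V" and j: "joins \<Gamma> e w v"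
      and alt: "v \<noteq> w \<and> v \<noteq> r \<and> (\<forall>f\<in>E. incident \<Gamma> f v \<longrightarrow> f = e) \<or>
        comb_connected (subgraph \<Gamma> V (E - {e})) \<and> (v = r \<or> v = w \<or>
        (\<exists>e1\<in>E - {e}. \<exists>e2\<in>E - {e}. e1 \<noteq> e2 \<and> incident \<Gamma> e1 v \<and> incident \<Gamma> e2 v))"
      by (elim bexE conjE)
    define far where "far = (if src \<Gamma> e = v \<and> tgt \<Gamma> e = w then 0 else len \<Gamma> e)"
    have far: "far = 0 \<or> far = len \<Gamma> e"
      "far = 0 \<and> src \<Gamma> e = v \<and> tgt \<Gamma> e = w \<or> far = len \<Gamma> e \<and> tgt \<Gamma> e = v \<and> src \<Gamma> e = w"
      using j by (auto simp: far_def joins_def)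
    let ?E = "E - {e}"
    have E: "finite ?E" "e \<notin> ?E" "insert e ?E = E" using fin e by auto
    have cE: "card ?E < card E" "real (card ?E) = real (card E) - 1"
      using card.remove[OF fin(2) e] by simp_all
    have lenE: "(\<Sum>f\<in>E. len \<Gamma> f) = len \<Gamma> e + (\<Sum>f\<in>?E. len \<Gamma> f)" by (rule sum.remove[OF fin(2) e])
    \<comment> \<open>Half of the slack in the strict inequality. The new edge loses at most this
      much phase, so the inequality stays strict for the smaller graph.\<close>
    define \<epsilon> where "\<epsilon> = ((\<Sum>e\<in>E. len \<Gamma> e) * \<omega> / pi + (\<Sum>u\<in>A. phase_weight (y u)) + phase_weight y0
      - 3 / 2 * (real (card E) - real (card V) + 1) - (real k - 2)) / 2"
    have \<epsilon>: "0 < \<epsilon>" using ineq by (simp add: \<epsilon>_def)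
    have deg1: "u \<in> insert w (A - {v}) \<or> u = r \<or> (\<exists>e\<in>?E. src \<Gamma> e = u \<and> tgt \<Gamma> e = u) \<or>
      (\<exists>e1\<in>?E. \<exists>e2\<in>?E. e1 \<noteq> e2 \<and> incident \<Gamma> e1 u \<and> incident \<Gamma> e2 u)" if u: "u \<in> V" "u \<noteq> v" for u
    proof (cases "u = w")
      case False
      then have "\<not> incident \<Gamma> e u" using joins_incident(4)[OF j] u(2) by metis
      then show ?thesis using deg[OF u(1)] u(2) by (auto simp: incident_def)
    qed simp
    show ?thesis
    proof (cases "v \<noteq> w \<and> v \<noteq> r \<and> (\<forall>f\<in>E. incident \<Gamma> f v \<longrightarrow> f = e)")
      case True
      then have vw: "v \<noteq> w" "v \<noteq> r" and leaf: "\<And>f. f \<in> E \<Longrightarrow> incident \<Gamma> f v \<Longrightarrow> f = e" by auto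
      \<comment> \<open>A leaf other than the root has neither a loop nor two edges, so it carries a
        Robin condition, and its weight is available for the edge.\<close>
      have vA: "v \<in> A"
      proof (rule ccontr)
        assume "v \<notin> A"
        then consider "\<exists>e\<in>E. src \<Gamma> e = v \<and> tgt \<Gamma> e = v" | "\<exists>e1\<in>E. \<exists>e2\<in>E. e1 \<noteq> e2 \<and> incident \<Gamma> e1 v \<and> incident \<Gamma> e2 v"
          using deg[OF v] vw by blast
        then show False
        proof cases
          case 1
          then obtain f where "f \<in> E" "src \<Gamma> f = v" "tgt \<Gamma> f = v" by blast
          then have "src \<Gamma> e = v" "tgt \<Gamma> e = v" using leaf[of f] by (auto simp: incident_def)
          then show False using j vw by (auto simp: joins_def)
        next
          case 2
          then show False using leaf by metis
        qed
      qed
      from extend_over_edge[OF \<omega> pos[OF e] \<epsilon> far(1) E(1,2), of "y v"] obtain n :: nat and y' where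
        wt: "phase_weight (y v) + len \<Gamma> e * \<omega> / pi - n - \<epsilon> \<le> phase_weight y'" and
        ext: "\<And>V w L v' (Q :: ('v \<Rightarrow> real) \<Rightarrow> real) k \<phi>.
          neg_family (sobolev (subgraph \<Gamma> V ?E)) (\<lambda>x. defect (subgraph \<Gamma> V ?E) \<omega> x + Q (val x) + \<omega> * y' * (val x w)\<^sup>2)
            (vanishes (subgraph \<Gamma> V ?E)) k \<phi> \<Longrightarrow>
          (\<forall>f g. (\<forall>u\<in>V. f u = g u) \<longrightarrow> Q f = Q g) \<Longrightarrow> w \<in> V \<Longrightarrow>
          (\<forall>f\<in>?E. src \<Gamma> f \<in> V \<and> tgt \<Gamma> f \<in> V) \<Longrightarrow> (L \<longrightarrow> v' \<notin> V) \<Longrightarrow>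
          (\<exists>\<psi>. neg_family (pre_extension \<Gamma> V ?E e far w L v')
            (\<lambda>x. defect (subgraph \<Gamma> V (insert e ?E)) \<omega> x + Q (val x) + \<omega> * y v * (fn x e far)\<^sup>2)
            (vanishes (subgraph \<Gamma> V (insert e ?E))) (k + n) \<psi>)" by blast
      let ?V = "V - {v}"
      \<comment> \<open>Truncated subtraction: if n is at least k, the arcs alone provide enough
        dimensions and the empty family suffices on the smaller graph.\<close>
      define k' where "k' = k - n"
      define z where "z = y(v := 0)"
      define Q where "Q f = (\<Sum>u\<in>?V. \<omega> * y u * (f u)\<^sup>2) + \<omega> * y0 * (f r)\<^sup>2" for f :: "'v \<Rightarrow> real"
      have "\<exists>\<phi>. neg_family (sobolev (subgraph \<Gamma> ?V ?E))
          (\<lambda>x. defect (subgraph \<Gamma> ?V ?E) \<omega> x + Q (val x) + \<omega> * y' * (val x w)\<^sup>2) (vanishes (subgraph \<Gamma> ?V ?E)) k' \<phi>"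
      proof (cases "k \<le> n")
        case True
        then have "k' = 0" by (simp add: k'_def)
        have "Q (val 0) = 0" by (simp add: Q_def)
        then show ?thesis using \<open>k' = 0\<close>
          by (intro exI[of _ "\<lambda>_. 0"]) (simp add: neg_family_def defect_def dirichlet_form_def potential_form_def)
      next
        case False
        then have k': "real k' = real k - real n" by (simp add: k'_def)
        have ysum: "(\<Sum>u\<in>A. phase_weight (y u)) = phase_weight (y v) + (\<Sum>u\<in>A - {v}. phase_weight (z u))"
        proof -
          have "(\<Sum>u\<in>A - {v}. phase_weight (z u)) = (\<Sum>u\<in>A - {v}. phase_weight (y u))"
            by (rule sum.cong) (auto simp: z_def)
          then show ?thesis using sum.remove[OF fin(3) vA, of "\<lambda>u. phase_weight (y u)"] by simp
        qed
        have cV: "real (card ?V) = real (card V) - 1"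
          using card.remove[OF fin(1) v] by simp
        have "\<exists>\<phi>. neg_family (sobolev (subgraph \<Gamma> ?V ?E))
          (\<lambda>x. defect (subgraph \<Gamma> ?V ?E) \<omega> x + ((\<Sum>u\<in>?V. \<omega> * (z(w := z w + y')) u * (val x u)\<^sup>2) + \<omega> * y0 * (val x r)\<^sup>2))
          (vanishes (subgraph \<Gamma> ?V ?E)) k' \<phi>"
        proof (rule less.hyps[OF cE(1), where A = "insert w (A - {v})"])
          show "finite_graph (subgraph \<Gamma> ?V ?E)"
            using finite_graph_remove(2)[OF fg, of v e] leaf by (simp add: incident_def)
          have leaf': "\<forall>f\<in>edges ?G. incident ?G f v \<longrightarrow> f = e"
            using leaf by (simp add: incident_def)
          have "e \<in> edges ?G" "joins ?G e w v" "w \<in> verts ?G" "v \<in> verts ?G" using e j w v by simp_all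
          from comb_connected_remove_leaf[OF conn this(1,2) vw(1) this(3,4) leaf']
          show "comb_connected (subgraph \<Gamma> ?V ?E)" by simp
          show "0 < len \<Gamma> f" if "f \<in> ?E" for f using pos that by auto
          show "r \<in> ?V" using r vw by auto
          show "insert w (A - {v}) \<subseteq> ?V" using A w vw by auto
          show "(z(w := z w + y')) u = 0" if "u \<notin> insert w (A - {v})" for u
            using that yA by (auto simp: z_def)
          show "u \<in> insert w (A - {v}) \<or> u = r \<or> (\<exists>e\<in>?E. src \<Gamma> e = u \<and> tgt \<Gamma> e = u) \<or>
            (\<exists>e1\<in>?E. \<exists>e2\<in>?E. e1 \<noteq> e2 \<and> incident \<Gamma> e1 u \<and> incident \<Gamma> e2 u)" if "u \<in> ?V" for u
            using deg1[of u] that by blast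
          show "?E \<noteq> {} \<or> r \<in> insert w (A - {v})"
          proof (cases "?E = {}")
            case True
            have "?V = {r}"
              using comb_connected_no_edges[OF \<open>comb_connected (subgraph \<Gamma> ?V ?E)\<close>, of r] True r vw by auto
            then show ?thesis using w vw by auto
          qed simp
          have "(\<Sum>u\<in>A - {v}. phase_weight (z u)) + phase_weight y' \<le> (\<Sum>u\<in>insert w (A - {v}). phase_weight ((z(w := z w + y')) u))"
            by (rule phase_weight_update_sum) (use fin yA in \<open>auto simp: z_def\<close>)
          moreover have "(\<Sum>e\<in>E. len \<Gamma> e) * \<omega> / pi = len \<Gamma> e * \<omega> / pi + (\<Sum>f\<in>?E. len \<Gamma> f) * \<omega> / pi"
            by (simp add: lenE distrib_right add_divide_distrib)
          moreover have "2 * \<epsilon> = (\<Sum>e\<in>E. len \<Gamma> e) * \<omega> / pi + (\<Sum>u\<in>A. phase_weight (y u)) + phase_weight y0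
            - 3 / 2 * (real (card E) - real (card V) + 1) - (real k - 2)" by (simp add: \<epsilon>_def)
          moreover have "3 / 2 * (real (card ?E) - real (card ?V) + 1) = 3 / 2 * (real (card E) - real (card V) + 1)"
            by (simp add: cV cE(2))
          ultimately show "real k' - 2 < (\<Sum>e\<in>?E. len \<Gamma> e) * \<omega> / pi
            + (\<Sum>u\<in>insert w (A - {v}). phase_weight ((z(w := z w + y')) u)) + phase_weight y0
            - 3 / 2 * (real (card ?E) - real (card ?V) + 1)"
            using wt k' \<epsilon> ysum by linarith
        qed
        moreover have "(\<Sum>u\<in>?V. \<omega> * (z(w := z w + y')) u * (f u)\<^sup>2) = (\<Sum>u\<in>?V. \<omega> * y u * (f u)\<^sup>2) + \<omega> * y' * (f w)\<^sup>2" for f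
        proof -
          have "(\<Sum>u\<in>?V. \<omega> * (z(w := z w + y')) u * (f u)\<^sup>2)
              = (\<Sum>u\<in>?V. \<omega> * y u * (f u)\<^sup>2 + (if u = w then \<omega> * y' * (f w)\<^sup>2 else 0))"
            by (rule sum.cong) (auto simp: z_def distrib_left distrib_right vw)
          then show ?thesis using w vw fin by (simp add: sum.distrib)
        qed
        ultimately show ?thesis by (simp add: Q_def add.assoc add.left_commute add.commute)
      qed
      then obtain \<phi> where \<phi>: "neg_family (sobolev (subgraph \<Gamma> ?V ?E))
          (\<lambda>x. defect (subgraph \<Gamma> ?V ?E) \<omega> x + Q (val x) + \<omega> * y' * (val x w)\<^sup>2) (vanishes (subgraph \<Gamma> ?V ?E)) k' \<phi>" by blast
      have Qloc: "\<forall>f g. (\<forall>u\<in>?V. f u = g u) \<longrightarrow> Q f = Q g"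
        unfolding Q_def using r vw by (auto intro!: sum.cong)
      have ends': "\<forall>f\<in>?E. src \<Gamma> f \<in> ?V \<and> tgt \<Gamma> f \<in> ?V"
        using ends leaf unfolding incident_def by blast
      from ext[OF \<phi> Qloc _ ends', of True v] w vw obtain \<psi> where
        \<psi>: "neg_family (pre_extension \<Gamma> ?V ?E e far w True v)
            (\<lambda>x. defect (subgraph \<Gamma> ?V (insert e ?E)) \<omega> x + Q (val x) + \<omega> * y v * (fn x e far)\<^sup>2)
            (vanishes (subgraph \<Gamma> ?V (insert e ?E))) (k' + n) \<psi>" by auto
      have "neg_family (sobolev ?G)
        (\<lambda>x. defect ?G \<omega> x + ((\<Sum>u\<in>V. \<omega> * y u * (val x u)\<^sup>2) + \<omega> * y0 * (val x r)\<^sup>2)) (vanishes ?G) (k' + n) \<psi>"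
      proof (rule neg_family_weaken[OF \<psi> subspace_pre_extension])
        fix x assume x: "x \<in> pre_extension \<Gamma> ?V ?E e far w True v"
        have vx: "fn x e far = val x v" using x by (simp add: pre_extension_def)
        show "x \<in> sobolev ?G" using sobolev_pre_extension[OF far(2) x vx, of V] E(3) by simp
        have "defect ?G \<omega> x = defect (subgraph \<Gamma> ?V (insert e ?E)) \<omega> x"
          unfolding E(3) by (simp add: defect_def dirichlet_form_def potential_form_def)
        moreover have "(\<Sum>u\<in>V. \<omega> * y u * (val x u)\<^sup>2) = \<omega> * y v * (val x v)\<^sup>2 + (\<Sum>u\<in>?V. \<omega> * y u * (val x u)\<^sup>2)"
          by (rule sum.remove[OF fin(1) v])
        ultimately show "defect ?G \<omega> x + ((\<Sum>u\<in>V. \<omega> * y u * (val x u)\<^sup>2) + \<omega> * y0 * (val x r)\<^sup>2)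
          \<le> defect (subgraph \<Gamma> ?V (insert e ?E)) \<omega> x + Q (val x) + \<omega> * y v * (fn x e far)\<^sup>2"
          by (simp add: Q_def vx)
        show "vanishes (subgraph \<Gamma> ?V (insert e ?E)) x" if "vanishes ?G x"
          using that unfolding E(3) by (simp add: vanishes_def)
      qed
      then have "neg_family (sobolev ?G)
        (\<lambda>x. defect ?G \<omega> x + ((\<Sum>u\<in>V. \<omega> * y u * (val x u)\<^sup>2) + \<omega> * y0 * (val x r)\<^sup>2)) (vanishes ?G) k \<psi>"
        by (rule neg_family_mono) (simp add: k'_def)
      then show ?thesis by blast
    next
      case False
      then have conn1: "comb_connected (subgraph \<Gamma> V ?E)"
        and vdeg: "v = r \<or> v = w \<or> (\<exists>e1\<in>?E. \<exists>e2\<in>?E. e1 \<noteq> e2 \<and> incident \<Gamma> e1 v \<and> incident \<Gamma> e2 v)"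
        using alt by blast+
      \<comment> \<open>The loose end is free, hence strength 0 and weight -1/2; whatever condition
        v carries stays at v.\<close>
      from extend_over_edge[OF \<omega> pos[OF e] \<epsilon> far(1) E(1,2), of 0] obtain n :: nat and y' where
        wt: "phase_weight 0 + len \<Gamma> e * \<omega> / pi - n - \<epsilon> \<le> phase_weight y'" and
        ext: "\<And>V w L v' (Q :: ('v \<Rightarrow> real) \<Rightarrow> real) k \<phi>.
          neg_family (sobolev (subgraph \<Gamma> V ?E)) (\<lambda>x. defect (subgraph \<Gamma> V ?E) \<omega> x + Q (val x) + \<omega> * y' * (val x w)\<^sup>2)
            (vanishes (subgraph \<Gamma> V ?E)) k \<phi> \<Longrightarrow>
          (\<forall>f g. (\<forall>u\<in>V. f u = g u) \<longrightarrow> Q f = Q g) \<Longrightarrow> w \<in> V \<Longrightarrow>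
          (\<forall>f\<in>?E. src \<Gamma> f \<in> V \<and> tgt \<Gamma> f \<in> V) \<Longrightarrow> (L \<longrightarrow> v' \<notin> V) \<Longrightarrow>
          (\<exists>\<psi>. neg_family (pre_extension \<Gamma> V ?E e far w L v')
            (\<lambda>x. defect (subgraph \<Gamma> V (insert e ?E)) \<omega> x + Q (val x) + \<omega> * 0 * (fn x e far)\<^sup>2)
            (vanishes (subgraph \<Gamma> V (insert e ?E))) (k + n) \<psi>)" by blast
      \<comment> \<open>One dimension more than wanted, to be spent on closing the cut.\<close>
      define k' where "k' = k + 1 - n"
      define Q where "Q f = (\<Sum>u\<in>V. \<omega> * y u * (f u)\<^sup>2) + \<omega> * y0 * (f r)\<^sup>2" for f :: "'v \<Rightarrow> real"
      have "\<exists>\<phi>. neg_family (sobolev (subgraph \<Gamma> V ?E))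
          (\<lambda>x. defect (subgraph \<Gamma> V ?E) \<omega> x + Q (val x) + \<omega> * y' * (val x w)\<^sup>2) (vanishes (subgraph \<Gamma> V ?E)) k' \<phi>"
      proof (cases "k + 1 \<le> n")
        case True
        then have "k' = 0" by (simp add: k'_def)
        have "Q (val 0) = 0" by (simp add: Q_def)
        then show ?thesis using \<open>k' = 0\<close>
          by (intro exI[of _ "\<lambda>_. 0"]) (simp add: neg_family_def defect_def dirichlet_form_def potential_form_def)
      next
        case False
        then have k': "real k' = real k + 1 - real n" by (simp add: k'_def)
        have "\<exists>\<phi>. neg_family (sobolev (subgraph \<Gamma> V ?E))
          (\<lambda>x. defect (subgraph \<Gamma> V ?E) \<omega> x + ((\<Sum>u\<in>V. \<omega> * (y(w := y w + y')) u * (val x u)\<^sup>2) + \<omega> * y0 * (val x r)\<^sup>2))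
          (vanishes (subgraph \<Gamma> V ?E)) k' \<phi>"
        proof (rule less.hyps[OF cE(1), where A = "insert w A"])
          show "finite_graph (subgraph \<Gamma> V ?E)" using finite_graph_remove(1)[OF fg, of e] by simp
          show "comb_connected (subgraph \<Gamma> V ?E)" by (rule conn1)
          show "0 < len \<Gamma> f" if "f \<in> ?E" for f using pos that by auto
          show "r \<in> V" by (rule r)
          show "insert w A \<subseteq> V" using A w by auto
          show "(y(w := y w + y')) u = 0" if "u \<notin> insert w A" for u using that yA by auto
          show "u \<in> insert w A \<or> u = r \<or> (\<exists>e\<in>?E. src \<Gamma> e = u \<and> tgt \<Gamma> e = u) \<or>
            (\<exists>e1\<in>?E. \<exists>e2\<in>?E. e1 \<noteq> e2 \<and> incident \<Gamma> e1 u \<and> incident \<Gamma> e2 u)" if "u \<in> V" for u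
            using deg1[of u] vdeg that by blast
          show "?E \<noteq> {} \<or> r \<in> insert w A"
            using comb_connected_no_edges[OF conn1, of r] r w by auto
          have "(\<Sum>u\<in>A. phase_weight (y u)) + phase_weight y' \<le> (\<Sum>u\<in>insert w A. phase_weight ((y(w := y w + y')) u))"
            by (rule phase_weight_update_sum) (use fin yA in auto)
          moreover have "(\<Sum>e\<in>E. len \<Gamma> e) * \<omega> / pi = len \<Gamma> e * \<omega> / pi + (\<Sum>f\<in>?E. len \<Gamma> f) * \<omega> / pi"
            by (simp add: lenE distrib_right add_divide_distrib)
          moreover have "2 * \<epsilon> = (\<Sum>e\<in>E. len \<Gamma> e) * \<omega> / pi + (\<Sum>u\<in>A. phase_weight (y u)) + phase_weight y0
            - 3 / 2 * (real (card E) - real (card V) + 1) - (real k - 2)" by (simp add: \<epsilon>_def)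
          moreover have "3 / 2 * (real (card ?E) - real (card V) + 1) = 3 / 2 * (real (card E) - real (card V) + 1) - 3 / 2"
            by (simp add: cE(2) field_simps)
          moreover have "phase_weight 0 = - 1 / 2" by (simp add: phase_weight_def)
          ultimately show "real k' - 2 < (\<Sum>e\<in>?E. len \<Gamma> e) * \<omega> / pi
            + (\<Sum>u\<in>insert w A. phase_weight ((y(w := y w + y')) u)) + phase_weight y0
            - 3 / 2 * (real (card ?E) - real (card V) + 1)"
            using wt k' \<epsilon> by linarith
        qed
        moreover have "(\<Sum>u\<in>V. \<omega> * (y(w := y w + y')) u * (f u)\<^sup>2) = (\<Sum>u\<in>V. \<omega> * y u * (f u)\<^sup>2) + \<omega> * y' * (f w)\<^sup>2" for f
        proof -
          have "(\<Sum>u\<in>V. \<omega> * (y(w := y w + y')) u * (f u)\<^sup>2)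
              = (\<Sum>u\<in>V. \<omega> * y u * (f u)\<^sup>2 + (if u = w then \<omega> * y' * (f w)\<^sup>2 else 0))"
            by (rule sum.cong) (auto simp: distrib_left distrib_right)
          then show ?thesis using w fin by (simp add: sum.distrib)
        qed
        ultimately show ?thesis by (simp add: Q_def add.assoc add.left_commute add.commute)
      qed
      then obtain \<phi> where \<phi>: "neg_family (sobolev (subgraph \<Gamma> V ?E))
          (\<lambda>x. defect (subgraph \<Gamma> V ?E) \<omega> x + Q (val x) + \<omega> * y' * (val x w)\<^sup>2) (vanishes (subgraph \<Gamma> V ?E)) k' \<phi>" by blast
      have Qloc: "\<forall>f g. (\<forall>u\<in>V. f u = g u) \<longrightarrow> Q f = Q g"
        unfolding Q_def using r by (auto intro!: sum.cong)
      have ends': "\<forall>f\<in>?E. src \<Gamma> f \<in> V \<and> tgt \<Gamma> f \<in> V" using ends by auto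
      from ext[OF \<phi> Qloc w ends', of False v] obtain \<psi> where
        \<psi>: "neg_family (pre_extension \<Gamma> V ?E e far w False v)
            (\<lambda>x. defect ?G \<omega> x + Q (val x)) (vanishes ?G) (k' + n) \<psi>" unfolding E(3) by auto
      have "Suc k \<le> k' + n" by (simp add: k'_def)
      from neg_family_constraint[OF neg_family_mono[OF \<psi> this] subspace_pre_extension linear_far_gap]
      obtain \<xi> where \<xi>: "neg_family {x \<in> pre_extension \<Gamma> V ?E e far w False v. fn x e far - val x v = 0}
            (\<lambda>x. defect ?G \<omega> x + Q (val x)) (vanishes ?G) k \<xi>" by blast
      have sub: "subspace {x \<in> pre_extension \<Gamma> V ?E e far w False v. fn x e far - val x v = 0}"
        using subspace_inter[OF subspace_pre_extension[of \<Gamma> V ?E e far w False v] linear_subspace_kernel[OF linear_far_gap[of e far v]]]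
        by (simp add: Int_def)
      have "neg_family (sobolev ?G)
        (\<lambda>x. defect ?G \<omega> x + ((\<Sum>u\<in>V. \<omega> * y u * (val x u)\<^sup>2) + \<omega> * y0 * (val x r)\<^sup>2)) (vanishes ?G) k \<xi>"
      proof (rule neg_family_weaken[OF \<xi> sub])
        fix x assume "x \<in> {x \<in> pre_extension \<Gamma> V ?E e far w False v. fn x e far - val x v = 0}"
        then have "x \<in> pre_extension \<Gamma> V ?E e far w False v" "fn x e far = val x v" by auto
        from sobolev_pre_extension[OF far(2) this, of V] show "x \<in> sobolev ?G" unfolding E(3) .
      qed (auto simp: Q_def)
      then show ?thesis by blast
    qed
  qed
qed

section \<open>Degrees, connectedness and cycles\<close>

lemma degree_eq:
  assumes "finite (edges \<Gamma>)"
  shows "degree \<Gamma> v = card {e \<in> edges \<Gamma>. incident \<Gamma> e v} + card {e \<in> edges \<Gamma>. src \<Gamma> e = v \<and> tgt \<Gamma> e = v}"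
proof -
  have "{e \<in> edges \<Gamma>. incident \<Gamma> e v} = {e \<in> edges \<Gamma>. src \<Gamma> e = v} \<union> {e \<in> edges \<Gamma>. tgt \<Gamma> e = v}"
    "{e \<in> edges \<Gamma>. src \<Gamma> e = v \<and> tgt \<Gamma> e = v} = {e \<in> edges \<Gamma>. src \<Gamma> e = v} \<inter> {e \<in> edges \<Gamma>. tgt \<Gamma> e = v}"
    by (auto simp: incident_def)
  then show ?thesis
    unfolding degree_def using card_Un_Int[of "{e \<in> edges \<Gamma>. src \<Gamma> e = v}" "{e \<in> edges \<Gamma>. tgt \<Gamma> e = v}"] assms by simp
qed

lemma degree_ge_card:
  assumes "finite (edges \<Gamma>)" "S \<subseteq> edges \<Gamma>" "\<And>e. e \<in> S \<Longrightarrow> incident \<Gamma> e v"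
  shows "card S \<le> degree \<Gamma> v"
proof -
  have "card S \<le> card {e \<in> edges \<Gamma>. incident \<Gamma> e v}" by (rule card_mono) (use assms in auto)
  then show ?thesis using degree_eq[OF assms(1), of v] by linarith
qed

lemma degree_ge_card_loop:
  assumes "finite (edges \<Gamma>)" "S \<subseteq> edges \<Gamma>" "\<And>e. e \<in> S \<Longrightarrow> incident \<Gamma> e v"
    and l: "l \<in> edges \<Gamma>" "src \<Gamma> l = v" "tgt \<Gamma> l = v"
  shows "card S + 1 \<le> degree \<Gamma> v"
proof -
  have "card S \<le> card {e \<in> edges \<Gamma>. incident \<Gamma> e v}" by (rule card_mono) (use assms in auto)
  moreover have "card {l} \<le> card {e \<in> edges \<Gamma>. src \<Gamma> e = v \<and> tgt \<Gamma> e = v}"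
    by (rule card_mono) (use assms in auto)
  ultimately show ?thesis using degree_eq[OF assms(1), of v] by simp
qed

lemma two_le_cardE:
  assumes "2 \<le> card A"
  obtains a b where "a \<in> A" "b \<in> A" "a \<noteq> b"
proof -
  have "finite A" using assms by (metis card.infinite not_numeral_le_zero)
  moreover have "\<not> card A \<le> Suc 0" using assms by simp
  ultimately show ?thesis using card_le_Suc0_iff_eq[of A] that by blast
qed

lemma degree_ge_two_cases:
  assumes "finite (edges \<Gamma>)" "2 \<le> degree \<Gamma> v"
  shows "(\<exists>e\<in>edges \<Gamma>. src \<Gamma> e = v \<and> tgt \<Gamma> e = v) \<or>
    (\<exists>e1\<in>edges \<Gamma>. \<exists>e2\<in>edges \<Gamma>. e1 \<noteq> e2 \<and> incident \<Gamma> e1 v \<and> incident \<Gamma> e2 v)"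
proof (cases "\<exists>e\<in>edges \<Gamma>. src \<Gamma> e = v \<and> tgt \<Gamma> e = v")
  case False
  then have no_loop: "{e \<in> edges \<Gamma>. src \<Gamma> e = v \<and> tgt \<Gamma> e = v} = {}" by blast
  have "2 \<le> card {e \<in> edges \<Gamma>. incident \<Gamma> e v}"
    using degree_eq[OF assms(1), of v] assms(2) unfolding no_loop by simp
  then obtain e1 e2 where "e1 \<in> {e \<in> edges \<Gamma>. incident \<Gamma> e v}" "e2 \<in> {e \<in> edges \<Gamma>. incident \<Gamma> e v}" "e1 \<noteq> e2"
    by (rule two_le_cardE)
  then show ?thesis by blast
qed simp

text \<open>An edge that is not a loop at v takes up only one unit of the degree, so two units
  remain.\<close>

lemma degree_ge_three_cases:
  assumes "finite (edges \<Gamma>)" "3 \<le> degree \<Gamma> v" "\<not> (src \<Gamma> f = v \<and> tgt \<Gamma> f = v)"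
  shows "(\<exists>e\<in>edges \<Gamma> - {f}. src \<Gamma> e = v \<and> tgt \<Gamma> e = v) \<or>
    (\<exists>e1\<in>edges \<Gamma> - {f}. \<exists>e2\<in>edges \<Gamma> - {f}. e1 \<noteq> e2 \<and> incident \<Gamma> e1 v \<and> incident \<Gamma> e2 v)"
proof (cases "\<exists>e\<in>edges \<Gamma>. src \<Gamma> e = v \<and> tgt \<Gamma> e = v")
  case True
  then show ?thesis using assms(3) by blast
next
  case False
  then have no_loop: "{e \<in> edges \<Gamma>. src \<Gamma> e = v \<and> tgt \<Gamma> e = v} = {}" by blast
  have "3 \<le> card {e \<in> edges \<Gamma>. incident \<Gamma> e v}"
    using degree_eq[OF assms(1), of v] assms(2) unfolding no_loop by simp
  then have "2 \<le> card ({e \<in> edges \<Gamma>. incident \<Gamma> e v} - {f})"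
    using diff_card_le_card_Diff[of "{f}" "{e \<in> edges \<Gamma>. incident \<Gamma> e v}"] by simp
  then obtain e1 e2 where "e1 \<in> {e \<in> edges \<Gamma>. incident \<Gamma> e v} - {f}" "e2 \<in> {e \<in> edges \<Gamma>. incident \<Gamma> e v} - {f}" "e1 \<noteq> e2"
    by (rule two_le_cardE)
  then show ?thesis by blast
qed

context metric_graph
begin

lemma finite_graph: "finite_graph \<Gamma>"
  using finite_verts finite_edges src_in_verts tgt_in_verts by (auto simp: finite_graph_def)

lemma verts_nonempty: "verts \<Gamma> \<noteq> {}"
  using edges_nonempty src_in_verts by blast

lemma degree_pos:
  assumes "v \<in> verts \<Gamma>"
  shows "1 \<le> degree \<Gamma> v"
proof -
  obtain e where "e \<in> edges \<Gamma>" "incident \<Gamma> e v"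
    using no_isolated_verts[OF assms] by (auto simp: incident_def)
  then show ?thesis using degree_ge_card[OF finite_edges, of "{e}" v] by simp
qed

lemma handshake: "(\<Sum>v\<in>verts \<Gamma>. degree \<Gamma> v) = 2 * card (edges \<Gamma>)"
proof -
  have "(\<Sum>v\<in>verts \<Gamma>. \<Sum>e | e \<in> edges \<Gamma> \<and> src \<Gamma> e = v. 1) = (\<Sum>e\<in>edges \<Gamma>. 1 :: nat)"
    by (rule sum.group) (use finite_edges finite_verts src_in_verts in auto)
  moreover have "(\<Sum>v\<in>verts \<Gamma>. \<Sum>e | e \<in> edges \<Gamma> \<and> tgt \<Gamma> e = v. 1) = (\<Sum>e\<in>edges \<Gamma>. 1 :: nat)"
    by (rule sum.group) (use finite_edges finite_verts tgt_in_verts in auto)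
  ultimately show ?thesis by (simp add: degree_def sum.distrib)
qed

text \<open>A vertex set closed under edges, with the interiors of the edges starting in it, is open
  in the glued space, and so is the set belonging to the complement; hence it is clopen.\<close>

lemma connected_imp_comb_connected:
  assumes "graph_connected \<Gamma>"
  shows "comb_connected \<Gamma>"
  unfolding comb_connected_def
proof (intro allI impI)
  fix S assume S: "S \<subseteq> verts \<Gamma>" "S \<noteq> {}" and cl: "\<forall>e\<in>edges \<Gamma>. (src \<Gamma> e \<in> S) = (tgt \<Gamma> e \<in> S)"
  define U where "U T = Vertex ` T \<union> {Inner e t | e t. e \<in> edges \<Gamma> \<and> src \<Gamma> e \<in> T \<and> 0 < t \<and> t < len \<Gamma> e}" for T
  have op: "openin (graph_topology \<Gamma>) (U T)"
    if T: "T \<subseteq> verts \<Gamma>" and Tcl: "\<forall>e\<in>edges \<Gamma>. (src \<Gamma> e \<in> T) = (tgt \<Gamma> e \<in> T)" for T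
    unfolding openin_graph_topology
  proof (intro conjI ballI)
    show "U T \<subseteq> points \<Gamma>" using T by (auto simp: U_def points_def)
    fix e assume e: "e \<in> edges \<Gamma>"
    have "edge_preimage \<Gamma> e (U T) = (if src \<Gamma> e \<in> T then {0..len \<Gamma> e} else {})"
      using Tcl e len_pos[OF e] by (auto simp: edge_preimage_def edge_point_def U_def)
    then show "openin (top_of_set {0..len \<Gamma> e}) (edge_preimage \<Gamma> e (U T))" by simp
  qed
  have compl: "points \<Gamma> - U S = U (verts \<Gamma> - S)"
    using S src_in_verts by (auto simp: U_def points_def)
  have "openin (graph_topology \<Gamma>) (points \<Gamma> - U S)"
    unfolding compl by (rule op) (use cl src_in_verts tgt_in_verts in auto)
  moreover have "U S \<subseteq> points \<Gamma>" using S by (auto simp: U_def points_def)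
  ultimately have "closedin (graph_topology \<Gamma>) (U S)"
    by (simp add: closedin_def topspace_graph_topology)
  moreover have "openin (graph_topology \<Gamma>) (U S)" using op[OF S(1) cl] .
  ultimately have "U S = {} \<or> U S = points \<Gamma>"
    using assms unfolding graph_connected_def connected_space_clopen_in topspace_graph_topology by blast
  moreover have "U S \<noteq> {}" using S(2) by (auto simp: U_def)
  ultimately have US: "U S = points \<Gamma>" by blast
  have "v \<in> S" if "v \<in> verts \<Gamma>" for v
  proof -
    have "Vertex v \<in> U S" unfolding US using that by (simp add: points_def)
    then show ?thesis by (auto simp: U_def)
  qed
  then show "S = verts \<Gamma>" using S(1) by blast
qed

lemma betti_nonneg: "graph_connected \<Gamma> \<Longrightarrow> 0 \<le> betti \<Gamma>"
  using comb_connected_card_verts[OF finite_graph connected_imp_comb_connected] by (simp add: betti_def)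

text \<open>By the handshake identity 2|V| is at most 2|E| + P, since only pendants have degree
  below 2; for \<beta> = 0 the number of vertices is |E| + 1.\<close>

lemma pendants_tree:
  assumes "betti \<Gamma> = 0"
  shows "2 \<le> card (pendants \<Gamma>)"
proof -
  have "2 \<le> degree \<Gamma> v + (if v \<in> pendants \<Gamma> then 1 else 0)" if "v \<in> verts \<Gamma>" for v
    using degree_pos[OF that] that by (auto simp: pendants_def)
  then have "(\<Sum>v\<in>verts \<Gamma>. 2) \<le> (\<Sum>v\<in>verts \<Gamma>. degree \<Gamma> v + (if v \<in> pendants \<Gamma> then 1 else 0))"
    by (rule sum_mono)
  also have "\<dots> = 2 * card (edges \<Gamma>) + card (pendants \<Gamma>)"
  proof -
    have "(\<Sum>v\<in>verts \<Gamma>. if v \<in> pendants \<Gamma> then 1 else 0) = card (verts \<Gamma> \<inter> pendants \<Gamma>)"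
      using finite_verts by (simp add: sum.If_cases)
    moreover have "verts \<Gamma> \<inter> pendants \<Gamma> = pendants \<Gamma>" by (auto simp: pendants_def)
    ultimately show ?thesis by (simp add: sum.distrib handshake)
  qed
  finally show ?thesis using assms by (simp add: betti_def)
qed


section \<open>A graph all of whose degrees are two is a circle\<close>

lemma points_eq_Union_edges: "points \<Gamma> = (\<Union>e\<in>edges \<Gamma>. edge_point \<Gamma> e ` {0..len \<Gamma> e})"
proof
  show "points \<Gamma> \<subseteq> (\<Union>e\<in>edges \<Gamma>. edge_point \<Gamma> e ` {0..len \<Gamma> e})"
  proof
    fix p assume "p \<in> points \<Gamma>"
    then consider v where "v \<in> verts \<Gamma>" "p = Vertex v"
      | e t where "e \<in> edges \<Gamma>" "0 < t" "t < len \<Gamma> e" "p = Inner e t" by (auto simp: points_def)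
    then show "p \<in> (\<Union>e\<in>edges \<Gamma>. edge_point \<Gamma> e ` {0..len \<Gamma> e})"
    proof cases
      case 1
      then obtain e where e: "e \<in> edges \<Gamma>" "src \<Gamma> e = v \<or> tgt \<Gamma> e = v" using no_isolated_verts by blast
      then have "p = edge_point \<Gamma> e 0 \<or> p = edge_point \<Gamma> e (len \<Gamma> e)"
        using 1 len_pos[OF e(1)] by (auto simp: edge_point_def)
      then show ?thesis using e(1) len_pos[OF e(1)] by force
    next
      case 2
      then have "p = edge_point \<Gamma> e t" by (simp add: edge_point_def)
      then show ?thesis using 2(1-3) by (intro UN_I[of e] image_eqI[of _ _ t]) simp_all
    qed
  qed
qed (use edge_point_in_points in auto)

text \<open>Compactness is what makes a continuous bijection onto the circle a
  homeomorphism.\<close>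

lemma compact_space_graph: "compact_space (graph_topology \<Gamma>)"
  unfolding compact_space_def topspace_graph_topology points_eq_Union_edges
proof (rule compactin_Union)
  fix K assume "K \<in> (\<lambda>e. edge_point \<Gamma> e ` {0..len \<Gamma> e}) ` edges \<Gamma>"
  then obtain e where e: "e \<in> edges \<Gamma>" "K = edge_point \<Gamma> e ` {0..len \<Gamma> e}" by blast
  have "compactin (top_of_set {0..len \<Gamma> e}) {0..len \<Gamma> e}"
    by (simp add: compactin_subtopology)
  moreover have "continuous_map (top_of_set {0..len \<Gamma> e}) (graph_topology \<Gamma>) (edge_point \<Gamma> e)"
    using e(1) edge_point_in_points[OF e(1)]
    by (auto simp: continuous_map_def topspace_graph_topology openin_graph_topology edge_preimage_def)
  ultimately show "compactin (graph_topology \<Gamma>) K" unfolding e(2) by (rule image_compactin)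
qed (use finite_edges in auto)

lemma degree_two_no_third_edge:
  assumes "degree \<Gamma> v = 2" "e1 \<in> edges \<Gamma>" "e2 \<in> edges \<Gamma>" "e3 \<in> edges \<Gamma>"
    and "incident \<Gamma> e1 v" "incident \<Gamma> e2 v" "incident \<Gamma> e3 v" "e1 \<noteq> e2"
  shows "e3 = e1 \<or> e3 = e2"
proof (rule ccontr)
  assume "\<not> ?thesis"
  then have "card {e1, e2, e3} = 3" using assms(8) by auto
  then show False using degree_ge_card[OF finite_edges, of "{e1, e2, e3}" v] assms by auto
qed

lemma degree_two_loop:
  assumes "degree \<Gamma> v = 2" "l \<in> edges \<Gamma>" "src \<Gamma> l = v" "tgt \<Gamma> l = v" "e \<in> edges \<Gamma>" "incident \<Gamma> e v"
  shows "e = l"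
proof (rule ccontr)
  assume "e \<noteq> l"
  then have "card {e, l} = 2" by auto
  then show False
    using degree_ge_card_loop[OF finite_edges, of "{e, l}" v l] assms by (auto simp: incident_def)
qed

text \<open>The last vertex of a longest path has one more edge, which must return to the path, and
  can do so only at its first vertex. The closed path uses up both edge ends at each of its
  vertices, so by connectedness it is the whole graph. A single loop is the case of length
  1.\<close>

lemma degree_two_cyclic_order:
  assumes conn: "comb_connected \<Gamma>" and deg: "\<forall>v\<in>verts \<Gamma>. degree \<Gamma> v = 2"
  obtains vs es where "es \<noteq> []" "length vs = length es" "distinct vs" "distinct es"
    "set vs = verts \<Gamma>" "set es = edges \<Gamma>"
    "\<And>i. i < length es \<Longrightarrow> joins \<Gamma> (es ! i) (vs ! i) (vs ! (Suc i mod length es))"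
proof -
  obtain r where "r \<in> verts \<Gamma>" using verts_nonempty by blast
  from maximal_simple_path[OF finite_graph this] obtain vs es where p: "simple_path \<Gamma> vs es"
    and max: "\<forall>e\<in>edges \<Gamma>. \<forall>u. joins \<Gamma> e (vs ! length es) u \<longrightarrow> u \<in> set vs" by blast
  note ps = simple_path_simps[OF p]
  let ?m = "length es"
  define w where "w = vs ! ?m"
  have vsv: "vs ! i \<in> verts \<Gamma>" if "i \<le> ?m" for i
    using ps(1,3) nth_mem[of i vs] that by auto
  have w: "w \<in> verts \<Gamma>" unfolding w_def by (rule vsv) simp
  have ese: "es ! i \<in> edges \<Gamma>" if "i < ?m" for i using nth_mem[OF that] ps(4) by blast
  have "\<exists>e. e \<in> edges \<Gamma> \<and> incident \<Gamma> e w \<and> e \<notin> set es"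
  proof (cases "?m = 0")
    case True
    then show ?thesis using no_isolated_verts[OF w] by (auto simp: incident_def)
  next
    case False
    then have m: "?m - 1 < ?m" "Suc (?m - 1) = ?m" by auto
    let ?f = "es ! (?m - 1)"
    have jf: "joins \<Gamma> ?f (vs ! (?m - 1)) w" using ps(5)[OF m(1)] m(2) by (simp add: w_def)
    have uw: "vs ! (?m - 1) \<noteq> w"
      unfolding w_def using nth_eq_iff_index_eq[OF ps(2), of "?m - 1" ?m] ps(1) m by auto
    have "(\<exists>e\<in>edges \<Gamma>. src \<Gamma> e = w \<and> tgt \<Gamma> e = w) \<or>
      (\<exists>e1\<in>edges \<Gamma>. \<exists>e2\<in>edges \<Gamma>. e1 \<noteq> e2 \<and> incident \<Gamma> e1 w \<and> incident \<Gamma> e2 w)"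
      by (rule degree_ge_two_cases[OF finite_edges]) (use deg w in simp)
    then have "\<exists>e\<in>edges \<Gamma>. incident \<Gamma> e w \<and> e \<noteq> ?f"
    proof (elim disjE bexE conjE)
      fix e assume "e \<in> edges \<Gamma>" "src \<Gamma> e = w" "tgt \<Gamma> e = w"
      moreover from this have "e \<noteq> ?f" using jf uw by (auto simp: joins_def)
      ultimately show ?thesis by (auto simp: incident_def)
    next
      fix e1 e2 assume "e1 \<in> edges \<Gamma>" "e2 \<in> edges \<Gamma>" "e1 \<noteq> e2" "incident \<Gamma> e1 w" "incident \<Gamma> e2 w"
      then show ?thesis by metis
    qed
    then obtain e where e: "e \<in> edges \<Gamma>" "incident \<Gamma> e w" "e \<noteq> ?f" by blast
    have "e \<notin> set es"
    proof
      assume "e \<in> set es"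
      then obtain k where k: "k < ?m" "e = es ! k" by (auto simp: in_set_conv_nth)
      then have "?m = k \<or> ?m = Suc k" using simple_path_incident[OF p k(1), of ?m] e(2) by (simp add: w_def)
      then have "k = ?m - 1" using k(1) by auto
      then show False using e(3) k(2) by simp
    qed
    then show ?thesis using e by blast
  qed
  then obtain e where e: "e \<in> edges \<Gamma>" "incident \<Gamma> e w" "e \<notin> set es" by blast
  then obtain v where j: "joins \<Gamma> e w v" using joins_incident(3) by metis
  then have "v \<in> set vs" using max e(1) by (simp add: w_def)
  then obtain i where i: "i \<le> ?m" "v = vs ! i" using ps(1) by (metis in_set_conv_nth less_Suc_eq_le)
  \<comment> \<open>At an inner vertex the new edge would be a third one; at the last vertex it
    would be a loop in addition to a path edge. Both exceed degree 2.\<close>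
  have i0: "i = 0"
  proof (rule ccontr)
    assume "i \<noteq> 0"
    then have i1: "i - 1 < ?m" "Suc (i - 1) = i" using i(1) by auto
    have a: "es ! (i - 1) \<in> edges \<Gamma>" "incident \<Gamma> (es ! (i - 1)) v" "es ! (i - 1) \<noteq> e"
      using ese[OF i1(1)] joins_incident(2)[OF ps(5)[OF i1(1)]] i1(2) i(2) e(3) nth_mem[OF i1(1)] by auto
    have dv: "degree \<Gamma> v = 2" using deg vsv[OF i(1)] i(2) by simp
    show False
    proof (cases "i = ?m")
      case True
      then have "src \<Gamma> e = v" "tgt \<Gamma> e = v" using j i(2) by (auto simp: joins_def w_def)
      then show False using degree_two_loop[OF dv e(1) _ _ a(1,2)] a(3) by blast
    next
      case False
      then have i2: "i < ?m" using i(1) by simp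
      have b: "es ! i \<in> edges \<Gamma>" "incident \<Gamma> (es ! i) v" "es ! i \<noteq> e"
        using ese[OF i2] joins_incident(1)[OF ps(5)[OF i2]] i(2) e(3) nth_mem[OF i2] by auto
      have "es ! (i - 1) \<noteq> es ! i" using simple_path_edges_distinct[OF p i1(1) i2] i1(2) by auto
      from degree_two_no_third_edge[OF dv a(1) b(1) e(1) a(2) b(2) joins_incident(2)[OF j] this]
      show False using a(3) b(3) by blast
    qed
  qed
  have v0: "v = vs ! 0" using i(2) i0 by simp
  define es' where "es' = es @ [e]"
  have len: "length es' = Suc ?m" by (simp add: es'_def)
  have es_dist: "distinct es"
    unfolding distinct_conv_nth using simple_path_edges_distinct[OF p] by blast
  have js: "joins \<Gamma> (es' ! i) (vs ! i) (vs ! (Suc i mod length es'))" if "i < length es'" for i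
  proof (cases "i < ?m")
    case True
    then show ?thesis using ps(5)[OF True] by (simp add: es'_def nth_append)
  next
    case False
    then have "i = ?m" using that by (simp add: len)
    then show ?thesis using j v0 by (simp add: es'_def w_def)
  qed
  have es'E: "set es' \<subseteq> edges \<Gamma>" using ps(4) e(1) by (simp add: es'_def)
  have es'd: "distinct es'" using es_dist e(3) by (simp add: es'_def)
  have closed: "f \<in> set es'" if f: "f \<in> edges \<Gamma>" "incident \<Gamma> f u" "u \<in> set vs" for f u
  proof -
    obtain i where i: "i < length es'" "u = vs ! i" using f(3) ps(1) len by (auto simp: in_set_conv_nth)
    have du: "degree \<Gamma> u = 2" using deg f(3) ps(3) by blast
    have mem: "es' ! k \<in> edges \<Gamma>" "es' ! k \<in> set es'" if "k < length es'" for k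
      using nth_mem[OF that] es'E by auto
    show ?thesis
    proof (cases "?m = 0")
      case True
      then have "joins \<Gamma> (es' ! 0) u u" using js[of 0] len i by simp
      then have "f = es' ! 0"
        using degree_two_loop[OF du mem(1)[of 0] _ _ f(1,2)] len by (auto simp: joins_def)
      then show ?thesis using mem(2)[of 0] len by simp
    next
      case False
      define l where "l = (if i = 0 then ?m else i - 1)"
      have l: "l < length es'" "l \<noteq> i" "Suc l mod length es' = i"
        using i(1) False by (auto simp: l_def len)
      have "es' ! i \<noteq> es' ! l" using nth_eq_iff_index_eq[OF es'd i(1) l(1)] l(2) by simp
      from degree_two_no_third_edge[OF du mem(1)[OF i(1)] mem(1)[OF l(1)] f(1) _ _ f(2) this]
      have "f = es' ! i \<or> f = es' ! l"
        using joins_incident(1)[OF js[OF i(1)]] joins_incident(2)[OF js[OF l(1)]] l(3) i(2) by simp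
      then show ?thesis using mem(2) i(1) l(1) by blast
    qed
  qed
  have ends: "src \<Gamma> f \<in> set vs \<and> tgt \<Gamma> f \<in> set vs" if "f \<in> set es'" for f
  proof -
    obtain i where i: "i < length es'" "f = es' ! i" using \<open>f \<in> set es'\<close> by (metis in_set_conv_nth)
    have "vs ! i \<in> set vs" "vs ! (Suc i mod length es') \<in> set vs"
      using ps(1) len i(1) by (auto intro!: nth_mem)
    then show ?thesis using js[OF i(1)] i(2) by (auto simp: joins_def)
  qed
  have V: "set vs = verts \<Gamma>"
  proof -
    have "set vs \<noteq> {}" using ps(1) by auto
    moreover have "\<forall>f\<in>edges \<Gamma>. (src \<Gamma> f \<in> set vs) = (tgt \<Gamma> f \<in> set vs)"
      using closed ends unfolding incident_def by blast
    ultimately show ?thesis using conn ps(3) unfolding comb_connected_def by blast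
  qed
  have E: "set es' = edges \<Gamma>"
  proof
    show "edges \<Gamma> \<subseteq> set es'"
    proof
      fix f assume f: "f \<in> edges \<Gamma>"
      then show "f \<in> set es'" using closed[OF f, of "src \<Gamma> f"] src_in_verts[OF f] V by (simp add: incident_def)
    qed
  qed (rule es'E)
  have "es' \<noteq> []" "length vs = length es'" using len ps(1) by auto
  from that[OF this ps(2) es'd V E js] show thesis .
qed

text \<open>The circle is divided into n equal sectors; the i-th vertex goes to the start of sector
  i, and the i-th edge is spread affinely over that sector.\<close>

lemma cyclic_order_imp_cycle:
  assumes ne: "es \<noteq> []" and lvs: "length vs = length es" and dist: "distinct vs" "distinct es"
    and V: "set vs = verts \<Gamma>" and E: "set es = edges \<Gamma>"
    and js: "\<And>i. i < length es \<Longrightarrow> joins \<Gamma> (es ! i) (vs ! i) (vs ! (Suc i mod length es))"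
  shows "graph_cycle \<Gamma>"
proof -
  define n where "n = length es"
  have n: "0 < n" using ne by (simp add: n_def)
  define iv where "iv = inv_into {..<n} ((!) vs)"
  define ie where "ie = inv_into {..<n} ((!) es)"
  have iv: "iv (vs ! i) = i" if "i < n" for i
    unfolding iv_def by (rule inv_into_f_f) (use that dist lvs in \<open>auto simp: n_def intro!: inj_on_nth\<close>)
  have ie: "ie (es ! i) = i" if "i < n" for i
    unfolding ie_def by (rule inv_into_f_f) (use that dist in \<open>auto simp: n_def intro!: inj_on_nth\<close>)
  have ee: "es ! i \<in> edges \<Gamma>" if "i < n" for i using that E nth_mem[of i es] by (simp add: n_def)
  \<comment> \<open>Edges are parametrized along their own orientation, which may run against the
    cyclic order; \<sigma> corrects this and is its own inverse.\<close>
  define \<sigma> where "\<sigma> e s = (if src \<Gamma> e = vs ! ie e then s else 1 - s)" for e and s :: real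
  have \<sigma>\<sigma>: "\<sigma> e (\<sigma> e s) = s" for e s by (simp add: \<sigma>_def)
  have \<sigma>01: "0 < \<sigma> e s \<and> \<sigma> e s < 1" if "0 < s" "s < 1" for e s using that by (simp add: \<sigma>_def)
  define \<theta> where "\<theta> p = (case p of Vertex v \<Rightarrow> real (iv v) | Inner e t \<Rightarrow> real (ie e) + \<sigma> e (t / len \<Gamma> e))" for p
  define h where "h p = cis (2 * pi * \<theta> p / n)" for p
  have \<theta>V: "\<theta> (Vertex (vs ! i)) = i" if "i < n" for i using iv[OF that] by (simp add: \<theta>_def)
  have \<theta>E: "\<theta> (Inner (es ! i) t) = i + \<sigma> (es ! i) (t / len \<Gamma> (es ! i))" if "i < n" for i t
    using ie[OF that] by (simp add: \<theta>_def)
  have wrap: "cis (2 * pi * (Suc i mod n) / n) = cis (2 * pi * (real i + 1) / n)" if "i < n" for i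
  proof (cases "Suc i = n")
    case True
    then have "real i + 1 = real n" by (simp add: add.commute)
    then show ?thesis using True n by (simp only: mod_self) simp
  next
    case False
    then show ?thesis using that by (simp add: add.commute)
  qed
  have hE: "h (edge_point \<Gamma> (es ! i) t) = cis (2 * pi * (i + \<sigma> (es ! i) (t / len \<Gamma> (es ! i))) / n)"
    if i: "i < n" and t: "t \<in> {0..len \<Gamma> (es ! i)}" for i t
  proof -
    have l: "0 < len \<Gamma> (es ! i)" using len_pos ee[OF i] by blast
    have j: "joins \<Gamma> (es ! i) (vs ! i) (vs ! (Suc i mod n))" using js i by (simp add: n_def)
    have i': "Suc i mod n < n" using n by simp
    have hV: "h (Vertex (vs ! i)) = cis (2 * pi * i / n)"
      "h (Vertex (vs ! (Suc i mod n))) = cis (2 * pi * (real i + 1) / n)"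
      using wrap[OF i] by (simp_all only: h_def \<theta>V[OF i] \<theta>V[OF i'])
    have fwd: "src \<Gamma> (es ! i) = vs ! i \<and> tgt \<Gamma> (es ! i) = vs ! (Suc i mod n) \<and> \<sigma> (es ! i) = (\<lambda>s. s) \<or>
      src \<Gamma> (es ! i) = vs ! (Suc i mod n) \<and> tgt \<Gamma> (es ! i) = vs ! i \<and> \<sigma> (es ! i) = (\<lambda>s. 1 - s)"
      using j unfolding joins_def \<sigma>_def ie[OF i] by (cases "src \<Gamma> (es ! i) = vs ! i") auto
    consider "t = 0" | "t = len \<Gamma> (es ! i)" | "0 < t" "t < len \<Gamma> (es ! i)" using t by fastforce
    then show ?thesis
    proof cases
      case 1
      then have "h (edge_point \<Gamma> (es ! i) t) = h (Vertex (src \<Gamma> (es ! i)))" by (simp add: edge_point_def)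
      then show ?thesis using fwd hV 1 by (elim disjE conjE) simp_all
    next
      case 2
      then have "h (edge_point \<Gamma> (es ! i) t) = h (Vertex (tgt \<Gamma> (es ! i)))" using l by (simp add: edge_point_def)
      moreover have "t / len \<Gamma> (es ! i) = 1" using 2 l by simp
      ultimately show ?thesis using fwd hV by (elim disjE conjE) simp_all
    next
      case 3
      then show ?thesis using \<theta>E[OF i, of t] by (simp add: h_def edge_point_def)
    qed
  qed
  have cont: "continuous_map (graph_topology \<Gamma>) euclidean h"
  proof (rule continuous_map_graph)
    fix e assume "e \<in> edges \<Gamma>"
    then obtain i where i: "i < n" "e = es ! i" using E by (metis in_set_conv_nth n_def)
    have "continuous_on {0..len \<Gamma> e} (\<lambda>t. cis (2 * pi * (i + \<sigma> e (t / len \<Gamma> e)) / n))"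
      unfolding \<sigma>_def using len_pos[OF \<open>e \<in> edges \<Gamma>\<close>] n by (cases "src \<Gamma> e = vs ! ie e") (auto intro!: continuous_intros)
    then show "continuous_on {0..len \<Gamma> e} (\<lambda>t. h (edge_point \<Gamma> e t))"
      by (rule continuous_on_cong[THEN iffD1, rotated 2]) (use hE i in auto)
  qed
  \<comment> \<open>Vertices have integer \<theta>, and interior points of edge i lie strictly
    between i and i + 1; hence the integer part of \<theta> identifies the vertex or the
    edge.\<close>
  have pt: "(\<exists>i<n. p = Vertex (vs ! i) \<and> \<theta> p = i) \<or>
    (\<exists>i<n. \<exists>t. p = Inner (es ! i) t \<and> \<theta> p = i + \<sigma> (es ! i) (t / len \<Gamma> (es ! i)) \<and> i < \<theta> p \<and> \<theta> p < i + 1)"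
    if p: "p \<in> points \<Gamma>" for p
  proof -
    consider v where "v \<in> verts \<Gamma>" "p = Vertex v"
      | e t where "e \<in> edges \<Gamma>" "0 < t" "t < len \<Gamma> e" "p = Inner e t" using p by (auto simp: points_def)
    then show ?thesis
    proof cases
      case 1
      then obtain i where "i < n" "v = vs ! i" using V lvs by (metis in_set_conv_nth n_def)
      then show ?thesis using 1 \<theta>V by blast
    next
      case 2
      then obtain i where i: "i < n" "e = es ! i" using E by (metis in_set_conv_nth n_def)
      have "0 < \<sigma> e (t / len \<Gamma> e) \<and> \<sigma> e (t / len \<Gamma> e) < 1" by (rule \<sigma>01) (use 2 in auto)
      then show ?thesis using 2 i \<theta>E[OF i(1), of t] by auto
    qed
  qed
  have \<theta>_range: "0 \<le> \<theta> p \<and> \<theta> p < n" if "p \<in> points \<Gamma>" for p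
    using pt[OF that]
  proof (elim disjE exE conjE)
    fix i assume "i < n" "\<theta> p = real i"
    then show ?thesis by simp
  next
    fix i assume i: "i < n" "real i < \<theta> p" "\<theta> p < real i + 1"
    then have "real i + 1 \<le> n" by linarith
    then show ?thesis using i by linarith
  qed
  have \<theta>_inj: "p = q" if p: "p \<in> points \<Gamma>" and q: "q \<in> points \<Gamma>" and eq: "\<theta> p = \<theta> q" for p q
    using pt[OF p] pt[OF q]
  proof (elim disjE exE conjE)
    fix i j assume "p = Vertex (vs ! i)" "\<theta> p = real i" "q = Vertex (vs ! j)" "\<theta> q = real j"
    then show ?thesis using eq by simp
  next
    fix i j assume "\<theta> p = real i" "real j < \<theta> q" "\<theta> q < real j + 1"
    then have "real j < real i" "real i < real (Suc j)" using eq by simp_all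
    then have False unfolding of_nat_less_iff by linarith
    then show ?thesis ..
  next
    fix i j assume "\<theta> q = real i" "real j < \<theta> p" "\<theta> p < real j + 1"
    then have "real j < real i" "real i < real (Suc j)" using eq by simp_all
    then have False unfolding of_nat_less_iff by linarith
    then show ?thesis ..
  next
    fix i j t s
    assume a: "i < n" "p = Inner (es ! i) t" "\<theta> p = real i + \<sigma> (es ! i) (t / len \<Gamma> (es ! i))" "real i < \<theta> p" "\<theta> p < real i + 1"
      and b: "q = Inner (es ! j) s" "\<theta> q = real j + \<sigma> (es ! j) (s / len \<Gamma> (es ! j))" "real j < \<theta> q" "\<theta> q < real j + 1"
    have "real i < real j + 1" "real j < real i + 1" using a b eq by linarith+
    then have ij: "j = i" by linarith
    have "\<sigma> (es ! i) (t / len \<Gamma> (es ! i)) = \<sigma> (es ! i) (s / len \<Gamma> (es ! i))" using a(3) b(2) eq ij by simp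
    then have "t / len \<Gamma> (es ! i) = s / len \<Gamma> (es ! i)" by (metis \<sigma>\<sigma>)
    then have "t = s" using len_pos[OF ee[OF a(1)]] by simp
    then show ?thesis using a(2) b(1) ij by simp
  qed
  have inj: "inj_on h (points \<Gamma>)"
  proof (rule inj_onI)
    fix p q assume p: "p \<in> points \<Gamma>" and q: "q \<in> points \<Gamma>" and "h p = h q"
    then have A: "exp (\<i> * complex_of_real (2 * pi * \<theta> p / n)) = exp (\<i> * complex_of_real (2 * pi * \<theta> q / n))"
      by (simp add: h_def cis_conv_exp)
    have B: "\<bar>2 * pi * \<theta> p / n - 2 * pi * \<theta> q / n\<bar> < 2 * pi"
    proof -
      have "\<bar>\<theta> p - \<theta> q\<bar> < n" using \<theta>_range[OF p] \<theta>_range[OF q] by linarith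
      then have "2 * pi * \<bar>\<theta> p - \<theta> q\<bar> / n < 2 * pi" using n by (simp add: divide_simps)
      moreover have "2 * pi * \<theta> p / n - 2 * pi * \<theta> q / n = 2 * pi * (\<theta> p - \<theta> q) / n"
        by (simp add: diff_divide_distrib right_diff_distrib)
      ultimately show ?thesis by (simp add: abs_mult)
    qed
    have "\<i> * complex_of_real (2 * pi * \<theta> p / n) = \<i> * complex_of_real (2 * pi * \<theta> q / n)"
      by (rule exp_complex_eqI[OF _ A]) (use B in simp)
    then have "2 * pi * \<theta> p / n = 2 * pi * \<theta> q / n" by (metis mult_cancel_left complex_i_not_zero of_real_eq_iff)
    then have "\<theta> p = \<theta> q" using n by simp
    then show "p = q" by (rule \<theta>_inj[OF p q])
  qed
  have "h ` points \<Gamma> = sphere 0 1"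
  proof
    show "h ` points \<Gamma> \<subseteq> sphere 0 1" by (auto simp: h_def)
    show "sphere 0 1 \<subseteq> h ` points \<Gamma>"
    proof
      fix z :: complex assume "z \<in> sphere 0 1"
      then have z: "z = cis (Arg2pi z)" using Arg2pi_eq[of z] by (simp add: cis_conv_exp)
      define x where "x = n * Arg2pi z / (2 * pi)"
      have x: "0 \<le> x" "x < n" using Arg2pi_ge_0[of z] Arg2pi_lt_2pi[of z] n by (simp_all add: x_def divide_simps)
      have zx: "z = cis (2 * pi * x / n)" using n z by (simp add: x_def)
      define i where "i = nat \<lfloor>x\<rfloor>"
      have i: "real i \<le> x" "x < real i + 1" "i < n" using x by (simp_all add: i_def) linarith+
      show "z \<in> h ` points \<Gamma>"
      proof (cases "x = i")
        case True
        have "Vertex (vs ! i) \<in> points \<Gamma>" using i(3) V lvs nth_mem[of i vs] by (simp add: points_def n_def)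
        moreover have "h (Vertex (vs ! i)) = z" using \<theta>V[OF i(3)] True zx by (simp add: h_def)
        ultimately show ?thesis by blast
      next
        case False
        then have s: "0 < x - i" "x - i < 1" using i by auto
        let ?e = "es ! i"
        have l: "0 < len \<Gamma> ?e" using len_pos ee[OF i(3)] by blast
        let ?t = "\<sigma> ?e (x - i) * len \<Gamma> ?e"
        have "Inner ?e ?t \<in> points \<Gamma>" using \<sigma>01[OF s, of ?e] ee[OF i(3)] l by (auto simp: points_def)
        moreover have "\<theta> (Inner ?e ?t) = x" using \<theta>E[OF i(3), of ?t] l \<sigma>\<sigma>[of ?e "x - i"] by simp
        then have "h (Inner ?e ?t) = z" using zx by (simp add: h_def)
        ultimately show ?thesis by blast
      qed
    qed
  qed
  then have "homeomorphic_map (graph_topology \<Gamma>) (top_of_set (sphere 0 1)) h"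
    using cont inj
    by (intro continuous_imp_homeomorphic_map[OF _ compact_space_graph])
      (auto simp: Hausdorff_space_subtopology topspace_graph_topology continuous_map_in_subtopology)
  then show ?thesis unfolding graph_cycle_def by (rule homeomorphic_map_imp_homeomorphic_space)
qed

lemma exists_degree_ne_two:
  assumes "graph_connected \<Gamma>" "\<not> graph_cycle \<Gamma>"
  shows "\<exists>v\<in>verts \<Gamma>. degree \<Gamma> v \<noteq> 2"
proof (rule ccontr)
  assume "\<not> ?thesis"
  then have "\<forall>v\<in>verts \<Gamma>. degree \<Gamma> v = 2" by blast
  from connected_imp_comb_connected[OF assms(1)] this show False
  proof (rule degree_two_cyclic_order)
    fix vs es
    assume "es \<noteq> []" "length vs = length es" "distinct vs" "distinct es" "set vs = verts \<Gamma>" "set es = edges \<Gamma>"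
      "\<And>i. i < length es \<Longrightarrow> joins \<Gamma> (es ! i) (vs ! i) (vs ! (Suc i mod length es))"
    then have "graph_cycle \<Gamma>" by (rule cyclic_order_imp_cycle)
    with assms(2) show False by blast
  qed
qed

lemma kirchhoff_neg_family:
  assumes conn: "graph_connected \<Gamma>" and nc: "\<not> graph_cycle \<Gamma>" and \<omega>: "0 < \<omega>"
    and ineq: "real k - 2 + real (card (pendants \<Gamma>)) / 2 + 3 / 2 * real_of_int (betti \<Gamma>) < total_length \<Gamma> * \<omega> / pi"
  shows "\<exists>\<phi>. neg_family (sobolev \<Gamma>) (defect \<Gamma> \<omega>) (vanishes \<Gamma>) k \<phi>"
proof -
  let ?V = "verts \<Gamma>" and ?E = "edges \<Gamma>"
  note cc = connected_imp_comb_connected[OF conn]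
  have pw0: "phase_weight 0 = - 1 / 2" by (simp add: phase_weight_def)
  have bt: "3 / 2 * real_of_int (betti \<Gamma>) = 3 / 2 * (real (card ?E) - real (card ?V) + 1)"
    by (simp add: betti_def)
  have Gs: "subgraph \<Gamma> ?V ?E = \<Gamma>" by simp
  show ?thesis
  proof (cases "pendants \<Gamma> = {}")
    case False
    then obtain r where r: "r \<in> pendants \<Gamma>" by blast
    have finP: "finite (pendants \<Gamma>)" using finite_verts by (simp add: pendants_def)
    have P: "real (card (pendants \<Gamma> - {r})) = real (card (pendants \<Gamma>)) - 1"
      using card.remove[OF finP r] by simp
    have "\<exists>\<phi>. neg_family (sobolev (subgraph \<Gamma> ?V ?E))
      (\<lambda>x. defect (subgraph \<Gamma> ?V ?E) \<omega> x + ((\<Sum>u\<in>?V. \<omega> * 0 * (val x u)\<^sup>2) + \<omega> * 0 * (val x r)\<^sup>2))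
      (vanishes (subgraph \<Gamma> ?V ?E)) k \<phi>"
    proof (rule neg_family_exists[OF \<omega>, where A = "pendants \<Gamma> - {r}"])
      show "finite_graph (subgraph \<Gamma> ?V ?E)" "comb_connected (subgraph \<Gamma> ?V ?E)"
        unfolding Gs by (rule finite_graph cc)+
      show "r \<in> ?V" "pendants \<Gamma> - {r} \<subseteq> ?V" using r by (auto simp: pendants_def)
      show "u \<in> pendants \<Gamma> - {r} \<or> u = r \<or> (\<exists>e\<in>?E. src \<Gamma> e = u \<and> tgt \<Gamma> e = u) \<or>
        (\<exists>e1\<in>?E. \<exists>e2\<in>?E. e1 \<noteq> e2 \<and> incident \<Gamma> e1 u \<and> incident \<Gamma> e2 u)" if u: "u \<in> ?V" for u
      proof (cases "u \<in> pendants \<Gamma>")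
        case False
        then have "2 \<le> degree \<Gamma> u" using degree_pos[OF u] u by (simp add: pendants_def)
        from degree_ge_two_cases[OF finite_edges this] show ?thesis by (elim disjE) simp_all
      qed blast
      show "?E \<noteq> {} \<or> r \<in> pendants \<Gamma> - {r}" using edges_nonempty by blast
      have sumP: "(\<Sum>u\<in>pendants \<Gamma> - {r}. phase_weight 0) = 1 / 2 - real (card (pendants \<Gamma>)) / 2"
        unfolding pw0 sum_constant P by (simp add: field_simps)
      show "real k - 2 < (\<Sum>e\<in>?E. len \<Gamma> e) * \<omega> / pi + (\<Sum>u\<in>pendants \<Gamma> - {r}. phase_weight 0) + phase_weight 0
        - 3 / 2 * (real (card ?E) - real (card ?V) + 1)"
        using sumP pw0 ineq[unfolded bt total_length_def] by argo
    qed (use len_pos in auto)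
    then show ?thesis by simp
  next
    case True
    then have deg2: "2 \<le> degree \<Gamma> u" if "u \<in> ?V" for u
      using degree_pos[OF that] that by (force simp: pendants_def)
    obtain r where r: "r \<in> ?V" "degree \<Gamma> r \<noteq> 2" using exists_degree_ne_two[OF conn nc] by blast
    then have deg3: "3 \<le> degree \<Gamma> r" using deg2[of r] by simp
    from graph_reduction[OF finite_graph cc r(1) edges_nonempty] obtain e w v where
      e: "e \<in> ?E" and w: "w \<in> ?V" and v: "v \<in> ?V" and j: "joins \<Gamma> e w v"
      and alt: "v \<noteq> w \<and> v \<noteq> r \<and> (\<forall>f\<in>?E. incident \<Gamma> f v \<longrightarrow> f = e) \<or>
        comb_connected (\<Gamma>\<lparr>edges := ?E - {e}\<rparr>) \<and> (v = r \<or> v = w \<or>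
         (\<exists>e1\<in>?E - {e}. \<exists>e2\<in>?E - {e}. e1 \<noteq> e2 \<and> incident \<Gamma> e1 v \<and> incident \<Gamma> e2 v))"
      by blast
    have "\<not> (v \<noteq> w \<and> v \<noteq> r \<and> (\<forall>f\<in>?E. incident \<Gamma> f v \<longrightarrow> f = e))"
    proof
      assume a: "v \<noteq> w \<and> v \<noteq> r \<and> (\<forall>f\<in>?E. incident \<Gamma> f v \<longrightarrow> f = e)"
      from degree_ge_two_cases[OF finite_edges deg2[OF v]] show False
      proof (elim disjE bexE conjE)
        fix f assume f: "f \<in> ?E" "src \<Gamma> f = v" "tgt \<Gamma> f = v"
        then have "f = e" using a unfolding incident_def by blast
        then show False using f j a unfolding joins_def by metis
      next
        fix f g assume "f \<in> ?E" "g \<in> ?E" "f \<noteq> g" "incident \<Gamma> f v" "incident \<Gamma> g v"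
        then show False using a by metis
      qed
    qed
    then have conn1: "comb_connected (\<Gamma>\<lparr>edges := ?E - {e}\<rparr>)" and vdeg: "v = r \<or> v = w \<or>
         (\<exists>e1\<in>?E - {e}. \<exists>e2\<in>?E - {e}. e1 \<noteq> e2 \<and> incident \<Gamma> e1 v \<and> incident \<Gamma> e2 v)"
      using alt by blast+
    let ?F = "?E - {e}"
    have F: "finite ?F" "e \<notin> ?F" "insert e ?F = ?E" using finite_edges e by auto
    have Fs: "subgraph \<Gamma> ?V ?F = \<Gamma>\<lparr>edges := ?F\<rparr>" by simp
    have cF: "real (card ?F) = real (card ?E) - 1" using card.remove[OF finite_edges e] by simp
    have lenE: "total_length \<Gamma> = len \<Gamma> e + (\<Sum>f\<in>?F. len \<Gamma> f)"
      unfolding total_length_def by (rule sum.remove[OF finite_edges e])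
    define far where "far = (if src \<Gamma> e = v \<and> tgt \<Gamma> e = w then 0 else len \<Gamma> e)"
    have far: "far = 0 \<or> far = len \<Gamma> e"
      "far = 0 \<and> src \<Gamma> e = v \<and> tgt \<Gamma> e = w \<or> far = len \<Gamma> e \<and> tgt \<Gamma> e = v \<and> src \<Gamma> e = w"
      using j by (auto simp: far_def joins_def)
    define \<epsilon> where "\<epsilon> = (total_length \<Gamma> * \<omega> / pi - (real k - 2 + 3 / 2 * real_of_int (betti \<Gamma>))) / 2"
    have \<epsilon>: "0 < \<epsilon>" using ineq True by (simp add: \<epsilon>_def)
    have F_ne: "?F \<noteq> {}"
    proof
      assume "?F = {}"
      then have "?E = {e}" using e by blast
      then have "(\<Sum>u\<in>?V. degree \<Gamma> u) = 2" using handshake by simp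
      moreover have "degree \<Gamma> r \<le> (\<Sum>u\<in>?V. degree \<Gamma> u)" by (rule member_le_sum) (use r finite_verts in auto)
      ultimately show False using deg3 by simp
    qed
    from extend_over_edge[OF \<omega> len_pos[OF e] \<epsilon> far(1) F(1,2), of 0] obtain n :: nat and y' where
      wt: "phase_weight 0 + len \<Gamma> e * \<omega> / pi - n - \<epsilon> \<le> phase_weight y'" and
      ext: "\<And>V w L v' (Q :: ('v \<Rightarrow> real) \<Rightarrow> real) k \<phi>.
        neg_family (sobolev (subgraph \<Gamma> V ?F)) (\<lambda>x. defect (subgraph \<Gamma> V ?F) \<omega> x + Q (val x) + \<omega> * y' * (val x w)\<^sup>2)
          (vanishes (subgraph \<Gamma> V ?F)) k \<phi> \<Longrightarrow>
        (\<forall>f g. (\<forall>u\<in>V. f u = g u) \<longrightarrow> Q f = Q g) \<Longrightarrow> w \<in> V \<Longrightarrow>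
        (\<forall>f\<in>?F. src \<Gamma> f \<in> V \<and> tgt \<Gamma> f \<in> V) \<Longrightarrow> (L \<longrightarrow> v' \<notin> V) \<Longrightarrow>
        (\<exists>\<psi>. neg_family (pre_extension \<Gamma> V ?F e far w L v')
          (\<lambda>x. defect (subgraph \<Gamma> V (insert e ?F)) \<omega> x + Q (val x) + \<omega> * 0 * (fn x e far)\<^sup>2)
          (vanishes (subgraph \<Gamma> V (insert e ?F))) (k + n) \<psi>)" by blast
    define k' where "k' = k + 1 - n"
    have "\<exists>\<phi>. neg_family (sobolev (subgraph \<Gamma> ?V ?F))
        (\<lambda>x. defect (subgraph \<Gamma> ?V ?F) \<omega> x + 0 + \<omega> * y' * (val x w)\<^sup>2) (vanishes (subgraph \<Gamma> ?V ?F)) k' \<phi>"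
    proof (cases "k + 1 \<le> n")
      case True
      then have "k' = 0" by (simp add: k'_def)
      then show ?thesis
        by (intro exI[of _ "\<lambda>_. 0"]) (simp add: neg_family_def defect_def dirichlet_form_def potential_form_def)
    next
      case False
      then have k': "real k' = real k + 1 - real n" by (simp add: k'_def)
      have "\<exists>\<phi>. neg_family (sobolev (subgraph \<Gamma> ?V ?F))
        (\<lambda>x. defect (subgraph \<Gamma> ?V ?F) \<omega> x + ((\<Sum>u\<in>?V. \<omega> * 0 * (val x u)\<^sup>2) + \<omega> * y' * (val x w)\<^sup>2))
        (vanishes (subgraph \<Gamma> ?V ?F)) k' \<phi>"
      \<comment> \<open>The strength y' left behind by the cut edge becomes the root condition at w,
        so no further weight is spent.\<close>
      proof (rule neg_family_exists[OF \<omega>, where A = "{}"])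
        show "finite_graph (subgraph \<Gamma> ?V ?F)" unfolding Fs by (rule finite_graph_remove(1)[OF finite_graph])
        show "comb_connected (subgraph \<Gamma> ?V ?F)" unfolding Fs by (rule conn1)
        show "0 < len \<Gamma> f" if "f \<in> ?F" for f using len_pos that by blast
        show "u \<in> {} \<or> u = w \<or> (\<exists>e\<in>?F. src \<Gamma> e = u \<and> tgt \<Gamma> e = u) \<or>
          (\<exists>e1\<in>?F. \<exists>e2\<in>?F. e1 \<noteq> e2 \<and> incident \<Gamma> e1 u \<and> incident \<Gamma> e2 u)" if u: "u \<in> ?V" for u
        proof -
          consider "u = w" | "u \<noteq> w" "u \<noteq> v" | "u \<noteq> w" "u = v" by blast
          then show ?thesis
          proof cases
            case 2
            then have ni: "\<not> incident \<Gamma> e u" using joins_incident(4)[OF j] by metis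
            from degree_ge_two_cases[OF finite_edges deg2[OF u]] show ?thesis
            proof (elim disjE bexE conjE)
              fix f assume f: "f \<in> ?E" "src \<Gamma> f = u" "tgt \<Gamma> f = u"
              then have "f \<in> ?F" using ni unfolding incident_def by blast
              then show ?thesis using f by blast
            next
              fix f g assume "f \<in> ?E" "g \<in> ?E" "f \<noteq> g" "incident \<Gamma> f u" "incident \<Gamma> g u"
              moreover from this have "f \<in> ?F" "g \<in> ?F" using ni by blast+
              ultimately show ?thesis by blast
            qed
          next
            case 3
            have nl: "\<not> (src \<Gamma> e = v \<and> tgt \<Gamma> e = v)" using j 3 unfolding joins_def by metis
            show ?thesis
            proof (cases "v = r")
              case True
              then have "3 \<le> degree \<Gamma> v" using deg3 by simp
              from degree_ge_three_cases[OF finite_edges this nl] show ?thesis unfolding 3(2) by (elim disjE) simp_all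
            next
              case False
              then show ?thesis using vdeg 3(1) unfolding 3(2) by (elim disjE) simp_all
            qed
          qed blast
        qed
        have "(\<Sum>u\<in>({} :: 'v set). phase_weight (0 :: real)) = 0" by simp
        moreover have "total_length \<Gamma> * \<omega> / pi = len \<Gamma> e * \<omega> / pi + (\<Sum>f\<in>?F. len \<Gamma> f) * \<omega> / pi"
          by (simp add: lenE distrib_right add_divide_distrib)
        moreover have "2 * \<epsilon> = total_length \<Gamma> * \<omega> / pi - (real k - 2 + 3 / 2 * real_of_int (betti \<Gamma>))"
          by (simp add: \<epsilon>_def)
        moreover have "3 / 2 * (real (card ?F) - real (card ?V) + 1) = 3 / 2 * real_of_int (betti \<Gamma>) - 3 / 2"
          unfolding bt cF by (simp add: field_simps)
        ultimately show "real k' - 2 < (\<Sum>e\<in>?F. len \<Gamma> e) * \<omega> / pi + (\<Sum>u\<in>({} :: 'v set). phase_weight (0 :: real)) + phase_weight y'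
          - 3 / 2 * (real (card ?F) - real (card ?V) + 1)"
          using wt k' \<epsilon> pw0 by linarith
      qed (use F_ne w in auto)
      then show ?thesis by simp
    qed
    then obtain \<phi> where \<phi>: "neg_family (sobolev (subgraph \<Gamma> ?V ?F))
        (\<lambda>x. defect (subgraph \<Gamma> ?V ?F) \<omega> x + 0 + \<omega> * y' * (val x w)\<^sup>2) (vanishes (subgraph \<Gamma> ?V ?F)) k' \<phi>" by blast
    have ends: "\<forall>f\<in>?F. src \<Gamma> f \<in> ?V \<and> tgt \<Gamma> f \<in> ?V" using src_in_verts tgt_in_verts by blast
    have "\<exists>\<psi>. neg_family (pre_extension \<Gamma> ?V ?F e far w False v)
        (\<lambda>x. defect (subgraph \<Gamma> ?V (insert e ?F)) \<omega> x + 0 + \<omega> * 0 * (fn x e far)\<^sup>2)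
        (vanishes (subgraph \<Gamma> ?V (insert e ?F))) (k' + n) \<psi>"
      by (rule ext[OF \<phi> _ w ends]) simp_all
    then obtain \<psi> where \<psi>: "neg_family (pre_extension \<Gamma> ?V ?F e far w False v) (defect \<Gamma> \<omega>) (vanishes \<Gamma>) (k' + n) \<psi>"
      unfolding F(3) by auto
    have "Suc k \<le> k' + n" by (simp add: k'_def)
    from neg_family_constraint[OF neg_family_mono[OF \<psi> this] subspace_pre_extension linear_far_gap]
    obtain \<xi> where \<xi>: "neg_family {x \<in> pre_extension \<Gamma> ?V ?F e far w False v. fn x e far - val x v = 0}
          (defect \<Gamma> \<omega>) (vanishes \<Gamma>) k \<xi>" by blast
    have sub: "subspace {x \<in> pre_extension \<Gamma> ?V ?F e far w False v. fn x e far - val x v = 0}"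
      using subspace_inter[OF subspace_pre_extension[of \<Gamma> ?V ?F e far w False v] linear_subspace_kernel[OF linear_far_gap[of e far v]]]
      by (simp add: Int_def)
    have "neg_family (sobolev \<Gamma>) (defect \<Gamma> \<omega>) (vanishes \<Gamma>) k \<xi>"
    proof (rule neg_family_weaken[OF \<xi> sub])
      fix x assume "x \<in> {x \<in> pre_extension \<Gamma> ?V ?F e far w False v. fn x e far - val x v = 0}"
      then have "x \<in> pre_extension \<Gamma> ?V ?F e far w False v" "fn x e far = val x v" by auto
      from sobolev_pre_extension[OF far(2) this, of ?V] show "x \<in> sobolev \<Gamma>" unfolding F(3) Gs .
    qed auto
    then show ?thesis by blast
  qed
qed

end

section \<open>Eigenvalue bounds\<close>

text \<open>The weight \<omega> balances the two terms: once the Dirichlet integral is at most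
  \<omega>^2 times the mass, both are at most \<omega> times the mass.\<close>

lemma integral_abs_product_le:
  assumes \<omega>: "0 < \<omega>" and u: "abs_cont_deriv l u g" and g: "sq_int (leb l) g"
  shows "(LINT t|leb l. \<bar>g t * u t + u t * g t\<bar>) \<le> \<omega> * (LINT t|leb l. u t * u t) + (LINT t|leb l. g t * g t) / \<omega>"
proof -
  note c = acd_continuous[OF u]
  have iu: "integrable (leb l) (\<lambda>t. u t * u t)" by (rule integrable_leb_continuous) (intro continuous_intros c)
  have ig: "integrable (leb l) (\<lambda>t. g t * g t)" by (rule sq_int_mult[OF g g])
  have igu: "integrable (leb l) (\<lambda>t. g t * u t)"
    by (rule integrable_leb_mult_continuous[OF acd_integrable[OF u] c])
  have "(LINT t|leb l. \<bar>g t * u t + u t * g t\<bar>) \<le> (LINT t|leb l. \<omega> * (u t * u t) + g t * g t / \<omega>)"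
  proof (rule integral_mono)
    show "integrable (leb l) (\<lambda>t. \<bar>g t * u t + u t * g t\<bar>)"
      using Bochner_Integration.integrable_add[OF igu igu] by (intro integrable_abs) (simp add: mult.commute)
    show "integrable (leb l) (\<lambda>t. \<omega> * (u t * u t) + g t * g t / \<omega>)" using iu ig by simp
    fix t
    have "0 \<le> (\<omega> * \<bar>u t\<bar> - \<bar>g t\<bar>)\<^sup>2 / \<omega>" using \<omega> by simp
    also have "\<dots> = \<omega> * (u t * u t) + g t * g t / \<omega> - 2 * (\<bar>g t\<bar> * \<bar>u t\<bar>)"
      using \<omega> by (simp add: power2_eq_square field_simps)
    finally show "\<bar>g t * u t + u t * g t\<bar> \<le> \<omega> * (u t * u t) + g t * g t / \<omega>"
      using abs_triangle_ineq[of "g t * u t" "u t * g t"] by (simp add: abs_mult mult.commute)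
  qed
  also have "\<dots> = \<omega> * (LINT t|leb l. u t * u t) + (LINT t|leb l. g t * g t) / \<omega>" using iu ig by simp
  finally show ?thesis .
qed

context metric_graph
begin

text \<open>The image of \<open>g\<close> is an interval covered by the images of the edges.\<close>

lemma oscillation_le_variation:
  assumes conn: "graph_connected \<Gamma>" and g: "continuous_map (graph_topology \<Gamma>) euclideanreal g"
    and D: "\<And>e s t. e \<in> edges \<Gamma> \<Longrightarrow> s \<in> {0..len \<Gamma> e} \<Longrightarrow> t \<in> {0..len \<Gamma> e} \<Longrightarrow>
      \<bar>pullback g e s - pullback g e t\<bar> \<le> D e"
    and c: "\<And>e. e \<in> edges \<Gamma> \<Longrightarrow> continuous_on {0..len \<Gamma> e} (pullback g e)"
    and p: "p \<in> points \<Gamma>" and p': "p' \<in> points \<Gamma>"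
  shows "g p - g p' \<le> (\<Sum>e\<in>edges \<Gamma>. D e)"
proof -
  have "connectedin euclideanreal (g ` points \<Gamma>)"
    by (rule connectedin_continuous_map_image[OF g])
      (use conn in \<open>simp add: graph_connected_def connectedin_topspace flip: topspace_graph_topology\<close>)
  then have "connected (g ` points \<Gamma>)" by simp
  from connected_contains_Icc[OF this imageI[OF p'] imageI[OF p]]
  have sub: "{g p'..g p} \<subseteq> g ` points \<Gamma>" .
  have "\<exists>a. \<exists>b\<ge>a. b - a \<le> D e \<and> (\<forall>t\<in>{0..len \<Gamma> e}. pullback g e t \<in> {a..b})" if e: "e \<in> edges \<Gamma>" for e
  proof -
    have ne: "{0..len \<Gamma> e} \<noteq> {}" using len_pos[OF e] by simp
    obtain s where s: "s \<in> {0..len \<Gamma> e}" "\<forall>t\<in>{0..len \<Gamma> e}. pullback g e s \<le> pullback g e t"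
      using continuous_attains_inf[OF compact_Icc ne c[OF e]] by blast
    obtain r where r: "r \<in> {0..len \<Gamma> e}" "\<forall>t\<in>{0..len \<Gamma> e}. pullback g e t \<le> pullback g e r"
      using continuous_attains_sup[OF compact_Icc ne c[OF e]] by blast
    show ?thesis
      by (rule exI[of _ "pullback g e s"], rule exI[of _ "pullback g e r"]) (use s r D[OF e r(1) s(1)] in auto)
  qed
  then obtain a b where ab: "\<And>e. e \<in> edges \<Gamma> \<Longrightarrow> a e \<le> b e" "\<And>e. e \<in> edges \<Gamma> \<Longrightarrow> b e - a e \<le> D e"
    "\<And>e t. e \<in> edges \<Gamma> \<Longrightarrow> t \<in> {0..len \<Gamma> e} \<Longrightarrow> pullback g e t \<in> {a e..b e}" by metis
  have "g ` points \<Gamma> \<subseteq> (\<Union>e\<in>edges \<Gamma>. {a e..b e})"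
    unfolding points_eq_Union_edges using ab(3) by blast
  with sub have cover: "{g p'..g p} \<subseteq> (\<Union>e\<in>edges \<Gamma>. {a e..b e})" by blast
  have "g p - g p' \<le> measure lborel {g p'..g p}" by (cases "g p' \<le> g p") auto
  also have "\<dots> \<le> measure lborel (\<Union>e\<in>edges \<Gamma>. {a e..b e})"
  proof (rule measure_mono_fmeasurable[OF cover])
    show "(\<Union>e\<in>edges \<Gamma>. {a e..b e}) \<in> fmeasurable lborel"
      by (rule fmeasurable.finite_UN[OF finite_edges]) (simp add: fmeasurable_def emeasure_lborel_Icc_eq)
  qed simp
  also have "\<dots> \<le> (\<Sum>e\<in>edges \<Gamma>. measure lborel {a e..b e})"
    by (rule measure_UNION_le) (use finite_edges in auto)
  also have "\<dots> \<le> (\<Sum>e\<in>edges \<Gamma>. D e)" by (rule sum_mono) (use ab(1,2) in auto)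
  finally show ?thesis .
qed

end

context graph_form
begin

text \<open>Connectedness lets the values on different edges be compared, so the average is taken
  over the whole graph and 1/L appears instead of the inverse length of one edge.\<close>

lemma connected_sup_bound:
  assumes conn: "graph_connected \<Gamma>" and x: "x \<in> sobolev \<Gamma>" and \<omega>: "0 < \<omega>"
    and d: "dirichlet_form \<Gamma> x x \<le> \<omega>\<^sup>2 * mass_form \<Gamma> x x" and p: "p \<in> points \<Gamma>"
  shows "(point_fun x p)\<^sup>2 \<le> (1 / total_length \<Gamma> + 2 * \<omega>) * mass_form \<Gamma> x x"
proof -
  define g where "g p = (point_fun x p)\<^sup>2" for p
  define D where "D e = (LINT t|leb (len \<Gamma> e). \<bar>der x e t * fn x e t + fn x e t * der x e t\<bar>)" for e
  have ge: "pullback g e t = fn x e t * fn x e t" if "e \<in> edges \<Gamma>" "t \<in> {0..len \<Gamma> e}" for e t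
    using point_fun_edge_point[OF x that] by (simp add: g_def power2_eq_square)
  have cg: "continuous_on {0..len \<Gamma> e} (pullback g e)" if e: "e \<in> edges \<Gamma>" for e
  proof -
    have "continuous_on {0..len \<Gamma> e} (\<lambda>t. fn x e t * fn x e t)" by (intro continuous_intros sobolevD(5)[OF x e])
    then show ?thesis by (rule continuous_on_cong[THEN iffD1, rotated 2]) (use ge[OF e] in auto)
  qed
  have osc: "g p - g p' \<le> (\<Sum>e\<in>edges \<Gamma>. D e)" if p': "p' \<in> points \<Gamma>" for p'
  proof (rule oscillation_le_variation[OF conn continuous_map_graph[OF cg] _ cg p p'])
    fix e s t assume e: "e \<in> edges \<Gamma>" and st: "s \<in> {0..len \<Gamma> e}" "t \<in> {0..len \<Gamma> e}"
    show "\<bar>pullback g e s - pullback g e t\<bar> \<le> D e"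
      using acd_abs_diff_le[OF acd_mult[OF sobolevD(1)[OF x e] sobolevD(1)[OF x e]] st(2,1)] ge[OF e] st
      by (simp add: D_def)
  qed
  have "(\<Sum>e\<in>edges \<Gamma>. D e) \<le> (\<Sum>e\<in>edges \<Gamma>. \<omega> * (LINT t|leb (len \<Gamma> e). fn x e t * fn x e t) + (LINT t|leb (len \<Gamma> e). der x e t * der x e t) / \<omega>)"
    unfolding D_def by (rule sum_mono) (rule integral_abs_product_le[OF \<omega> sobolevD(1,2)[OF x]])
  also have "\<dots> = \<omega> * mass_form \<Gamma> x x + dirichlet_form \<Gamma> x x / \<omega>"
    by (simp add: potential_form_def dirichlet_form_def sum.distrib sum_distrib_left sum_divide_distrib)
  also have "\<dots> \<le> \<omega> * mass_form \<Gamma> x x + \<omega>\<^sup>2 * mass_form \<Gamma> x x / \<omega>"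
    using d \<omega> by (simp add: divide_right_mono)
  also have "\<dots> = 2 * \<omega> * mass_form \<Gamma> x x" using \<omega> by (simp add: power2_eq_square)
  finally have var: "(\<Sum>e\<in>edges \<Gamma>. D e) \<le> 2 * \<omega> * mass_form \<Gamma> x x" .
  \<comment> \<open>By the variation bound, h lies below the square of the function everywhere;
    integrating it over the graph compares it with the mass.\<close>
  define h where "h = g p - 2 * \<omega> * mass_form \<Gamma> x x"
  have "total_length \<Gamma> * h = (\<Sum>e\<in>edges \<Gamma>. LINT t|leb (len \<Gamma> e). h)"
  proof -
    have "(LINT t|leb (len \<Gamma> e). h) = len \<Gamma> e * h" if "e \<in> edges \<Gamma>" for e
      using integral_leb_const[of "len \<Gamma> e" h] len_pos[OF that] by simp
    then show ?thesis unfolding total_length_def sum_distrib_right by (intro sum.cong[OF refl]) (rule sym)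
  qed
  also have "\<dots> \<le> (\<Sum>e\<in>edges \<Gamma>. LINT t|leb (len \<Gamma> e). 1 * (fn x e t * fn x e t))"
  proof (rule sum_mono, rule integral_mono)
    fix e assume e: "e \<in> edges \<Gamma>"
    show "integrable (leb (len \<Gamma> e)) (\<lambda>t. h)" by (rule integrable_leb_continuous) (rule continuous_on_const)
    show "integrable (leb (len \<Gamma> e)) (\<lambda>t. 1 * (fn x e t * fn x e t))"
      by (rule integrable_leb_continuous) (intro continuous_intros sobolevD(5)[OF x e])
    fix t assume "t \<in> space (leb (len \<Gamma> e))"
    then have t: "t \<in> {0..len \<Gamma> e}" by (simp add: space_restrict_space)
    then show "h \<le> 1 * (fn x e t * fn x e t)"
      using osc[OF edge_point_in_points[OF e, of t]] ge[OF e t] var by (simp add: h_def)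
  qed
  also have "\<dots> = mass_form \<Gamma> x x" by (simp add: potential_form_def)
  finally have "h \<le> mass_form \<Gamma> x x / total_length \<Gamma>"
    using total_length_pos by (simp add: pos_le_divide_eq mult.commute)
  then show ?thesis by (simp add: h_def g_def distrib_right)
qed

end

context schroedinger_form
begin

lemma eigenvalue_nth_le_kirchhoff:
  assumes conn: "graph_connected \<Gamma>" and nc: "\<not> graph_cycle \<Gamma>" and k: "0 < k"
    and p: "1 \<le> p" and q: "q \<in> Lp_space p (graph_measure \<Gamma>)" and \<omega>: "0 < \<omega>"
    and ineq: "real k - 2 + real (card (pendants \<Gamma>)) / 2 + 3 / 2 * real_of_int (betti \<Gamma>) < total_length \<Gamma> * \<omega> / pi"
    and W: "1 / total_length \<Gamma> + 2 * \<omega> \<le> W"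
  shows "eigenvalue_nth \<Gamma> \<alpha> q k \<le> \<omega>\<^sup>2 + (\<Sum>v\<in>verts \<Gamma>. \<alpha> v) * W
    + Lp_norm p (graph_measure \<Gamma>) (\<lambda>x. max (q x) 0) * W powr real_of_ereal (1 / p)"
proof -
  obtain \<phi> where \<phi>: "neg_family (sobolev \<Gamma>) (defect \<Gamma> \<omega>) (vanishes \<Gamma>) k \<phi>"
    using kirchhoff_neg_family[OF conn nc \<omega> ineq] by blast
  have L: "0 < total_length \<Gamma>" by (rule total_length_pos)
  have Wpos: "0 < W" using W \<omega> L by (smt (verit) divide_pos_pos)
  show ?thesis
  proof (rule eigenvalue_nth_le[OF k])
    show "\<phi> i \<in> sobolev \<Gamma>" if "i < k" for i by (rule neg_familyD(1)[OF \<phi> that])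
    fix c assume m0: "mass_form \<Gamma> (\<Sum>i<k. c i *\<^sub>R \<phi> i) (\<Sum>i<k. c i *\<^sub>R \<phi> i) = 0"
    define x where "x = (\<Sum>i<k. c i *\<^sub>R \<phi> i)"
    have x: "x \<in> sobolev \<Gamma>"
      unfolding x_def
      by (rule subspace_sum[OF subspace_sobolev]) (rule subspace_scale[OF subspace_sobolev], rule neg_familyD(1)[OF \<phi>], simp)
    have z: "fn x e t = 0" if "e \<in> edges \<Gamma>" "t \<in> {0..len \<Gamma> e}" for e t
      by (rule mass_zero_imp_zero[OF x m0[folded x_def] that])
    have "val x v = 0" if v: "v \<in> verts \<Gamma>" for v
    proof -
      obtain e where e: "e \<in> edges \<Gamma>" "src \<Gamma> e = v \<or> tgt \<Gamma> e = v" using no_isolated_verts[OF v] by blast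
      have "fn x e 0 = 0" "fn x e (len \<Gamma> e) = 0" using z[OF e(1)] len_pos[OF e(1)] by simp_all
      then show ?thesis using e(2) sobolevD(3,4)[OF x e(1)] by (elim disjE) simp_all
    qed
    then have "vanishes \<Gamma> x" using z unfolding vanishes_def by blast
    then have "c i = 0" if "i < k" for i using neg_familyD(3)[OF \<phi>, of c i] that unfolding x_def by simp
    then show "\<forall>i<k. c i = 0" by blast
  next
    fix x assume x: "x \<in> sobolev \<Gamma>" and "\<exists>c. x = (\<Sum>i<k. c i *\<^sub>R \<phi> i)"
    then obtain c where c: "x = (\<Sum>i<k. c i *\<^sub>R \<phi> i)" by blast
    let ?m = "mass_form \<Gamma> x x"
    have d: "dirichlet_form \<Gamma> x x \<le> \<omega>\<^sup>2 * ?m"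
      using neg_familyD(2)[OF \<phi>, of c] unfolding c[symmetric] defect_def by linarith
    have sup: "(point_fun x p)\<^sup>2 \<le> W * ?m" if "p \<in> points \<Gamma>" for p
      using connected_sup_bound[OF conn x \<omega> d that] mult_right_mono[OF W mass_nonneg[of x]] by linarith
    have "vertex_form \<Gamma> \<alpha> x x \<le> (\<Sum>v\<in>verts \<Gamma>. \<alpha> v * (W * ?m))"
      unfolding vertex_form_def
    proof (rule sum_mono)
      fix v assume v: "v \<in> verts \<Gamma>"
      have "(val x v)\<^sup>2 \<le> W * ?m" using sup[of "Vertex v"] v by (simp add: points_def point_fun_def)
      then show "\<alpha> v * (val x v * val x v) \<le> \<alpha> v * (W * ?m)"
        unfolding power2_eq_square by (rule mult_left_mono) (rule \<alpha>_ge0[OF v])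
    qed
    also have "\<dots> = (\<Sum>v\<in>verts \<Gamma>. \<alpha> v) * W * ?m" by (simp add: sum_distrib_right mult.assoc)
    finally have v: "vertex_form \<Gamma> \<alpha> x x \<le> (\<Sum>v\<in>verts \<Gamma>. \<alpha> v) * W * ?m" .
    have "potential_form \<Gamma> (pullback q) x x
      \<le> Lp_norm p (graph_measure \<Gamma>) (\<lambda>x. max (q x) 0) * W powr real_of_ereal (1 / p) * ?m"
    proof (rule potential_form_Lp_bound[OF q p x Wpos])
      fix e t assume e: "e \<in> edges \<Gamma>" "t \<in> {0..len \<Gamma> e}"
      show "(fn x e t)\<^sup>2 \<le> W * ?m"
        using sup[OF edge_point_in_points[OF e(1), of t]] point_fun_edge_point[OF x e] by simp
    qed
    then show "energy x x \<le> (\<omega>\<^sup>2 + (\<Sum>v\<in>verts \<Gamma>. \<alpha> v) * W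
      + Lp_norm p (graph_measure \<Gamma>) (\<lambda>x. max (q x) 0) * W powr real_of_ereal (1 / p)) * ?m"
      using d v by (simp add: energy_def distrib_right)
  qed
qed

end

section \<open>Sine arcs inside the edges and the final bounds\<close>

definition bump :: "'e \<Rightarrow> real \<Rightarrow> real \<Rightarrow> ('v, 'e) graph_fun"
  where "bump e a s = (\<lambda>v. 0,
    \<lambda>e' t. if e' = e then indicator {a..<a + s} t * sin (pi * (t - a) / s) else 0,
    \<lambda>e' t. if e' = e then indicator {a..<a + s} t * (pi / s * cos (pi * (t - a) / s)) else 0)"

lemma bump_simps:
  "val (bump e a s) v = 0"
  "fn (bump e a s) e' t = (if e' = e then indicator {a..<a + s} t * sin (pi * (t - a) / s) else 0)"
  "der (bump e a s) e' t = (if e' = e then indicator {a..<a + s} t * (pi / s * cos (pi * (t - a) / s)) else 0)"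
  by (simp_all add: bump_def)

text \<open>The sine vanishes at both ends of its arc, so clamping the argument and cutting off give
  the same function.\<close>

lemma bump_acd:
  assumes s: "0 < s" and a: "0 \<le> a" "a + s \<le> l"
  shows "abs_cont_deriv l (\<lambda>t. indicator {a..<a + s} t * sin (pi * (t - a) / s))
      (\<lambda>t. indicator {a..<a + s} t * (pi / s * cos (pi * (t - a) / s)))"
    and "sq_int (leb l) (\<lambda>t. indicator {a..<a + s} t * (pi / s * cos (pi * (t - a) / s)))"
proof -
  have D: "((\<lambda>t. sin (pi * (t - a) / s)) has_real_derivative pi / s * cos (pi * (t - a) / s)) (at t)" for t
    using s by (auto intro!: derivative_eq_intros)
  have C: "continuous_on UNIV (\<lambda>t. pi / s * cos (pi * (t - a) / s))"
    using s by (intro continuous_intros) auto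
  have "a \<le> a + s" using s by simp
  note cl = acd_clamp[OF D C a(1) this a(2)]
  show "sq_int (leb l) (\<lambda>t. indicator {a..<a + s} t * (pi / s * cos (pi * (t - a) / s)))" by (rule cl(2))
  show "abs_cont_deriv l (\<lambda>t. indicator {a..<a + s} t * sin (pi * (t - a) / s))
      (\<lambda>t. indicator {a..<a + s} t * (pi / s * cos (pi * (t - a) / s)))"
  proof (rule acd_cong[OF cl(1)])
    fix t :: real
    consider "t < a" | "a \<le> t" "t < a + s" | "a + s \<le> t" by linarith
    then show "sin (pi * (max a (min (a + s) t) - a) / s) = indicator {a..<a + s} t * sin (pi * (t - a) / s)"
      using s by cases (simp_all add: max_def min_def)
  qed simp
qed

text \<open>In the primitives of sin^2 and cos^2 the oscillating term vanishes at both ends of the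
  arc, so each integral is half the length.\<close>

lemma bump_integrals:
  assumes s: "0 < s" and a: "0 \<le> a" "a + s \<le> l"
  shows "integrable (leb l) (\<lambda>t. (indicator {a..<a + s} t * sin (pi * (t - a) / s))\<^sup>2)"
    and "(LINT t|leb l. (indicator {a..<a + s} t * sin (pi * (t - a) / s))\<^sup>2) = s / 2"
    and "integrable (leb l) (\<lambda>t. (indicator {a..<a + s} t * (pi / s * cos (pi * (t - a) / s)))\<^sup>2)"
    and "(LINT t|leb l. (indicator {a..<a + s} t * (pi / s * cos (pi * (t - a) / s)))\<^sup>2) = (pi / s)\<^sup>2 * (s / 2)"
proof -
  let ?x = "\<lambda>t. pi * (t - a) / s"
  have ind: "(indicator A t * c)\<^sup>2 = indicator A t * c\<^sup>2" for A and t c :: real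
    by (simp add: indicator_def power2_eq_square)
  have as: "a \<le> a + s" using s by simp
  have S: "((\<lambda>t. t / 2 - s / (2 * pi) * (sin (?x t) * cos (?x t))) has_real_derivative (sin (?x t))\<^sup>2) (at t)" for t
  proof -
    have "((\<lambda>t. t / 2 - s / (2 * pi) * (sin (?x t) * cos (?x t))) has_real_derivative
      1 / 2 - ((cos (?x t))\<^sup>2 - (sin (?x t))\<^sup>2) / 2) (at t)"
      using s by (auto intro!: derivative_eq_intros simp: field_simps power2_eq_square)
    moreover have "1 / 2 - ((cos (?x t))\<^sup>2 - (sin (?x t))\<^sup>2) / 2 = (sin (?x t))\<^sup>2"
      using sin_cos_squared_add[of "?x t"] by argo
    ultimately show ?thesis by simp
  qed
  have Cc: "((\<lambda>t. (pi / s)\<^sup>2 * (t / 2 + s / (2 * pi) * (sin (?x t) * cos (?x t)))) has_real_derivative (pi / s * cos (?x t))\<^sup>2) (at t)" for t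
  proof -
    have "((\<lambda>t. t / 2 + s / (2 * pi) * (sin (?x t) * cos (?x t))) has_real_derivative
      1 / 2 + ((cos (?x t))\<^sup>2 - (sin (?x t))\<^sup>2) / 2) (at t)"
      using s by (auto intro!: derivative_eq_intros simp: field_simps power2_eq_square)
    moreover have "1 / 2 + ((cos (?x t))\<^sup>2 - (sin (?x t))\<^sup>2) / 2 = (cos (?x t))\<^sup>2"
      using sin_cos_squared_add[of "?x t"] by argo
    ultimately have "((\<lambda>t. t / 2 + s / (2 * pi) * (sin (?x t) * cos (?x t))) has_real_derivative (cos (?x t))\<^sup>2) (at t)" by simp
    from DERIV_cmult[OF this, of "(pi / s)\<^sup>2"] show ?thesis by (simp only: power_mult_distrib)
  qed
  have cS: "continuous_on UNIV (\<lambda>t. (sin (?x t))\<^sup>2)" "continuous_on UNIV (\<lambda>t. (pi / s * cos (?x t))\<^sup>2)"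
    using s by (auto intro!: continuous_intros)
  show "integrable (leb l) (\<lambda>t. (indicator {a..<a + s} t * sin (?x t))\<^sup>2)"
    "integrable (leb l) (\<lambda>t. (indicator {a..<a + s} t * (pi / s * cos (?x t)))\<^sup>2)"
    unfolding ind using integral_leb_FTC(1)[OF S cS(1) a(1) as a(2)] integral_leb_FTC(1)[OF Cc cS(2) a(1) as a(2)] .
  show "(LINT t|leb l. (indicator {a..<a + s} t * sin (?x t))\<^sup>2) = s / 2"
    unfolding ind integral_leb_FTC(2)[OF S cS(1) a(1) as a(2)] using s by (simp add: add_divide_distrib)
  show "(LINT t|leb l. (indicator {a..<a + s} t * (pi / s * cos (?x t)))\<^sup>2) = (pi / s)\<^sup>2 * (s / 2)"
    unfolding ind integral_leb_FTC(2)[OF Cc cS(2) a(1) as a(2)] using s by (simp add: add_divide_distrib distrib_left)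
qed

lemma sum_indexed_enumeration:
  fixes h :: "nat \<Rightarrow> 'b::comm_monoid_add"
  assumes "finite E" "\<And>i. i < k \<Longrightarrow> f i \<in> E"
  shows "(\<Sum>e\<in>E. \<Sum>i | i < k \<and> f i = e. h i) = (\<Sum>i<k. h i)"
  using sum.group[of "{..<k}" E f h] assms by (simp add: image_subset_iff)

context metric_graph
begin

text \<open>Edge e holds the integer part of its length over s; less than one interval per edge is
  lost. The quotients sum to k - 1 + |E|, so more than k - 1 intervals fit, hence at least
  k.\<close>

lemma many_subintervals:
  assumes k: "0 < k" and s: "s = total_length \<Gamma> / (real k - 1 + real (card (edges \<Gamma>)))" "0 < s"
  shows "\<exists>f j. (\<forall>i<k. f i \<in> edges \<Gamma> \<and> real (j i + 1) * s \<le> len \<Gamma> (f i)) \<and> inj_on (\<lambda>i. (f i, j i :: nat)) {..<k}"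
proof -
  define N where "N e = nat \<lfloor>len \<Gamma> e / s\<rfloor>" for e
  let ?I = "SIGMA e:edges \<Gamma>. {..<N e}"
  have cE: "0 < card (edges \<Gamma>)" using finite_edges edges_nonempty by (simp add: card_gt_0_iff)
  have "real k - 1 + real (card (edges \<Gamma>)) = total_length \<Gamma> / s"
  proof -
    have "0 < real k - 1 + real (card (edges \<Gamma>))" using k cE by linarith
    moreover have "total_length \<Gamma> \<noteq> 0" using s by auto
    ultimately show ?thesis using s by simp
  qed
  also have "\<dots> = (\<Sum>e\<in>edges \<Gamma>. len \<Gamma> e / s)" by (simp add: total_length_def sum_divide_distrib)
  also have "\<dots> < (\<Sum>e\<in>edges \<Gamma>. real (N e) + 1)"
  proof (rule sum_strict_mono[OF finite_edges edges_nonempty])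
    fix e assume "e \<in> edges \<Gamma>"
    then show "len \<Gamma> e / s < real (N e) + 1" unfolding N_def using len_pos s(2) by linarith
  qed
  also have "\<dots> = real (\<Sum>e\<in>edges \<Gamma>. N e) + real (card (edges \<Gamma>))" by (simp add: sum.distrib)
  finally have "k \<le> (\<Sum>e\<in>edges \<Gamma>. N e)" by linarith
  then have "card {..<k} \<le> card ?I" using finite_edges by simp
  from card_le_inj[OF _ _ this] obtain h where h: "h ` {..<k} \<subseteq> ?I" "inj_on h {..<k}"
    using finite_edges by auto
  have "fst (h i) \<in> edges \<Gamma> \<and> real (snd (h i) + 1) * s \<le> len \<Gamma> (fst (h i))" if i: "i < k" for i
  proof -
    have "h i \<in> ?I" using h(1) i by blast
    then have hi: "fst (h i) \<in> edges \<Gamma>" "snd (h i) < N (fst (h i))" by (cases "h i"; simp)+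
    then have "real (snd (h i) + 1) \<le> len \<Gamma> (fst (h i)) / s" unfolding N_def by linarith
    then show ?thesis using hi s(2) by (simp add: pos_le_divide_eq)
  qed
  moreover have "inj_on (\<lambda>i. (fst (h i), snd (h i))) {..<k}" using h(2) by simp
  ultimately show ?thesis by (intro exI[of _ "\<lambda>i. fst (h i)"] exI[of _ "\<lambda>i. snd (h i)"]) blast
qed

end

context schroedinger_form
begin

text \<open>All arcs vanish at the vertices and have the same length s, so every combination has
  Rayleigh quotient (pi/s)^2 before the potential is added. At each point at most one arc is nonzero
  and its mass is s/2, whence the sup bound with 2/s.\<close>

lemma eigenvalue_nth_le_dirichlet:
  assumes k: "0 < k" and p: "1 \<le> p" and q: "q \<in> Lp_space p (graph_measure \<Gamma>)"
    and s: "s = total_length \<Gamma> / (real k - 1 + real (card (edges \<Gamma>)))"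
  shows "eigenvalue_nth \<Gamma> \<alpha> q k \<le> (pi / s)\<^sup>2
    + Lp_norm p (graph_measure \<Gamma>) (\<lambda>x. max (q x) 0) * (2 / s) powr real_of_ereal (1 / p)"
proof -
  have cE: "0 < card (edges \<Gamma>)" using finite_edges edges_nonempty by (simp add: card_gt_0_iff)
  have s0: "0 < s" unfolding s using total_length_pos k cE by (intro divide_pos_pos) linarith+
  from many_subintervals[OF k s s0] obtain f j where
    f: "\<And>i. i < k \<Longrightarrow> f i \<in> edges \<Gamma>" and j: "\<And>i. i < k \<Longrightarrow> real (j i + 1) * s \<le> len \<Gamma> (f i)"
    and inj: "inj_on (\<lambda>i. (f i, j i :: nat)) {..<k}" by blast
  define a where "a i = real (j i) * s" for i
  define \<phi> :: "nat \<Rightarrow> ('v, 'e) graph_fun" where "\<phi> i = bump (f i) (a i) s" for i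
  define S where "S i t = indicator {a i..<a i + s} t * sin (pi * (t - a i) / s)" for i and t :: real
  define T where "T i t = indicator {a i..<a i + s} t * (pi / s * cos (pi * (t - a i) / s))" for i and t :: real
  have al: "0 \<le> a i" "a i + s \<le> len \<Gamma> (f i)" if "i < k" for i
    using j[OF that] s0 by (simp_all add: a_def distrib_right)
  have \<phi>: "\<phi> i \<in> sobolev \<Gamma>" if i: "i < k" for i
    unfolding sobolev_def
  proof (intro CollectI ballI)
    fix e assume e: "e \<in> edges \<Gamma>"
    show "abs_cont_deriv (len \<Gamma> e) (fn (\<phi> i) e) (der (\<phi> i) e) \<and> sq_int (leb (len \<Gamma> e)) (der (\<phi> i) e) \<and>
      fn (\<phi> i) e 0 = val (\<phi> i) (src \<Gamma> e) \<and> fn (\<phi> i) e (len \<Gamma> e) = val (\<phi> i) (tgt \<Gamma> e)"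
    proof (cases "e = f i")
      case True
      then show ?thesis using bump_acd[OF s0 al[OF i]] al[OF i] s0
        by (auto simp: \<phi>_def bump_def indicator_def)
    next
      case False
      then show ?thesis by (simp add: \<phi>_def bump_def acd_zero sq_int_def)
    qed
  qed
  have fnx: "fn (\<Sum>i<k. c i *\<^sub>R \<phi> i) e t = (\<Sum>i | i < k \<and> f i = e. c i * S i t)"
    and derx: "der (\<Sum>i<k. c i *\<^sub>R \<phi> i) e t = (\<Sum>i | i < k \<and> f i = e. c i * T i t)"
    and valx: "val (\<Sum>i<k. c i *\<^sub>R \<phi> i) v = 0" for c e t v
  proof -
    have e: "{i. i < k \<and> f i = e} = {..<k} \<inter> {i. f i = e}" by auto
    show "fn (\<Sum>i<k. c i *\<^sub>R \<phi> i) e t = (\<Sum>i | i < k \<and> f i = e. c i * S i t)"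
      unfolding e graph_fun_sum sum.inter_restrict[OF finite_lessThan]
      by (rule sum.cong) (auto simp: \<phi>_def bump_simps S_def scaleR_fun_def)
    show "der (\<Sum>i<k. c i *\<^sub>R \<phi> i) e t = (\<Sum>i | i < k \<and> f i = e. c i * T i t)"
      unfolding e graph_fun_sum sum.inter_restrict[OF finite_lessThan]
      by (rule sum.cong) (auto simp: \<phi>_def bump_simps T_def scaleR_fun_def)
    show "val (\<Sum>i<k. c i *\<^sub>R \<phi> i) v = 0"
      unfolding graph_fun_sum by (rule sum.neutral) (simp add: \<phi>_def bump_simps scaleR_fun_def)
  qed
  have disj: "indicator {a i..<a i + s} t * indicator {a i'..<a i' + s} t = (0 :: real)"
    if "i < k" "i' < k" "f i = f i'" "i \<noteq> i'" for i i' t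
  proof -
    have "j i \<noteq> j i'" using inj that unfolding inj_on_def by auto
    then have "real (j i + 1) * s \<le> real (j i') * s \<or> real (j i' + 1) * s \<le> real (j i) * s"
      using s0 by (auto simp: mult_le_cancel_right)
    then have "a i + s \<le> a i' \<or> a i' + s \<le> a i" by (simp add: a_def distrib_right add.commute)
    then show ?thesis by (auto simp: indicator_def)
  qed
  have sqS: "(fn (\<Sum>i<k. c i *\<^sub>R \<phi> i) e t)\<^sup>2 = (\<Sum>i | i < k \<and> f i = e. (c i)\<^sup>2 * (S i t)\<^sup>2)" for c e t
  proof -
    have "(\<Sum>i | i < k \<and> f i = e. c i * S i t)\<^sup>2 = (\<Sum>i | i < k \<and> f i = e. (c i * S i t)\<^sup>2)"
      by (rule sum_square_disjoint) (use disj[of _ _ t] in \<open>auto simp: S_def\<close>)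
    then show ?thesis unfolding fnx by (simp only: power_mult_distrib)
  qed
  have sqT: "(der (\<Sum>i<k. c i *\<^sub>R \<phi> i) e t)\<^sup>2 = (\<Sum>i | i < k \<and> f i = e. (c i)\<^sup>2 * (T i t)\<^sup>2)" for c e t
  proof -
    have "(\<Sum>i | i < k \<and> f i = e. c i * T i t)\<^sup>2 = (\<Sum>i | i < k \<and> f i = e. (c i * T i t)\<^sup>2)"
      by (rule sum_square_disjoint) (use disj[of _ _ t] in \<open>auto simp: T_def\<close>)
    then show ?thesis unfolding derx by (simp only: power_mult_distrib)
  qed
  have mass: "mass_form \<Gamma> (\<Sum>i<k. c i *\<^sub>R \<phi> i) (\<Sum>i<k. c i *\<^sub>R \<phi> i) = (\<Sum>i<k. (c i)\<^sup>2) * (s / 2)"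
    and diri: "dirichlet_form \<Gamma> (\<Sum>i<k. c i *\<^sub>R \<phi> i) (\<Sum>i<k. c i *\<^sub>R \<phi> i) = (pi / s)\<^sup>2 * ((\<Sum>i<k. (c i)\<^sup>2) * (s / 2))" for c
  proof -
    define x where "x = (\<Sum>i<k. c i *\<^sub>R \<phi> i)"
    have "(LINT t|leb (len \<Gamma> e). (fn x e t)\<^sup>2) = (\<Sum>i | i < k \<and> f i = e. (c i)\<^sup>2 * (s / 2))" for e
    proof -
      have "(LINT t|leb (len \<Gamma> e). (fn x e t)\<^sup>2) = (\<Sum>i | i < k \<and> f i = e. LINT t|leb (len \<Gamma> e). (c i)\<^sup>2 * (S i t)\<^sup>2)"
        unfolding x_def sqS
        by (rule Bochner_Integration.integral_sum) (use bump_integrals(1)[OF s0 al] in \<open>auto simp: S_def\<close>)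
      also have "\<dots> = (\<Sum>i | i < k \<and> f i = e. (c i)\<^sup>2 * (s / 2))"
        by (rule sum.cong) (use bump_integrals(2)[OF s0 al] in \<open>auto simp: S_def\<close>)
      finally show ?thesis .
    qed
    then show "mass_form \<Gamma> x x = (\<Sum>i<k. (c i)\<^sup>2) * (s / 2)"
      using sum_indexed_enumeration[OF finite_edges f, of k "\<lambda>i. i" "\<lambda>i. (c i)\<^sup>2 * (s / 2)"]
      by (simp add: potential_form_def power2_eq_square sum_distrib_right)
    have "(LINT t|leb (len \<Gamma> e). (der x e t)\<^sup>2) = (\<Sum>i | i < k \<and> f i = e. (c i)\<^sup>2 * ((pi / s)\<^sup>2 * (s / 2)))" for e
    proof -
      have "(LINT t|leb (len \<Gamma> e). (der x e t)\<^sup>2) = (\<Sum>i | i < k \<and> f i = e. LINT t|leb (len \<Gamma> e). (c i)\<^sup>2 * (T i t)\<^sup>2)"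
        unfolding x_def sqT
        by (rule Bochner_Integration.integral_sum) (use bump_integrals(3)[OF s0 al] in \<open>auto simp: T_def\<close>)
      also have "\<dots> = (\<Sum>i | i < k \<and> f i = e. (c i)\<^sup>2 * ((pi / s)\<^sup>2 * (s / 2)))"
        by (rule sum.cong) (use bump_integrals(4)[OF s0 al] in \<open>auto simp: T_def\<close>)
      finally show ?thesis .
    qed
    then show "dirichlet_form \<Gamma> x x = (pi / s)\<^sup>2 * ((\<Sum>i<k. (c i)\<^sup>2) * (s / 2))"
      using sum_indexed_enumeration[OF finite_edges f, of k "\<lambda>i. i" "\<lambda>i. (c i)\<^sup>2 * ((pi / s)\<^sup>2 * (s / 2))"]
      by (simp add: dirichlet_form_def power2_eq_square sum_distrib_right sum_distrib_left mult.assoc mult.left_commute)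
  qed
  show ?thesis
  proof (rule eigenvalue_nth_le[OF k \<phi>])
    fix c assume "mass_form \<Gamma> (\<Sum>i<k. c i *\<^sub>R \<phi> i) (\<Sum>i<k. c i *\<^sub>R \<phi> i) = 0"
    then have "(\<Sum>i<k. (c i)\<^sup>2) = 0" unfolding mass using s0 by simp
    then show "\<forall>i<k. c i = 0" by (subst (asm) sum_nonneg_eq_0_iff) auto
  next
    fix x assume x: "x \<in> sobolev \<Gamma>" and "\<exists>c. x = (\<Sum>i<k. c i *\<^sub>R \<phi> i)"
    then obtain c where c: "x = (\<Sum>i<k. c i *\<^sub>R \<phi> i)" by blast
    let ?m = "mass_form \<Gamma> x x"
    have m: "?m = (\<Sum>i<k. (c i)\<^sup>2) * (s / 2)" unfolding c by (rule mass)
    have v: "vertex_form \<Gamma> \<alpha> x x = 0" unfolding vertex_form_def c valx by simp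
    have d: "dirichlet_form \<Gamma> x x = (pi / s)\<^sup>2 * ?m" unfolding m unfolding c by (rule diri)
    have "potential_form \<Gamma> (pullback q) x x
      \<le> Lp_norm p (graph_measure \<Gamma>) (\<lambda>x. max (q x) 0) * (2 / s) powr real_of_ereal (1 / p) * ?m"
    proof (rule potential_form_Lp_bound[OF q p x])
      fix e t
      have "(fn x e t)\<^sup>2 \<le> (\<Sum>i | i < k \<and> f i = e. (c i)\<^sup>2)"
        unfolding c sqS
      proof (rule sum_mono)
        fix i
        have "\<bar>S i t\<bar> \<le> 1" by (simp add: S_def indicator_def)
        then have "(S i t)\<^sup>2 \<le> 1" by (simp add: abs_square_le_1)
        then show "(c i)\<^sup>2 * (S i t)\<^sup>2 \<le> (c i)\<^sup>2" by (simp add: mult_left_le)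
      qed
      also have "\<dots> \<le> (\<Sum>i<k. (c i)\<^sup>2)" by (rule sum_mono2) auto
      also have "\<dots> = 2 / s * ?m" using s0 by (simp add: m)
      finally show "(fn x e t)\<^sup>2 \<le> 2 / s * ?m" .
    qed (use s0 in simp)
    then show "energy x x \<le> ((pi / s)\<^sup>2
      + Lp_norm p (graph_measure \<Gamma>) (\<lambda>x. max (q x) 0) * (2 / s) powr real_of_ereal (1 / p)) * ?m"
      unfolding energy_def v d by (simp add: distrib_right)
  qed
qed

end

text \<open>For p = \<infinity> both sides are 0, in accordance with the convention on
  exponents.\<close>

lemma real_of_ereal_divide_two: "1 \<le> p \<Longrightarrow> real_of_ereal (2 / p) = 2 * real_of_ereal (1 / p)"
  by (cases p) (simp_all add: divide_ereal_def)

lemma real_of_ereal_inverse_nonneg: "1 \<le> p \<Longrightarrow> 0 \<le> real_of_ereal (1 / p)"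
  by (cases p) (simp_all add: divide_ereal_def)

context metric_graph
begin

text \<open>A tree has at least two pendants, each counting 1/2; otherwise one independent cycle
  already counts 3/2.\<close>

lemma M_const_factor_ge_one:
  assumes conn: "graph_connected \<Gamma>" and k: "2 \<le> k"
  shows "1 \<le> real k - 2 + real (card (pendants \<Gamma>)) / 2 + 3 * real_of_int (betti \<Gamma>) / 2"
proof (cases "betti \<Gamma> = 0")
  case True
  then show ?thesis using pendants_tree[OF True] k by simp
next
  case False
  then have "1 \<le> betti \<Gamma>" using betti_nonneg[OF conn] by simp
  then have "1 \<le> real_of_int (betti \<Gamma>)" by simp
  moreover have "0 \<le> real (card (pendants \<Gamma>))" "2 \<le> real k" using k by simp_all
  ultimately show ?thesis by linarith
qed

end

context schroedinger_form
begin

lemma M_const_pos: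
  assumes "graph_connected \<Gamma>" "2 \<le> k"
  shows "0 < M_const \<Gamma> k"
  unfolding M_const_def using M_const_factor_ge_one[OF assms] total_length_pos by (intro mult_pos_pos) auto

lemma eigenvalue_nth_le_M_const:
  assumes conn: "graph_connected \<Gamma>" and nc: "\<not> graph_cycle \<Gamma>" and k: "2 \<le> k"
    and p: "1 \<le> p" and q: "q \<in> Lp_space p (graph_measure \<Gamma>)"
  shows "eigenvalue_nth \<Gamma> \<alpha> q k \<le> (M_const \<Gamma> k)\<^sup>2 / total_length \<Gamma>
    + (\<Sum>v\<in>verts \<Gamma>. \<alpha> v) * (real k * (M_const \<Gamma> k)\<^sup>2)
    + Lp_norm p (graph_measure \<Gamma>) (\<lambda>x. max (q x) 0) * (real k * (M_const \<Gamma> k)\<^sup>2) powr real_of_ereal (1 / p)"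
proof -
  let ?L = "total_length \<Gamma>" and ?M = "M_const \<Gamma> k"
  define m where "m = real k - 2 + real (card (pendants \<Gamma>)) / 2 + 3 * real_of_int (betti \<Gamma>) / 2"
  have m: "1 \<le> m" unfolding m_def by (rule M_const_factor_ge_one[OF conn k])
  have L: "0 < ?L" by (rule total_length_pos)
  have M2: "?M\<^sup>2 = pi\<^sup>2 * m\<^sup>2 / ?L"
    unfolding M_const_def m_def[symmetric] using L by (simp add: power_mult_distrib power_divide)
  define W where "W = real k * ?M\<^sup>2"
  define R where "R = (\<Sum>v\<in>verts \<Gamma>. \<alpha> v) * W
    + Lp_norm p (graph_measure \<Gamma>) (\<lambda>x. max (q x) 0) * W powr real_of_ereal (1 / p)"
  define \<omega>0 where "\<omega>0 = pi * m / ?L"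
  \<comment> \<open>The largest frequency whose sup constant 1/L + 2\<omega> is still at most W;
    this W is taken because its power 1/p splits into the two powers of the statement.\<close>
  define \<omega>1 where "\<omega>1 = (W - 1 / ?L) / 2"
  have \<omega>0: "0 < \<omega>0" unfolding \<omega>0_def using m L by simp
  \<comment> \<open>There is room between the two frequencies because pi m > 3 and k is at least 2:
    then 1 + 2 pi m < 2 (pi m)^2.\<close>
  have lt: "\<omega>0 < \<omega>1"
  proof -
    have "3 * m < pi * m" using m pi_gt3 by simp
    then have "3 < pi * m" using m by linarith
    then have "3 * (pi * m) < (pi * m) * (pi * m)" using m pi_gt_zero by (intro mult_strict_right_mono) auto
    then have "2 * (pi * m) + 1 < 2 * (pi * m)\<^sup>2"
      using \<open>3 < pi * m\<close> unfolding power2_eq_square by linarith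
    also have "\<dots> \<le> real k * (pi * m)\<^sup>2" by (rule mult_right_mono) (use k in auto)
    finally have "(2 * (pi * m) + 1) / ?L < real k * (pi * m)\<^sup>2 / ?L" using L by (simp add: divide_strict_right_mono)
    then have "2 * (pi * m / ?L) + 1 / ?L < real k * (pi\<^sup>2 * m\<^sup>2 / ?L)"
      by (simp add: power_mult_distrib add_divide_distrib)
    then show ?thesis unfolding \<omega>0_def \<omega>1_def W_def M2 by argo
  qed
  \<comment> \<open>The trial space requires a frequency strictly above \<omega>0; the bound holds
    for all of them up to \<omega>1 with the same R, hence in the limit.\<close>
  have "eigenvalue_nth \<Gamma> \<alpha> q k - R \<le> \<omega>0\<^sup>2"
  proof (rule dense_ge_bounded)
    show "\<omega>0\<^sup>2 < \<omega>1\<^sup>2" using lt \<omega>0 by (intro power_strict_mono) auto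
    fix z assume z: "\<omega>0\<^sup>2 < z" "z < \<omega>1\<^sup>2"
    define \<omega> where "\<omega> = sqrt z"
    have z0: "0 < z" using z(1) \<omega>0 by (smt (verit) zero_le_power2)
    have "\<omega>0 < \<omega>" unfolding \<omega>_def by (rule real_less_rsqrt) (rule z(1))
    have "\<omega> < \<omega>1" unfolding \<omega>_def by (rule real_less_lsqrt) (use z \<omega>0 lt z0 in auto)
    have "eigenvalue_nth \<Gamma> \<alpha> q k \<le> \<omega>\<^sup>2 + (\<Sum>v\<in>verts \<Gamma>. \<alpha> v) * W
      + Lp_norm p (graph_measure \<Gamma>) (\<lambda>x. max (q x) 0) * W powr real_of_ereal (1 / p)"
    proof (rule eigenvalue_nth_le_kirchhoff[OF conn nc _ p q])
      show "0 < k" using k by simp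
      show "0 < \<omega>" using \<open>\<omega>0 < \<omega>\<close> \<omega>0 by linarith
      have "m = ?L * \<omega>0 / pi" unfolding \<omega>0_def using L by simp
      also have "\<dots> < ?L * \<omega> / pi" using \<open>\<omega>0 < \<omega>\<close> L by (simp add: divide_strict_right_mono)
      finally show "real k - 2 + real (card (pendants \<Gamma>)) / 2 + 3 / 2 * real_of_int (betti \<Gamma>) < ?L * \<omega> / pi"
        by (simp add: m_def)
      show "1 / ?L + 2 * \<omega> \<le> W" using \<open>\<omega> < \<omega>1\<close> unfolding \<omega>1_def by argo
    qed
    moreover have "\<omega>\<^sup>2 = z" unfolding \<omega>_def using z0 by simp
    ultimately show "eigenvalue_nth \<Gamma> \<alpha> q k - R \<le> z" unfolding R_def by linarith
  qed
  moreover have "\<omega>0\<^sup>2 = ?M\<^sup>2 / ?L"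
    unfolding M2 \<omega>0_def by (simp add: power_mult_distrib power_divide power2_eq_square)
  ultimately show ?thesis unfolding R_def W_def by linarith
qed

text \<open>The sup constant 2/s is replaced by \<open>k * (2 / min_length \<Gamma>)\<close>: the
  sum k - 1 + |E| is at most k |E|, and |E| shortest lengths fit into L.\<close>

lemma eigenvalue_nth_le_min_length:
  assumes k: "0 < k" and p: "1 \<le> p" and q: "q \<in> Lp_space p (graph_measure \<Gamma>)"
  shows "eigenvalue_nth \<Gamma> \<alpha> q k \<le>
    Lp_norm p (graph_measure \<Gamma>) (\<lambda>x. max (q x) 0) * real k powr real_of_ereal (1 / p) * (2 / min_length \<Gamma>) powr real_of_ereal (1 / p)
    + pi\<^sup>2 / (total_length \<Gamma>)\<^sup>2 * (real k - 1 + real (card (edges \<Gamma>)))\<^sup>2"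
proof -
  let ?L = "total_length \<Gamma>" and ?l = "min_length \<Gamma>" and ?E = "real (card (edges \<Gamma>))"
  let ?Q = "Lp_norm p (graph_measure \<Gamma>) (\<lambda>x. max (q x) 0)" and ?r = "real_of_ereal (1 / p)"
  define s where "s = ?L / (real k - 1 + ?E)"
  have cE: "1 \<le> ?E" using finite_edges edges_nonempty by (simp add: Suc_le_eq card_gt_0_iff)
  have k1: "1 \<le> real k" using k by simp
  have L: "0 < ?L" by (rule total_length_pos)
  have l: "0 < ?l" "\<And>e. e \<in> edges \<Gamma> \<Longrightarrow> ?l \<le> len \<Gamma> e"
    unfolding min_length_def using finite_edges edges_nonempty len_pos by (auto simp: Min_gr_iff)
  have El: "?E * ?l \<le> ?L" unfolding total_length_def using sum_mono[of "edges \<Gamma>" "\<lambda>_. ?l" "len \<Gamma>"] l(2) by simp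
  have "0 \<le> (real k - 1) * (?E - 1)" using k1 cE by simp
  then have "real k - 1 + ?E \<le> real k * ?E" by (simp add: algebra_simps)
  then have "(real k - 1 + ?E) * ?l \<le> real k * ?E * ?l" using l(1) by (intro mult_right_mono) auto
  also have "\<dots> \<le> real k * ?L" using mult_left_mono[OF El, of "real k"] by (simp add: mult.assoc)
  finally have "(real k - 1 + ?E) / ?L \<le> real k / ?l" using l(1) L by (simp add: divide_simps mult.commute)
  then have "2 * ((real k - 1 + ?E) / ?L) \<le> 2 * (real k / ?l)" by linarith
  then have le: "2 / s \<le> real k * (2 / ?l)" unfolding s_def by (simp add: mult.commute)
  have "0 \<le> 2 / s" unfolding s_def using L k1 cE by simp
  then have "(2 / s) powr ?r \<le> (real k * (2 / ?l)) powr ?r"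
    using le by (intro powr_mono2 real_of_ereal_inverse_nonneg[OF p])
  also have "\<dots> = real k powr ?r * (2 / ?l) powr ?r" using l(1) by (intro powr_mult)
  finally have "?Q * (2 / s) powr ?r \<le> ?Q * (real k powr ?r * (2 / ?l) powr ?r)"
    by (rule mult_left_mono[OF _ Lp_norm_nonneg])
  moreover have "(pi / s)\<^sup>2 = pi\<^sup>2 / ?L\<^sup>2 * (real k - 1 + ?E)\<^sup>2"
    unfolding s_def by (simp add: power_mult_distrib power_divide)
  ultimately show ?thesis using eigenvalue_nth_le_dirichlet[OF k p q s_def] by (simp add: mult.assoc)
qed

end

theorem theorem1p3:
  fixes \<Gamma> :: "('v, 'e) pre_metric_graph" and k :: nat and p :: ereal
  assumes "metric_graph \<Gamma>" and "graph_connected \<Gamma>" and "\<not> graph_cycle \<Gamma>"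
    and "k \<ge> 2" and "1 \<le> p"
  shows "\<exists>C A0 A1 :: real. C \<ge> 0 \<and> A0 > 0 \<and> A1 \<ge> A0 \<and>
    (\<forall>(q :: ('v, 'e) gpoint \<Rightarrow> real) (\<alpha> :: 'v \<Rightarrow> real).
      q \<in> Lp_space p (graph_measure \<Gamma>) \<longrightarrow> (\<forall>v\<in>verts \<Gamma>. \<alpha> v \<ge> 0) \<longrightarrow>
      (let a = (\<Sum>v\<in>verts \<Gamma>. \<alpha> v);
           Q = Lp_norm p (graph_measure \<Gamma>) (\<lambda>x. max (q x) 0);
           M = M_const \<Gamma> k;
           L = total_length \<Gamma>
       in (a \<ge> A1 \<longrightarrow> eigenvalue_nth \<Gamma> \<alpha> q k \<le>
             (Q * real k powr real_of_ereal (1 / p) * (2 / min_length \<Gamma>) powr real_of_ereal (1 / p)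
               + pi\<^sup>2 / L\<^sup>2 * (real k - 1 + real (card (edges \<Gamma>)))\<^sup>2)
             * (1 + C * (M / a) * (Q + 1)))
        \<and> (a \<le> A0 \<longrightarrow> eigenvalue_nth \<Gamma> \<alpha> q k \<le>
             (Q * real k powr real_of_ereal (1 / p) * M powr real_of_ereal (2 / p) + M\<^sup>2 / L)
             * (1 + C * a * M * (Q + 1)))))"
  proof -
  interpret metric_graph \<Gamma> by fact
  \<comment> \<open>Zero data give access to the positivity of L and M, which concern the graph
    alone, before q and \<alpha> are chosen.\<close>
  interpret F: schroedinger_form \<Gamma> "\<lambda>_. 0" "\<lambda>_. 0" by unfold_locales simp_all
  define L where "L = total_length \<Gamma>"
  define M where "M = M_const \<Gamma> k"
  have L: "0 < L" unfolding L_def by (rule F.total_length_pos)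
  have M: "0 < M" unfolding M_def by (rule F.M_const_pos) fact+
  define C where "C = real k * L / M"
  have C: "0 \<le> C" unfolding C_def using L M by simp
  have CM: "C * M = real k * L" unfolding C_def using M by simp
  have main: "(a \<ge> 1 \<longrightarrow> eigenvalue_nth \<Gamma> \<alpha> q k \<le>
        (Q * real k powr real_of_ereal (1 / p) * (2 / min_length \<Gamma>) powr real_of_ereal (1 / p)
          + pi\<^sup>2 / L\<^sup>2 * (real k - 1 + real (card (edges \<Gamma>)))\<^sup>2)
        * (1 + C * (M / a) * (Q + 1)))
    \<and> (a \<le> 1 \<longrightarrow> eigenvalue_nth \<Gamma> \<alpha> q k \<le>
        (Q * real k powr real_of_ereal (1 / p) * M powr real_of_ereal (2 / p) + M\<^sup>2 / L)
        * (1 + C * a * M * (Q + 1)))"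
    if q: "q \<in> Lp_space p (graph_measure \<Gamma>)" and \<alpha>: "\<forall>v\<in>verts \<Gamma>. \<alpha> v \<ge> 0"
      and a: "a = (\<Sum>v\<in>verts \<Gamma>. \<alpha> v)" and Q: "Q = Lp_norm p (graph_measure \<Gamma>) (\<lambda>x. max (q x) 0)"
    for q :: "('v, 'e) gpoint \<Rightarrow> real" and \<alpha> :: "'v \<Rightarrow> real" and a Q
  proof -
    interpret S: schroedinger_form \<Gamma> \<alpha> q
      by unfold_locales (use \<alpha> Lp_edge_integrable[OF q \<open>1 \<le> p\<close>] in auto)
    have a0: "0 \<le> a" unfolding a using \<alpha> by (simp add: sum_nonneg)
    have Q0: "0 \<le> Q" unfolding Q by (rule Lp_norm_nonneg)
    let ?lam = "eigenvalue_nth \<Gamma> \<alpha> q k"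
    define B1 where "B1 = Q * real k powr real_of_ereal (1 / p) * (2 / min_length \<Gamma>) powr real_of_ereal (1 / p)
          + pi\<^sup>2 / L\<^sup>2 * (real k - 1 + real (card (edges \<Gamma>)))\<^sup>2"
    define B2 where "B2 = Q * real k powr real_of_ereal (1 / p) * M powr real_of_ereal (2 / p) + M\<^sup>2 / L"
    have "?lam \<le> B1"
      unfolding B1_def Q L_def by (rule S.eigenvalue_nth_le_min_length) (use \<open>2 \<le> k\<close> \<open>1 \<le> p\<close> q in auto)
    moreover have "0 \<le> B1" unfolding B1_def using Q0 by simp
    \<comment> \<open>The Dirichlet arcs give the bound without a correction factor, and the factor
      is at least 1.\<close>
    then have "B1 * 1 \<le> B1 * (1 + C * (M / a) * (Q + 1))"
      using C M a0 Q0 by (intro mult_left_mono) auto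
    ultimately have i: "?lam \<le> B1 * (1 + C * (M / a) * (Q + 1))" by linarith
    have "(real k * M\<^sup>2) powr real_of_ereal (1 / p) = real k powr real_of_ereal (1 / p) * M powr real_of_ereal (2 / p)"
    proof -
      have "M\<^sup>2 = M powr 2" using M by simp
      then show ?thesis
        unfolding real_of_ereal_divide_two[OF \<open>1 \<le> p\<close>] by (simp add: powr_mult powr_powr)
    qed
    then have "?lam \<le> B2 + a * (real k * M\<^sup>2)"
      using S.eigenvalue_nth_le_M_const[OF assms(2,3) \<open>2 \<le> k\<close> \<open>1 \<le> p\<close> q]
      unfolding B2_def Q a L_def M_def by (simp add: mult.assoc)
    \<comment> \<open>Since C M = k L, the summand M^2/L of B2 times C a M is exactly the coupling
      term; Q + 1 is at least 1.\<close>
    also have "a * (real k * M\<^sup>2) \<le> B2 * (C * a * M * (Q + 1))"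
    proof -
      have "a * (real k * M\<^sup>2) = M\<^sup>2 / L * (C * M * a * 1)" unfolding CM using L by simp
      also have "\<dots> \<le> B2 * (C * M * a * (Q + 1))"
        using C M a0 Q0 L unfolding B2_def by (intro mult_mono mult_left_mono) auto
      finally show ?thesis by (simp add: mult_ac)
    qed
    finally have ii: "?lam \<le> B2 * (1 + C * a * M * (Q + 1))" by (simp add: distrib_left)
    show ?thesis using i ii unfolding B1_def B2_def by blast
  qed
  show ?thesis
  proof (rule exI[of _ C], rule exI[of _ 1], rule exI[of _ 1], intro conjI allI impI)
    fix q :: "('v, 'e) gpoint \<Rightarrow> real" and \<alpha> :: "'v \<Rightarrow> real"
    assume "q \<in> Lp_space p (graph_measure \<Gamma>)" "\<forall>v\<in>verts \<Gamma>. \<alpha> v \<ge> 0"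
    from main[OF this refl refl] show "let a = (\<Sum>v\<in>verts \<Gamma>. \<alpha> v);
           Q = Lp_norm p (graph_measure \<Gamma>) (\<lambda>x. max (q x) 0);
           M = M_const \<Gamma> k;
           L = total_length \<Gamma>
       in (a \<ge> 1 \<longrightarrow> eigenvalue_nth \<Gamma> \<alpha> q k \<le>
             (Q * real k powr real_of_ereal (1 / p) * (2 / min_length \<Gamma>) powr real_of_ereal (1 / p)
               + pi\<^sup>2 / L\<^sup>2 * (real k - 1 + real (card (edges \<Gamma>)))\<^sup>2)
             * (1 + C * (M / a) * (Q + 1)))
        \<and> (a \<le> 1 \<longrightarrow> eigenvalue_nth \<Gamma> \<alpha> q k \<le>
             (Q * real k powr real_of_ereal (1 / p) * M powr real_of_ereal (2 / p) + M\<^sup>2 / L)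
             * (1 + C * a * M * (Q + 1)))"
      unfolding Let_def M_def L_def .
  qed (use C in auto)
qed

end
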